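(* Let $u$ be a subsonic variational solution (as defined in the context) in $\Omega$ with $(0,0)\in\Omega$, and let $\delta=\frac12\operatorname{dist}(0,\partial\Omega)$. Write $t(x)=\frac{|\nabla u(x)|^2}{x_1^2}$ and $H=H(t(x);x_2)$. For $r\in(0,\delta)$ define $$I(r)=\int_{B_r^+}x_1\big[F(t;x_2)+\lambda(x_2)\chi_{\{u>0\}}\big]dx,\qquad J(r)=\int_{\partial B_r^+}\frac{u^2}{x_1\bar\rho_0}\,d\mathcal{H}^1,$$ $$M^{x_1x_2}(r)=r^{-4}I(r)-\tfrac52r^{-5}J(r).$$ Then for a.e. $r\in(0,\delta)$, $$(M^{x_1x_2})'(r)=2r^{-4}\int_{\partial B_r^+}\frac1{x_1H}\Big(\nabla u\cdot\nu-\frac52\frac ur\Big)^2d\mathcal{H}^1+r^{-5}K_1^{x_2}(r)+r^{-5}\sum_{i=1}^3K_i^{x_1x_2}(r),$$ where $$K_1^{x_2}(r)=\int_{B_r^+}x_1\Big[\int_0^{t}\partial_\tau\Big(\tfrac1{H(\tau;x_2)}\Big)\tau\,d\tau-\Big(\int_0^{x_2}\partial_\tau\Big(\tfrac1{H(\tau;x_2)}\Big)\tau\,d\tau\Big)\chi_{\{u>0\}}\Big]dx,$$ $$K_1^{x_1x_2}(r)=\int_{B_r^+}x_1x_2\Big[\partial_2F(t;x_2)+\Big(\lambda'(x_2)-\frac1{\bar\rho_0}\Big)\chi_{\{u>0\}}\Big]dx,$$ $$K_2^{x_1x_2}(r)=5\int_{\partial B_r^+}\Big(\frac1{x_1H}-\frac1{x_1\bar\rho_0}\Big)u\nabla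 u\cdot\nu\,d\mathcal{H}^1,\qquad K_3^{x_1x_2}(r)=\frac{25}{2r}\int_{\partial B_r^+}\Big(\frac1{x_1\bar\rho_0}-\frac1{x_1H}\Big)u^2\,d\mathcal{H}^1.$$
   Context: Notation. $x=(x_1,x_2)$; $B_r$ is the open disc centred at $0$ in $\mathbb{R}^2$; $B_r^+=B_r\cap\{x_1>0\}$; $\partial B_r^+=\{x_1>0,|x|=r\}$; $\nu=x/r$ on it; $\chi_A$ is the characteristic function of $A$; $\mathcal{H}^1$ is one-dimensional Hausdorff measure; $\partial\Omega$ is the boundary of $\Omega$ relative to $\{x_1\ge0\}$. $W^{1,2}_{w,loc}(\Omega)$ is the space of $v$ with $\int_K\frac1{x_1}(|v|^2+|\nabla v|^2)dx<\infty$ for all compact $K\subset\Omega$. "Locally" means on each compact subset. Equation of state. $g>0$ and $\bar\rho_0>0$ are constants; $p\in C^{1,\alpha}([0,\infty))$, twice differentiable on $(0,\infty)$, with $p'(\rho)>0$ and $2p'(\rho)+\rho p''(\rho)>0$ for $\rho>0$; $h(\rho)=\int_{\bar\rho_0}^{\rho}\frac{p'(s)}{s}ds$; $s_*:=\frac{p'(\bar\rho_0)}{2g}$. For $0\le s<s_*$ let $\rho_{cr}(s)$ be the unique number with $\frac{p'(\rho_{cr}(s))}{2}+h(\rho_{cr}(s))=gs$. For $t\ge0$ let $H(t;s)$ be the unique solution $H>\rho_{cr}(s)$ of $\frac{g\bar\rho_0^2t}{H^2}+h(H)=gs$, whenever it exists; in particular $H(s;s)=\bar\rho_0$. Set $F(t;s)=\int_0^t\frac{d\tau}{H(\tau;s)}$,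 $\partial_1F=\partial F/\partial t=1/H$, $\partial_2F=\partial F/\partial s$, and $\lambda(s)=\frac{2s}{\bar\rho_0}-F(s;s)$. Free boundary problem: $\operatorname{div}\Big(\frac{\nabla u}{x_1H(|\nabla u|^2/x_1^2;x_2)}\Big)=0$ in $\Omega\cap\{u>0\}$, $\frac{|\nabla u|^2}{x_1^2}=x_2$ on $\Omega\cap\partial\{u>0\}$, where $\Omega$ is connected and relatively open in $\{x_1\ge0\}$, contained in $\{x_2<s_*\}$. Subsonic variational solution: $u\in W^{1,2}_{w,loc}(\Omega)$ such that (1) $u\ge0$ in $\Omega$, $u=0$ on $\{x_1=0\}$; (2) $u\in C^0(\Omega)\cap C^2(\Omega\cap\{u>0\})$; (3) for every $x^\circ\in\Omega\cap\{x_1=0\}$, as $x\to x^\circ$ with $x\in\Omega\cap\{u>0\}$, $\frac1{x_1}\partial_{x_2}u\to0$ and $\frac1{x_1}\partial_{x_1}u$ has a limit; (4) there is $\varepsilon_0>0$ such that $H(\frac{|\nabla u|^2}{x_1^2};x_2)-\rho_{cr}(x_2)\ge\varepsilon_0$ locally in $\Omega\cap\{x_2\ge0\}$; (5) $\{u>0\}$, hence the free surface $\partial\{u>0\}$, is contained in $\{x_1\ge0,x_2\ge0\}$ (all integrands involving $H,F,\lambda$ are read as $0$ where $x_2<0$); (6) for every $\phi=(\phi_1,\phi_2)\in C^1_0(\Omega;\mathbb{R}^2)$ with $\phi_1=0$ on $\{x_1=0\}$, writing $t=|\nabla u|^2/x_1^2$, $$0=\int_\Omega x_1[F(t;x_2)+\lambda(x_2)\chi_{\{u>0\}}]\operatorname{div}\phi-2\int_\Omega\partial_1F(t;x_2)\tfrac1{x_1}\nabla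 u\,D\phi\,\nabla u+\int_\Omega\big(F(t;x_2)-2\partial_1F(t;x_2)t+\lambda(x_2)\chi_{\{u>0\}}\big)\phi_1+\int_\Omega x_1\big(\partial_2F(t;x_2)+\lambda'(x_2)\chi_{\{u>0\}}\big)\phi_2 .$$ *)

theory Defs
  imports "HOL-Analysis.Analysis"
begin

type_synonym plane = "real \<times> real"

section \<open>One-dimensional Hausdorff measure\<close>

definition hausdorff1_outer :: "'a::metric_space set \<Rightarrow> ennreal" where
  "hausdorff1_outer A =
     (SUP d\<in>{0::real<..}.
        INF C\<in>{C :: nat \<Rightarrow> 'a set. A \<subseteq> (\<Union>i. C i) \<and> (\<forall>i. bounded (C i) \<and> diameter (C i) \<le> d)}.
          \<Sum>i. ennreal (diameter (C i)))"

text \<open>The sigma-algebra consists of the Caratheodory-measurable sets, so the measure is complete.\<close>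

definition hausdorff1 :: "'a::metric_space measure" where
  "hausdorff1 =
     measure_of UNIV (lambda_system UNIV (Pow UNIV) hausdorff1_outer) hausdorff1_outer"

section \<open>Equation of state\<close>

text \<open>Membership of \<open>p\<close> in \<open>C\<^sup>1\<^sup>,\<^sup>\<alpha>\<close> of the closed half-line: one-sided derivative at \<open>0\<close>;
  Hoelder continuity of the derivative on bounded intervals only, so that pressure laws of power
  type are admitted.\<close>

definition C1_holder_halfline :: "real \<Rightarrow> (real \<Rightarrow> real) \<Rightarrow> bool" where
  "C1_holder_halfline \<alpha> p \<longleftrightarrow>
     (\<exists>p'. (\<forall>\<rho>\<ge>0. (p has_real_derivative p' \<rho>) (at \<rho> within {0..})) \<and>
       (\<forall>R>0. \<exists>C. \<forall>a\<in>{0..R}. \<forall>b\<in>{0..R}. \<bar>p' a - p' b\<bar> \<le> C * \<bar>a - b\<bar> powr \<alpha>))"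

locale equation_of_state =
  fixes g \<rho>0 \<alpha> :: real and p :: "real \<Rightarrow> real"
  assumes g_pos: "g > 0"
    and rho0_pos: "\<rho>0 > 0"
    and alpha: "0 < \<alpha>" "\<alpha> \<le> 1"
    and p_C1: "C1_holder_halfline \<alpha> p"
    and p_twice_diff: "\<And>\<rho>. \<rho> > 0 \<Longrightarrow> deriv p differentiable (at \<rho>)"
    and p'_pos: "\<And>\<rho>. \<rho> > 0 \<Longrightarrow> deriv p \<rho> > 0"
    and p''_cond: "\<And>\<rho>. \<rho> > 0 \<Longrightarrow> 2 * deriv p \<rho> + \<rho> * deriv (deriv p) \<rho> > 0"

definition h_fun :: "real \<Rightarrow> (real \<Rightarrow> real) \<Rightarrow> real \<Rightarrow> real" where
  "h_fun \<rho>0 p \<rho> = (LBINT s=ereal \<rho>0..ereal \<rho>. deriv p s / s)"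

definition s_star :: "real \<Rightarrow> real \<Rightarrow> (real \<Rightarrow> real) \<Rightarrow> real" where
  "s_star g \<rho>0 p = deriv p \<rho>0 / (2 * g)"

definition rho_cr :: "real \<Rightarrow> real \<Rightarrow> (real \<Rightarrow> real) \<Rightarrow> real \<Rightarrow> real" where
  "rho_cr g \<rho>0 p s = (THE \<rho>. \<rho> > 0 \<and> deriv p \<rho> / 2 + h_fun \<rho>0 p \<rho> = g * s)"

definition is_H :: "real \<Rightarrow> real \<Rightarrow> (real \<Rightarrow> real) \<Rightarrow> real \<Rightarrow> real \<Rightarrow> real \<Rightarrow> bool" where
  "is_H g \<rho>0 p t s \<eta> \<longleftrightarrow>
     \<eta> > rho_cr g \<rho>0 p s \<and> g * \<rho>0\<^sup>2 * t / \<eta>\<^sup>2 + h_fun \<rho>0 p \<eta> = g * s"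

definition H_fun :: "real \<Rightarrow> real \<Rightarrow> (real \<Rightarrow> real) \<Rightarrow> real \<Rightarrow> real \<Rightarrow> real" where
  "H_fun g \<rho>0 p t s = (THE \<eta>. is_H g \<rho>0 p t s \<eta>)"

definition F_fun :: "real \<Rightarrow> real \<Rightarrow> (real \<Rightarrow> real) \<Rightarrow> real \<Rightarrow> real \<Rightarrow> real" where
  "F_fun g \<rho>0 p t s = (LBINT \<tau>=ereal 0..ereal t. 1 / H_fun g \<rho>0 p \<tau> s)"

definition lam :: "real \<Rightarrow> real \<Rightarrow> (real \<Rightarrow> real) \<Rightarrow> real \<Rightarrow> real" where
  "lam g \<rho>0 p s = 2 * s / \<rho>0 - F_fun g \<rho>0 p s s"

text \<open>The variables range over \<open>t \<ge> 0\<close> and \<open>0 \<le> s < s\<^sub>*\<close>; all derivatives are taken relative to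
  these intervals, hence one-sided at \<open>0\<close>.\<close>

definition d1F :: "real \<Rightarrow> real \<Rightarrow> (real \<Rightarrow> real) \<Rightarrow> real \<Rightarrow> real \<Rightarrow> real" where
  "d1F g \<rho>0 p t s = vector_derivative (\<lambda>\<tau>. F_fun g \<rho>0 p \<tau> s) (at t within {0..})"

definition d2F :: "real \<Rightarrow> real \<Rightarrow> (real \<Rightarrow> real) \<Rightarrow> real \<Rightarrow> real \<Rightarrow> real" where
  "d2F g \<rho>0 p t s =
     vector_derivative (\<lambda>\<sigma>. F_fun g \<rho>0 p t \<sigma>) (at s within {0..<s_star g \<rho>0 p})"

definition dlam :: "real \<Rightarrow> real \<Rightarrow> (real \<Rightarrow> real) \<Rightarrow> real \<Rightarrow> real" where
  "dlam g \<rho>0 p s = vector_derivative (lam g \<rho>0 p) (at s within {0..<s_star g \<rho>0 p})"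

definition dinvH :: "real \<Rightarrow> real \<Rightarrow> (real \<Rightarrow> real) \<Rightarrow> real \<Rightarrow> real \<Rightarrow> real" where
  "dinvH g \<rho>0 p \<tau> s = vector_derivative (\<lambda>q. 1 / H_fun g \<rho>0 p q s) (at \<tau> within {0..})"

section \<open>Function spaces\<close>

definition half_plane :: "plane set" where
  "half_plane = {x. fst x \<ge> 0}"

definition C1_on :: "plane set \<Rightarrow> (plane \<Rightarrow> 'b::real_normed_vector) \<Rightarrow> (plane \<Rightarrow> plane \<Rightarrow> 'b) \<Rightarrow> bool"
  where
  "C1_on S \<phi> \<phi>' \<longleftrightarrow>
     (\<forall>x\<in>S. (\<phi> has_derivative \<phi>' x) (at x within S)) \<and> (\<forall>v. continuous_on S (\<lambda>x. \<phi>' x v))"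

text \<open>For \<open>S\<close> relatively open in the closed half-plane the support may touch \<open>x\<^sub>1 = 0\<close>, and
  differentiability is understood up to that line.\<close>

definition C1_0 :: "plane set \<Rightarrow> (plane \<Rightarrow> 'b::real_normed_vector) \<Rightarrow> (plane \<Rightarrow> plane \<Rightarrow> 'b) \<Rightarrow> bool"
  where
  "C1_0 S \<phi> \<phi>' \<longleftrightarrow>
     C1_on S \<phi> \<phi>' \<and> (\<exists>K. compact K \<and> K \<subseteq> S \<and> (\<forall>x\<in>S - K. \<phi> x = 0))"

definition weak_gradient :: "plane set \<Rightarrow> (plane \<Rightarrow> real) \<Rightarrow> (plane \<Rightarrow> plane) \<Rightarrow> bool" where
  "weak_gradient U v Dv \<longleftrightarrow>
     (\<forall>\<psi> \<psi>'. C1_0 U \<psi> \<psi>' \<longrightarrow>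
       (\<forall>e\<in>Basis. (LINT x:U|lebesgue. v x * \<psi>' x e) = - (LINT x:U|lebesgue. (Dv x \<bullet> e) * \<psi> x)))"

text \<open>\<open>Dv\<close> is a representative of the weak gradient of \<open>v\<close> in the open set
  \<open>\<Omega> \<inter> {x\<^sub>1 > 0}\<close>, which is all of \<open>\<Omega>\<close> up to a null set.\<close>

definition W12_w_loc :: "plane set \<Rightarrow> (plane \<Rightarrow> real) \<Rightarrow> (plane \<Rightarrow> plane) \<Rightarrow> bool" where
  "W12_w_loc \<Omega> v Dv \<longleftrightarrow>
     set_borel_measurable lebesgue \<Omega> v \<and> set_borel_measurable lebesgue \<Omega> Dv \<and>
     weak_gradient (\<Omega> \<inter> {x. fst x > 0}) v Dv \<and>
     (\<forall>K. compact K \<longrightarrow> K \<subseteq> \<Omega> \<longrightarrow>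
        set_integrable lebesgue K (\<lambda>x. 1 / fst x * (\<bar>v x\<bar>\<^sup>2 + (norm (Dv x))\<^sup>2)))"

section \<open>Subsonic variational solutions\<close>

definition tq :: "(plane \<Rightarrow> plane) \<Rightarrow> plane \<Rightarrow> real" where
  "tq Du x = (norm (Du x))\<^sup>2 / (fst x)\<^sup>2"

definition pos_set :: "(plane \<Rightarrow> real) \<Rightarrow> plane set" where
  "pos_set u = {x. u x > 0}"

text \<open>Integrands involving \<open>H\<close>, \<open>F\<close>, \<open>\<lambda>\<close> are read as \<open>0\<close> where \<open>x\<^sub>2 < 0\<close>: their integrals are
  taken over the intersection of the given set with \<open>upper\<close>.\<close>

definition upper :: "plane set" where
  "upper = {x. snd x \<ge> 0}"

text \<open>Values of \<open>u\<close> and \<open>Du\<close> outside \<open>\<Omega>\<close> are irrelevant. \<open>Du\<close> is any representative of the weak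
  gradient of \<open>u\<close> that coincides with the classical gradient where \<open>u > 0\<close>.\<close>

locale subsonic_variational_solution = equation_of_state g \<rho>0 \<alpha> p
  for g \<rho>0 \<alpha> :: real and p :: "real \<Rightarrow> real" +
  fixes \<Omega> :: "plane set" and u :: "plane \<Rightarrow> real" and Du :: "plane \<Rightarrow> plane"
  assumes connected: "connected \<Omega>"
    and rel_open: "openin (top_of_set half_plane) \<Omega>"
    and below_s_star: "\<Omega> \<subseteq> {x. snd x < s_star g \<rho>0 p}"
    and sobolev: "W12_w_loc \<Omega> u Du"
    and nonneg: "\<And>x. x \<in> \<Omega> \<Longrightarrow> u x \<ge> 0"
    and zero_on_axis: "\<And>x. x \<in> \<Omega> \<Longrightarrow> fst x = 0 \<Longrightarrow> u x = 0"
    and continuous: "continuous_on \<Omega> u"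
    and C2: "C1_on (\<Omega> \<inter> pos_set u) u (\<lambda>x v. Du x \<bullet> v)"
            "\<exists>D2u. C1_on (\<Omega> \<inter> pos_set u) Du D2u"
    and axis_limits:
      "\<And>x0. x0 \<in> \<Omega> \<Longrightarrow> fst x0 = 0 \<Longrightarrow>
         ((\<lambda>x. 1 / fst x * snd (Du x)) \<longlongrightarrow> 0) (at x0 within (\<Omega> \<inter> pos_set u))"
      "\<And>x0. x0 \<in> \<Omega> \<Longrightarrow> fst x0 = 0 \<Longrightarrow>
         \<exists>l. ((\<lambda>x. 1 / fst x * fst (Du x)) \<longlongrightarrow> l) (at x0 within (\<Omega> \<inter> pos_set u))"
    and subsonic:
      "\<And>K. compact K \<Longrightarrow> K \<subseteq> \<Omega> \<inter> upper \<Longrightarrow>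
         \<exists>\<epsilon>0>0. AE x in lebesgue. x \<in> K \<longrightarrow>
           (\<exists>\<eta>. is_H g \<rho>0 p (tq Du x) (snd x) \<eta>) \<and>
           H_fun g \<rho>0 p (tq Du x) (snd x) - rho_cr g \<rho>0 p (snd x) \<ge> \<epsilon>0"
    and support: "\<Omega> \<inter> pos_set u \<subseteq> {x. fst x \<ge> 0 \<and> snd x \<ge> 0}"
    and domain_variation:
      "\<And>\<phi> \<phi>'. C1_0 \<Omega> \<phi> \<phi>' \<Longrightarrow> (\<And>x. x \<in> \<Omega> \<Longrightarrow> fst x = 0 \<Longrightarrow> fst (\<phi> x) = 0) \<Longrightarrow>
         0 = (LINT x:\<Omega> \<inter> upper|lebesgue.
                fst x * (F_fun g \<rho>0 p (tq Du x) (snd x)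
                         + lam g \<rho>0 p (snd x) * indicator (pos_set u) x)
                      * (fst (\<phi>' x (1, 0)) + snd (\<phi>' x (0, 1))))
           - 2 * (LINT x:\<Omega> \<inter> upper|lebesgue.
                d1F g \<rho>0 p (tq Du x) (snd x) * (1 / fst x) * (Du x \<bullet> \<phi>' x (Du x)))
           + (LINT x:\<Omega> \<inter> upper|lebesgue.
                (F_fun g \<rho>0 p (tq Du x) (snd x)
                  - 2 * d1F g \<rho>0 p (tq Du x) (snd x) * tq Du x
                  + lam g \<rho>0 p (snd x) * indicator (pos_set u) x) * fst (\<phi> x))
           + (LINT x:\<Omega> \<inter> upper|lebesgue.
                fst x * (d2F g \<rho>0 p (tq Du x) (snd x)
                         + dlam g \<rho>0 p (snd x) * indicator (pos_set u) x) * snd (\<phi> x))"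

section \<open>The monotonicity functional\<close>

definition half_disc :: "real \<Rightarrow> plane set" where
  "half_disc r = ball 0 r \<inter> {x. fst x > 0}"

definition half_circle :: "real \<Rightarrow> plane set" where
  "half_circle r = {x. fst x > 0 \<and> norm x = r}"

definition I_fun ::
  "real \<Rightarrow> real \<Rightarrow> (real \<Rightarrow> real) \<Rightarrow> (plane \<Rightarrow> real) \<Rightarrow> (plane \<Rightarrow> plane) \<Rightarrow> real \<Rightarrow> real" where
  "I_fun g \<rho>0 p u Du r =
     (LINT x:half_disc r \<inter> upper|lebesgue.
        fst x * (F_fun g \<rho>0 p (tq Du x) (snd x)
                 + lam g \<rho>0 p (snd x) * indicator (pos_set u) x))"

definition J_fun :: "real \<Rightarrow> (plane \<Rightarrow> real) \<Rightarrow> real \<Rightarrow> real" where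
  "J_fun \<rho>0 u r = (LINT x:half_circle r|hausdorff1. (u x)\<^sup>2 / (fst x * \<rho>0))"

definition M_x1x2 ::
  "real \<Rightarrow> real \<Rightarrow> (real \<Rightarrow> real) \<Rightarrow> (plane \<Rightarrow> real) \<Rightarrow> (plane \<Rightarrow> plane) \<Rightarrow> real \<Rightarrow> real" where
  "M_x1x2 g \<rho>0 p u Du r = r powi (-4) * I_fun g \<rho>0 p u Du r - 5 / 2 * r powi (-5) * J_fun \<rho>0 u r"

definition K1_x2 ::
  "real \<Rightarrow> real \<Rightarrow> (real \<Rightarrow> real) \<Rightarrow> (plane \<Rightarrow> real) \<Rightarrow> (plane \<Rightarrow> plane) \<Rightarrow> real \<Rightarrow> real" where
  "K1_x2 g \<rho>0 p u Du r =
     (LINT x:half_disc r \<inter> upper|lebesgue.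
        fst x * ((LBINT \<tau>=ereal 0..ereal (tq Du x). dinvH g \<rho>0 p \<tau> (snd x) * \<tau>)
                 - (LBINT \<tau>=ereal 0..ereal (snd x). dinvH g \<rho>0 p \<tau> (snd x) * \<tau>)
                   * indicator (pos_set u) x))"

definition K1_x1x2 ::
  "real \<Rightarrow> real \<Rightarrow> (real \<Rightarrow> real) \<Rightarrow> (plane \<Rightarrow> real) \<Rightarrow> (plane \<Rightarrow> plane) \<Rightarrow> real \<Rightarrow> real" where
  "K1_x1x2 g \<rho>0 p u Du r =
     (LINT x:half_disc r \<inter> upper|lebesgue.
        fst x * snd x * (d2F g \<rho>0 p (tq Du x) (snd x)
                         + (dlam g \<rho>0 p (snd x) - 1 / \<rho>0) * indicator (pos_set u) x))"

text \<open>In the boundary integrals \<open>\<nu> = x / r\<close>.\<close>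

definition K2_x1x2 ::
  "real \<Rightarrow> real \<Rightarrow> (real \<Rightarrow> real) \<Rightarrow> (plane \<Rightarrow> real) \<Rightarrow> (plane \<Rightarrow> plane) \<Rightarrow> real \<Rightarrow> real" where
  "K2_x1x2 g \<rho>0 p u Du r =
     5 * (LINT x:half_circle r \<inter> upper|hausdorff1.
        (1 / (fst x * H_fun g \<rho>0 p (tq Du x) (snd x)) - 1 / (fst x * \<rho>0))
        * u x * (Du x \<bullet> (x /\<^sub>R r)))"

definition K3_x1x2 ::
  "real \<Rightarrow> real \<Rightarrow> (real \<Rightarrow> real) \<Rightarrow> (plane \<Rightarrow> real) \<Rightarrow> (plane \<Rightarrow> plane) \<Rightarrow> real \<Rightarrow> real" where
  "K3_x1x2 g \<rho>0 p u Du r =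
     25 / (2 * r) * (LINT x:half_circle r \<inter> upper|hausdorff1.
        (1 / (fst x * \<rho>0) - 1 / (fst x * H_fun g \<rho>0 p (tq Du x) (snd x))) * (u x)\<^sup>2)"

end

theory Submission
  imports Defs
begin

text \<open>
  All integrands vanish almost everywhere off the open set \<open>P = \<Omega> \<inter> {u > 0}\<close>, and on \<open>P\<close> near
  the origin every quantity is continuous and bounded, because \<open>H\<close> is a differentiable function of
  \<open>(t, s)\<close> on an open set \<open>D\<close> and subsonicity bounds \<open>t\<close>. Two identities drive the proof. The
  domain variation formula with the radial fields \<open>\<phi>(x) = e(|x|\<^sup>2) x\<close> is a Pohozaev identity. With
  \<open>\<phi> = \<psi> Du / (|Du|\<^sup>2 + k)\<close>, \<open>\<psi>\<close> of compact support in \<open>P\<close> and \<open>k \<rightarrow> 0\<close> it gives the weak form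
  of \<open>div (\<nabla>u / (x\<^sub>1 H)) = 0\<close> in \<open>P\<close>, and testing that with \<open>e(|x|\<^sup>2) u\<close>, truncated near the zero
  set of \<open>u\<close>, gives the energy identity. Letting \<open>e\<close> approach the indicator function of
  \<open>[0, r\<^sup>2]\<close> turns both into relations between integrals over the half-disc of radius \<open>r\<close> and
  over its circular arc, valid for almost every \<open>r\<close>. The derivative of \<open>I\<close> is an arc integral by
  polar coordinates; that of \<open>J\<close> follows by differentiating under the integral, since \<open>u\<close> is
  Lipschitz along rays with constant proportional to \<open>cos \<theta>\<close>. The formula is then algebra,
  because \<open>\<partial>\<^sub>2F + \<lambda>' = H / \<rho>0\<^sup>2\<close>.
\<close>

section \<open>Equation of state\<close>

text \<open>Scaling fixes the constants. On the free surface \<open>t = x_2\<close>, which suggests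
  that \<open>|Du|\<close> behaves like \<open>x_1 x_2^(1/2)\<close> and \<open>u\<close> like
  \<open>|x|^(5/2)\<close>; then \<open>I\<close> scales like \<open>r^4\<close>, \<open>J\<close>
  like \<open>r^5\<close>, and the squared boundary term vanishes for homogeneous profiles. The
  equation is not among the hypotheses and no regularity of the free boundary is known, so there is
  no divergence theorem on half-discs: all boundary terms have to come from variations. Moving
  points along \<open>\<phi>\<close> changes \<open>u\<close> to first order by
  \<open>Du \<bullet> \<phi>\<close>; for \<open>\<phi> = \<psi> Du / (|Du|^2 + k)\<close> this is
  nearly \<open>\<psi>\<close>, which is why domain variations contain the equation. In the final
  formula the mixed term of the square comes half from five times the energy identity and half from
  the derivative of \<open>J\<close>. As \<open>J\<close> has \<open>\<rho>0\<close> where the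
  square has \<open>H\<close>, the terms \<open>K2_x1x2\<close> and \<open>K3_x1x2\<close> make up
  the difference. The singular weight \<open>1 / x_1\<close> is harmless because subsonicity bounds
  \<open>|Du| / x_1\<close>, hence also \<open>u / x_1\<close>.\<close>

context equation_of_state
begin

abbreviation h :: "real \<Rightarrow> real" where "h \<equiv> h_fun \<rho>0 p"

text \<open>\<open>rho_cr\<close> is the solution of \<open>Q \<rho> = g * s\<close>. The sign of
  \<open>g * s - Q \<eta>\<close> separates subsonic from supersonic densities.\<close>

definition Q :: "real \<Rightarrow> real" where
  "Q \<rho> = deriv p \<rho> / 2 + h \<rho>"

lemma continuous_on_dp: "continuous_on {0<..} (deriv p)"
  using p_twice_diff by (simp add: continuous_at_imp_continuous_on differentiable_imp_continuous_within)

lemma h_has_derivative: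
  assumes "\<rho> > 0" shows "(h has_real_derivative deriv p \<rho> / \<rho>) (at \<rho>)"
proof -
  \<comment> \<open>An interval in the positive half-line around both \<open>\<rho>\<close> and
    \<open>\<rho>0\<close>, so that either order of the limits of integration is covered.\<close>
  define a b where "a = min \<rho> \<rho>0 / 2" and "b = max \<rho> \<rho>0 + 1"
  have ab: "0 < a" "a < \<rho>" "\<rho> < b" "a \<le> \<rho>0" "\<rho>0 \<le> b"
    using assms rho0_pos by (auto simp: a_def b_def)
  have "continuous_on {a..b} (\<lambda>s. deriv p s / s)"
    using ab by (intro continuous_intros continuous_on_subset[OF continuous_on_dp]) auto
  then have "((\<lambda>u. LBINT y=\<rho>0..u. deriv p y / y) has_vector_derivative deriv p \<rho> / \<rho>) (at \<rho> within {a..b})"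
    using ab by (intro interval_integral_FTC2) auto
  then show ?thesis
    using ab at_within_interior[of \<rho> "{a..b}"]
    by (simp add: h_fun_def[abs_def] has_real_derivative_iff_has_vector_derivative)
qed

lemma h_rho0: "h \<rho>0 = 0"
  by (simp add: h_fun_def)

lemma continuous_on_h: "continuous_on {0<..} h"
  by (meson DERIV_isCont continuous_at_imp_continuous_on greaterThan_iff h_has_derivative)

text \<open>This is where \<open>p''_cond\<close> enters:
  \<open>Q' = (2 p' + \<rho> p'') / (2 \<rho>)\<close>.\<close>

lemma Q_has_derivative:
  assumes "\<rho> > 0" shows "\<exists>d>0. (Q has_real_derivative d) (at \<rho>)"
proof -
  have "(deriv p has_real_derivative deriv (deriv p) \<rho>) (at \<rho>)"
    using p_twice_diff[OF assms] by (simp add: DERIV_deriv_iff_real_differentiable)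
  then have "(Q has_real_derivative deriv (deriv p) \<rho> / 2 + deriv p \<rho> / \<rho>) (at \<rho>)"
    unfolding Q_def[abs_def] by (intro DERIV_add DERIV_cdivide h_has_derivative assms)
  moreover have "deriv (deriv p) \<rho> / 2 + deriv p \<rho> / \<rho> > 0"
    using p''_cond[OF assms] assms by (simp add: field_simps)
  ultimately show ?thesis by blast
qed

lemma continuous_on_Q: "continuous_on {0<..} Q"
  by (meson DERIV_isCont continuous_at_imp_continuous_on greaterThan_iff Q_has_derivative)

lemma Q_less: "0 < a \<Longrightarrow> a < b \<Longrightarrow> Q a < Q b"
  using DERIV_pos_imp_increasing[of a b Q] Q_has_derivative by (meson less_le_trans)

lemma Q_less_iff: "0 < a \<Longrightarrow> 0 < b \<Longrightarrow> Q a < Q b \<longleftrightarrow> a < b"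
  by (metis Q_less less_asym less_linear)

lemma h_less: "0 < a \<Longrightarrow> a < b \<Longrightarrow> h a < h b"
  using DERIV_pos_imp_increasing[of a b h] h_has_derivative p'_pos
  by (meson divide_pos_pos less_le_trans)

lemma h_less_iff: "0 < a \<Longrightarrow> 0 < b \<Longrightarrow> h a < h b \<longleftrightarrow> a < b"
  by (metis h_less less_asym less_linear)

lemma h_less_Q: "0 < a \<Longrightarrow> h a < Q a"
  using p'_pos[of a] by (simp add: Q_def)

text \<open>The reason for the value of \<open>s_star\<close>: for \<open>s < s_star\<close> the
  critical density stays below \<open>\<rho>0\<close>, so the state \<open>\<rho>0\<close> is
  subsonic.\<close>

lemma Q_rho0: "Q \<rho>0 = g * s_star g \<rho>0 p"
  using g_pos by (simp add: Q_def h_rho0 s_star_def)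

section \<open>Critical density\<close>

lemma dp_bounded:
  obtains B where "\<And>\<rho>. 0 < \<rho> \<Longrightarrow> \<rho> \<le> \<rho>0 \<Longrightarrow> deriv p \<rho> \<le> B"
proof -
  obtain p' where p': "\<And>\<rho>. \<rho> \<ge> 0 \<Longrightarrow> (p has_real_derivative p' \<rho>) (at \<rho> within {0..})"
    and hol: "\<And>R. R > 0 \<Longrightarrow> \<exists>C. \<forall>a\<in>{0..R}. \<forall>b\<in>{0..R}. \<bar>p' a - p' b\<bar> \<le> C * \<bar>a - b\<bar> powr \<alpha>"
    using p_C1 unfolding C1_holder_halfline_def by blast
  \<comment> \<open>\<open>deriv p\<close> is two-sided while \<open>p'\<close> is one-sided at
    \<open>0\<close>, so the two are compared for positive arguments only.\<close>
  have eq: "deriv p \<rho> = p' \<rho>" if "\<rho> > 0" for \<rho>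
    using p'[of \<rho>] that at_within_interior[of \<rho> "{0..}"] by (auto intro: DERIV_imp_deriv)
  obtain C where C: "\<And>a b. a \<in> {0..\<rho>0} \<Longrightarrow> b \<in> {0..\<rho>0} \<Longrightarrow> \<bar>p' a - p' b\<bar> \<le> C * \<bar>a - b\<bar> powr \<alpha>"
    using hol[OF rho0_pos] by blast
  have "deriv p \<rho> \<le> p' \<rho>0 + \<bar>C\<bar> * \<rho>0 powr \<alpha>" if "0 < \<rho>" "\<rho> \<le> \<rho>0" for \<rho>
  proof -
    have "\<bar>p' \<rho> - p' \<rho>0\<bar> \<le> C * \<bar>\<rho> - \<rho>0\<bar> powr \<alpha>" using C[of \<rho> \<rho>0] that rho0_pos by auto
    also have "\<dots> \<le> \<bar>C\<bar> * \<rho>0 powr \<alpha>"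
      using that alpha by (intro mult_mono powr_mono2) auto
    finally show ?thesis using eq[OF that(1)] by linarith
  qed
  then show ?thesis using that by blast
qed

text \<open>This yields the critical density for all \<open>s \<ge> 0\<close>. If \<open>Q\<close>
  were nonnegative, then \<open>p' \<ge> -2 h\<close>, which near \<open>0\<close> is bounded below
  by a positive \<open>c\<close>. Integrating \<open>p' / s \<ge> c / s\<close> sends
  \<open>h\<close> to minus infinity like \<open>c * ln s\<close>, and \<open>p' \<ge> -2 h\<close>
  then contradicts the boundedness of \<open>p'\<close>.\<close>

lemma Q_negative: "\<exists>a>0. Q a < 0"
proof (rule ccontr)
  assume "\<not> ?thesis"
  then have Q0: "Q a \<ge> 0" if "a > 0" for a using that by force
  obtain B where B: "\<And>\<rho>. 0 < \<rho> \<Longrightarrow> \<rho> \<le> \<rho>0 \<Longrightarrow> deriv p \<rho> \<le> B" using dp_bounded by metis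
  define b c where "b = \<rho>0 / 2" and "c = - 2 * h b"
  have b: "0 < b" "b < \<rho>0" using rho0_pos by (auto simp: b_def)
  have c: "c > 0" using h_less[OF b] h_rho0 by (simp add: c_def)
  have q: "deriv p s \<ge> c" if "0 < s" "s \<le> b" for s
  proof -
    have "h s \<le> h b" using h_less[of s b] that by (cases "s = b") auto
    then show ?thesis using Q0[OF that(1)] by (simp add: Q_def c_def)
  qed
  have hb: "h s \<le> c * (ln s - ln b)" if "0 < s" "s \<le> b" for s
  proof -
    have "h s - c * ln s \<le> h b - c * ln b"
    proof (rule DERIV_nonneg_imp_nondecreasing[OF that(2)])
      fix x assume x: "s \<le> x" "x \<le> b"
      have "((\<lambda>x. h x - c * ln x) has_real_derivative deriv p x / x - c * (1 / x)) (at x)"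
        using x that by (intro DERIV_diff DERIV_cmult DERIV_ln_divide h_has_derivative) auto
      moreover have "deriv p x / x - c * (1 / x) \<ge> 0"
        using q[of x] x that by (simp add: field_simps)
      ultimately show "\<exists>y. ((\<lambda>x. h x - c * ln x) has_real_derivative y) (at x) \<and> 0 \<le> y" by blast
    qed
    moreover have "h b \<le> 0" using c by (simp add: c_def)
    ultimately show ?thesis by (simp add: algebra_simps)
  qed
  \<comment> \<open>Chosen so that \<open>c * (ln s - ln b)\<close> equals
    \<open>- (\<bar>B\<bar> + 1)\<close>, which pushes \<open>deriv p s\<close> above
    \<open>B\<close>.\<close>
  define s where "s = b * exp (- (\<bar>B\<bar> + 1) / c)"
  have s: "0 < s" "s \<le> b" using b c by (auto simp: s_def mult_le_cancel_left1 field_simps)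
  have "ln s - ln b = - (\<bar>B\<bar> + 1) / c"
    using b by (simp add: s_def ln_mult)
  then have "h s \<le> - (\<bar>B\<bar> + 1)" using hb[OF s] c by simp
  then have "deriv p s \<ge> 2 * (\<bar>B\<bar> + 1)" using Q0[OF s(1)] by (simp add: Q_def)
  moreover have "deriv p s \<le> B" using B s b by simp
  ultimately have "2 * (\<bar>B\<bar> + 1) \<le> \<bar>B\<bar>" using abs_ge_self[of B] by (meson order.trans)
  then show False by simp
qed

text \<open>An open set of admissible parameters: it reaches slightly below \<open>0\<close>, so that the
  one-sided derivatives at \<open>s = 0\<close> are restrictions of two-sided ones.\<close>

definition S :: "real set" where
  "S = {s. s < s_star g \<rho>0 p \<and> (\<exists>a>0. Q a < g * s)}"

lemma in_S: "0 \<le> s \<Longrightarrow> s < s_star g \<rho>0 p \<Longrightarrow> s \<in> S"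
  using Q_negative g_pos unfolding S_def
  by (smt (verit) mem_Collect_eq mult_nonneg_nonneg)

lemma open_S: "open S"
proof -
  have "S = {..<s_star g \<rho>0 p} \<inter> (\<Union>a\<in>{0<..}. {Q a / g<..})"
    using g_pos by (auto simp: S_def field_simps)
  then show ?thesis by (simp only:) (intro open_Int open_UN open_lessThan ballI open_greaterThan)
qed

text \<open>Intermediate value theorem on \<open>[a, \<rho>0]\<close>: membership in
  \<open>S\<close> provides \<open>a\<close> on the left, and \<open>s < s_star\<close> means
  \<open>g * s < Q \<rho>0\<close> on the right. Uniqueness is strict monotonicity of
  \<open>Q\<close>.\<close>

lemma Q_rho_cr:
  assumes "s \<in> S"
  shows "rho_cr g \<rho>0 p s > 0" "Q (rho_cr g \<rho>0 p s) = g * s" "rho_cr g \<rho>0 p s < \<rho>0"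
proof -
  obtain a where a: "a > 0" "Q a < g * s" and s: "g * s < Q \<rho>0"
    using assms g_pos by (auto simp: S_def Q_rho0)
  have "a < \<rho>0" using a s Q_less_iff rho0_pos by fastforce
  then obtain x where x: "a \<le> x" "x \<le> \<rho>0" "Q x = g * s"
    using IVT'[of Q a "g * s" \<rho>0] a s continuous_on_subset[OF continuous_on_Q, of "{a..\<rho>0}"]
    by (metis atLeastAtMost_iff greaterThan_iff less_le_trans less_imp_le subsetI)
  then have "rho_cr g \<rho>0 p s = x"
    unfolding rho_cr_def Q_def[symmetric]
    using a by (intro the_equality) (auto, metis Q_less less_linear less_irrefl less_le_trans)
  then show "rho_cr g \<rho>0 p s > 0" "Q (rho_cr g \<rho>0 p s) = g * s" "rho_cr g \<rho>0 p s < \<rho>0"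
    using a x s by (auto simp: less_le)
qed

lemma rho_cr_less_iff: "s \<in> S \<Longrightarrow> 0 < \<eta> \<Longrightarrow> rho_cr g \<rho>0 p s < \<eta> \<longleftrightarrow> g * s < Q \<eta>"
  using Q_rho_cr[of s] Q_less_iff by metis

lemma rho_cr_mono: "s \<in> S \<Longrightarrow> s' \<in> S \<Longrightarrow> s \<le> s' \<Longrightarrow> rho_cr g \<rho>0 p s \<le> rho_cr g \<rho>0 p s'"
  by (smt (verit) Q_rho_cr Q_less_iff g_pos mult_left_mono)

section \<open>The density as a function of \<open>t\<close> and \<open>s\<close>\<close>

definition T :: "real \<Rightarrow> real \<Rightarrow> real" where
  "T \<eta> s = \<eta>\<^sup>2 * (g * s - h \<eta>) / (g * \<rho>0\<^sup>2)"

text \<open>The condition \<open>g * s < Q \<eta>\<close> says \<open>\<eta> > rho_cr\<close>. As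
  \<open>T\<close> is the equation for \<open>H\<close> solved for \<open>t\<close>, on
  \<open>V\<close> the function \<open>H\<close> inverts \<open>T\<close> in its first
  argument.\<close>

definition V :: "(real \<times> real) set" where
  "V = {(\<eta>, s). 0 < \<eta> \<and> s \<in> S \<and> g * s < Q \<eta>}"

text \<open>Parametrising the admissible pairs by the density makes this an image of an explicit
  set; the range of \<open>t\<close> for a given \<open>s\<close> never has to be computed.\<close>

definition D :: "(real \<times> real) set" where
  "D = (\<lambda>(\<eta>, s). (T \<eta> s, s)) ` V"

abbreviation H :: "real \<Rightarrow> real \<Rightarrow> real" where "H \<equiv> H_fun g \<rho>0 p"

lemma is_H_iff:
  assumes "s \<in> S" shows "is_H g \<rho>0 p t s \<eta> \<longleftrightarrow> (\<eta>, s) \<in> V \<and> T \<eta> s = t"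
proof -
  have "\<eta> > 0 \<Longrightarrow> g * \<rho>0\<^sup>2 * t / \<eta>\<^sup>2 + h \<eta> = g * s \<longleftrightarrow> T \<eta> s = t"
    using g_pos rho0_pos by (auto simp: T_def field_simps)
  then show ?thesis
    unfolding is_H_def V_def using assms rho_cr_less_iff[OF assms] Q_rho_cr(1)[OF assms]
    by (smt (verit) mem_Collect_eq prod.case)
qed

lemma V_S: "(\<eta>, s) \<in> V \<Longrightarrow> s \<in> S"
  by (simp add: V_def)

lemma T_has_derivative:
  assumes "\<eta> > 0"
  shows "((\<lambda>\<eta>. T \<eta> s) has_real_derivative 2 * \<eta> * (g * s - Q \<eta>) / (g * \<rho>0\<^sup>2)) (at \<eta>)"
  unfolding T_def using assms g_pos rho0_pos
  by (auto intro!: derivative_eq_intros h_has_derivative simp: Q_def power2_eq_square field_simps)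

text \<open>The derivative of \<open>T\<close> in \<open>\<eta>\<close> is a positive multiple of
  \<open>g * s - Q \<eta>\<close>, so subsonicity is exactly strict decrease. Since \<open>Q\<close>
  increases, the sign persists on all of \<open>[a, b]\<close>.\<close>

lemma T_less:
  assumes "(a, s) \<in> V" "a < b" shows "T b s < T a s"
proof (rule DERIV_neg_imp_decreasing[OF assms(2)])
  fix x assume x: "a \<le> x" "x \<le> b"
  have a: "0 < a" "g * s < Q a" using assms by (auto simp: V_def)
  have "g * s < Q x" using Q_less[of a x] x a by (cases "a = x") auto
  then have "2 * x * (g * s - Q x) / (g * \<rho>0\<^sup>2) < 0"
    using a x g_pos rho0_pos by (auto intro!: divide_neg_pos mult_pos_neg)
  then show "\<exists>y. ((\<lambda>\<eta>. T \<eta> s) has_real_derivative y) (at x) \<and> y < 0"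
    using T_has_derivative[of x s] a x by (intro exI conjI) auto
qed

lemma T_inj: "(a, s) \<in> V \<Longrightarrow> (b, s) \<in> V \<Longrightarrow> T a s = T b s \<Longrightarrow> a = b"
  by (metis T_less less_irrefl linorder_cases)

lemma H_eqI: "(\<eta>, s) \<in> V \<Longrightarrow> H (T \<eta> s) s = \<eta>"
  unfolding H_fun_def using T_inj by (intro the_equality) (auto simp: is_H_iff V_S)

lemma H_in_V:
  assumes "(t, s) \<in> D" shows "(H t s, s) \<in> V" "T (H t s) s = t"
  using assms by (auto simp: D_def H_eqI)

lemma D_I: "(\<eta>, s) \<in> V \<Longrightarrow> (T \<eta> s, s) \<in> D"
  by (auto simp: D_def)

lemma in_D_iff: "(t, s) \<in> D \<longleftrightarrow> s \<in> S \<and> (\<exists>\<eta>. is_H g \<rho>0 p t s \<eta>)"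
proof
  assume "(t, s) \<in> D"
  then obtain \<eta> where "(\<eta>, s) \<in> V" "T \<eta> s = t" by (auto simp: D_def)
  then show "s \<in> S \<and> (\<exists>\<eta>. is_H g \<rho>0 p t s \<eta>)" using is_H_iff V_S by blast
next
  assume "s \<in> S \<and> (\<exists>\<eta>. is_H g \<rho>0 p t s \<eta>)"
  then obtain \<eta> where "s \<in> S" "is_H g \<rho>0 p t s \<eta>" by blast
  then have "(\<eta>, s) \<in> V" "T \<eta> s = t" using is_H_iff by auto
  then show "(t, s) \<in> D" using D_I by blast
qed

lemma V_up: "(a, s) \<in> V \<Longrightarrow> a \<le> b \<Longrightarrow> (b, s) \<in> V"
  unfolding V_def using Q_less[of a b] by (cases "a = b") auto

lemma open_V: "open V"
proof -
  have *: "open ({0::real<..} \<times> S)" by (intro open_Times open_S) simp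
  have "continuous_on ({0<..} \<times> S) (\<lambda>x. Q (fst x) - g * snd x)"
    by (intro continuous_intros continuous_on_compose2[OF continuous_on_Q]) auto
  then have "open (({0<..} \<times> S) \<inter> (\<lambda>x. Q (fst x) - g * snd x) -` {0<..})"
    by (rule continuous_open_preimage[OF _ *]) auto
  moreover have "V = ({0<..} \<times> S) \<inter> (\<lambda>x. Q (fst x) - g * snd x) -` {0<..}"
    by (auto simp: V_def)
  ultimately show ?thesis by simp
qed

lemma continuous_on_Psi: "continuous_on V (\<lambda>(\<eta>, s). (T \<eta> s, s))"
  unfolding T_def case_prod_beta using g_pos rho0_pos
  by (intro continuous_intros continuous_on_compose2[OF continuous_on_h]) (auto simp: V_def)

text \<open>Invariance of domain: \<open>(\<eta>, s) \<mapsto> (T \<eta> s, s)\<close> is continuous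
  and injective on the open set \<open>V\<close>.\<close>

lemma open_D: "open D"
  unfolding D_def
  by (rule invariance_of_domain[OF continuous_on_Psi open_V]) (auto simp: inj_on_def intro: T_inj)

lemma H_pos: "(t, s) \<in> D \<Longrightarrow> H t s > 0"
  using H_in_V by (auto simp: V_def)

definition dH :: "real \<Rightarrow> real \<Rightarrow> real" where
  "dH t s = g * \<rho>0\<^sup>2 / (2 * H t s * (g * s - Q (H t s)))"

text \<open>Inverse function theorem for \<open>(\<eta>, s) \<mapsto> (T \<eta> s, s)\<close>, whose
  derivative is triangular with first row \<open>c\<close>,
  \<open>\<eta>\<^sup>2 / \<rho>0\<^sup>2\<close>. The inverse map is already at hand, so it is
  enough to invert the derivative at one point.\<close>

lemma H_has_derivative:
  assumes "(t, s) \<in> D"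
  shows "((\<lambda>x. H (fst x) (snd x)) has_derivative
    (\<lambda>v. dH t s * (fst v - (H t s)\<^sup>2 / \<rho>0\<^sup>2 * snd v))) (at (t, s))"
proof -
  define \<eta> where "\<eta> = H t s"
  have V: "(\<eta>, s) \<in> V" "T \<eta> s = t" using H_in_V[OF assms] by (auto simp: \<eta>_def)
  have pos: "\<eta> > 0" "g * s < Q \<eta>" using V by (auto simp: V_def)
  define c where "c = 2 * \<eta> * (g * s - Q \<eta>) / (g * \<rho>0\<^sup>2)"
  have c: "c \<noteq> 0" using pos g_pos rho0_pos by (auto simp: c_def)
  have dT: "((\<lambda>x. T (fst x) (snd x)) has_derivative (\<lambda>v. c * fst v + \<eta>\<^sup>2 / \<rho>0\<^sup>2 * snd v)) (at (\<eta>, s))"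
  proof -
    have dh: "(h has_derivative (*) (deriv p \<eta> / \<eta>)) (at (fst (\<eta>, s)))"
      using h_has_derivative[OF pos(1)] by (simp add: has_field_derivative_def)
    have dh: "((\<lambda>x::real\<times>real. h (fst x)) has_derivative (\<lambda>v. deriv p \<eta> / \<eta> * fst v)) (at (\<eta>, s))"
      using has_derivative_compose[OF has_derivative_fst[OF has_derivative_ident] dh] .
    have "((\<lambda>x::real\<times>real. (fst x)\<^sup>2 * (g * snd x - h (fst x)) * (1 / (g * \<rho>0\<^sup>2))) has_derivative
      (\<lambda>v. (\<eta>\<^sup>2 * (g * snd v - deriv p \<eta> / \<eta> * fst v) + 2 * \<eta> * fst v * (g * s - h \<eta>)) * (1 / (g * \<rho>0\<^sup>2)))) (at (\<eta>, s))"
      by (rule derivative_eq_intros dh refl | simp add: fun_eq_iff)+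
    moreover have "(\<eta>\<^sup>2 * (g * snd v - deriv p \<eta> / \<eta> * fst v) + 2 * \<eta> * fst v * (g * s - h \<eta>)) * (1 / (g * \<rho>0\<^sup>2))
       = c * fst v + \<eta>\<^sup>2 / \<rho>0\<^sup>2 * snd v" for v :: "real \<times> real"
      using pos g_pos rho0_pos by (simp add: c_def Q_def field_simps power2_eq_square)
    ultimately show ?thesis unfolding T_def by simp
  qed
  have "((\<lambda>y. (H (fst y) (snd y), snd y)) has_derivative
      (\<lambda>v. (1 / c * (fst v - \<eta>\<^sup>2 / \<rho>0\<^sup>2 * snd v), snd v))) (at ((\<lambda>(\<eta>, s). (T \<eta> s, s)) (\<eta>, s)))"
  proof (rule has_derivative_inverse_strong[OF open_V V(1) continuous_on_Psi])
    show "((\<lambda>(\<eta>, s). (T \<eta> s, s)) has_derivative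
        (\<lambda>v. (c * fst v + \<eta>\<^sup>2 / \<rho>0\<^sup>2 * snd v, snd v))) (at (\<eta>, s))"
      unfolding case_prod_beta
      by (intro has_derivative_Pair dT has_derivative_snd has_derivative_ident)
  next
    fix x assume "x \<in> V"
    then show "(\<lambda>y. (H (fst y) (snd y), snd y)) ((\<lambda>(\<eta>, s). (T \<eta> s, s)) x) = x"
      by (cases x) (simp add: H_eqI)
  next
    show "(\<lambda>v. (c * fst v + \<eta>\<^sup>2 / \<rho>0\<^sup>2 * snd v, snd v)) \<circ>
        (\<lambda>v. (1 / c * (fst v - \<eta>\<^sup>2 / \<rho>0\<^sup>2 * snd v), snd v)) = id"
      using c by (auto simp: fun_eq_iff)
  qed
  then have "((\<lambda>y. (H (fst y) (snd y), snd y)) has_derivative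
      (\<lambda>v. (1 / c * (fst v - \<eta>\<^sup>2 / \<rho>0\<^sup>2 * snd v), snd v))) (at (t, s))"
    using V by simp
  from has_derivative_fst[OF this]
  have "((\<lambda>x. H (fst x) (snd x)) has_derivative (\<lambda>v. 1 / c * (fst v - \<eta>\<^sup>2 / \<rho>0\<^sup>2 * snd v))) (at (t, s))"
    by (simp only: fst_conv)
  moreover have "1 / c = dH t s" by (simp add: dH_def c_def \<eta>_def)
  ultimately show ?thesis by (simp only: \<eta>_def)
qed

lemma continuous_on_H: "continuous_on D (\<lambda>x. H (fst x) (snd x))"
proof (intro continuous_at_imp_continuous_on ballI)
  fix x assume "x \<in> D"
  then show "isCont (\<lambda>x. H (fst x) (snd x)) x"
    using has_derivative_continuous[OF H_has_derivative[of "fst x" "snd x"]] by simp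
qed

lemma continuous_on_dH: "continuous_on D (\<lambda>x. dH (fst x) (snd x))"
proof -
  have "H (fst x) (snd x) > 0 \<and> g * snd x < Q (H (fst x) (snd x))" if "x \<in> D" for x
    using H_in_V(1)[of "fst x" "snd x"] that by (auto simp: V_def)
  then have *: "(\<lambda>x. H (fst x) (snd x)) ` D \<subseteq> {0<..}"
      "\<And>x. x \<in> D \<Longrightarrow> 2 * H (fst x) (snd x) * (g * snd x - Q (H (fst x) (snd x))) \<noteq> 0"
    by (blast, smt (verit) mult_eq_0_iff)
  show ?thesis unfolding dH_def
    by (intro continuous_intros continuous_on_H continuous_on_compose2[OF continuous_on_Q continuous_on_H] *)
       (use *(2) in auto)
qed

text \<open>By \<open>p''_cond\<close> the function \<open>\<rho>\<^sup>2 p'\<close> increases.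
  Hence \<open>p' \<ge> k / \<rho>\<^sup>2\<close> beyond \<open>\<rho>0\<close>, and integrating
  \<open>p' / \<rho>\<close> bounds \<open>h\<close> from below by an expression with limit
  \<open>k / (2 \<rho>0\<^sup>2) = g * s_star\<close>. This provides a density at
  \<open>t = 0\<close> for every \<open>s < s_star\<close>.\<close>

lemma h_large: "\<exists>\<eta>\<ge>\<rho>0. h \<eta> \<ge> g * s_star g \<rho>0 p - e" if "e > 0" for e
proof -
  define k where "k = deriv p \<rho>0 * \<rho>0\<^sup>2"
  have k: "k > 0" using p'_pos rho0_pos by (simp add: k_def)
  have q: "deriv p x * x\<^sup>2 \<ge> k" if "x \<ge> \<rho>0" for x
    unfolding k_def
  proof (rule DERIV_nonneg_imp_nondecreasing[OF that])
    fix y assume y: "\<rho>0 \<le> y"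
    then have y0: "y > 0" using rho0_pos by simp
    have "(deriv p has_real_derivative deriv (deriv p) y) (at y)"
      using p_twice_diff[OF y0] by (simp add: DERIV_deriv_iff_real_differentiable)
    then have "((\<lambda>x. deriv p x * x\<^sup>2) has_real_derivative y * (2 * deriv p y + y * deriv (deriv p) y)) (at y)"
      by (auto intro!: derivative_eq_intros simp: power2_eq_square algebra_simps)
    then show "\<exists>z. ((\<lambda>x. deriv p x * x\<^sup>2) has_real_derivative z) (at y) \<and> 0 \<le> z"
      using p''_cond[OF y0] y0 by (intro exI conjI) auto
  qed
  have hb: "k / 2 * (1 / \<rho>0\<^sup>2 - 1 / x\<^sup>2) \<le> h x" if "x \<ge> \<rho>0" for x
  proof -
    have "h \<rho>0 + k / 2 * (1 / \<rho>0\<^sup>2) \<le> h x + k / 2 * (1 / x\<^sup>2)"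
    proof (rule DERIV_nonneg_imp_nondecreasing[OF that])
      fix y assume y: "\<rho>0 \<le> y"
      then have y0: "y > 0" using rho0_pos by simp
      have "((\<lambda>x. h x + k / 2 * (1 / x\<^sup>2)) has_real_derivative deriv p y / y - k / y ^ 3) (at y)"
        using y0 by (auto intro!: derivative_eq_intros h_has_derivative simp: field_simps eval_nat_numeral)
      moreover have "deriv p y / y - k / y ^ 3 \<ge> 0"
        using q[OF y] y0 by (simp add: field_simps power2_eq_square eval_nat_numeral)
      ultimately show "\<exists>z. ((\<lambda>x. h x + k / 2 * (1 / x\<^sup>2)) has_real_derivative z) (at y) \<and> 0 \<le> z"
        by blast
    qed
    then show ?thesis by (simp add: h_rho0 algebra_simps)
  qed
  have lim: "k / 2 * (1 / \<rho>0\<^sup>2) = g * s_star g \<rho>0 p"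
    using g_pos rho0_pos by (simp add: k_def s_star_def)
  define x where "x = max \<rho>0 (sqrt (k / (2 * e)))"
  have x: "x \<ge> \<rho>0" "x > 0" using rho0_pos by (auto simp: x_def)
  have "x\<^sup>2 \<ge> k / (2 * e)"
    using x k that by (metis x_def max.cobounded2 real_sqrt_le_iff real_sqrt_unique less_imp_le sqrt_le_D)
  then have "k / 2 * (1 / x\<^sup>2) \<le> e" using that x k by (simp add: field_simps)
  then have "h x \<ge> g * s_star g \<rho>0 p - e"
    using hb[OF x(1)] lim by (simp add: algebra_simps)
  then show ?thesis using x by blast
qed

text \<open>For fixed \<open>s\<close> the function \<open>T\<close> is continuous and decreasing,
  so it takes the value \<open>\<tau>\<close> between the densities belonging to \<open>t'\<close>
  and \<open>t\<close>.\<close>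

lemma D_interval:
  assumes "(t, s) \<in> D" "(t', s) \<in> D" "t \<le> \<tau>" "\<tau> \<le> t'" shows "(\<tau>, s) \<in> D"
proof -
  define a b where "a = H t' s" and "b = H t s"
  have V: "(a, s) \<in> V" "T a s = t'" "(b, s) \<in> V" "T b s = t"
    using H_in_V assms by (auto simp: a_def b_def)
  have "a \<le> b" using T_less[of b s a] V assms by fastforce
  moreover have "continuous_on {a..b} (\<lambda>\<eta>. T \<eta> s)"
    using V by (intro continuous_at_imp_continuous_on ballI DERIV_isCont[OF T_has_derivative])
      (auto simp: V_def)
  ultimately obtain x where "a \<le> x" "T x s = \<tau>"
    using IVT2'[of "\<lambda>\<eta>. T \<eta> s" b \<tau> a] V assms by auto
  then show ?thesis using D_I V_up V by blast
qed

lemma rho0_in_V: "s \<in> S \<Longrightarrow> (\<rho>0, s) \<in> V"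
  using rho0_pos g_pos by (auto simp: V_def Q_rho0 S_def)

lemma diag_in_D: "s \<in> S \<Longrightarrow> (s, s) \<in> D" and H_diag: "s \<in> S \<Longrightarrow> H s s = \<rho>0"
proof -
  assume s: "s \<in> S"
  have "T \<rho>0 s = s" using g_pos rho0_pos by (simp add: T_def h_rho0)
  then show "(s, s) \<in> D" "H s s = \<rho>0" using D_I H_eqI rho0_in_V[OF s] by metis+
qed

text \<open>At \<open>t = 0\<close> the density solves \<open>h \<eta> = g * s\<close>. At the
  critical density \<open>h < Q = g * s\<close>, while \<open>h_large\<close> gives a density with
  \<open>h \<ge> g * s\<close>; a solution in between is subsonic because
  \<open>Q > h\<close>.\<close>

lemma zero_in_D:
  assumes s: "s \<in> S" shows "(0, s) \<in> D"
proof -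
  obtain \<eta> where \<eta>: "\<eta> \<ge> \<rho>0" "h \<eta> \<ge> g * s_star g \<rho>0 p - g * (s_star g \<rho>0 p - s)"
    using h_large[of "g * (s_star g \<rho>0 p - s)"] s g_pos by (auto simp: S_def)
  then have h\<eta>: "h \<eta> \<ge> g * s" by (simp add: algebra_simps)
  define c where "c = rho_cr g \<rho>0 p s"
  have c: "0 < c" "Q c = g * s" "c < \<rho>0" using Q_rho_cr[OF s] by (auto simp: c_def)
  have "h c \<le> g * s" using h_less_Q[OF c(1)] c by simp
  then obtain x where x: "c \<le> x" "h x = g * s"
    using IVT'[of h c "g * s" \<eta>] h\<eta> c \<eta> continuous_on_subset[OF continuous_on_h, of "{c..\<eta>}"]
    by (metis atLeastAtMost_iff greaterThan_iff less_le_trans order.trans less_imp_le subsetI)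
  have "(x, s) \<in> V" using x c s h_less_Q[of x] by (auto simp: V_def)
  moreover have "T x s = 0" using x by (simp add: T_def)
  ultimately show ?thesis using D_I by metis
qed

lemma h_H0: "s \<in> S \<Longrightarrow> h (H 0 s) = g * s"
  using H_in_V[OF zero_in_D] g_pos rho0_pos H_pos[OF zero_in_D]
  by (fastforce simp: T_def)

lemma H_antimono:
  assumes "(t, s) \<in> D" "(t', s) \<in> D" "t \<le> t'" shows "H t' s \<le> H t s"
  using T_less[of "H t s" s "H t' s"] H_in_V[OF assms(1)] H_in_V[OF assms(2)] assms(3) by fastforce


lemma D_in_S: "(t, s) \<in> D \<Longrightarrow> s \<in> S"
  using in_D_iff by blast

lemma H0_has_derivative:
  assumes "s \<in> S"
  shows "((\<lambda>s. H 0 s) has_real_derivative - dH 0 s * (H 0 s)\<^sup>2 / \<rho>0\<^sup>2) (at s)"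
proof -
  have *: "((\<lambda>s. (0::real, s)) has_derivative (\<lambda>v. (0, v))) (at s)"
    by (intro has_derivative_Pair has_derivative_const has_derivative_ident)
  have "((\<lambda>x. H (fst x) (snd x)) has_derivative
    (\<lambda>v. dH 0 s * (fst v - (H 0 s)\<^sup>2 / \<rho>0\<^sup>2 * snd v))) (at (0, s))"
    using H_has_derivative[OF zero_in_D[OF assms]] .
  from has_derivative_compose[OF * this]
  show ?thesis
    by (auto simp: has_field_derivative_def fun_eq_iff elim!: has_derivative_eq_rhs)
qed

lemma H_has_real_derivative_1:
  assumes "(t, s) \<in> D"
  shows "((\<lambda>t. H t s) has_real_derivative dH t s) (at t)"
proof -
  have *: "((\<lambda>t. (t, s)) has_derivative (\<lambda>v. (v, 0::real))) (at t)"
    by (intro has_derivative_Pair has_derivative_const has_derivative_ident)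
  from has_derivative_compose[OF * H_has_derivative[OF assms]]
  show ?thesis
    by (auto simp: has_field_derivative_def fun_eq_iff elim!: has_derivative_eq_rhs)
qed

section \<open>Closed form of \<open>F\<close>, and the derivatives of \<open>F\<close>,
  \<open>lam\<close> and \<open>1 / H\<close>\<close>

definition \<Phi> :: "real \<Rightarrow> real" where
  "\<Phi> x = (LBINT y=ereal \<rho>0..ereal x. h y)"

lemma \<Phi>_has_derivative:
  assumes "x > 0" shows "(\<Phi> has_real_derivative h x) (at x)"
proof -
  define a b where "a = min x \<rho>0 / 2" and "b = max x \<rho>0 + 1"
  have ab: "0 < a" "a < x" "x < b" "a \<le> \<rho>0" "\<rho>0 \<le> b"
    using assms rho0_pos by (auto simp: a_def b_def)
  have "continuous_on {a..b} h"
    using ab by (intro continuous_on_subset[OF continuous_on_h]) auto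
  then have "((\<lambda>u. LBINT y=\<rho>0..u. h y) has_vector_derivative h x) (at x within {a..b})"
    using ab by (intro interval_integral_FTC2) auto
  then show ?thesis
    using ab at_within_interior[of x "{a..b}"]
    by (simp add: \<Phi>_def[abs_def] has_real_derivative_iff_has_vector_derivative)
qed

text \<open>Integrating \<open>1 / H\<close> by parts and substituting \<open>\<tau> = T \<eta> s\<close> gives a closed form of \<open>F\<close>
  in terms of \<open>H\<close> and an antiderivative of \<open>h\<close>.\<close>

definition Fx :: "real \<times> real \<Rightarrow> real" where
  "Fx x = fst x / H (fst x) (snd x)
     - (g * snd x * (H 0 (snd x) - H (fst x) (snd x)) - \<Phi> (H 0 (snd x)) + \<Phi> (H (fst x) (snd x)))
       / (g * \<rho>0\<^sup>2)"

text \<open>All terms containing derivatives of \<open>H\<close> cancel: those at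
  \<open>(t, s)\<close> by \<open>t = T (H t s) s\<close>, those at \<open>(0, s)\<close> by
  \<open>h (H 0 s) = g * s\<close>. The closed form thus gives the derivative in \<open>s\<close>
  without differentiating under the integral that defines \<open>F\<close>.\<close>

lemma Fx_has_derivative:
  assumes "(t, s) \<in> D"
  shows "(Fx has_derivative (\<lambda>v. fst v / H t s + (H t s - H 0 s) / \<rho>0\<^sup>2 * snd v)) (at (t, s))"
proof -
  have s: "s \<in> S" using D_in_S assms .
  define c0 where "c0 = - dH 0 s * (H 0 s)\<^sup>2 / \<rho>0\<^sup>2"
  define L where "L v = dH t s * (fst v - (H t s)\<^sup>2 / \<rho>0\<^sup>2 * snd v)" for v :: "real \<times> real"
  have dH: "((\<lambda>x. H (fst x) (snd x)) has_derivative L) (at (t, s))"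
    unfolding L_def using H_has_derivative[OF assms] .
  have "((\<lambda>s. H 0 s) has_derivative (*) c0) (at (snd (t, s)))"
    using H0_has_derivative[OF s] by (simp add: c0_def has_field_derivative_def)
  from has_derivative_compose[OF has_derivative_snd[OF has_derivative_ident] this]
  have dH0: "((\<lambda>x::real\<times>real. H 0 (snd x)) has_derivative (\<lambda>v. c0 * snd v)) (at (t, s))" .
  have pos: "H t s > 0" "H 0 s > 0" using H_pos assms zero_in_D[OF s] by auto
  have d\<Phi>: "(\<Phi> has_derivative (*) (h x)) (at x)" if "x > 0" for x
    using \<Phi>_has_derivative[OF that] by (simp add: has_field_derivative_def)
  have d1: "((\<lambda>x. \<Phi> (H (fst x) (snd x))) has_derivative (\<lambda>v. h (H t s) * L v)) (at (t, s))"
    by (rule has_derivative_compose[OF dH]) (use d\<Phi>[OF pos(1)] in simp)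
  have d2: "((\<lambda>x. \<Phi> (H 0 (snd x))) has_derivative (\<lambda>v. h (H 0 s) * (c0 * snd v))) (at (t, s))"
    by (rule has_derivative_compose[OF dH0]) (use d\<Phi>[OF pos(2)] in simp)
  have pos': "H (fst (t, s)) (snd (t, s)) \<noteq> 0" using pos by simp
  have dA: "((\<lambda>x. fst x / H (fst x) (snd x)) has_derivative
      (\<lambda>v. (fst v * H t s - t * L v) / (H t s * H t s))) (at (t, s))"
    using has_derivative_divide'[OF has_derivative_fst[OF has_derivative_ident] dH pos'] by simp
  have dg: "((\<lambda>x::real\<times>real. g * snd x) has_derivative (\<lambda>v. g * snd v)) (at (t, s))"
    by (intro has_derivative_mult_right has_derivative_snd has_derivative_ident)
  have dB: "((\<lambda>x. g * snd x * (H 0 (snd x) - H (fst x) (snd x))) has_derivative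
      (\<lambda>v. g * s * (c0 * snd v - L v) + g * snd v * (H 0 s - H t s))) (at (t, s))"
    using has_derivative_mult[OF dg has_derivative_diff[OF dH0 dH]] by simp
  have "(Fx has_derivative (\<lambda>v. (fst v * H t s - t * L v) / (H t s * H t s)
     - (g * s * (c0 * snd v - L v) + g * snd v * (H 0 s - H t s) - h (H 0 s) * (c0 * snd v) + h (H t s) * L v)
       / (g * \<rho>0\<^sup>2))) (at (t, s))"
    unfolding Fx_def[abs_def]
    by (intro has_derivative_diff dA has_derivative_add dB d1 d2
        bounded_linear.has_derivative[OF bounded_linear_divide])
  moreover have "(fst v * H t s - t * L v) / (H t s * H t s)
     - (g * s * (c0 * snd v - L v) + g * snd v * (H 0 s - H t s) - h (H 0 s) * (c0 * snd v) + h (H t s) * L v)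
       / (g * \<rho>0\<^sup>2) = fst v / H t s + (H t s - H 0 s) / \<rho>0\<^sup>2 * snd v" for v
  proof -
    define \<eta> \<eta>0 l where "\<eta> = H t s" and "\<eta>0 = H 0 s" and "l = L v"
    have t: "t = \<eta>\<^sup>2 * (g * s - h \<eta>) / (g * \<rho>0\<^sup>2)"
      using H_in_V(2)[OF assms] by (simp add: T_def \<eta>_def)
    have \<eta>: "\<eta> > 0" using pos by (simp add: \<eta>_def)
    have 1: "(fst v * \<eta> - t * l) / (\<eta> * \<eta>) = fst v / \<eta> - (g * s - h \<eta>) * l / (g * \<rho>0\<^sup>2)"
      using \<eta> g_pos rho0_pos unfolding t by (simp add: field_simps power2_eq_square)
    have 2: "g * s * (c0 * snd v - l) + g * snd v * (\<eta>0 - \<eta>) - g * s * (c0 * snd v) + h \<eta> * l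
        = - ((g * s - h \<eta>) * l) + g * (snd v * (\<eta>0 - \<eta>))"
      by (simp add: algebra_simps)
    have 3: "(- ((g * s - h \<eta>) * l) + g * (snd v * (\<eta>0 - \<eta>))) / (g * \<rho>0\<^sup>2)
        = - ((g * s - h \<eta>) * l / (g * \<rho>0\<^sup>2)) - (\<eta> - \<eta>0) / \<rho>0\<^sup>2 * snd v"
      using g_pos rho0_pos by (simp add: field_simps)
    show ?thesis
      unfolding \<eta>_def[symmetric] \<eta>0_def[symmetric] l_def[symmetric]
        h_H0[OF s, folded \<eta>0_def] 1 2 3 by simp
  qed
  ultimately show ?thesis by simp
qed

lemma Fx_has_real_derivative_1:
  assumes "(t, s) \<in> D"
  shows "((\<lambda>t. Fx (t, s)) has_real_derivative 1 / H t s) (at t)"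
proof -
  have *: "((\<lambda>t. (t, s)) has_derivative (\<lambda>v. (v, 0::real))) (at t)"
    by (intro has_derivative_Pair has_derivative_const has_derivative_ident)
  from has_derivative_compose[OF * Fx_has_derivative[OF assms]]
  show ?thesis
    by (auto simp: has_field_derivative_def fun_eq_iff elim!: has_derivative_eq_rhs)
qed

lemma Fx_has_real_derivative_2:
  assumes "(t, s) \<in> D"
  shows "((\<lambda>s. Fx (t, s)) has_real_derivative (H t s - H 0 s) / \<rho>0\<^sup>2) (at s)"
proof -
  have *: "((\<lambda>s. (t, s)) has_derivative (\<lambda>v. (0::real, v))) (at s)"
    by (intro has_derivative_Pair has_derivative_const has_derivative_ident)
  from has_derivative_compose[OF * Fx_has_derivative[OF assms]]
  show ?thesis
    by (auto simp: has_field_derivative_def fun_eq_iff elim!: has_derivative_eq_rhs)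
qed

text \<open>Negative \<open>t\<close> are included: \<open>D\<close> is a neighbourhood of
  \<open>t = 0\<close>, and the derivative at \<open>t = 0\<close> is compared on both
  sides.\<close>

lemma F_eq_Fx:
  assumes "(t, s) \<in> D" shows "F_fun g \<rho>0 p t s = Fx (t, s)"
proof -
  have s: "s \<in> S" using D_in_S assms .
  have D: "(\<tau>, s) \<in> D" if "min 0 t \<le> \<tau>" "\<tau> \<le> max 0 t" for \<tau>
    using D_interval[OF assms zero_in_D[OF s]] D_interval[OF zero_in_D[OF s] assms] that
    by (cases "t \<le> 0") auto
  have "(LBINT \<tau>=ereal 0..ereal t. 1 / H \<tau> s) = Fx (t, s) - Fx (0, s)"
  proof (rule interval_integral_FTC_finite)
    show "continuous_on {min 0 t..max 0 t} (\<lambda>\<tau>. 1 / H \<tau> s)"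
    proof (intro continuous_at_imp_continuous_on ballI)
      fix x assume "x \<in> {min 0 t..max 0 t}"
      then have D: "(x, s) \<in> D" using D by auto
      show "isCont (\<lambda>\<tau>. 1 / H \<tau> s) x"
        using DERIV_isCont[OF H_has_real_derivative_1[OF D]] H_pos[OF D]
        by (intro continuous_intros) auto
    qed
  next
    fix x assume "min 0 t \<le> x" "x \<le> max 0 t"
    from Fx_has_real_derivative_1[OF D[OF this]]
    show "((\<lambda>t. Fx (t, s)) has_vector_derivative 1 / H x s) (at x within {min 0 t..max 0 t})"
      by (simp add: has_real_derivative_iff_has_vector_derivative has_vector_derivative_at_within)
  qed
  moreover have "Fx (0, s) = 0" by (simp add: Fx_def)
  ultimately show ?thesis by (simp add: F_fun_def)
qed

text \<open>Reduces the one-sided derivatives of the definitions to two-sided ones. Here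
  \<open>f'\<close> is another function that agrees with \<open>f\<close> near the point, not a
  derivative of \<open>f\<close>.\<close>

lemma vector_derivative_eqI:
  "(f has_real_derivative d) (at x) \<Longrightarrow> at x within A \<noteq> bot \<Longrightarrow> f x = f' x \<Longrightarrow>
   eventually (\<lambda>y. f y = f' y) (nhds x) \<Longrightarrow> vector_derivative f' (at x within A) = d"
  by (rule vector_derivative_within)
     (auto simp: has_real_derivative_iff_has_vector_derivative[symmetric]
        intro: DERIV_subset[OF _ subset_UNIV] DERIV_cong_ev[THEN iffD1, rotated -1])

lemma eventually_D_1: "(t, s) \<in> D \<Longrightarrow> eventually (\<lambda>t. (t, s) \<in> D) (nhds t)"
  and eventually_D_2: "(t, s) \<in> D \<Longrightarrow> eventually (\<lambda>s. (t, s) \<in> D) (nhds s)"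
proof -
  assume ts: "(t, s) \<in> D"
  have "open ((\<lambda>t. (t, s)) -` D)" "open ((\<lambda>s. (t, s)) -` D)"
    by (intro open_vimage open_D continuous_intros)+
  then show "eventually (\<lambda>t. (t, s) \<in> D) (nhds t)" "eventually (\<lambda>s. (t, s) \<in> D) (nhds s)"
    using ts by (auto simp: eventually_nhds vimage_def)
qed

lemma at_within_s: "0 \<le> s \<Longrightarrow> s < c \<Longrightarrow> at s within {0..<c} \<noteq> bot" for s c :: real
proof -
  assume s: "0 \<le> s" "s < c"
  have "s islimpt {s<..<c}" using s islimpt_greaterThanLessThan1[of s c] by simp
  then have "s islimpt {0..<c}" by (rule islimpt_subset) (use s in auto)
  then show ?thesis by (simp add: trivial_limit_within)
qed

lemma at_within_t: "0 \<le> t \<Longrightarrow> at t within {0..} \<noteq> bot" for t :: real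
  using at_within_s[of t "t + 1"] at_le[of "{0..<t + 1}" "{0..}" t]
  by (metis atLeast_iff atLeastLessThan_iff bot_unique less_add_one subsetI)

lemma d1F_eq:
  assumes "(t, s) \<in> D" "0 \<le> t" shows "d1F g \<rho>0 p t s = 1 / H t s"
  unfolding d1F_def
proof (rule vector_derivative_eqI[OF Fx_has_real_derivative_1[OF assms(1)]])
  show "at t within {0..} \<noteq> bot" using assms(2) by (rule at_within_t)
  show "\<forall>\<^sub>F y in nhds t. Fx (y, s) = F_fun g \<rho>0 p y s"
    using eventually_D_1[OF assms(1)] by eventually_elim (simp add: F_eq_Fx)
qed (simp add: F_eq_Fx assms)

lemma d2F_eq:
  assumes "(t, s) \<in> D" "0 \<le> s" shows "d2F g \<rho>0 p t s = (H t s - H 0 s) / \<rho>0\<^sup>2"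
  unfolding d2F_def
proof (rule vector_derivative_eqI[OF Fx_has_real_derivative_2[OF assms(1)]])
  show "at s within {0..<s_star g \<rho>0 p} \<noteq> bot"
    using assms D_in_S[of t s] by (intro at_within_s) (auto simp: S_def)
  show "\<forall>\<^sub>F y in nhds s. Fx (t, y) = F_fun g \<rho>0 p t y"
    using eventually_D_2[OF assms(1)] by eventually_elim (simp add: F_eq_Fx)
qed (simp add: F_eq_Fx assms)

definition lamx :: "real \<Rightarrow> real" where
  "lamx s = 2 * s / \<rho>0 - Fx (s, s)"

lemma lam_eq: "s \<in> S \<Longrightarrow> lam g \<rho>0 p s = lamx s"
  by (simp add: lam_def lamx_def F_eq_Fx diag_in_D)

text \<open>Chain rule along the diagonal, where \<open>H s s = \<rho>0\<close>; both partial
  derivatives of \<open>F\<close> contribute.\<close>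

lemma lamx_has_derivative:
  assumes s: "s \<in> S"
  shows "(lamx has_real_derivative 1 / \<rho>0 - (\<rho>0 - H 0 s) / \<rho>0\<^sup>2) (at s)"
proof -
  have *: "((\<lambda>s. (s, s)) has_derivative (\<lambda>v. (v, v))) (at s)"
    by (intro has_derivative_Pair has_derivative_ident)
  have "((\<lambda>s. Fx (s, s)) has_derivative (\<lambda>v. v / H s s + (H s s - H 0 s) / \<rho>0\<^sup>2 * v)) (at s)"
    using has_derivative_compose[OF * Fx_has_derivative[OF diag_in_D[OF s]]] by simp
  then have "((\<lambda>s. Fx (s, s)) has_real_derivative (1 / \<rho>0 + (\<rho>0 - H 0 s) / \<rho>0\<^sup>2)) (at s)"
    unfolding has_field_derivative_def H_diag[OF s]
    by (rule has_derivative_eq_rhs) (simp add: fun_eq_iff distrib_right)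
  moreover have "((\<lambda>s. 2 * s / \<rho>0) has_real_derivative 2 / \<rho>0) (at s)"
    using rho0_pos by (auto intro!: derivative_eq_intros)
  ultimately have "(lamx has_real_derivative 2 / \<rho>0 - (1 / \<rho>0 + (\<rho>0 - H 0 s) / \<rho>0\<^sup>2)) (at s)"
    unfolding lamx_def[abs_def] by (intro DERIV_diff)
  then show ?thesis by (simp add: field_simps)
qed

text \<open>Added to \<open>d2F_eq\<close>, the terms with \<open>H 0 s\<close> cancel and
  \<open>H t s / \<rho>0\<^sup>2\<close> remains.\<close>

lemma dlam_eq:
  assumes "0 \<le> s" "s < s_star g \<rho>0 p"
  shows "dlam g \<rho>0 p s = 1 / \<rho>0 - (\<rho>0 - H 0 s) / \<rho>0\<^sup>2"
  unfolding dlam_def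
proof (rule vector_derivative_eqI[OF lamx_has_derivative at_within_s[OF assms]])
  show s: "s \<in> S" using in_S assms .
  show "lamx s = lam g \<rho>0 p s" using lam_eq[OF s] by simp
  have "\<forall>\<^sub>F y in nhds s. y \<in> S" using open_S s by (auto simp: eventually_nhds)
  then show "\<forall>\<^sub>F y in nhds s. lamx y = lam g \<rho>0 p y"
    by eventually_elim (simp add: lam_eq)
qed

lemma dinvH_eq:
  assumes "(t, s) \<in> D" "0 \<le> t" shows "dinvH g \<rho>0 p t s = - dH t s / (H t s)\<^sup>2"
  unfolding dinvH_def
proof (rule vector_derivative_eqI)
  show "((\<lambda>q. 1 / H q s) has_real_derivative - dH t s / (H t s)\<^sup>2) (at t)"
    using H_has_real_derivative_1[OF assms(1)] H_pos[OF assms(1)]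
    by (auto intro!: derivative_eq_intros simp: power2_eq_square)
  show "at t within {0..} \<noteq> bot" using assms(2) by (rule at_within_t)
qed auto

text \<open>Integration by parts: \<open>\<tau> / H - F\<close> is an antiderivative of
  \<open>\<tau> (1 / H)'\<close>. This expresses the inner integrals of \<open>K1_x2\<close> through
  \<open>F\<close>.\<close>

lemma integral_dinvH:
  assumes "(t, s) \<in> D" "0 \<le> t"
  shows "(LBINT \<tau>=ereal 0..ereal t. dinvH g \<rho>0 p \<tau> s * \<tau>) = t / H t s - F_fun g \<rho>0 p t s"
proof -
  have s: "s \<in> S" using D_in_S assms(1) .
  have D: "(\<tau>, s) \<in> D" if "0 \<le> \<tau>" "\<tau> \<le> t" for \<tau>
    using D_interval[OF zero_in_D[OF s] assms(1)] that by auto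
  have "(LBINT \<tau>=ereal 0..ereal t. dinvH g \<rho>0 p \<tau> s * \<tau>) =
      (\<lambda>\<tau>. \<tau> / H \<tau> s - Fx (\<tau>, s)) t - (\<lambda>\<tau>. \<tau> / H \<tau> s - Fx (\<tau>, s)) 0"
  proof (rule interval_integral_FTC_finite)
    have cont: "continuous_on {0..t} (\<lambda>\<tau>. (\<tau>, s))" by (intro continuous_intros)
    have sub: "(\<lambda>\<tau>. (\<tau>, s)) ` {0..t} \<subseteq> D" using D by auto
    have "continuous_on {0..t} (\<lambda>\<tau>. dH \<tau> s)"
      using continuous_on_compose2[OF continuous_on_dH cont sub] by simp
    moreover have "continuous_on {0..t} (\<lambda>\<tau>. H \<tau> s)"
      using continuous_on_compose2[OF continuous_on_H cont sub] by simp
    moreover have "H \<tau> s \<noteq> 0" if "\<tau> \<in> {0..t}" for \<tau>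
      using H_pos[of \<tau> s] D that by fastforce
    ultimately have "continuous_on {0..t} (\<lambda>\<tau>. - dH \<tau> s / (H \<tau> s)\<^sup>2 * \<tau>)"
      by (intro continuous_intros) auto
    then show "continuous_on {min 0 t..max 0 t} (\<lambda>\<tau>. dinvH g \<rho>0 p \<tau> s * \<tau>)"
      using assms D by (subst continuous_on_cong[OF refl, of _ _ "\<lambda>\<tau>. - dH \<tau> s / (H \<tau> s)\<^sup>2 * \<tau>"])
        (auto simp: dinvH_eq min_def max_def)
  next
    fix x assume "min 0 t \<le> x" "x \<le> max 0 t"
    then have x: "0 \<le> x" "(x, s) \<in> D" using D assms by auto
    have "((\<lambda>\<tau>. \<tau> / H \<tau> s - Fx (\<tau>, s)) has_real_derivative
        (1 * H x s - x * dH x s) / (H x s * H x s) - 1 / H x s) (at x)"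
      using H_pos[OF x(2)]
      by (intro DERIV_diff DERIV_divide DERIV_ident H_has_real_derivative_1 Fx_has_real_derivative_1 x) auto
    also have "(1 * H x s - x * dH x s) / (H x s * H x s) - 1 / H x s = dinvH g \<rho>0 p x s * x"
      using H_pos[OF x(2)] by (simp add: dinvH_eq[OF x(2,1)] power2_eq_square field_simps)
    finally show "((\<lambda>\<tau>. \<tau> / H \<tau> s - Fx (\<tau>, s)) has_vector_derivative dinvH g \<rho>0 p x s * x)
        (at x within {min 0 t..max 0 t})"
      by (simp add: has_real_derivative_iff_has_vector_derivative has_vector_derivative_at_within)
  qed
  also have "Fx (0, s) = 0" by (simp add: Fx_def)
  finally show ?thesis by (simp add: F_eq_Fx assms)
qed

section \<open>Continuity and uniform bounds for subsonic states\<close>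

lemma continuous_on_Fx: "continuous_on D Fx"
  by (intro continuous_at_imp_continuous_on ballI)
     (use Fx_has_derivative in \<open>auto intro: has_derivative_continuous\<close>)

lemma continuous_on_lamx: "continuous_on S lamx"
  by (meson DERIV_isCont continuous_at_imp_continuous_on lamx_has_derivative)

text \<open>Monotonicity gives explicit constants: \<open>H\<close> lies above \<open>rho_cr\<close>
  at \<open>s\<close>, which is at least \<open>rho_cr\<close> at \<open>0\<close>, and
  \<open>H t s \<le> H 0 s \<le> H 0 s1\<close>. The bound on \<open>t\<close> is then read off from
  \<open>t = T (H t s) s\<close>.\<close>

lemma uniform_bounds:
  assumes s1: "0 \<le> s1" "s1 < s_star g \<rho>0 p"
  obtains c C M where "0 < c" "0 < C"
    "\<And>t s. (t, s) \<in> D \<Longrightarrow> 0 \<le> t \<Longrightarrow> 0 \<le> s \<Longrightarrow> s \<le> s1 \<Longrightarrow> c \<le> H t s \<and> H t s \<le> C \<and> t \<le> M"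
proof -
  have S: "s \<in> S" if "0 \<le> s" "s \<le> s1" for s using in_S that s1 by auto
  define c C where "c = rho_cr g \<rho>0 p 0" and "C = H 0 s1"
  have c: "c > 0" using Q_rho_cr(1)[OF S[of 0]] s1 by (simp add: c_def)
  have C: "C > 0" using H_pos[OF zero_in_D[OF S[of s1]]] s1 by (simp add: C_def)
  have "c \<le> H t s \<and> H t s \<le> C \<and> t \<le> C\<^sup>2 * (g * s1 - h c) / (g * \<rho>0\<^sup>2)"
    if D: "(t, s) \<in> D" and "0 \<le> t" "0 \<le> s" "s \<le> s1" for t s
  proof -
    have s: "s \<in> S" using S that by auto
    have "is_H g \<rho>0 p t s (H t s)" using H_in_V[OF D] is_H_iff[OF s] by auto
    then have "rho_cr g \<rho>0 p s < H t s" by (simp add: is_H_def)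
    then have 1: "c \<le> H t s" using rho_cr_mono[OF S[of 0] s] that s1 by (simp add: c_def)
    have "H t s \<le> H 0 s" using H_antimono[OF zero_in_D[OF s] D] that by auto
    moreover have "H 0 s \<le> H 0 s1"
    proof -
      have "h (H 0 s) \<le> h (H 0 s1)" using h_H0[OF s] h_H0[OF S[of s1]] that s1 g_pos by simp
      then show ?thesis
        using h_less_iff[of "H 0 s1" "H 0 s"] H_pos[OF zero_in_D[OF s]] C
        unfolding C_def by fastforce
    qed
    ultimately have 2: "H t s \<le> C" by (simp add: C_def)
    have t: "t = (H t s)\<^sup>2 * (g * s - h (H t s)) / (g * \<rho>0\<^sup>2)"
      using H_in_V(2)[OF D] by (simp add: T_def)
    have hc: "h c \<le> h (H t s)" using h_less[of c "H t s"] c 1 by (cases "c = H t s") auto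
    have gs: "g * s \<le> g * s1" using that g_pos by simp
    \<comment> \<open>Equivalent to \<open>t \<ge> 0\<close>; it provides the sign needed to
      multiply the two estimates.\<close>
    have "h (H t s) \<le> g * s"
    proof (rule ccontr)
      assume "\<not> ?thesis"
      then have "(H t s)\<^sup>2 * (g * s - h (H t s)) / (g * \<rho>0\<^sup>2) < 0"
        using H_pos[OF D] g_pos rho0_pos by (intro divide_neg_pos mult_pos_neg) auto
      then show False using t that by linarith
    qed
    then have "(H t s)\<^sup>2 * (g * s - h (H t s)) \<le> C\<^sup>2 * (g * s1 - h c)"
      using hc gs 2 H_pos[OF D] by (intro mult_mono power_mono) auto
    then have "(H t s)\<^sup>2 * (g * s - h (H t s)) / (g * \<rho>0\<^sup>2) \<le> C\<^sup>2 * (g * s1 - h c) / (g * \<rho>0\<^sup>2)"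
      using g_pos rho0_pos by (intro divide_right_mono) auto
    then show ?thesis using 1 2 t by simp
  qed
  then show ?thesis using that c C by blast
qed

text \<open>The derivative of \<open>F\<close> in \<open>t\<close> is \<open>1 / H\<close>, which is
  positive and at most \<open>1 / c\<close> on \<open>[0, t]\<close> because \<open>H\<close>
  decreases in \<open>t\<close>.\<close>

lemma Fx_bounds:
  assumes D: "(t, s) \<in> D" "0 \<le> t" and c: "0 < c" "c \<le> H t s"
  shows "0 \<le> Fx (t, s) \<and> Fx (t, s) \<le> t / c"
proof -
  have Dx: "(x, s) \<in> D" if "0 \<le> x" "x \<le> t" for x
    using D_interval[OF zero_in_D[OF D_in_S[OF D(1)]] D(1)] that by auto
  have F0: "Fx (0, s) = 0" by (simp add: Fx_def)
  have "Fx (0, s) \<le> Fx (t, s)"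
  proof (rule DERIV_nonneg_imp_nondecreasing[OF D(2)])
    fix x assume "0 \<le> x" "x \<le> t"
    then have x: "(x, s) \<in> D" using Dx by auto
    show "\<exists>y. ((\<lambda>t. Fx (t, s)) has_real_derivative y) (at x) \<and> 0 \<le> y"
      using Fx_has_real_derivative_1[OF x] H_pos[OF x] by (intro exI[of _ "1 / H x s"]) auto
  qed
  moreover have "Fx (t, s) - t / c \<le> Fx (0, s) - 0 / c"
  proof (rule DERIV_nonpos_imp_nonincreasing[OF D(2)])
    fix x assume x': "0 \<le> x" "x \<le> t"
    then have x: "(x, s) \<in> D" using Dx by auto
    have "H t s \<le> H x s" using H_antimono[OF x D(1)] x' by auto
    then have "1 / H x s \<le> 1 / c" using c by (intro divide_left_mono) auto
    moreover have "((\<lambda>t. Fx (t, s) - t / c) has_real_derivative 1 / H x s - 1 / c) (at x)"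
      by (intro DERIV_diff Fx_has_real_derivative_1 x DERIV_cdivide DERIV_ident)
    ultimately show "\<exists>y. ((\<lambda>t. Fx (t, s) - t / c) has_real_derivative y) (at x) \<and> y \<le> 0"
      by (intro exI[of _ "1 / H x s - 1 / c"]) auto
  qed
  ultimately show ?thesis by (simp add: F0)
qed

end

section \<open>Smooth truncation\<close>

lemma max0_square_has_derivative:
  "((\<lambda>z. (max 0 z)\<^sup>2) has_real_derivative 2 * max 0 z) (at z)" for z :: real
proof -
  consider "z > 0" | "z < 0" | "z = 0" by linarith
  then show ?thesis
  proof cases
    case 1
    have "((\<lambda>z. z\<^sup>2) has_real_derivative 2 * max 0 z) (at z)"
      using 1 by (auto intro!: derivative_eq_intros)
    then show ?thesis
      by (rule has_field_derivative_transform_within_open[of _ _ _ "{0<..}"]) (use 1 in auto)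
  next
    case 2
    have "((\<lambda>z. 0) has_real_derivative 2 * max 0 z) (at z)"
      using 2 by (auto intro!: derivative_eq_intros)
    then show ?thesis
      by (rule has_field_derivative_transform_within_open[of _ _ _ "{..<0}"]) (use 2 in auto)
  next
    case 3
    have "((\<lambda>h::real. (max 0 h)\<^sup>2 / h) \<longlongrightarrow> 0) (at 0)"
    proof (rule Lim_null_comparison)
      show "\<forall>\<^sub>F h in at (0::real). norm ((max 0 h)\<^sup>2 / h) \<le> \<bar>h\<bar>"
        by (rule always_eventually) (auto simp: max_def power2_eq_square)
      show "((\<lambda>h::real. \<bar>h\<bar>) \<longlongrightarrow> 0) (at 0)" by (auto intro: tendsto_eq_intros)
    qed
    then show ?thesis using 3 by (simp add: DERIV_def)
  qed
qed

text \<open>A \<open>C\<^sup>1\<close> approximation of the positive part that vanishes on \<open>z \<le> \<epsilon>\<close>.\<close>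

definition cutoff :: "real \<Rightarrow> real \<Rightarrow> real" where
  "cutoff \<epsilon> z = (max 0 (z - \<epsilon>))\<^sup>2 / sqrt ((max 0 (z - \<epsilon>))\<^sup>2 + \<epsilon>\<^sup>2)"

text \<open>The ratio of \<open>cutoff\<close> to \<open>max 0 (z - \<epsilon>)\<close>, with values
  in \<open>[0, 1]\<close>. The derivative of \<open>cutoff\<close> is a polynomial in it, which
  makes that derivative continuous and at most \<open>2\<close> in modulus.\<close>

definition slope :: "real \<Rightarrow> real \<Rightarrow> real" where
  "slope \<epsilon> z = max 0 (z - \<epsilon>) / sqrt ((max 0 (z - \<epsilon>))\<^sup>2 + \<epsilon>\<^sup>2)"

definition cutoff' :: "real \<Rightarrow> real \<Rightarrow> real" where
  "cutoff' \<epsilon> z = 2 * slope \<epsilon> z - (slope \<epsilon> z) ^ 3"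

lemma cutoff_has_derivative:
  assumes "\<epsilon> > 0"
  shows "(cutoff \<epsilon> has_real_derivative cutoff' \<epsilon> z) (at z)"
proof -
  define m where "m = max 0 (z - \<epsilon>)"
  have pos: "m\<^sup>2 + \<epsilon>\<^sup>2 > 0" using assms by (simp add: add_nonneg_pos)
  have M: "((\<lambda>z. (max 0 (z - \<epsilon>))\<^sup>2) has_real_derivative 2 * m) (at z)"
    using DERIV_chain2[OF max0_square_has_derivative, of "\<lambda>z. z - \<epsilon>" 1 z UNIV]
      DERIV_diff[OF DERIV_ident DERIV_const, of \<epsilon> z UNIV]
    by (simp add: m_def)
  have S: "((\<lambda>z. sqrt ((max 0 (z - \<epsilon>))\<^sup>2 + \<epsilon>\<^sup>2)) has_real_derivative
      inverse (sqrt (m\<^sup>2 + \<epsilon>\<^sup>2)) / 2 * (2 * m)) (at z)"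
  proof -
    have D: "((\<lambda>z. (max 0 (z - \<epsilon>))\<^sup>2 + \<epsilon>\<^sup>2) has_real_derivative 2 * m) (at z)"
      using DERIV_add[OF M DERIV_const[of "\<epsilon>\<^sup>2"]] by simp
    show ?thesis
      unfolding m_def
      by (rule DERIV_chain2[where f = sqrt, OF DERIV_real_sqrt D[unfolded m_def]]) (use pos in \<open>simp add: m_def\<close>)
  qed
  have ne: "sqrt ((max 0 (z - \<epsilon>))\<^sup>2 + \<epsilon>\<^sup>2) \<noteq> 0" using assms by simp
  have "(cutoff \<epsilon> has_real_derivative
     ((2 * m) * sqrt (m\<^sup>2 + \<epsilon>\<^sup>2) - m\<^sup>2 * (inverse (sqrt (m\<^sup>2 + \<epsilon>\<^sup>2)) / 2 * (2 * m)))
       / (sqrt (m\<^sup>2 + \<epsilon>\<^sup>2) * sqrt (m\<^sup>2 + \<epsilon>\<^sup>2))) (at z)"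
    unfolding cutoff_def[abs_def]
    using DERIV_divide[OF M S ne] unfolding m_def .
  also have "((2 * m) * sqrt (m\<^sup>2 + \<epsilon>\<^sup>2) - m\<^sup>2 * (inverse (sqrt (m\<^sup>2 + \<epsilon>\<^sup>2)) / 2 * (2 * m)))
       / (sqrt (m\<^sup>2 + \<epsilon>\<^sup>2) * sqrt (m\<^sup>2 + \<epsilon>\<^sup>2)) = cutoff' \<epsilon> z"
  proof -
    define q where "q = sqrt (m\<^sup>2 + \<epsilon>\<^sup>2)"
    have "q > 0" using pos by (simp add: q_def)
    then show ?thesis
      unfolding cutoff'_def slope_def m_def[symmetric] q_def[symmetric]
      by (simp add: field_simps power2_eq_square power3_eq_cube)
  qed
  finally show ?thesis .
qed

lemma slope_bounds: "\<epsilon> > 0 \<Longrightarrow> 0 \<le> slope \<epsilon> z \<and> slope \<epsilon> z \<le> 1"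
  unfolding slope_def by (auto intro!: divide_le_eq_1[THEN iffD2] real_le_rsqrt add_nonneg_pos)

lemma cutoff'_bounds: assumes "\<epsilon> > 0" shows "\<bar>cutoff' \<epsilon> z\<bar> \<le> 2"
proof -
  have "0 \<le> slope \<epsilon> z" "slope \<epsilon> z \<le> 1" using slope_bounds[OF assms] by auto
  moreover have "(slope \<epsilon> z) ^ 3 \<le> slope \<epsilon> z"
    using calculation power_decreasing[of 1 3 "slope \<epsilon> z"] by simp
  moreover have "0 \<le> (slope \<epsilon> z) ^ 3" using calculation by simp
  ultimately show ?thesis unfolding cutoff'_def by linarith
qed

lemma continuous_cutoff': "\<epsilon> > 0 \<Longrightarrow> continuous_on A (cutoff' \<epsilon>)"
  unfolding cutoff'_def slope_def
  by (intro continuous_intros) (auto simp: sum_power2_eq_zero_iff)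

lemma continuous_cutoff: "\<epsilon> > 0 \<Longrightarrow> continuous_on A (cutoff \<epsilon>)"
  by (meson DERIV_isCont continuous_at_imp_continuous_on cutoff_has_derivative)

lemma cutoff_eq_0: "z \<le> \<epsilon> \<Longrightarrow> cutoff \<epsilon> z = 0" and cutoff'_eq_0: "z \<le> \<epsilon> \<Longrightarrow> cutoff' \<epsilon> z = 0"
  by (auto simp: cutoff_def cutoff'_def slope_def)

lemma cutoff_eq: "cutoff \<epsilon> z = max 0 (z - \<epsilon>) * slope \<epsilon> z"
  by (simp add: cutoff_def slope_def power2_eq_square)

lemma cutoff_bounds: assumes "\<epsilon> > 0" shows "0 \<le> cutoff \<epsilon> z \<and> cutoff \<epsilon> z \<le> max 0 z"
proof -
  have "max 0 (z - \<epsilon>) * slope \<epsilon> z \<le> max 0 z * 1"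
    using slope_bounds[OF assms, of z] assms by (intro mult_mono) auto
  then show ?thesis using slope_bounds[OF assms, of z] by (simp add: cutoff_eq)
qed

lemma slope_tendsto:
  assumes "\<And>n. e n > 0" "e \<longlonglongrightarrow> 0"
  shows "(\<lambda>n. slope (e n) z) \<longlonglongrightarrow> indicator {0<..} z"
proof (cases "z > 0")
  case True
  have "(\<lambda>n. max 0 (z - e n) / sqrt ((max 0 (z - e n))\<^sup>2 + (e n)\<^sup>2)) \<longlonglongrightarrow>
     max 0 (z - 0) / sqrt ((max 0 (z - 0))\<^sup>2 + 0\<^sup>2)"
    using True by (intro tendsto_intros assms) auto
  then show ?thesis using True by (simp add: slope_def)
next
  case False
  then have "slope (e n) z = 0" for n
    using assms(1)[of n] by (simp add: slope_def max_def)
  then show ?thesis using False by simp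
qed

lemma cutoff_tendsto:
  assumes "\<And>n. e n > 0" "e \<longlonglongrightarrow> 0"
  shows "(\<lambda>n. cutoff (e n) z) \<longlonglongrightarrow> max 0 z"
proof -
  have "(\<lambda>n. max 0 (z - e n) * slope (e n) z) \<longlonglongrightarrow> max 0 (z - 0) * indicator {0<..} z"
    by (intro tendsto_intros slope_tendsto assms)
  moreover have "max 0 (z - 0) * indicator {0<..} z = max 0 z" by (cases "z > 0") auto
  ultimately show ?thesis unfolding cutoff_eq by metis
qed

lemma cutoff'_tendsto:
  assumes "\<And>n. e n > 0" "e \<longlonglongrightarrow> 0"
  shows "(\<lambda>n. cutoff' (e n) z) \<longlonglongrightarrow> indicator {0<..} z"
proof -
  have "(\<lambda>n. cutoff' (e n) z) \<longlonglongrightarrow> 2 * indicator {0<..} z - (indicator {0<..} z) ^ 3"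
    unfolding cutoff'_def by (intro tendsto_intros slope_tendsto assms)
  then show ?thesis by (cases "z > 0") auto
qed

text \<open>At zeros of \<open>f\<close> no derivative is available. Composed with
  \<open>cutoff\<close>, however, \<open>f\<close> is locally \<open>0\<close> near such points, so
  the mean value theorem applies to the composition with slope at most \<open>2 * L\<close>; then
  \<open>\<epsilon>\<close> tends to \<open>0\<close>. The factor \<open>2\<close> is the bound on
  \<open>cutoff'\<close>.\<close>

lemma lipschitz_of_positive_part:
  fixes f f' :: "real \<Rightarrow> real"
  assumes ab: "a \<le> b" and cont: "continuous_on {a..b} f"
    and nonneg: "\<And>x. a \<le> x \<Longrightarrow> x \<le> b \<Longrightarrow> 0 \<le> f x"
    and der: "\<And>x. a < x \<Longrightarrow> x < b \<Longrightarrow> f x > 0 \<Longrightarrow> (f has_real_derivative f' x) (at x)"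
    and bd: "\<And>x. a < x \<Longrightarrow> x < b \<Longrightarrow> f x > 0 \<Longrightarrow> \<bar>f' x\<bar> \<le> L"
    and L: "0 \<le> L"
  shows "\<bar>f b - f a\<bar> \<le> 2 * L * (b - a)"
proof (cases "a = b")
  case False
  then have ab: "a < b" using ab by simp
  have *: "\<bar>cutoff \<epsilon> (f b) - cutoff \<epsilon> (f a)\<bar> \<le> 2 * L * (b - a)" if e: "\<epsilon> > 0" for \<epsilon>
  proof -
    define D where "D x = (if f x > 0 then cutoff' \<epsilon> (f x) * f' x else 0)" for x
    have der2: "((\<lambda>x. cutoff \<epsilon> (f x)) has_real_derivative D x) (at x)" if x: "a < x" "x < b" for x
    proof (cases "f x > 0")
      case True
      then show ?thesis
        using DERIV_chain2[OF cutoff_has_derivative[OF e] der[OF x True]] by (simp add: D_def)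
    next
      case False
      then have "f x = 0" using nonneg[of x] x by simp
      have "continuous_on {a<..<b} f" using cont by (rule continuous_on_subset) auto
      then have op: "open ({a<..<b} \<inter> f -` {..<\<epsilon>})" by (intro continuous_open_preimage) auto
      have D0: "((\<lambda>x. 0) has_real_derivative D x) (at x)" using False by (simp add: D_def)
      show ?thesis
      proof (rule has_field_derivative_transform_within_open[OF D0 op])
        show "x \<in> {a<..<b} \<inter> f -` {..<\<epsilon>}" using x e \<open>f x = 0\<close> by simp
        show "0 = cutoff \<epsilon> (f y)" if "y \<in> {a<..<b} \<inter> f -` {..<\<epsilon>}" for y
          using that by (intro cutoff_eq_0[symmetric]) auto
      qed
    qed
    have "continuous_on {a..b} (\<lambda>x. cutoff \<epsilon> (f x))"
      using continuous_on_compose2[OF continuous_cutoff[OF e] cont, of UNIV] by auto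
    then obtain z where z: "a < z" "z < b"
      "cutoff \<epsilon> (f b) - cutoff \<epsilon> (f a) = D z * (b - a)"
      using mvt[OF ab, of "\<lambda>x. cutoff \<epsilon> (f x)" "\<lambda>x. (*) (D x)"] der2
      by (auto simp: has_field_derivative_def)
    have "\<bar>D z\<bar> \<le> 2 * L"
      using cutoff'_bounds[OF e] bd[OF z(1,2)] L by (auto simp: D_def abs_mult intro!: mult_mono)
    then show ?thesis using z ab by (simp add: abs_mult mult_right_mono)
  qed
  define e where "e n = inverse (real (Suc n))" for n
  have e: "\<And>n. e n > 0" "e \<longlonglongrightarrow> 0"
    unfolding e_def using LIMSEQ_inverse_real_of_nat by auto
  have "(\<lambda>n. \<bar>cutoff (e n) (f b) - cutoff (e n) (f a)\<bar>) \<longlonglongrightarrow> \<bar>max 0 (f b) - max 0 (f a)\<bar>"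
    by (intro tendsto_intros cutoff_tendsto e)
  then have "\<bar>max 0 (f b) - max 0 (f a)\<bar> \<le> 2 * L * (b - a)"
    by (rule LIMSEQ_le_const2) (use * e in auto)
  then show ?thesis using nonneg[of a] nonneg[of b] ab by (simp add: max_def split: if_splits)
qed auto

section \<open>Lebesgue differentiation\<close>

lemma AE_eq_0_of_boxes:
  fixes f :: "'a::euclidean_space \<Rightarrow> real"
  assumes U: "open U"
    and int: "\<And>a b. cbox a b \<subseteq> U \<Longrightarrow> set_integrable lebesgue (cbox a b) f"
    and zero: "\<And>a b. cbox a b \<subseteq> U \<Longrightarrow> (LINT x:cbox a b|lebesgue. f x) = 0"
  shows "AE x in lebesgue. x \<in> U \<longrightarrow> f x = 0"
proof -
  have loc: "AE x in lebesgue. x \<in> box a b \<longrightarrow> f x = 0" if sub: "cbox a b \<subseteq> U" for a b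
  proof -
    define F where "F x = (if x \<in> cbox a b then f x else 0)" for x
    have "f absolutely_integrable_on cbox a b" using int[OF sub] .
    then have "F absolutely_integrable_on UNIV"
      unfolding F_def by (simp add: absolutely_integrable_restrict_UNIV)
    then have "F integrable_on cbox c d" for c d
      by (meson integrable_on_subcbox set_lebesgue_integral_eq_integral(1) subset_UNIV)
    \<comment> \<open>Off the null set \<open>N\<close> the averages over cubes with lower corner
      \<open>x\<close> converge to \<open>F x\<close>; for small cubes inside the box these averages
      vanish.\<close>
    then obtain N where N: "negligible N"
       "\<And>x e. \<lbrakk>x \<notin> N; 0 < e\<rbrakk> \<Longrightarrow> \<exists>d>0. \<forall>h. 0 < h \<and> h < d \<longrightarrow>
            norm (integral (cbox x (x + h *\<^sub>R One)) F /\<^sub>R h ^ DIM('a) - F x) < e"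
      using integrable_ccontinuous_explicit[of F] by blast
    have "f x = 0" if x: "x \<in> box a b" "x \<notin> N" for x
    proof (rule ccontr)
      assume "f x \<noteq> 0"
      then obtain d where d: "d > 0" "\<And>h. 0 < h \<Longrightarrow> h < d \<Longrightarrow>
          norm (integral (cbox x (x + h *\<^sub>R One)) F /\<^sub>R h ^ DIM('a) - F x) < \<bar>f x\<bar>"
        using N(2)[OF x(2), of "\<bar>f x\<bar>"] by auto
      obtain k where k: "k > 0" "ball x k \<subseteq> box a b"
        using x open_box open_contains_ball by blast
      define c where "c = k / (norm (One :: 'a) + 1)"
      have c: "c > 0" "c * (norm (One :: 'a) + 1) = k"
        using k by (auto simp: c_def add_nonneg_eq_0_iff intro!: divide_pos_pos add_nonneg_pos)
      define h where "h = min d c / 2"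
      have h: "0 < h" "h < d" "h < c" using d c by (auto simp: h_def min_def)
      have hk: "h * norm (One :: 'a) < k"
      proof -
        have "h * norm (One :: 'a) \<le> h * (norm (One::'a) + 1)" using h by simp
        also have "\<dots> < c * (norm (One::'a) + 1)"
          using h by (intro mult_strict_right_mono) (auto simp: add_nonneg_pos)
        finally show ?thesis using c by simp
      qed
      have sub': "cbox x (x + h *\<^sub>R One) \<subseteq> cbox a b"
      proof -
        have "x + h *\<^sub>R One \<in> box a b" using k hk h by (intro subsetD[OF k(2)]) (auto simp: dist_norm)
        then show ?thesis using x box_subset_cbox[of a b]
          by (auto simp: mem_box intro: order.trans less_imp_le) (meson order.trans less_imp_le)+
      qed
      have "integral (cbox x (x + h *\<^sub>R One)) F = integral (cbox x (x + h *\<^sub>R One)) f"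
        by (rule integral_cong) (use sub' in \<open>auto simp: F_def\<close>)
      also have "\<dots> = (LINT y:cbox x (x + h *\<^sub>R One)|lebesgue. f y)"
        using int sub sub' by (intro set_lebesgue_integral_eq_integral(2)[symmetric]) auto
      also have "\<dots> = 0" using zero sub sub' by auto
      finally have "norm (F x) < \<bar>f x\<bar>" using d(2)[OF h(1,2)] by simp
      then show False using x box_subset_cbox[of a b] by (auto simp: F_def)
    qed
    then have "AE x in lebesgue. x \<notin> N \<longrightarrow> (x \<in> box a b \<longrightarrow> f x = 0)" by auto
    moreover have "AE x in lebesgue. x \<notin> N" using N(1) by (simp add: AE_not_in negligible_iff_null_sets)
    ultimately show ?thesis by (auto elim: AE_mp)
  qed
  \<comment> \<open>Boundaries of boxes are null sets, so a countable cover of \<open>U\<close> by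
    closed boxes carries the local statement to all of \<open>U\<close>.\<close>
  obtain \<D> where \<D>: "countable \<D>" "\<D> \<subseteq> Pow U" "\<And>X. X \<in> \<D> \<Longrightarrow> \<exists>a b. X = cbox a b" "\<Union>\<D> = U"
    using open_countable_Union_open_cbox[OF U] by metis
  have "AE x in lebesgue. x \<in> X \<longrightarrow> f x = 0" if XD: "X \<in> \<D>" for X
  proof -
    obtain a b where X: "X = cbox a b" using \<D>(3)[OF XD] by blast
    have "cbox a b - box a b \<in> null_sets lebesgue"
      using negligible_frontier_interval[of a b] by (simp add: negligible_iff_null_sets)
    then have "AE x in lebesgue. x \<notin> cbox a b - box a b" by (rule AE_not_in)
    moreover have "AE x in lebesgue. x \<in> box a b \<longrightarrow> f x = 0" using loc[of a b] \<D>(2) XD X by auto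
    ultimately show ?thesis unfolding X by eventually_elim auto
  qed
  then have "AE x in lebesgue. \<forall>X\<in>\<D>. x \<in> X \<longrightarrow> f x = 0"
    using AE_ball_countable[OF \<D>(1), of "\<lambda>x X. x \<in> X \<longrightarrow> f x = 0" lebesgue] by blast
  then show ?thesis by (eventually_elim) (use \<D>(4) in auto)
qed

lemma AE_eq_0_reflect:
  "AE x in lebesgue. P x \<Longrightarrow> AE x in lebesgue. P (- x)" for P :: "real \<Rightarrow> bool"
proof -
  assume "AE x in lebesgue. P x"
  then obtain N where N: "{x. \<not> P x} \<subseteq> N" "negligible N"
    by (auto simp: eventually_ae_filter negligible_iff_null_sets)
  have "negligible (uminus ` N)"
    by (rule negligible_differentiable_image_negligible[OF _ N(2)])
      (auto intro!: derivative_intros simp: differentiable_on_def)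
  then show ?thesis
    using N by (intro AE_I'[of "uminus ` N"]) (auto simp: negligible_iff_null_sets intro!: image_eqI[of _ _ "- _"])
qed

lemma AE_right_derivative:
  fixes f :: "real \<Rightarrow> real"
  assumes "integrable lborel f"
  shows "AE x in lebesgue. ((\<lambda>h. (LINT s:{x..x + h}|lborel. f s) / h) \<longlongrightarrow> f x) (at_right 0)"
proof -
  have si: "set_integrable lborel {a..b} f" for a b
    using integrable_mult_indicator[OF _ assms, of "{a..b}"] by (simp add: set_integrable_def)
  then have I: "f integrable_on cbox a b" "integral (cbox a b) f = (LINT s:{a..b}|lborel. f s)" for a b
    using set_borel_integral_eq_integral[OF si] by auto
  obtain N where N: "negligible N"
       "\<And>x e. \<lbrakk>x \<notin> N; 0 < e\<rbrakk> \<Longrightarrow> \<exists>d>0. \<forall>h. 0 < h \<and> h < d \<longrightarrow>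
            norm (integral (cbox x (x + h *\<^sub>R One)) f /\<^sub>R h ^ DIM(real) - f x) < e"
    by (rule integrable_ccontinuous_explicit[OF I(1)]) (rule that)
  have "((\<lambda>h. (LINT s:{x..x + h}|lborel. f s) / h) \<longlongrightarrow> f x) (at_right 0)" if xN: "x \<notin> N" for x
  proof (rule tendstoI)
    fix e :: real assume "e > 0"
    then obtain d where "d > 0" "\<And>h. 0 < h \<Longrightarrow> h < d \<Longrightarrow>
          norm (integral (cbox x (x + h *\<^sub>R One)) f /\<^sub>R h ^ DIM(real) - f x) < e"
      using N(2)[OF xN] by blast
    then have "\<And>h. 0 < h \<Longrightarrow> h < d \<Longrightarrow> dist ((LINT s:{x..x + h}|lborel. f s) / h) (f x) < e"
      using I(2) by (simp add: dist_real_def divide_inverse mult.commute)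
    then show "\<forall>\<^sub>F h in at_right 0. dist ((LINT s:{x..x + h}|lborel. f s) / h) (f x) < e"
      using \<open>d > 0\<close> by (auto simp: eventually_at_right_field)
  qed
  moreover have "AE x in lebesgue. x \<notin> N" using N(1) by (simp add: AE_not_in negligible_iff_null_sets)
  ultimately show ?thesis by (auto elim: eventually_mono)
qed

text \<open>The differentiation theorem at hand supplies right-hand limits. Left-hand limits are
  right-hand limits for the reflected function \<open>f (- x)\<close>, and reflection preserves null
  sets.\<close>

lemma AE_has_derivative_indefinite_integral:
  fixes f :: "real \<Rightarrow> real"
  assumes f: "integrable lborel f"
  shows "AE x in lborel. x > 0 \<longrightarrow>
    ((\<lambda>r. LINT s:{0..r}|lborel. f s) has_real_derivative f x) (at x)"
proof -
  define F where "F r = (LINT s:{0..r}|lborel. f s)" for r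
  have si: "set_integrable lborel {a..b} f" for a b
    using integrable_mult_indicator[OF _ f, of "{a..b}"] by (simp add: set_integrable_def)
  have F: "F b - F a = (LINT s:{a..b}|lborel. f s)" if "0 \<le> a" "a \<le> b" for a b
  proof -
    have I: "f integrable_on {a..b}" "integral {a..b} f = (LINT s:{a..b}|lborel. f s)" for a b
      using set_borel_integral_eq_integral[OF si] by auto
    show ?thesis
      using Henstock_Kurzweil_Integration.integral_combine[OF that I(1)] by (simp add: F_def I(2)[symmetric])
  qed
  have "integrable lborel (\<lambda>x. f (- x))"
    using lborel_integrable_real_affine[OF f, of "-1" 0] by simp
  from AE_eq_0_reflect[OF AE_right_derivative[OF this]]
  have "AE x in lebesgue. ((\<lambda>h. (LINT s:{- x..- x + h}|lborel. f (- s)) / h) \<longlongrightarrow> f x) (at_right 0)"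
    by simp
  moreover have "(LINT s:{- x..- x + h}|lborel. f (- s)) = (LINT s:{x - h..x}|lborel. f s)" for x h
    using lborel_integral_real_affine[of "-1" "\<lambda>s. indicator {x - h..x} s *\<^sub>R f s" 0]
    unfolding set_lebesgue_integral_def
    by (simp add: indicator_def[abs_def]) (rule Bochner_Integration.integral_cong; auto)
  ultimately have "AE x in lebesgue. ((\<lambda>h. (LINT s:{x - h..x}|lborel. f s) / h) \<longlongrightarrow> f x) (at_right 0)"
    by simp
  with AE_right_derivative[OF f]
  have "AE x in lebesgue. x > 0 \<longrightarrow> (F has_real_derivative f x) (at x)"
  proof eventually_elim
    case (elim x)
    show ?case
    proof
      assume x: "x > 0"
      have R: "((\<lambda>h. (F (x + h) - F x) / h) \<longlongrightarrow> f x) (at_right 0)"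
        by (rule Lim_transform_eventually[OF elim(1)])
          (use x in \<open>auto simp: F eventually_at_right_field intro!: exI[of _ 1]\<close>)
      have "((\<lambda>h. (F (x - h) - F x) / (- h)) \<longlongrightarrow> f x) (at_right 0)"
        by (rule Lim_transform_eventually[OF elim(2)])
          (use x F[of "x - _" x] in \<open>auto simp: eventually_at_right_field minus_divide_right[symmetric]
            divide_simps intro!: exI[of _ x]\<close>)
      then have L: "((\<lambda>h. (F (x + h) - F x) / h) \<longlongrightarrow> f x) (at_left 0)"
        using filterlim_at_left_to_right[of "\<lambda>h. (F (x + h) - F x) / h" "nhds (f x)" 0] by simp
      show "(F has_real_derivative f x) (at x)"
        unfolding DERIV_def using L R by (rule filterlim_split_at)
    qed
  qed
  then show ?thesis unfolding F_def using AE_completion_iff by blast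
qed

section \<open>Hausdorff measure on half-circles\<close>

definition size_covers :: "real \<Rightarrow> 'a::metric_space set \<Rightarrow> (nat \<Rightarrow> 'a set) set" where
  "size_covers d A = {C. A \<subseteq> (\<Union>i. C i) \<and> (\<forall>i. bounded (C i) \<and> diameter (C i) \<le> d)}"

text \<open>The approximation at scale \<open>d\<close>, named separately because subadditivity and
  the splitting of covers are proved at a fixed scale before passing to the supremum.\<close>

definition hausdorff1_pre :: "real \<Rightarrow> 'a::metric_space set \<Rightarrow> ennreal" where
  "hausdorff1_pre d A = (INF C\<in>size_covers d A. \<Sum>i. ennreal (diameter (C i)))"

lemma hausdorff1_outer_eq: "hausdorff1_outer A = (SUP d\<in>{0<..}. hausdorff1_pre d A)"
  unfolding hausdorff1_outer_def hausdorff1_pre_def size_covers_def ..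

lemma pre_le_outer: "d > 0 \<Longrightarrow> hausdorff1_pre d A \<le> hausdorff1_outer A"
  unfolding hausdorff1_outer_eq by (rule SUP_upper) simp

lemma outer_leI: "(\<And>d. d > 0 \<Longrightarrow> hausdorff1_pre d A \<le> c) \<Longrightarrow> hausdorff1_outer A \<le> c"
  unfolding hausdorff1_outer_eq by (rule SUP_least) simp

lemma pre_leI: "C \<in> size_covers d A \<Longrightarrow> (\<Sum>i. ennreal (diameter (C i))) \<le> c \<Longrightarrow> hausdorff1_pre d A \<le> c"
  unfolding hausdorff1_pre_def by (rule INF_lower2)

lemma pre_mono: "A \<subseteq> B \<Longrightarrow> hausdorff1_pre d A \<le> hausdorff1_pre d B"
  unfolding hausdorff1_pre_def size_covers_def by (rule INF_superset_mono) auto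

lemma pre_antimono: "d \<le> d' \<Longrightarrow> hausdorff1_pre d' A \<le> hausdorff1_pre d A"
  unfolding hausdorff1_pre_def size_covers_def by (rule INF_superset_mono) (auto intro: order.trans)

lemma outer_mono: "A \<subseteq> B \<Longrightarrow> hausdorff1_outer A \<le> hausdorff1_outer B"
  by (meson outer_leI order.trans pre_le_outer pre_mono)

lemma outer_empty [simp]: "hausdorff1_outer {} = 0"
proof -
  have "hausdorff1_pre d {} \<le> 0" if "d > 0" for d
    by (rule pre_leI[of "\<lambda>_. {}"]) (use that in \<open>auto simp: size_covers_def\<close>)
  then have "hausdorff1_outer {} \<le> 0" by (rule outer_leI)
  then show ?thesis by simp
qed

text \<open>Near-optimal covers of the sets \<open>A i\<close> with errors
  \<open>e / 2^(i+1)\<close> are merged into one sequence by \<open>prod_decode\<close>.\<close>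

lemma pre_countably_subadditive:
  "hausdorff1_pre d (\<Union>i. A i) \<le> (\<Sum>i. hausdorff1_pre d (A i))" for A :: "nat \<Rightarrow> 'a::metric_space set"
proof (rule ennreal_le_epsilon)
  fix e :: real assume e: "0 < e" and fin: "(\<Sum>i. hausdorff1_pre d (A i)) < top"
  have "\<exists>C\<in>size_covers d (A i). (\<Sum>j. ennreal (diameter (C j))) \<le> hausdorff1_pre d (A i) + ennreal (e * (1/2) ^ Suc i)" for i
  proof -
    have "hausdorff1_pre d (A i) < top"
      using fin by (metis ennreal_suminf_lessD)
    then have "hausdorff1_pre d (A i) < hausdorff1_pre d (A i) + ennreal (e * (1/2) ^ Suc i)"
      using e by (auto simp: less_top)
    then show ?thesis
      unfolding hausdorff1_pre_def[of d "A i"] INF_less_iff by (auto intro: less_imp_le)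
  qed
  then obtain C where C: "\<And>i. C i \<in> size_covers d (A i)"
    "\<And>i. (\<Sum>j. ennreal (diameter (C i j))) \<le> hausdorff1_pre d (A i) + ennreal (e * (1/2) ^ Suc i)"
    by metis
  define B where "B = (\<lambda>(i, j). C i j) \<circ> prod_decode"
  have "(\<Union>i. A i) \<subseteq> (\<Union>n. B n)"
  proof
    fix x assume "x \<in> (\<Union>i. A i)"
    then obtain i j where "x \<in> C i j" using C(1) by (fastforce simp: size_covers_def)
    then have "x \<in> B (prod_encode (i, j))" by (simp add: B_def)
    then show "x \<in> (\<Union>n. B n)" by blast
  qed
  moreover have "bounded (B n) \<and> diameter (B n) \<le> d" for n
    using C(1) by (cases "prod_decode n") (auto simp: B_def size_covers_def)
  ultimately have "B \<in> size_covers d (\<Union>i. A i)" by (simp add: size_covers_def)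
  moreover have "(\<Sum>n. ennreal (diameter (B n))) \<le> (\<Sum>i. hausdorff1_pre d (A i)) + ennreal e"
  proof -
    have "(\<Sum>n. ennreal (diameter (B n))) = (\<Sum>n. (\<lambda>(i, j). ennreal (diameter (C i j))) (prod_decode n))"
      by (simp add: B_def case_prod_beta)
    also have "\<dots> = (\<Sum>i. \<Sum>j. ennreal (diameter (C i j)))"
      by (rule suminf_ennreal_2dimen) simp
    also have "\<dots> \<le> (\<Sum>i. hausdorff1_pre d (A i) + ennreal (e * (1/2) ^ Suc i))"
      by (intro suminf_le C(2) summableI)
    also have "\<dots> = (\<Sum>i. hausdorff1_pre d (A i)) + (\<Sum>i. ennreal (e * (1/2) ^ Suc i))"
      by (intro suminf_add[symmetric] summableI)
    also have "(\<Sum>i. ennreal (e * (1/2) ^ Suc i)) = ennreal e"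
      using sums_mult[OF power_half_series, of e] e
      by (intro suminf_ennreal_eq) auto
    finally show ?thesis .
  qed
  ultimately show "hausdorff1_pre d (\<Union>i. A i) \<le> (\<Sum>i. hausdorff1_pre d (A i)) + ennreal e"
    by (rule pre_leI)
qed

lemma outer_countably_subadditive:
  "hausdorff1_outer (\<Union>i. A i) \<le> (\<Sum>i. hausdorff1_outer (A i))" for A :: "nat \<Rightarrow> 'a::metric_space set"
proof (rule outer_leI)
  fix d :: real assume "d > 0"
  then have "(\<Sum>i. hausdorff1_pre d (A i)) \<le> (\<Sum>i. hausdorff1_outer (A i))"
    by (intro suminf_le pre_le_outer summableI)
  then show "hausdorff1_pre d (\<Union>i. A i) \<le> (\<Sum>i. hausdorff1_outer (A i))"
    using pre_countably_subadditive order.trans by blast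
qed

lemma outer_Un_le: "hausdorff1_outer (A \<union> B) \<le> hausdorff1_outer A + hausdorff1_outer B"
proof -
  define X where "X i = (if i = 0 then A else if i = 1 then B else {})" for i :: nat
  have "A \<union> B \<subseteq> X 0 \<union> X 1" by (auto simp: X_def)
  then have "(\<Union>i. X i) = A \<union> B" by (auto simp: X_def split: if_splits)
  moreover have "(\<Sum>i. hausdorff1_outer (X i)) = (\<Sum>i\<in>{0, 1}. hausdorff1_outer (X i))"
    by (rule suminf_finite) (auto simp: X_def)
  ultimately show ?thesis using outer_countably_subadditive[of X] by (simp add: X_def)
qed

lemma outer_measure_space_hausdorff1: "outer_measure_space (Pow UNIV) hausdorff1_outer"
  unfolding outer_measure_space_def
  by (auto simp: positive_def increasing_def countably_subadditive_def outer_mono outer_countably_subadditive)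

lemma hausdorff1_measure_space:
  "measure_space UNIV (lambda_system UNIV (Pow UNIV) hausdorff1_outer) hausdorff1_outer"
  using sigma_algebra.caratheodory_lemma[OF sigma_algebra_Pow outer_measure_space_hausdorff1] .

lemma sets_hausdorff1: "sets hausdorff1 = lambda_system UNIV (Pow UNIV) hausdorff1_outer"
  using hausdorff1_measure_space unfolding hausdorff1_def measure_space_def
  by (intro sigma_algebra.sets_measure_of_eq) blast

lemma space_hausdorff1 [simp]: "space hausdorff1 = UNIV"
  by (simp add: hausdorff1_def)

lemma emeasure_hausdorff1: "A \<in> sets hausdorff1 \<Longrightarrow> emeasure hausdorff1 A = hausdorff1_outer A"
proof -
  assume "A \<in> sets hausdorff1"
  then have A: "A \<in> lambda_system UNIV (Pow UNIV) hausdorff1_outer" by (simp only: sets_hausdorff1)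
  show ?thesis
    using hausdorff1_measure_space unfolding hausdorff1_def measure_space_def
    by (elim conjE) (rule emeasure_measure_of_sigma[OF _ _ _ A])
qed

lemma sets_hausdorff1I:
  assumes "\<And>X. hausdorff1_outer X < top \<Longrightarrow> hausdorff1_outer (A \<inter> X) + hausdorff1_outer (X - A) \<le> hausdorff1_outer X"
  shows "A \<in> sets hausdorff1"
proof -
  have "hausdorff1_outer (A \<inter> X) + hausdorff1_outer ((UNIV - A) \<inter> X) = hausdorff1_outer X" for X
  proof (rule antisym)
    have "(UNIV - A) \<inter> X = X - A" by auto
    then show "hausdorff1_outer (A \<inter> X) + hausdorff1_outer ((UNIV - A) \<inter> X) \<le> hausdorff1_outer X"
      using assms[of X] by (cases "hausdorff1_outer X = top") (auto simp: less_top)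
    show "hausdorff1_outer X \<le> hausdorff1_outer (A \<inter> X) + hausdorff1_outer ((UNIV - A) \<inter> X)"
      using outer_Un_le[of "A \<inter> X" "(UNIV - A) \<inter> X"] by (simp flip: Int_Un_distrib2)
  qed
  then show ?thesis by (simp add: sets_hausdorff1 lambda_system_def)
qed

lemma hausdorff1_null: assumes "hausdorff1_outer A = 0" shows "A \<in> null_sets hausdorff1"
proof -
  have "A \<in> sets hausdorff1"
  proof (rule sets_hausdorff1I)
    fix X
    have "hausdorff1_outer (A \<inter> X) = 0" using outer_mono[of "A \<inter> X" A] assms by auto
    then show "hausdorff1_outer (A \<inter> X) + hausdorff1_outer (X - A) \<le> hausdorff1_outer X"
      using outer_mono[of "X - A" X] by auto
  qed
  then show ?thesis using assms by (simp add: null_sets_def emeasure_hausdorff1)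
qed

section \<open>Metric outer measures: closed sets are measurable\<close>

lemma outer_Un_separated:
  assumes e: "e > 0" and sep: "\<And>a b. a \<in> A \<Longrightarrow> b \<in> B \<Longrightarrow> e \<le> dist a b"
  shows "hausdorff1_outer A + hausdorff1_outer B \<le> hausdorff1_outer (A \<union> B)"
proof -
  have *: "hausdorff1_pre d A + hausdorff1_pre d B \<le> hausdorff1_pre d (A \<union> B)" if d: "0 < d" "d < e" for d
    unfolding hausdorff1_pre_def[of d "A \<union> B"]
  proof (rule INF_greatest)
    fix C assume C: "C \<in> size_covers d (A \<union> B)"
    \<comment> \<open>A set of diameter at most \<open>d < e\<close> cannot meet both
      \<open>A\<close> and \<open>B\<close>, so a fine cover splits into one cover for each.\<close>
    have disj: "C i \<inter> A = {} \<or> C i \<inter> B = {}" for i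
    proof (rule ccontr)
      assume "\<not> ?thesis"
      then obtain a b where ab: "a \<in> A" "b \<in> B" "a \<in> C i" "b \<in> C i" by blast
      then have "dist a b \<le> d"
        using C diameter_bounded_bound[of "C i" a b] by (auto simp: size_covers_def intro: order.trans)
      then show False using sep[of a b] ab d by simp
    qed
    define CA CB where "CA i = (if C i \<inter> A = {} then {} else C i)"
      and "CB i = (if C i \<inter> B = {} then {} else C i)" for i
    have "CA \<in> size_covers d A" "CB \<in> size_covers d B"
      using C d by (auto simp: size_covers_def CA_def CB_def subset_iff) blast+
    then have "hausdorff1_pre d A + hausdorff1_pre d B \<le>
        (\<Sum>i. ennreal (diameter (CA i))) + (\<Sum>i. ennreal (diameter (CB i)))"
      unfolding hausdorff1_pre_def by (intro add_mono INF_lower)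
    also have "\<dots> = (\<Sum>i. ennreal (diameter (CA i)) + ennreal (diameter (CB i)))"
      by (intro suminf_add summableI)
    also have "\<dots> \<le> (\<Sum>i. ennreal (diameter (C i)))"
      using disj by (intro suminf_le summableI) (auto simp: CA_def CB_def)
    finally show "hausdorff1_pre d A + hausdorff1_pre d B \<le> (\<Sum>i. ennreal (diameter (C i)))" .
  qed
  have **: "hausdorff1_pre d A + hausdorff1_pre d' B \<le> hausdorff1_outer (A \<union> B)"
    if "0 < d" "0 < d'" for d d'
  proof -
    \<comment> \<open>The two suprema run over independent scales; a common finer scale below
      \<open>e\<close> serves both.\<close>
    define k where "k = min (min d d') (e / 2)"
    have k: "0 < k" "k < e" "k \<le> d" "k \<le> d'" using that e by (auto simp: k_def)
    have "hausdorff1_pre d A + hausdorff1_pre d' B \<le> hausdorff1_pre k A + hausdorff1_pre k B"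
      using k by (intro add_mono pre_antimono)
    also have "\<dots> \<le> hausdorff1_outer (A \<union> B)"
      using *[OF k(1,2)] pre_le_outer[OF k(1)] order.trans by blast
    finally show ?thesis .
  qed
  have "hausdorff1_pre d A + hausdorff1_outer B \<le> hausdorff1_outer (A \<union> B)" if "0 < d" for d
  proof -
    have "hausdorff1_pre d A + hausdorff1_outer B = (SUP d'\<in>{0<..}. hausdorff1_pre d A + hausdorff1_pre d' B)"
      unfolding hausdorff1_outer_eq[of B] by (subst ennreal_SUP_add_right) (auto simp: greaterThan_non_empty)
    also have "\<dots> \<le> hausdorff1_outer (A \<union> B)" by (intro SUP_least ** that) simp
    finally show ?thesis .
  qed
  moreover have "hausdorff1_outer A + hausdorff1_outer B = (SUP d\<in>{0<..}. hausdorff1_pre d A + hausdorff1_outer B)"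
    unfolding hausdorff1_outer_eq[of A] by (subst ennreal_SUP_add_left) (auto simp: greaterThan_non_empty)
  ultimately show ?thesis by (simp add: SUP_le_iff)
qed

lemma outer_sum_separated:
  fixes R :: "nat \<Rightarrow> 'a::metric_space set"
  assumes "\<And>i j. i < j \<Longrightarrow> \<exists>e>0. \<forall>a\<in>R i. \<forall>b\<in>R j. e \<le> dist a b"
  shows "(\<Sum>i<n. hausdorff1_outer (R i)) \<le> hausdorff1_outer (\<Union>i<n. R i)"
proof (induction n)
  case (Suc n)
  have "\<forall>i. \<exists>e>0. i < n \<longrightarrow> (\<forall>a\<in>R i. \<forall>b\<in>R n. e \<le> dist a b)"
    using assms[of _ n] zero_less_one by blast
  then obtain e where e: "\<And>i. e i > 0" "\<And>i a b. i < n \<Longrightarrow> a \<in> R i \<Longrightarrow> b \<in> R n \<Longrightarrow> e i \<le> dist a b"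
    by metis
  define k where "k = Min (insert 1 (e ` {..<n}))"
  have k: "k > 0" unfolding k_def using e(1) by (subst Min_gr_iff) auto
  have ke: "k \<le> e i" if "i < n" for i unfolding k_def using that by (intro Min_le) auto
  have "(\<Sum>i<Suc n. hausdorff1_outer (R i)) \<le> hausdorff1_outer (\<Union>i<n. R i) + hausdorff1_outer (R n)"
    using Suc.IH by (simp add: add_mono)
  also have "\<dots> \<le> hausdorff1_outer ((\<Union>i<n. R i) \<union> R n)"
    by (rule outer_Un_separated[OF k]) (use e(2) ke in \<open>fastforce intro: order.trans\<close>)
  also have "(\<Union>i<n. R i) \<union> R n = (\<Union>i<Suc n. R i)" by (auto simp: less_Suc_eq)
  finally show ?case .
qed simp

text \<open>Caratheodory's argument for metric outer measures. \<open>A\<close> and the points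
  \<open>Y n\<close> of \<open>X\<close> at distance at least \<open>w n\<close> are separated, so
  outer measure adds on them. The rest of \<open>X - A\<close> is covered by the shells
  \<open>R k\<close> with \<open>k \<ge> n\<close>, whose outer measures form a convergent series,
  so its tail tends to \<open>0\<close>.\<close>

lemma closed_in_sets_hausdorff1:
  fixes A :: "'a::metric_space set"
  assumes "closed A" shows "A \<in> sets hausdorff1"
proof (cases "A = {}")
  case False
  show ?thesis
  proof (rule sets_hausdorff1I)
    fix X :: "'a set" assume fin: "hausdorff1_outer X < top"
    define w where "w n = inverse (real (Suc n))" for n
    have w_mono: "w n \<le> w m" if "m \<le> n" for m n using that by (simp add: w_def)
    have w_strict: "w n < w m" if "m < n" for m n using that by (simp add: w_def)
    define Y where "Y n = {x\<in>X. w n \<le> infdist x A}" for n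
    define R where "R n = {x\<in>X. w (Suc n) \<le> infdist x A \<and> infdist x A < w n}" for n
    \<comment> \<open>Consecutive shells may touch, but shells whose indices differ by at least two
      are separated. Hence the even and the odd shells are summed apart below.\<close>
    have sepR: "\<exists>e>0. \<forall>a\<in>R i. \<forall>b\<in>R j. e \<le> dist a b" if "Suc i < j" for i j
    proof (intro exI conjI ballI)
      show "w (Suc i) - w j > 0" using w_strict that by simp
      fix a b assume "a \<in> R i" "b \<in> R j"
      then have "w (Suc i) \<le> infdist a A" "infdist b A < w j" by (auto simp: R_def)
      moreover have "infdist a A \<le> infdist b A + dist a b" by (rule infdist_triangle)
      ultimately show "w (Suc i) - w j \<le> dist a b" by linarith
    qed
    have half: "(\<Sum>k. hausdorff1_outer (R (2 * k + c))) \<le> hausdorff1_outer X" for c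
    proof (rule suminf_le_const[OF summableI])
      fix n
      have "(\<Sum>k<n. hausdorff1_outer (R (2 * k + c))) \<le> hausdorff1_outer (\<Union>k<n. R (2 * k + c))"
        by (rule outer_sum_separated) (rule sepR, simp)
      also have "\<dots> \<le> hausdorff1_outer X" by (rule outer_mono) (auto simp: R_def)
      finally show "(\<Sum>k<n. hausdorff1_outer (R (2 * k + c))) \<le> hausdorff1_outer X" .
    qed
    have "(\<Sum>k. hausdorff1_outer (R k)) \<le> hausdorff1_outer X + hausdorff1_outer X"
    proof (rule suminf_le_const[OF summableI])
      fix n
      have "(\<Sum>k<n. hausdorff1_outer (R k)) \<le> (\<Sum>k<2 * n. hausdorff1_outer (R k))"
        by (rule sum_mono2) auto
      also have "\<dots> = (\<Sum>k<n. hausdorff1_outer (R (2 * k + 0))) + (\<Sum>k<n. hausdorff1_outer (R (2 * k + 1)))"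
        by (induction n) (auto simp: algebra_simps)
      also have "\<dots> \<le> (\<Sum>k. hausdorff1_outer (R (2 * k + 0))) + (\<Sum>k. hausdorff1_outer (R (2 * k + 1)))"
        by (intro add_mono sum_le_suminf summableI) auto
      also have "\<dots> \<le> hausdorff1_outer X + hausdorff1_outer X" by (intro add_mono half)
      finally show "(\<Sum>k<n. hausdorff1_outer (R k)) \<le> hausdorff1_outer X + hausdorff1_outer X" .
    qed
    then have finR: "(\<Sum>k. hausdorff1_outer (R k)) < top" using fin by (auto intro: le_less_trans simp: ennreal_add_less_top)
    have sepY: "hausdorff1_outer (A \<inter> X) + hausdorff1_outer (Y n) \<le> hausdorff1_outer X" for n
    proof -
      have "hausdorff1_outer (A \<inter> X) + hausdorff1_outer (Y n) \<le> hausdorff1_outer (A \<inter> X \<union> Y n)"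
      proof (rule outer_Un_separated)
        show "w n > 0" by (simp add: w_def)
        show "w n \<le> dist a b" if "a \<in> A \<inter> X" "b \<in> Y n" for a b
          using that infdist_le[of a A b] by (auto simp: Y_def dist_commute)
      qed
      also have "\<dots> \<le> hausdorff1_outer X" by (rule outer_mono) (auto simp: Y_def)
      finally show ?thesis .
    qed
    have cover: "X - A \<subseteq> Y n \<union> (\<Union>k. R (k + n))" for n
    proof
      fix x assume x: "x \<in> X - A"
      then have "infdist x A > 0"
        using assms False in_closed_iff_infdist_zero[of A x] infdist_nonneg[of x A] by fastforce
      then obtain N where N: "w N < infdist x A"
        using reals_Archimedean unfolding w_def by blast
      show "x \<in> Y n \<union> (\<Union>k. R (k + n))"
      proof (cases "w n \<le> infdist x A")
        case False
        define m where "m = (LEAST m. w m \<le> infdist x A)"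
        have m: "w m \<le> infdist x A" unfolding m_def by (rule LeastI[of _ N]) (use N in simp)
        have "n < m" using m False w_mono by (meson linorder_not_less order.trans)
        then obtain j where j: "m = Suc j" "n \<le> j" by (cases m) auto
        have "infdist x A < w j" using not_less_Least[of j "\<lambda>m. w m \<le> infdist x A"] j
          by (simp add: m_def[symmetric] not_le)
        then have "x \<in> R j" using m j x by (simp add: R_def)
        then show ?thesis using j by (auto intro!: exI[of _ "j - n"])
      qed (use x in \<open>simp add: Y_def\<close>)
    qed
    have "hausdorff1_outer (A \<inter> X) + hausdorff1_outer (X - A) \<le>
        hausdorff1_outer X + (\<Sum>k. hausdorff1_outer (R (k + n)))" for n
    proof -
      have "hausdorff1_outer (X - A) \<le> hausdorff1_outer (Y n) + hausdorff1_outer (\<Union>k. R (k + n))"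
        using outer_mono[OF cover] outer_Un_le order.trans by blast
      also have "\<dots> \<le> hausdorff1_outer (Y n) + (\<Sum>k. hausdorff1_outer (R (k + n)))"
        by (intro add_left_mono outer_countably_subadditive)
      finally have "hausdorff1_outer (A \<inter> X) + hausdorff1_outer (X - A) \<le>
        (hausdorff1_outer (A \<inter> X) + hausdorff1_outer (Y n)) + (\<Sum>k. hausdorff1_outer (R (k + n)))"
        by (metis add.assoc add_left_mono)
      also have "\<dots> \<le> hausdorff1_outer X + (\<Sum>k. hausdorff1_outer (R (k + n)))"
        by (intro add_right_mono sepY)
      finally show ?thesis .
    qed
    moreover have "(\<lambda>n. \<Sum>k. hausdorff1_outer (R (k + n))) \<longlonglongrightarrow> 0"
    proof -
      define f where "f k = enn2real (hausdorff1_outer (R k))" for k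
      have fk: "hausdorff1_outer (R k) = ennreal (f k)" for k
        using ennreal_suminf_lessD[OF finR, of k] by (simp add: f_def)
      have f0: "f k \<ge> 0" for k by (simp add: f_def)
      have sf: "summable f"
        by (rule summable_suminf_not_top) (use finR f0 in \<open>auto simp: fk\<close>)
      have "(\<Sum>k. hausdorff1_outer (R (k + n))) = ennreal (suminf f - (\<Sum>k<n. f k))" for n
        unfolding fk using sf f0
        by (subst suminf_ennreal2) (auto simp: suminf_minus_initial_segment)
      moreover have "(\<lambda>n. ennreal (suminf f - (\<Sum>k<n. f k))) \<longlonglongrightarrow> ennreal (suminf f - suminf f)"
        by (intro tendsto_ennrealI tendsto_intros summable_LIMSEQ sf)
      ultimately show ?thesis by simp
    qed
    then have "(\<lambda>n. hausdorff1_outer X + (\<Sum>k. hausdorff1_outer (R (k + n)))) \<longlonglongrightarrow> hausdorff1_outer X + 0"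
      by (intro tendsto_add tendsto_const)
    ultimately show "hausdorff1_outer (A \<inter> X) + hausdorff1_outer (X - A) \<le> hausdorff1_outer X"
      using LIMSEQ_le_const[of "\<lambda>n. hausdorff1_outer X + (\<Sum>k. hausdorff1_outer (R (k + n)))" "hausdorff1_outer X"]
      by simp
  qed
qed simp

lemma borel_subset_hausdorff1: "sets borel \<subseteq> sets (hausdorff1 :: 'a::metric_space measure)"
proof -
  have "sets (borel :: 'a measure) = sigma_sets UNIV (Collect closed)"
    by (simp add: borel_eq_closed)
  also have "\<dots> \<subseteq> sets hausdorff1"
    using sets.sigma_sets_subset[of "Collect closed" hausdorff1] closed_in_sets_hausdorff1 by auto
  finally show ?thesis .
qed

section \<open>Length of circular arcs\<close>

definition polar :: "real \<Rightarrow> real \<Rightarrow> plane" where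
  "polar r \<theta> = (r * cos \<theta>, r * sin \<theta>)"

lemma dist_polar: "r > 0 \<Longrightarrow> dist (polar r x) (polar r y) = 2 * r * \<bar>sin ((x - y) / 2)\<bar>"
proof -
  assume r: "r > 0"
  have "(r * cos x - r * cos y)\<^sup>2 + (r * sin x - r * sin y)\<^sup>2
      = r\<^sup>2 * ((cos x)\<^sup>2 + (sin x)\<^sup>2 + ((cos y)\<^sup>2 + (sin y)\<^sup>2) - 2 * (cos x * cos y + sin x * sin y))"
    by (simp only: power2_eq_square) algebra
  also have "\<dots> = r\<^sup>2 * (2 - 2 * cos (x - y))" by (simp add: cos_diff)
  also have "cos (x - y) = 1 - 2 * (sin ((x - y) / 2))\<^sup>2"
    using cos_double_sin[of "(x - y) / 2"] by (simp only: mult_2 field_sum_of_halves)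
  also have "r\<^sup>2 * (2 - 2 * (1 - 2 * (sin ((x - y) / 2))\<^sup>2)) = (2 * r * \<bar>sin ((x - y) / 2)\<bar>)\<^sup>2"
    by (simp add: power2_eq_square algebra_simps)
  finally show ?thesis using r by (simp add: polar_def dist_Pair_Pair dist_real_def)
qed

lemma dist_polar_le: "r > 0 \<Longrightarrow> dist (polar r x) (polar r y) \<le> r * \<bar>x - y\<bar>"
  using abs_sin_x_le_abs_x[of "(x - y) / 2"] by (simp add: dist_polar)

text \<open>The chord over the angle \<open>2 z\<close> is \<open>2 r sin z\<close>, and
  \<open>sin z \<ge> z cos z \<ge> z cos (w / 2)\<close> once \<open>z \<le> w / 2\<close>, which
  the bound on the chord ensures. Thus chord and arc differ by a factor close to \<open>1\<close> at
  small scales.\<close>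

lemma dist_polar_ge:
  assumes r: "r > 0" and w: "0 < w" "w < pi" and xy: "\<bar>x - y\<bar> < pi"
    and d: "dist (polar r x) (polar r y) \<le> 2 * r * sin (w / 2)"
  shows "r * cos (w / 2) * \<bar>x - y\<bar> \<le> dist (polar r x) (polar r y)"
proof -
  define z where "z = \<bar>x - y\<bar> / 2"
  have z: "0 \<le> z" "z < pi / 2" using xy by (auto simp: z_def)
  have sz: "\<bar>sin ((x - y) / 2)\<bar> = sin z"
  proof (cases "x \<ge> y")
    case True
    then show ?thesis using z by (simp add: z_def sin_ge_zero)
  next
    case False
    then have "(x - y) / 2 = - z" unfolding z_def abs_if by argo
    then have "sin ((x - y) / 2) = - sin z" by (simp only: sin_minus)
    then show ?thesis using z by (simp add: sin_ge_zero)
  qed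
  have "sin z \<le> sin (w / 2)" using d r sz by (simp add: dist_polar)
  then have zw: "z \<le> w / 2" using z w sin_mono_le_eq[of z "w / 2"] by (simp add: field_simps)
  have "z * cos z \<le> sin z"
  proof (cases "z = 0")
    case False
    have "z * cos z - sin z \<le> 0 * cos 0 - sin 0"
    proof (rule DERIV_nonpos_imp_nonincreasing[OF z(1)])
      fix t assume t: "0 \<le> t" "t \<le> z"
      have "((\<lambda>z. z * cos z - sin z) has_real_derivative - (t * sin t)) (at t)"
        by (auto intro!: derivative_eq_intros)
      moreover have "- (t * sin t) \<le> 0" using t z by (simp add: sin_ge_zero)
      ultimately show "\<exists>y. ((\<lambda>z. z * cos z - sin z) has_real_derivative y) (at t) \<and> y \<le> 0" by blast
    qed
    then show ?thesis by simp
  qed simp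
  moreover have "cos (w / 2) \<le> cos z" using zw z w by (intro cos_monotone_0_pi_le) auto
  ultimately have "z * cos (w / 2) \<le> sin z" using z by (meson mult_left_mono order.trans)
  then have "2 * r * (z * cos (w / 2)) \<le> 2 * r * sin z" using r by (intro mult_left_mono) auto
  then show ?thesis using r sz by (simp add: dist_polar z_def algebra_simps)
qed

text \<open>The arc is cut into \<open>n\<close> equal pieces; a chord is no longer than its arc, so
  the diameters sum to at most the arc length.\<close>

lemma outer_polar_le:
  assumes r: "r > 0" and ab: "a \<le> b"
  shows "hausdorff1_outer (polar r ` {a..b}) \<le> ennreal (r * (b - a))"
proof (rule outer_leI)
  fix d :: real assume d: "d > 0"
  obtain n :: nat where n: "r * (b - a) / d < real n" using reals_Archimedean2 by blast
  have n0: "n > 0" using n ab r d by (metis divide_nonneg_pos diff_ge_0_iff_ge gr0I less_imp_le mult_nonneg_nonneg not_le of_nat_0)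
  define s where "s = (b - a) / real n"
  have s: "s \<ge> 0" "r * s \<le> d" using n n0 d ab r by (auto simp: s_def field_simps)
  define C where "C i = (if i < n then polar r ` {a + real i * s..a + real (Suc i) * s} else {})" for i
  have diam: "bounded (C i) \<and> diameter (C i) \<le> r * s" for i
  proof -
    have "dist x y \<le> r * s" if xy: "x \<in> C i" "y \<in> C i" for x y
    proof -
      obtain u v where uv: "x = polar r u" "y = polar r v" "\<bar>u - v\<bar> \<le> s"
      proof -
        obtain u v where uv: "x = polar r u" "y = polar r v"
          "u \<in> {a + real i * s..a + real (Suc i) * s}" "v \<in> {a + real i * s..a + real (Suc i) * s}"
          using xy by (auto simp: C_def split: if_splits)
        then have "\<bar>u - v\<bar> \<le> s" by (simp add: algebra_simps abs_le_iff)
        then show ?thesis using that uv by blast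
      qed
      then show ?thesis using dist_polar_le[OF r, of u v] r
        by (meson mult_left_mono order.trans less_imp_le)
    qed
    then have D: "\<forall>x\<in>C i. \<forall>y\<in>C i. dist x y \<le> r * s" by blast
    have "r * s \<ge> 0" using r s by simp
    then have "diameter (C i) \<le> r * s" using D by (intro diameter_le) (simp_all add: dist_norm)
    moreover have "bounded (C i)" unfolding bounded_two_points using D by blast
    ultimately show ?thesis by blast
  qed
  have "polar r ` {a..b} \<subseteq> (\<Union>i. C i)"
  proof
    fix p assume "p \<in> polar r ` {a..b}"
    then obtain t where t: "p = polar r t" "a \<le> t" "t \<le> b" by auto
    show "p \<in> (\<Union>i. C i)"
    proof (cases "t < b")
      case True
      then have s0: "s > 0" using t n0 by (simp add: s_def)
      define i where "i = nat \<lfloor>(t - a) / s\<rfloor>"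
      have fl: "real i \<le> (t - a) / s" "(t - a) / s < real i + 1"
        using t s0 by (auto simp: i_def)
      have "(t - a) / s < real n" using True s0 n0 by (simp add: s_def field_simps)
      then have "i < n" using fl by linarith
      moreover have "t \<in> {a + real i * s..a + real (Suc i) * s}"
        using fl s0 by (auto simp: field_simps)
      ultimately have "p \<in> C i" using t by (auto simp: C_def)
      then show ?thesis by blast
    next
      case False
      then have "t = b" using t by simp
      have "real (Suc (n - 1)) * s = b - a" using n0 by (simp add: s_def)
      moreover have "real (n - 1) * s \<le> real (Suc (n - 1)) * s" using s by (intro mult_right_mono) auto
      ultimately have "p \<in> C (n - 1)"
        using t \<open>t = b\<close> n0 by (auto simp: C_def intro!: image_eqI[of _ _ b])
      then show ?thesis by blast
    qed
  qed
  then have "C \<in> size_covers d (polar r ` {a..b})"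
    using diam s by (auto simp: size_covers_def intro: order.trans)
  moreover have "(\<Sum>i. ennreal (diameter (C i))) \<le> ennreal (r * (b - a))"
  proof -
    have "(\<Sum>i. ennreal (diameter (C i))) = (\<Sum>i<n. ennreal (diameter (C i)))"
      by (rule suminf_finite) (auto simp: C_def)
    also have "\<dots> \<le> (\<Sum>i<n. ennreal (r * s))" by (intro sum_mono ennreal_leI) (use diam in auto)
    also have "\<dots> = ennreal (real n * (r * s))" using r s by (simp add: ennreal_of_nat_eq_real_of_nat ennreal_mult)
    also have "real n * (r * s) = r * (b - a)" using n0 by (simp add: s_def)
    finally show ?thesis .
  qed
  ultimately show "hausdorff1_pre d (polar r ` {a..b}) \<le> ennreal (r * (b - a))" by (rule pre_leI)
qed

text \<open>A cover of the arc by small sets pulls back to sets of angles, each inside an interval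
  of length \<open>k * diameter\<close>. These intervals cover \<open>(a, b)\<close>, so
  subadditivity of Lebesgue measure bounds \<open>b - a\<close>. The factor
  \<open>cos (w / 2)\<close> lost in replacing arcs by chords tends to \<open>1\<close> with
  \<open>w\<close>.\<close>

lemma outer_polar_ge:
  assumes r: "r > 0" and ab: "a < b" "b - a \<le> pi"
  shows "ennreal (r * (b - a)) \<le> hausdorff1_outer (polar r ` {a<..<b})"
proof -
  have *: "ennreal (r * cos (w / 2) * (b - a)) \<le> hausdorff1_outer (polar r ` {a<..<b})" if w: "0 < w" "w < pi" for w
  proof -
    define d where "d = 2 * r * sin (w / 2)"
    define k where "k = 1 / (r * cos (w / 2))"
    have cw: "cos (w / 2) > 0" using w by (intro cos_gt_zero_pi) auto
    have k: "k > 0" using cw r by (simp add: k_def)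
    have d: "d > 0" using r w by (auto simp: d_def intro!: mult_pos_pos sin_gt_zero)
    have "ennreal (r * cos (w / 2) * (b - a)) \<le> hausdorff1_pre d (polar r ` {a<..<b})"
      unfolding hausdorff1_pre_def
    proof (rule INF_greatest)
      fix C assume C: "C \<in> size_covers d (polar r ` {a<..<b})"
      define T where "T i = {t\<in>{a<..<b}. polar r t \<in> C i}" for i
      have "\<exists>u. T i \<subseteq> {u..u + k * diameter (C i)}" for i
      proof (cases "T i = {}")
        case False
        have "\<bar>x - y\<bar> \<le> k * diameter (C i)" if xy: "x \<in> T i" "y \<in> T i" for x y
        proof -
          have D: "dist (polar r x) (polar r y) \<le> diameter (C i)"
            using xy C by (intro diameter_bounded_bound) (auto simp: T_def size_covers_def)
          then have D2: "dist (polar r x) (polar r y) \<le> 2 * r * sin (w / 2)"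
            using C by (auto simp: size_covers_def d_def intro: order.trans)
          have "\<bar>x - y\<bar> < pi" using xy ab by (auto simp: T_def)
          from dist_polar_ge[OF r w this D2] D
          have "r * cos (w / 2) * \<bar>x - y\<bar> \<le> diameter (C i)" by linarith
          then show ?thesis using r cw by (simp add: k_def field_simps)
        qed
        then have le: "x - y \<le> k * diameter (C i)" if "x \<in> T i" "y \<in> T i" for x y
          using that by (meson abs_ge_self order.trans)
        have bb: "bdd_below (T i)" by (rule bdd_belowI[of _ a]) (auto simp: T_def)
        have "x \<le> Inf (T i) + k * diameter (C i)" if "x \<in> T i" for x
        proof -
          have "x - k * diameter (C i) \<le> Inf (T i)"
            by (rule cInf_greatest[OF False]) (use le[OF that] in \<open>simp add: algebra_simps\<close>)
          then show ?thesis by simp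
        qed
        then show ?thesis using bb by (intro exI[of _ "Inf (T i)"]) (auto intro: cInf_lower)
      qed auto
      then obtain U where U: "\<And>i. T i \<subseteq> {U i..U i + k * diameter (C i)}" by metis
      have dC: "diameter (C i) \<ge> 0" for i using C by (auto simp: size_covers_def intro!: diameter_ge_0)
      have "{a<..<b} \<subseteq> (\<Union>i. T i)" using C by (fastforce simp: T_def size_covers_def)
      also have "\<dots> \<subseteq> (\<Union>i. {U i..U i + k * diameter (C i)})" using U by blast
      finally have "emeasure lborel {a<..<b} \<le> emeasure lborel (\<Union>i. {U i..U i + k * diameter (C i)})"
        by (intro emeasure_mono) auto
      also have "\<dots> \<le> (\<Sum>i. emeasure lborel {U i..U i + k * diameter (C i)})"
        by (intro emeasure_subadditive_countably) auto
      also have "\<dots> = (\<Sum>i. ennreal k * ennreal (diameter (C i)))"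
        using k dC by (simp add: ennreal_mult')
      also have "\<dots> = ennreal k * (\<Sum>i. ennreal (diameter (C i)))" by simp
      finally have le: "ennreal (b - a) \<le> ennreal k * (\<Sum>i. ennreal (diameter (C i)))" using ab by simp
      have "ennreal (r * cos (w / 2) * (b - a)) = ennreal (r * cos (w / 2)) * ennreal (b - a)"
        using r cw by (intro ennreal_mult'') (use ab in auto)
      also have "\<dots> \<le> ennreal (r * cos (w / 2)) * (ennreal k * (\<Sum>i. ennreal (diameter (C i))))"
        by (intro mult_left_mono le) auto
      also have "\<dots> = ennreal (r * cos (w / 2) * k) * (\<Sum>i. ennreal (diameter (C i)))"
        using r cw k by (simp add: ennreal_mult' mult.assoc)
      also have "r * cos (w / 2) * k = 1" using r cw by (simp add: k_def)
      finally show "ennreal (r * cos (w / 2) * (b - a)) \<le> (\<Sum>i. ennreal (diameter (C i)))" by simp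
    qed
    then show ?thesis using pre_le_outer[OF d] order.trans by blast
  qed
  define e where "e n = inverse (real (Suc n))" for n
  have e: "0 < e n" "e n < pi" for n
  proof -
    have "e n \<le> 1" by (simp add: e_def inverse_le_1_iff)
    then show "0 < e n" "e n < pi" using pi_gt3 by (auto simp: e_def)
  qed
  have "e \<longlonglongrightarrow> 0" unfolding e_def by (rule LIMSEQ_inverse_real_of_nat)
  then have "(\<lambda>n. ennreal (r * cos (e n / 2) * (b - a))) \<longlonglongrightarrow> ennreal (r * cos (0 / 2) * (b - a))"
    by (intro tendsto_ennrealI tendsto_intros) auto
  then show ?thesis by (intro LIMSEQ_le_const2[of _ "ennreal (r * (b - a))"]) (use *[OF e] in auto)
qed

section \<open>Integration over half-circles\<close>

definition ang :: "plane \<Rightarrow> real" where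
  "ang x = arctan (snd x / fst x)"

lemma ang_polar: "r > 0 \<Longrightarrow> - (pi / 2) < \<theta> \<Longrightarrow> \<theta> < pi / 2 \<Longrightarrow> ang (polar r \<theta>) = \<theta>"
  using arctan_tan[of \<theta>] by (simp add: ang_def polar_def tan_def)

lemma polar_ang:
  assumes "x \<in> half_circle r" shows "polar r (ang x) = x"
proof -
  have x: "fst x > 0" and r: "r = sqrt ((fst x)\<^sup>2 + (snd x)\<^sup>2)"
    using assms by (auto simp: half_circle_def norm_prod_def)
  have q: "sqrt (1 + (snd x / fst x)\<^sup>2) = r / fst x"
  proof -
    have "1 + (snd x / fst x)\<^sup>2 = ((fst x)\<^sup>2 + (snd x)\<^sup>2) / (fst x)\<^sup>2" using x by (simp add: field_simps)
    then show ?thesis using x r by (simp add: real_sqrt_divide)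
  qed
  have r0: "r > 0" using x r by (simp add: add_pos_nonneg)
  show ?thesis
    using x r0 by (simp add: polar_def ang_def cos_arctan sin_arctan q prod_eq_iff)
qed

lemma half_circle_eq: "r > 0 \<Longrightarrow> half_circle r = polar r ` {- (pi / 2)<..<pi / 2}"
proof (intro equalityI subsetI)
  fix x assume r: "r > 0" and x: "x \<in> half_circle r"
  have "ang x \<in> {- (pi / 2)<..<pi / 2}"
    using arctan_bounded by (simp add: ang_def)
  then show "x \<in> polar r ` {- (pi / 2)<..<pi / 2}" using polar_ang[OF x] by (metis image_eqI)
next
  fix x assume r: "r > 0" and "x \<in> polar r ` {- (pi / 2)<..<pi / 2}"
  then obtain t where t: "x = polar r t" "- (pi / 2) < t" "t < pi / 2" by auto
  have "(r * cos t)\<^sup>2 + (r * sin t)\<^sup>2 = r\<^sup>2 * ((cos t)\<^sup>2 + (sin t)\<^sup>2)"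
    by (simp only: power_mult_distrib distrib_left)
  then have "(r * cos t)\<^sup>2 + (r * sin t)\<^sup>2 = r\<^sup>2" by simp
  then show "x \<in> half_circle r"
    using r t by (auto simp: half_circle_def polar_def norm_prod_def cos_gt_zero_pi)
qed

lemma borel_measurable_ang [measurable]: "ang \<in> borel_measurable borel"
proof -
  have [measurable]: "fst \<in> borel_measurable (borel :: plane measure)" "snd \<in> borel_measurable (borel :: plane measure)"
    by (intro borel_measurable_continuous_onI continuous_intros)+
  have "arctan \<in> borel_measurable borel" by (intro borel_measurable_continuous_onI continuous_intros)
  then show ?thesis unfolding ang_def[abs_def] by measurable
qed

lemma borel_measurable_polar [measurable]: "polar r \<in> borel_measurable borel"
  unfolding polar_def[abs_def] by (intro borel_measurable_continuous_onI continuous_intros)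

lemma half_circle_borel [measurable]: "half_circle r \<in> sets borel"
proof -
  have "half_circle r = {x. fst x > 0} \<inter> {x. norm x = r}" by (auto simp: half_circle_def)
  moreover have "open {x::plane. fst x > 0}" by (intro open_Collect_less continuous_intros)
  moreover have "closed {x::plane. norm x = r}" by (intro closed_Collect_eq continuous_intros)
  ultimately show ?thesis by (metis borel_closed borel_open sets.Int)
qed

lemma measurable_hausdorff1: "f \<in> borel_measurable borel \<Longrightarrow> f \<in> borel_measurable hausdorff1"
  using borel_subset_hausdorff1 by (auto simp: measurable_def)

text \<open>It suffices to compare the measures on half-lines, whose preimages are arcs ending at
  the angle \<open>pi / 2\<close>; the two bounds on arcs give their length.\<close>

lemma distr_ang_hausdorff1:
  assumes r: "r > 0"
  shows "distr (density hausdorff1 (indicator (half_circle r))) borel ang =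
    density lborel (\<lambda>\<theta>. ennreal (r * indicator {- (pi / 2)<..<pi / 2} \<theta>))" (is "?M = ?N")
proof (rule measure_eqI_lessThan)
  fix x :: real
  define a where "a = max x (- (pi / 2))"
  have [measurable]: "half_circle r \<in> sets hausdorff1" using borel_subset_hausdorff1 by auto
  have [measurable]: "ang \<in> borel_measurable hausdorff1" by (rule measurable_hausdorff1) simp
  have S: "half_circle r \<inter> ang -` {x<..} = polar r ` {a<..<pi / 2}"
    using r by (auto simp: half_circle_eq ang_polar a_def image_iff)
  have "emeasure ?M {x<..} = emeasure (density hausdorff1 (indicator (half_circle r))) (ang -` {x<..})"
    by (subst emeasure_distr) auto
  also have "\<dots> = (\<integral>\<^sup>+y. indicator (half_circle r) y * indicator (ang -` {x<..}) y \<partial>hausdorff1)"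
    using measurable_sets[of ang hausdorff1 borel "{x<..}"] by (subst emeasure_density) auto
  also have "\<dots> = (\<integral>\<^sup>+y. indicator (half_circle r \<inter> ang -` {x<..}) y \<partial>hausdorff1)"
    by (intro nn_integral_cong) (auto split: split_indicator)
  also have "\<dots> = emeasure hausdorff1 (half_circle r \<inter> ang -` {x<..})"
    using measurable_sets[of ang hausdorff1 borel "{x<..}"] by (intro nn_integral_indicator) auto
  also have "\<dots> = hausdorff1_outer (polar r ` {a<..<pi / 2})"
    using measurable_sets[of ang hausdorff1 borel "{x<..}"]
    by (subst emeasure_hausdorff1) (auto simp: S[symmetric])
  also have "\<dots> = ennreal (r * (pi / 2 - a)) * (if a < pi / 2 then 1 else 0)"
  proof (cases "a < pi / 2")
    case True
    have "hausdorff1_outer (polar r ` {a<..<pi / 2}) \<le> hausdorff1_outer (polar r ` {a..pi / 2})"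
      by (intro outer_mono image_mono) auto
    also have "\<dots> \<le> ennreal (r * (pi / 2 - a))" using True by (intro outer_polar_le r) auto
    finally show ?thesis
      using outer_polar_ge[OF r True] True by (auto intro!: antisym simp: a_def)
  qed simp
  finally have M: "emeasure ?M {x<..} = ennreal (r * (pi / 2 - a)) * (if a < pi / 2 then 1 else 0)" .
  then show "emeasure ?M {x<..} < \<infinity>" by (auto simp: ennreal_mult_less_top)
  have "emeasure ?N {x<..} = (\<integral>\<^sup>+\<theta>. ennreal (r * indicator {- (pi / 2)<..<pi / 2} \<theta>) * indicator {x<..} \<theta> \<partial>lborel)"
    by (subst emeasure_density) auto
  also have "\<dots> = (\<integral>\<^sup>+\<theta>. ennreal r * indicator {a<..<pi / 2} \<theta> \<partial>lborel)"
    by (intro nn_integral_cong) (auto simp: a_def split: split_indicator)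
  also have "\<dots> = ennreal r * emeasure lborel {a<..<pi / 2}"
    by (simp add: nn_integral_cmult_indicator)
  also have "\<dots> = ennreal (r * (pi / 2 - a)) * (if a < pi / 2 then 1 else 0)"
    using r by (auto simp: ennreal_mult')
  finally show "emeasure ?M {x<..} = emeasure ?N {x<..}" using M by simp
qed auto

lemma integral_half_circle:
  fixes G :: "plane \<Rightarrow> real"
  assumes r: "r > 0" and [measurable]: "G \<in> borel_measurable borel"
  shows "(LINT x:half_circle r|hausdorff1. G x) = (LINT \<theta>:{- (pi / 2)<..<pi / 2}|lborel. r * G (polar r \<theta>))"
proof -
  have [measurable]: "half_circle r \<in> sets hausdorff1" using borel_subset_hausdorff1 by auto
  have [measurable]: "ang \<in> borel_measurable hausdorff1" by (rule measurable_hausdorff1) simp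
  have "(LINT x:half_circle r|hausdorff1. G x) = (LINT x:half_circle r|hausdorff1. G (polar r (ang x)))"
    unfolding set_lebesgue_integral_def
    by (intro Bochner_Integration.integral_cong) (auto simp: polar_ang split: split_indicator)
  also have "\<dots> = (\<integral>x. G (polar r (ang x)) \<partial>density hausdorff1 (\<lambda>x. ennreal (indicator (half_circle r) x)))"
    unfolding set_lebesgue_integral_def by (subst integral_density) auto
  also have "\<dots> = (\<integral>x. G (polar r (ang x)) \<partial>density hausdorff1 (indicator (half_circle r)))"
    by (simp add: ennreal_indicator)
  also have "\<dots> = (\<integral>\<theta>. G (polar r \<theta>) \<partial>distr (density hausdorff1 (indicator (half_circle r))) borel ang)"
    by (subst integral_distr) auto
  also have "\<dots> = (\<integral>\<theta>. (r * indicator {- (pi / 2)<..<pi / 2} \<theta>) *\<^sub>R G (polar r \<theta>) \<partial>lborel)"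
    unfolding distr_ang_hausdorff1[OF r] using r by (subst integral_density) auto
  also have "\<dots> = (LINT \<theta>:{- (pi / 2)<..<pi / 2}|lborel. r * G (polar r \<theta>))"
    unfolding set_lebesgue_integral_def by (intro Bochner_Integration.integral_cong) auto
  finally show ?thesis .
qed

lemma emeasure_half_circle_borel:
  assumes r: "r > 0" and N [measurable]: "N \<in> sets borel"
  shows "emeasure hausdorff1 (half_circle r \<inter> N) =
    (\<integral>\<^sup>+\<theta>. ennreal r * indicator {- (pi / 2)<..<pi / 2} \<theta> * indicator N (polar r \<theta>) \<partial>lborel)"
proof -
  have [measurable]: "half_circle r \<in> sets hausdorff1" "N \<in> sets hausdorff1"
    using borel_subset_hausdorff1 N by auto
  have [measurable]: "ang \<in> borel_measurable hausdorff1" by (rule measurable_hausdorff1) simp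
  have "emeasure hausdorff1 (half_circle r \<inter> N) = (\<integral>\<^sup>+x. indicator (half_circle r \<inter> N) x \<partial>hausdorff1)"
    by (intro nn_integral_indicator[symmetric]) auto
  also have "\<dots> = (\<integral>\<^sup>+x. indicator (half_circle r) x * indicator N (polar r (ang x)) \<partial>hausdorff1)"
    by (intro nn_integral_cong) (auto simp: polar_ang split: split_indicator)
  also have "\<dots> = (\<integral>\<^sup>+x. indicator N (polar r (ang x)) \<partial>density hausdorff1 (indicator (half_circle r)))"
    by (subst nn_integral_density) auto
  also have "\<dots> = (\<integral>\<^sup>+\<theta>. indicator N (polar r \<theta>) \<partial>distr (density hausdorff1 (indicator (half_circle r))) borel ang)"
    by (subst nn_integral_distr) auto
  also have "\<dots> = (\<integral>\<^sup>+\<theta>. ennreal (r * indicator {- (pi / 2)<..<pi / 2} \<theta>) * indicator N (polar r \<theta>) \<partial>lborel)"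
    unfolding distr_ang_hausdorff1[OF r] by (subst nn_integral_density) auto
  also have "\<dots> = (\<integral>\<^sup>+\<theta>. ennreal r * indicator {- (pi / 2)<..<pi / 2} \<theta> * indicator N (polar r \<theta>) \<partial>lborel)"
    by (intro nn_integral_cong) (auto split: split_indicator)
  finally show ?thesis .
qed

text \<open>\<open>f\<close> need not be Borel. The sigma-algebra of \<open>hausdorff1\<close>
  contains all subsets of null sets, so agreement with a Borel \<open>G\<close> off a null part of
  the arc makes \<open>f\<close> measurable on the arc.\<close>

lemma integral_half_circle_cong:
  fixes f G :: "plane \<Rightarrow> real"
  assumes G: "G \<in> borel_measurable borel" and N: "N \<in> sets borel"
    and null: "emeasure hausdorff1 (half_circle r \<inter> N) = 0"
    and eq: "\<And>x. x \<in> half_circle r \<Longrightarrow> x \<notin> N \<Longrightarrow> f x = G x"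
  shows "(LINT x:half_circle r|hausdorff1. f x) = (LINT x:half_circle r|hausdorff1. G x)"
proof -
  let ?N = "half_circle r \<inter> N"
  have H: "half_circle r \<in> sets hausdorff1" "?N \<in> sets hausdorff1"
    using borel_subset_hausdorff1 N by auto
  have o0: "hausdorff1_outer ?N = 0" using null emeasure_hausdorff1[OF H(2)] by simp
  have sub: "A \<in> sets hausdorff1" if "A \<subseteq> ?N" for A
    using hausdorff1_null[of A] outer_mono[OF that] o0 by auto
  define F where "F x = indicator (half_circle r) x *\<^sub>R f x" for x
  define G' where "G' x = indicator (half_circle r) x *\<^sub>R G x" for x
  have mG: "G' \<in> borel_measurable hausdorff1"
    unfolding G'_def
    by (intro borel_measurable_scaleR borel_measurable_indicator H(1) measurable_hausdorff1[OF G])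
  have FG: "F x = G' x" if "x \<notin> ?N" for x using that eq by (auto simp: F_def G'_def split: split_indicator)
  have "F \<in> borel_measurable hausdorff1"
  proof (rule measurableI)
    fix A :: "real set" assume A: "A \<in> sets borel"
    have eqA: "F -` A \<inter> space hausdorff1 = (G' -` A - ?N) \<union> (F -` A \<inter> ?N)" using FG by auto
    have "G' -` A \<in> sets hausdorff1" using measurable_sets[OF mG A] by simp
    then have "G' -` A - ?N \<in> sets hausdorff1" by (rule sets.Diff) (rule H(2))
    moreover have "F -` A \<inter> ?N \<in> sets hausdorff1" by (rule sub) auto
    ultimately show "F -` A \<inter> space hausdorff1 \<in> sets hausdorff1"
      unfolding eqA by (rule sets.Un)
  qed auto
  moreover have "AE x in hausdorff1. F x = G' x"
    using FG o0 by (intro AE_I'[OF hausdorff1_null[OF o0]]) auto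
  ultimately have "integral\<^sup>L hausdorff1 F = integral\<^sup>L hausdorff1 G'" using mG by (intro integral_cong_AE)
  then show ?thesis unfolding set_lebesgue_integral_def F_def[abs_def] G'_def[abs_def] .
qed

section \<open>Polar coordinates in the half-plane\<close>

abbreviation half_space :: "plane set" where "half_space \<equiv> {x. fst x > 0}"
abbreviation angles :: "real set" where "angles \<equiv> {- (pi / 2)<..<pi / 2}"

lemma borel_measurable_polar_pair [measurable]: "(\<lambda>x. polar (fst x) (snd x)) \<in> borel_measurable (borel \<Otimes>\<^sub>M borel)"
  unfolding polar_def by (simp add: borel_prod) (intro borel_measurable_continuous_onI continuous_intros)

lemma borel_measurable_tan [measurable]: "tan \<in> borel_measurable (borel :: real measure)"
  unfolding tan_def[abs_def]
  by (intro borel_measurable_divide borel_measurable_continuous_onI continuous_intros)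

text \<open>The substitution \<open>x_2 = c * tan \<theta>\<close> on the vertical line
  \<open>x_1 = c\<close>, put as an equality of measures.\<close>

lemma lborel_eq_distr_tan:
  assumes c: "c > 0"
  shows "lborel = distr (density lborel (\<lambda>\<theta>. ennreal (c / (cos \<theta>)\<^sup>2 * indicator angles \<theta>))) borel (\<lambda>\<theta>. c * tan \<theta>)"
    (is "lborel = ?M")
proof (rule lborel_eqI)
  fix l u :: real assume lu: "\<And>b. b \<in> Basis \<Longrightarrow> l \<bullet> b \<le> u \<bullet> b"
  then have lu: "l \<le> u" by simp
  define a b where "a = arctan (l / c)" and "b = arctan (u / c)"
  have ab: "a \<le> b" "- (pi / 2) < a" "b < pi / 2"
    using lu c arctan_bounded by (auto simp: a_def b_def arctan_le_iff divide_right_mono)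
  have [measurable]: "(\<lambda>\<theta>. c * tan \<theta>) -` {l<..<u} \<in> sets borel"
    using measurable_sets_borel[of "\<lambda>\<theta>. c * tan \<theta>" borel "{l<..<u}"] by measurable
  have "emeasure ?M (box l u) = (\<integral>\<^sup>+\<theta>. ennreal (c / (cos \<theta>)\<^sup>2 * indicator angles \<theta>) * indicator {l<..<u} (c * tan \<theta>) \<partial>lborel)"
    by (subst emeasure_distr, simp, simp, subst emeasure_density)
       (auto intro!: nn_integral_cong simp: box_real split: split_indicator)
  also have "\<dots> = (\<integral>\<^sup>+\<theta>. ennreal (c / (cos \<theta>)\<^sup>2) * indicator {a<..<b} \<theta> \<partial>lborel)"
  proof (rule nn_integral_cong)
    fix \<theta> :: real
    have "l < c * tan \<theta> \<longleftrightarrow> a < \<theta>" "c * tan \<theta> < u \<longleftrightarrow> \<theta> < b" if "\<theta> \<in> angles"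
    proof -
      have "l < c * tan \<theta> \<longleftrightarrow> l / c < tan \<theta>" "c * tan \<theta> < u \<longleftrightarrow> tan \<theta> < u / c"
        using c by (auto simp: field_simps)
      moreover have "l / c < tan \<theta> \<longleftrightarrow> a < arctan (tan \<theta>)" "tan \<theta> < u / c \<longleftrightarrow> arctan (tan \<theta>) < b"
        by (auto simp: a_def b_def arctan_less_iff)
      ultimately show "l < c * tan \<theta> \<longleftrightarrow> a < \<theta>" "c * tan \<theta> < u \<longleftrightarrow> \<theta> < b"
        using that by (auto simp: arctan_tan)
    qed
    then show "ennreal (c / (cos \<theta>)\<^sup>2 * indicator angles \<theta>) * indicator {l<..<u} (c * tan \<theta>) =
        ennreal (c / (cos \<theta>)\<^sup>2) * indicator {a<..<b} \<theta>"
      using ab by (auto split: split_indicator)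
  qed
  also have "\<dots> = (\<integral>\<^sup>+\<theta>. ennreal (c / (cos \<theta>)\<^sup>2) * indicator {a..b} \<theta> \<partial>lborel)"
    by (rule nn_integral_cong_AE)
       (use AE_lborel_singleton[of a] AE_lborel_singleton[of b] in \<open>eventually_elim, auto split: split_indicator\<close>)
  also have "\<dots> = ennreal (c * tan b - c * tan a)"
  proof -
    have D: "((\<lambda>x. c * tan x) has_real_derivative c / (cos x)\<^sup>2) (at x)" "0 \<le> c / (cos x)\<^sup>2"
      if x: "a \<le> x" "x \<le> b" for x
    proof -
      have "cos x > 0" using x ab by (intro cos_gt_zero_pi) auto
      then show "((\<lambda>x. c * tan x) has_real_derivative c / (cos x)\<^sup>2) (at x)" "0 \<le> c / (cos x)\<^sup>2"
        using c by (auto intro!: derivative_eq_intros simp: field_simps)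
    qed
    show ?thesis
      by (rule nn_integral_FTC_Icc) (use ab in \<open>auto intro: D has_field_derivative_at_within\<close>)
  qed
  also have "c * tan b - c * tan a = u - l" using c by (simp add: a_def b_def tan_arctan)
  finally show "emeasure ?M (box l u) = ennreal (\<Prod>b\<in>Basis. (u - l) \<bullet> b)" by simp
qed simp

lemma nn_integral_tan:
  assumes c: "c > 0" and [measurable]: "f \<in> borel_measurable borel"
  shows "(\<integral>\<^sup>+y. f y \<partial>lborel) = (\<integral>\<^sup>+\<theta>. ennreal (c / (cos \<theta>)\<^sup>2 * indicator angles \<theta>) * f (c * tan \<theta>) \<partial>lborel)"
proof -
  show ?thesis
    by (subst lborel_eq_distr_tan[OF c]) (simp add: nn_integral_distr nn_integral_density)
qed

text \<open>Polar coordinates from two one-dimensional substitutions: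
  \<open>x_2 = x_1 tan \<theta>\<close> on each vertical line and then, after exchanging the
  integrals, \<open>x_1 = \<rho> cos \<theta>\<close> for each angle. The densities
  \<open>x_1 / cos^2 \<theta>\<close> and \<open>cos \<theta>\<close> multiply to
  \<open>\<rho>\<close>.\<close>

lemma nn_integral_polar:
  assumes [measurable]: "f \<in> borel_measurable (borel :: plane measure)"
  shows "(\<integral>\<^sup>+x. f x * indicator half_space x \<partial>lborel) =
    (\<integral>\<^sup>+\<rho>. \<integral>\<^sup>+\<theta>. ennreal (\<rho> * indicator {0<..} \<rho> * indicator angles \<theta>) * f (polar \<rho> \<theta>) \<partial>lborel \<partial>lborel)"
proof -
  have [measurable]: "f \<in> borel_measurable (borel \<Otimes>\<^sub>M borel)" using assms by (simp add: borel_prod)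
  have [measurable]: "indicator half_space \<in> borel_measurable (borel :: plane measure)"
    by (intro borel_measurable_indicator borel_open open_Collect_less continuous_intros)
  define g where "g x \<theta> = ennreal (x / (cos \<theta>)\<^sup>2 * indicator angles \<theta>) * (f (x, x * tan \<theta>) * indicator {0<..} x)" for x \<theta>
  have [measurable]: "(\<lambda>x. g (fst x) (snd x)) \<in> borel_measurable (borel \<Otimes>\<^sub>M borel)"
    unfolding g_def by measurable
  have "(\<integral>\<^sup>+x. f x * indicator half_space x \<partial>lborel) =
      (\<integral>\<^sup>+x1. \<integral>\<^sup>+x2. f (x1, x2) * indicator half_space (x1, x2) \<partial>lborel \<partial>lborel)"
    by (subst lborel_prod[symmetric], subst lborel.nn_integral_fst[symmetric]) (auto simp: borel_prod)
  also have "\<dots> = (\<integral>\<^sup>+x1. \<integral>\<^sup>+\<theta>. g x1 \<theta> \<partial>lborel \<partial>lborel)"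
  proof (rule nn_integral_cong)
    fix x1 :: real
    show "(\<integral>\<^sup>+x2. f (x1, x2) * indicator half_space (x1, x2) \<partial>lborel) = (\<integral>\<^sup>+\<theta>. g x1 \<theta> \<partial>lborel)"
    proof (cases "x1 > 0")
      case True
      have "(\<integral>\<^sup>+x2. f (x1, x2) \<partial>lborel) = (\<integral>\<^sup>+\<theta>. ennreal (x1 / (cos \<theta>)\<^sup>2 * indicator angles \<theta>) * f (x1, x1 * tan \<theta>) \<partial>lborel)"
        by (rule nn_integral_tan[OF True]) measurable
      then show ?thesis using True by (simp add: g_def)
    qed (simp add: g_def)
  qed
  also have "\<dots> = (\<integral>\<^sup>+\<theta>. \<integral>\<^sup>+x1. g x1 \<theta> \<partial>lborel \<partial>lborel)"
    using lborel_pair.Fubini[of "\<lambda>x. g (fst x) (snd x)"] by simp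
  also have "\<dots> = (\<integral>\<^sup>+\<theta>. \<integral>\<^sup>+\<rho>. ennreal (\<rho> * indicator {0<..} \<rho> * indicator angles \<theta>) * f (polar \<rho> \<theta>) \<partial>lborel \<partial>lborel)"
  proof (rule nn_integral_cong)
    fix \<theta> :: real
    show "(\<integral>\<^sup>+x1. g x1 \<theta> \<partial>lborel) =
        (\<integral>\<^sup>+\<rho>. ennreal (\<rho> * indicator {0<..} \<rho> * indicator angles \<theta>) * f (polar \<rho> \<theta>) \<partial>lborel)"
    proof (cases "\<theta> \<in> angles")
      case True
      then have c: "cos \<theta> > 0" by (intro cos_gt_zero_pi) auto
      have m: "(\<lambda>x1. g x1 \<theta>) \<in> borel_measurable borel" unfolding g_def by measurable
      have "(\<integral>\<^sup>+x1. g x1 \<theta> \<partial>lborel) = ennreal (cos \<theta>) * (\<integral>\<^sup>+\<rho>. g (cos \<theta> * \<rho>) \<theta> \<partial>lborel)"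
        using nn_integral_real_affine[OF m, of "cos \<theta>" 0] c by simp
      also have "\<dots> = (\<integral>\<^sup>+\<rho>. ennreal (cos \<theta>) * g (cos \<theta> * \<rho>) \<theta> \<partial>lborel)"
        unfolding g_def by (rule nn_integral_cmult[symmetric]) measurable
      also have "\<dots> = (\<integral>\<^sup>+\<rho>. ennreal (\<rho> * indicator {0<..} \<rho> * indicator angles \<theta>) * f (polar \<rho> \<theta>) \<partial>lborel)"
      proof (intro nn_integral_cong)
        fix \<rho> :: real
        show "ennreal (cos \<theta>) * g (cos \<theta> * \<rho>) \<theta> =
            ennreal (\<rho> * indicator {0<..} \<rho> * indicator angles \<theta>) * f (polar \<rho> \<theta>)"
        proof (cases "\<rho> > 0")
          case \<rho>: True
          have "ennreal (cos \<theta>) * g (cos \<theta> * \<rho>) \<theta> =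
              ennreal (cos \<theta>) * ennreal (cos \<theta> * \<rho> / (cos \<theta>)\<^sup>2) * f (cos \<theta> * \<rho>, cos \<theta> * \<rho> * tan \<theta>)"
            using True \<rho> c by (simp add: g_def mult.assoc)
          also have "ennreal (cos \<theta>) * ennreal (cos \<theta> * \<rho> / (cos \<theta>)\<^sup>2) = ennreal \<rho>"
            using c \<rho> by (simp add: ennreal_mult[symmetric] power2_eq_square)
          also have "(cos \<theta> * \<rho>, cos \<theta> * \<rho> * tan \<theta>) = polar \<rho> \<theta>"
            using c by (simp add: polar_def tan_def)
          finally show ?thesis using True \<rho> by simp
        qed (use c in \<open>auto simp: g_def zero_less_mult_iff split: split_indicator\<close>)
      qed
      finally show ?thesis .
    qed (auto simp: g_def)
  qed
  also have "\<dots> = (\<integral>\<^sup>+\<rho>. \<integral>\<^sup>+\<theta>. ennreal (\<rho> * indicator {0<..} \<rho> * indicator angles \<theta>) * f (polar \<rho> \<theta>) \<partial>lborel \<partial>lborel)"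
    using lborel_pair.Fubini[of "\<lambda>x. ennreal (fst x * indicator {0<..} (fst x) * indicator angles (snd x)) * f (polar (fst x) (snd x))"]
    by simp
  finally show ?thesis .
qed

definition circ :: "(plane \<Rightarrow> real) \<Rightarrow> real \<Rightarrow> real" where
  "circ f \<rho> = (LINT \<theta>:angles|lborel. \<rho> * f (polar \<rho> \<theta>))"

lemma half_space_borel [measurable]: "half_space \<in> sets borel"
  by (intro borel_open open_Collect_less continuous_intros)

text \<open>The nonnegative case says that two measures on the plane agree; integrability and the
  value for signed \<open>f\<close> pass through this equality.\<close>

lemma integral_polar:
  fixes f :: "plane \<Rightarrow> real"
  assumes [measurable]: "f \<in> borel_measurable borel" and int: "set_integrable lborel half_space f"
  shows "integrable lborel (\<lambda>\<rho>. indicator {0<..} \<rho> * circ f \<rho>)"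
    and "(LINT x:half_space|lborel. f x) = (\<integral>\<rho>. indicator {0<..} \<rho> * circ f \<rho> \<partial>lborel)"
proof -
  define w where "w x = fst x * indicator {0<..} (fst x) * indicator angles (snd x)" for x :: plane
  define A where "A x = polar (fst x) (snd x)" for x :: plane
  have w0: "w x \<ge> 0" for x by (auto simp: w_def split: split_indicator)
  have [measurable]: "A \<in> borel_measurable (lborel \<Otimes>\<^sub>M lborel)" "w \<in> borel_measurable (lborel \<Otimes>\<^sub>M lborel)"
    unfolding A_def w_def by measurable
  have eq: "distr (density (lborel \<Otimes>\<^sub>M lborel) (\<lambda>x. ennreal (w x))) borel A =
      density lborel (\<lambda>x. ennreal (indicator half_space x))" (is "?M = ?N")
  proof (rule measure_eqI)
    fix E assume "E \<in> sets ?M"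
    then have [measurable]: "E \<in> sets borel" by simp
    have "emeasure ?M E = (\<integral>\<^sup>+x. ennreal (w x) * indicator E (A x) \<partial>(lborel \<Otimes>\<^sub>M lborel))"
      by (subst nn_integral_indicator[symmetric], simp, subst nn_integral_distr, simp, simp, subst nn_integral_density) auto
    also have "\<dots> = (\<integral>\<^sup>+\<rho>. \<integral>\<^sup>+\<theta>. ennreal (w (\<rho>, \<theta>)) * indicator E (A (\<rho>, \<theta>)) \<partial>lborel \<partial>lborel)"
      by (rule lborel.nn_integral_fst[symmetric]) measurable
    also have "\<dots> = (\<integral>\<^sup>+x. indicator E x * indicator half_space x \<partial>lborel)"
      by (subst nn_integral_polar) (auto simp: w_def A_def)
    also have "\<dots> = emeasure ?N E"
      by (subst emeasure_density) (auto intro!: nn_integral_cong split: split_indicator)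
    finally show "emeasure ?M E = emeasure ?N E" .
  qed simp
  have ind: "integrable ?N f"
    using int unfolding set_integrable_def by (subst integrable_density) auto
  then have "integrable ?M f" unfolding eq .
  then have I: "integrable (lborel \<Otimes>\<^sub>M lborel) (\<lambda>x. w x * f (A x))"
    using w0 by (simp add: integrable_distr_eq integrable_density)
  have inner: "(\<integral>\<theta>. w (\<rho>, \<theta>) * f (A (\<rho>, \<theta>)) \<partial>lborel) = indicator {0<..} \<rho> * circ f \<rho>" for \<rho>
    unfolding circ_def set_lebesgue_integral_def
    by (subst integral_mult_right_zero[symmetric])
       (auto simp: w_def A_def intro!: Bochner_Integration.integral_cong split: split_indicator)
  show "integrable lborel (\<lambda>\<rho>. indicator {0<..} \<rho> * circ f \<rho>)"
    using lborel_pair.integrable_fst'[OF I] by (simp add: inner)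
  have "(LINT x:half_space|lborel. f x) = integral\<^sup>L ?N f"
    unfolding set_lebesgue_integral_def by (subst integral_density) auto
  also have "\<dots> = integral\<^sup>L ?M f" unfolding eq ..
  also have "\<dots> = (\<integral>x. w x * f (A x) \<partial>(lborel \<Otimes>\<^sub>M lborel))"
    using w0 by (simp add: integral_distr integral_density)
  also have "\<dots> = (\<integral>\<rho>. \<integral>\<theta>. w (\<rho>, \<theta>) * f (A (\<rho>, \<theta>)) \<partial>lborel \<partial>lborel)"
    by (rule lborel_pair.integral_fst'[OF I, symmetric])
  finally show "(LINT x:half_space|lborel. f x) = (\<integral>\<rho>. indicator {0<..} \<rho> * circ f \<rho> \<partial>lborel)"
    by (simp add: inner)
qed

lemma circ_eq: "r > 0 \<Longrightarrow> f \<in> borel_measurable borel \<Longrightarrow> (LINT x:half_circle r|hausdorff1. f x) = circ f r"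
  unfolding circ_def by (rule integral_half_circle)

lemma norm_polar: "r > 0 \<Longrightarrow> norm (polar r \<theta>) = r"
  using real_sqrt_abs[of r] by (simp add: polar_def norm_prod_def power_mult_distrib flip: distrib_left)

text \<open>In polar coordinates the disc integral is an indefinite integral of arc integrals, so
  Lebesgue differentiation applies in the radius.\<close>

lemma AE_has_derivative_half_disc:
  fixes f :: "plane \<Rightarrow> real"
  assumes [measurable]: "f \<in> borel_measurable borel" and int: "set_integrable lborel half_space f"
  shows "AE r in lborel. r > 0 \<longrightarrow>
    ((\<lambda>r. LINT x:half_disc r|lborel. f x) has_real_derivative circ f r) (at r)"
proof -
  define C where "C \<rho> = indicator {0<..} \<rho> * circ f \<rho>" for \<rho>
  have iC: "integrable lborel C" unfolding C_def by (rule integral_polar) fact+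
  have eq: "(LINT x:half_disc r|lborel. f x) = (LINT s:{0..r}|lborel. C s)" if r: "r > 0" for r
  proof -
    define G where "G x = indicator (ball 0 r) x * f x" for x
    have [measurable]: "G \<in> borel_measurable borel" unfolding G_def
      by (intro borel_measurable_times borel_measurable_indicator borel_open open_ball assms(1))
    have "set_integrable lborel half_space G"
    proof -
      have "integrable lborel (\<lambda>x. indicator (ball 0 r) x *\<^sub>R (indicator half_space x *\<^sub>R f x))"
        by (rule integrable_mult_indicator) (use int in \<open>auto simp: set_integrable_def\<close>)
      then show ?thesis by (simp add: set_integrable_def G_def mult.left_commute)
    qed
    from integral_polar(2)[OF _ this]
    have "(LINT x:half_space|lborel. G x) = (\<integral>\<rho>. indicator {0<..} \<rho> * circ G \<rho> \<partial>lborel)" by simp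
    moreover have "(LINT x:half_space|lborel. G x) = (LINT x:half_disc r|lborel. f x)"
      unfolding set_lebesgue_integral_def G_def half_disc_def
      by (intro Bochner_Integration.integral_cong) (auto split: split_indicator)
    moreover have "indicator {0<..} \<rho> * circ G \<rho> = indicator {..<r} \<rho> * C \<rho>" for \<rho>
      by (cases "\<rho> > 0"; cases "\<rho> < r")
        (auto simp: C_def circ_def G_def norm_polar intro!: set_lebesgue_integral_cong)
    moreover have "(\<integral>\<rho>. indicator {..<r} \<rho> * C \<rho> \<partial>lborel) = (LINT s:{0..r}|lborel. C s)"
      unfolding set_lebesgue_integral_def
    proof (rule integral_cong_AE)
      have [measurable]: "C \<in> borel_measurable lborel" using iC by simp
      show "(\<lambda>\<rho>. indicator {..<r} \<rho> * C \<rho>) \<in> borel_measurable lborel"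
        "(\<lambda>\<rho>. indicator {0..r} \<rho> *\<^sub>R C \<rho>) \<in> borel_measurable lborel" by measurable
      have "C \<rho> = 0" if "\<rho> < 0" for \<rho> using that by (simp add: C_def)
      then have "\<rho> \<noteq> r \<Longrightarrow> indicator {..<r} \<rho> * C \<rho> = indicator {0..r} \<rho> *\<^sub>R C \<rho>" for \<rho>
        by (auto simp: not_le split: split_indicator)
      with AE_lborel_singleton[of r]
      show "AE \<rho> in lborel. indicator {..<r} \<rho> * C \<rho> = indicator {0..r} \<rho> *\<^sub>R C \<rho>"
        by (rule eventually_mono)
    qed
    ultimately show ?thesis by simp
  qed
  from AE_has_derivative_indefinite_integral[OF iC] show ?thesis
  proof eventually_elim
    case (elim r)
    show ?case
    proof
      assume r: "r > 0"
      then have "((\<lambda>r. LINT s:{0..r}|lborel. C s) has_real_derivative C r) (at r)" using elim by simp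
      then have "((\<lambda>r. LINT x:half_disc r|lborel. f x) has_real_derivative C r) (at r)"
        by (rule has_field_derivative_transform_within_open[of _ _ _ "{0<..}"]) (use r eq in auto)
      then show "((\<lambda>r. LINT x:half_disc r|lborel. f x) has_real_derivative circ f r) (at r)"
        using r by (simp add: C_def)
    qed
  qed
qed

text \<open>Polar coordinates for the indicator of \<open>N\<close>: the arc measures integrate to
  \<open>0\<close>, hence vanish for almost every radius.\<close>

lemma AE_half_circle_null:
  assumes N: "N \<in> null_sets (lborel :: plane measure)"
  shows "AE r in lborel. r > 0 \<longrightarrow> emeasure hausdorff1 (half_circle r \<inter> N) = 0"
proof -
  have [measurable]: "N \<in> sets borel" using N by auto
  have "(\<integral>\<^sup>+x. indicator N x * indicator half_space x \<partial>lborel) \<le> (\<integral>\<^sup>+x. indicator N x \<partial>lborel)"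
    by (intro nn_integral_mono) (auto split: split_indicator)
  also have "\<dots> = 0" using N by (simp add: null_setsD1)
  finally have "(\<integral>\<^sup>+\<rho>. \<integral>\<^sup>+\<theta>. ennreal (\<rho> * indicator {0<..} \<rho> * indicator angles \<theta>) * indicator N (polar \<rho> \<theta>) \<partial>lborel \<partial>lborel) = 0"
    by (simp add: nn_integral_polar)
  moreover have "(\<lambda>\<rho>. \<integral>\<^sup>+\<theta>. ennreal (\<rho> * indicator {0<..} \<rho> * indicator angles \<theta>) * indicator N (polar \<rho> \<theta>) \<partial>lborel) \<in> borel_measurable lborel"
    using lborel.borel_measurable_nn_integral_fst[of "\<lambda>x. ennreal (fst x * indicator {0<..} (fst x) * indicator angles (snd x)) * indicator N (polar (fst x) (snd x))" lborel]
    by simp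
  ultimately have "AE \<rho> in lborel. (\<integral>\<^sup>+\<theta>. ennreal (\<rho> * indicator {0<..} \<rho> * indicator angles \<theta>) * indicator N (polar \<rho> \<theta>) \<partial>lborel) = 0"
    by (simp add: nn_integral_0_iff_AE)
  then show ?thesis
  proof eventually_elim
    case (elim r)
    show ?case
    proof
      assume r: "r > 0"
      have "emeasure hausdorff1 (half_circle r \<inter> N) =
          (\<integral>\<^sup>+\<theta>. ennreal r * indicator angles \<theta> * indicator N (polar r \<theta>) \<partial>lborel)"
        by (rule emeasure_half_circle_borel[OF r]) simp
      also have "\<dots> = (\<integral>\<^sup>+\<theta>. ennreal (r * indicator {0<..} r * indicator angles \<theta>) * indicator N (polar r \<theta>) \<partial>lborel)"
        using r by (intro nn_integral_cong) (auto split: split_indicator)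
      finally show "emeasure hausdorff1 (half_circle r \<inter> N) = 0" using elim by simp
    qed
  qed
qed

section \<open>Functions of compact support\<close>

text \<open>Off \<open>K\<close> the function is locally \<open>0\<close>, so uniqueness of
  derivatives makes \<open>f'\<close> vanish on \<open>P - K\<close>. The open sets \<open>P\<close>
  and \<open>- K\<close> cover the space, which glues the two descriptions of the
  derivative.\<close>

lemma C1_extend:
  fixes f :: "'a::euclidean_space \<Rightarrow> 'b::real_normed_vector"
  assumes P: "open P" and "\<forall>x\<in>P. (f has_derivative f' x) (at x)"
    and cont: "\<And>v. continuous_on P (\<lambda>x. f' x v)"
    and K: "compact K" "K \<subseteq> P" and "\<forall>x. x \<notin> K \<longrightarrow> f x = 0"
  shows "\<And>x. (f has_derivative (\<lambda>v. if x \<in> K then f' x v else 0)) (at x)"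
    and "\<And>v. continuous_on UNIV (\<lambda>x. if x \<in> K then f' x v else 0)"
    and "\<And>x v. x \<in> P - K \<Longrightarrow> f' x v = 0"
proof -
  have der: "\<And>x. x \<in> P \<Longrightarrow> (f has_derivative f' x) (at x)" and zero: "\<And>x. x \<notin> K \<Longrightarrow> f x = 0"
    using assms by auto
  have opK: "open (- K)" using K by (simp add: compact_imp_closed open_Compl)
  have der0: "(f has_derivative (\<lambda>v. 0)) (at x)" if "x \<notin> K" for x
    by (rule has_derivative_transform_within_open[OF has_derivative_const opK]) (use that zero in auto)
  show f'0: "f' x v = 0" if "x \<in> P - K" for x v
    using has_derivative_unique[OF der[of x] der0[of x]] that by (simp add: fun_eq_iff)
  show "(f has_derivative (\<lambda>v. if x \<in> K then f' x v else 0)) (at x)" for x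
    using der[of x] der0[of x] K by (cases "x \<in> K") auto
  show "continuous_on UNIV (\<lambda>x. if x \<in> K then f' x v else 0)" for v
  proof -
    have "continuous_on P (\<lambda>x. if x \<in> K then f' x v else 0)"
      by (rule continuous_on_eq[OF cont[of v]]) (use f'0 in auto)
    moreover have "continuous_on (- K) (\<lambda>x. if x \<in> K then f' x v else 0)"
      by (rule continuous_on_eq[OF continuous_on_const[of _ 0]]) auto
    ultimately have "continuous_on (P \<union> - K) (\<lambda>x. if x \<in> K then f' x v else 0)"
      using P opK by (intro continuous_on_open_Un)
    moreover have "P \<union> - K = UNIV" using K by auto
    ultimately show ?thesis by simp
  qed
qed

lemma integrable_compact_support:
  fixes f :: "'a::euclidean_space \<Rightarrow> real"
  assumes "compact K" "continuous_on K f" "\<And>x. x \<notin> K \<Longrightarrow> f x = 0"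
  shows "integrable lborel f"
proof -
  have "integrable lborel (\<lambda>x. indicator K x *\<^sub>R f x)"
    using borel_integrable_compact[OF assms(1,2)] by (simp add: set_integrable_def)
  moreover have "(\<lambda>x. indicator K x *\<^sub>R f x) = f"
    using assms(3) by (auto simp: fun_eq_iff split: split_indicator)
  ultimately show ?thesis by simp
qed

text \<open>Fubini and the fundamental theorem of calculus on lines parallel to an axis; the ends of
  the segment \<open>[-R, R]\<close> lie outside the support.\<close>

lemma integral_partial_derivative_eq_0:
  fixes f :: "plane \<Rightarrow> real"
  assumes der: "\<And>x. (f has_derivative f' x) (at x)"
    and cont: "\<And>v. continuous_on UNIV (\<lambda>x. f' x v)"
    and K: "compact K" and "\<forall>x. x \<notin> K \<longrightarrow> f x = 0" "\<forall>x v. x \<notin> K \<longrightarrow> f' x v = 0"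
  shows "(\<integral>x. f' x (1, 0) \<partial>lborel) = 0" "(\<integral>x. f' x (0, 1) \<partial>lborel) = 0"
proof -
  have zero: "\<And>x. x \<notin> K \<Longrightarrow> f x = 0" "\<And>x v. x \<notin> K \<Longrightarrow> f' x v = 0"
    using assms(4,5) by blast+
  obtain R0 where R0: "\<And>x. x \<in> K \<Longrightarrow> norm x \<le> R0"
    using compact_imp_bounded[OF K] by (auto simp: bounded_iff)
  define R where "R = \<bar>R0\<bar> + 1"
  have R: "R > 0" "\<And>x. x \<in> K \<Longrightarrow> \<bar>fst x\<bar> < R \<and> \<bar>snd x\<bar> < R"
  proof -
    show "R > 0" by (simp add: R_def)
    fix x assume "x \<in> K"
    then show "\<bar>fst x\<bar> < R \<and> \<bar>snd x\<bar> < R"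
      using R0[of x] norm_fst_le[of "fst x" "snd x"] norm_snd_le[of "snd x" "fst x"] by (simp add: R_def)
  qed
  have int: "integrable (lborel \<Otimes>\<^sub>M lborel) (\<lambda>x. f' x v)" for v
    unfolding lborel_prod
    by (rule integrable_compact_support[OF K continuous_on_subset[OF cont]]) (auto simp: zero)
  have 1: "(\<integral>x. f' (x, y) (1, 0) \<partial>lborel) = 0" for y
  proof -
    have "(\<integral>x. f' (x, y) (1, 0) \<partial>lborel) = (\<integral>x. f' (x, y) (1, 0) * indicator {- R..R} x \<partial>lborel)"
    proof (rule Bochner_Integration.integral_cong[OF refl])
      fix x show "f' (x, y) (1, 0) = f' (x, y) (1, 0) * indicator {- R..R} x"
      proof (cases "x \<in> {- R..R}")
        case False
        then have "(x, y) \<notin> K" using R(2)[of "(x, y)"] by auto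
        then show ?thesis using False by (simp add: zero(2))
      qed simp
    qed
    also have "\<dots> = f (R, y) - f (- R, y)"
    proof (rule integral_FTC_Icc_real)
      show "((\<lambda>x. f (x, y)) has_real_derivative f' (x, y) (1, 0)) (at x)" for x
      proof -
        have *: "((\<lambda>x. (x, y)) has_derivative (\<lambda>v. (v, 0::real))) (at x)"
          by (intro has_derivative_Pair has_derivative_const has_derivative_ident)
        have "bounded_linear (f' (x, y))" using der has_derivative_bounded_linear by blast
        then have "f' (x, y) (v, 0) = f' (x, y) (1, 0) * v" for v
          using linear_scale[of "f' (x, y)" v "(1, 0)"] by (simp add: bounded_linear.linear)
        then have "(\<lambda>v. f' (x, y) (v, 0)) = (*) (f' (x, y) (1, 0))" by (rule ext)
        then show ?thesis
          using has_derivative_compose[OF * der] by (simp only: has_field_derivative_def)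
      qed
      show "isCont (\<lambda>x. f' (x, y) (1, 0)) x" for x
        using continuous_on_compose2[OF cont[of "(1, 0)"], of UNIV "\<lambda>x. (x, y)"]
        by (simp add: continuous_on_eq_continuous_at continuous_intros)
    qed (use R in auto)
    also have "\<dots> = 0"
    proof -
      have "(R, y) \<notin> K" "(- R, y) \<notin> K" using R(2)[of "(R, y)"] R(2)[of "(- R, y)"] by auto
      then show ?thesis by (simp add: zero(1))
    qed
    finally show ?thesis .
  qed
  have 2: "(\<integral>y. f' (x, y) (0, 1) \<partial>lborel) = 0" for x
  proof -
    have "(\<integral>y. f' (x, y) (0, 1) \<partial>lborel) = (\<integral>y. f' (x, y) (0, 1) * indicator {- R..R} y \<partial>lborel)"
    proof (rule Bochner_Integration.integral_cong[OF refl])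
      fix y show "f' (x, y) (0, 1) = f' (x, y) (0, 1) * indicator {- R..R} y"
      proof (cases "y \<in> {- R..R}")
        case False
        then have "(x, y) \<notin> K" using R(2)[of "(x, y)"] by auto
        then show ?thesis using False by (simp add: zero(2))
      qed simp
    qed
    also have "\<dots> = f (x, R) - f (x, - R)"
    proof (rule integral_FTC_Icc_real)
      show "((\<lambda>y. f (x, y)) has_real_derivative f' (x, y) (0, 1)) (at y)" for y
      proof -
        have *: "((\<lambda>y. (x, y)) has_derivative (\<lambda>v. (0::real, v))) (at y)"
          by (intro has_derivative_Pair has_derivative_const has_derivative_ident)
        have "bounded_linear (f' (x, y))" using der has_derivative_bounded_linear by blast
        then have "f' (x, y) (0, v) = f' (x, y) (0, 1) * v" for v
          using linear_scale[of "f' (x, y)" v "(0, 1)"] by (simp add: bounded_linear.linear)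
        then have "(\<lambda>v. f' (x, y) (0, v)) = (*) (f' (x, y) (0, 1))" by (rule ext)
        then show ?thesis
          using has_derivative_compose[OF * der] by (simp only: has_field_derivative_def)
      qed
      show "isCont (\<lambda>y. f' (x, y) (0, 1)) y" for y
        using continuous_on_compose2[OF cont[of "(0, 1)"], of UNIV "\<lambda>y. (x, y)"]
        by (simp add: continuous_on_eq_continuous_at continuous_intros)
    qed (use R in auto)
    also have "\<dots> = 0"
    proof -
      have "(x, R) \<notin> K" "(x, - R) \<notin> K" using R(2)[of "(x, R)"] R(2)[of "(x, - R)"] by auto
      then show ?thesis by (simp add: zero(1))
    qed
    finally show ?thesis .
  qed
  have "(\<integral>x. f' x (1, 0) \<partial>lborel) = (\<integral>y. \<integral>x. f' (x, y) (1, 0) \<partial>lborel \<partial>lborel)"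
  proof -
    have eq: "(\<lambda>(x, y). f' (x, y) (1, 0)) = (\<lambda>x. f' x (1, 0))" by (auto simp: fun_eq_iff)
    show ?thesis
      using lborel_pair.integral_snd[of "\<lambda>x y. f' (x, y) (1, 0)", unfolded eq, OF int, symmetric]
      by (simp only: lborel_prod)
  qed
  then show "(\<integral>x. f' x (1, 0) \<partial>lborel) = 0" by (simp add: 1)
  have "(\<integral>x. f' x (0, 1) \<partial>lborel) = (\<integral>x. \<integral>y. f' (x, y) (0, 1) \<partial>lborel \<partial>lborel)"
    using lborel_pair.integral_fst'[OF int[of "(0, 1)"]] by (simp add: lborel_prod)
  then show "(\<integral>x. f' x (0, 1) \<partial>lborel) = 0" by (simp add: 2)
qed

text \<open>Restriction to the half-plane turns derivatives into one-sided ones.\<close>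

lemma C1_0_of_UNIV:
  assumes der: "\<And>x. (f has_derivative f' x) (at x)"
    and cont: "\<And>v. continuous_on UNIV (\<lambda>x. f' x v)"
    and K: "compact K" "K \<subseteq> A" "\<And>x. x \<in> A - K \<Longrightarrow> f x = 0"
  shows "C1_0 A f f'"
  unfolding C1_0_def C1_on_def
  using assms by (meson continuous_on_subset has_derivative_at_withinI subset_UNIV)

section \<open>Local bounds\<close>

text \<open>\<open>f\<close> is not assumed measurable: agreement almost everywhere with a Borel
  function suffices, Lebesgue measure being complete. This spares measurability proofs for
  \<open>F_fun\<close>, \<open>lam\<close> and their derivatives.\<close>

lemma set_integral_cong_lborel:
  fixes f F :: "'a::euclidean_space \<Rightarrow> real"
  assumes F: "(\<lambda>x. indicator B x * F x) \<in> borel_measurable borel"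
    and eq: "AE x in lebesgue. indicator A x * f x = indicator B x * F x"
  shows "(LINT x:A|lebesgue. f x) = (\<integral>x. indicator B x * F x \<partial>lborel)"
proof -
  have F': "(\<lambda>x. indicator B x * F x) \<in> borel_measurable lebesgue"
    using F by (simp add: measurable_completion)
  have "(\<lambda>x. indicator A x * f x) \<in> borel_measurable lebesgue"
    by (rule borel_measurable_AE[OF F']) (use eq in \<open>auto elim: eventually_mono\<close>)
  then have "(LINT x:A|lebesgue. f x) = (\<integral>x. indicator B x * F x \<partial>lebesgue)"
    unfolding set_lebesgue_integral_def real_scaleR_def using F' eq by (intro integral_cong_AE)
  then show ?thesis using F by (simp add: integral_completion)
qed

lemma AE_in_open:
  fixes N :: "'a::euclidean_space set"
  assumes "open N" "N \<noteq> {}" "AE x in lebesgue. \<phi> x"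
  shows "\<exists>x\<in>N. \<phi> x"
proof (rule ccontr)
  assume no: "\<not> ?thesis"
  obtain Z where "{x. \<not> \<phi> x} \<subseteq> Z" "negligible Z"
    using assms(3) by (auto simp: eventually_ae_filter negligible_iff_null_sets)
  then have "negligible N" using no by (intro negligible_subset[of Z N]) auto
  then show False using open_not_negligible assms by blast
qed

lemma integrable_bounded_open:
  fixes f :: "'a::euclidean_space \<Rightarrow> real"
  assumes U: "open U" "bounded U" and f: "continuous_on U f" and B: "\<And>x. x \<in> U \<Longrightarrow> \<bar>f x\<bar> \<le> B"
  shows "(\<lambda>x. indicator U x * f x) \<in> borel_measurable borel"
    and "integrable lborel (\<lambda>x. indicator U x * f x)"
proof -
  show m: "(\<lambda>x. indicator U x * f x) \<in> borel_measurable borel"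
    using borel_measurable_continuous_on_indicator[OF borel_open[OF U(1)] f] by simp
  have "emeasure lborel U < \<infinity>" using emeasure_bounded_finite[OF U(2)] by simp
  then have "integrable lborel (\<lambda>x. \<bar>B\<bar> * indicator U x)"
    using U(1) by (intro integrable_mult_right integrable_real_indicator) auto
  then show "integrable lborel (\<lambda>x. indicator U x * f x)"
  proof (rule Bochner_Integration.integrable_bound)
    show "AE x in lborel. norm (indicator U x * f x) \<le> norm (\<bar>B\<bar> * indicator U x)"
    proof (rule AE_I2)
      fix x show "norm (indicator U x * f x) \<le> norm (\<bar>B\<bar> * indicator U x)"
        using B[of x] by (cases "x \<in> U") auto
    qed
  qed (use m in simp)
qed

text \<open>Here \<open>\<delta>\<close> is any radius whose closed half-disc lies in
  \<open>\<Omega>\<close>; the distance to the boundary enters only at the very end.\<close>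

locale solution_near_origin = subsonic_variational_solution g \<rho>0 \<alpha> p \<Omega> u Du
  for g \<rho>0 \<alpha> :: real and p :: "real \<Rightarrow> real" and \<Omega> :: "plane set"
    and u :: "plane \<Rightarrow> real" and Du :: "plane \<Rightarrow> plane" +
  fixes \<delta> :: real
  assumes \<delta>_pos: "\<delta> > 0" and disc_subset: "cball 0 \<delta> \<inter> half_plane \<subseteq> \<Omega>"
begin

abbreviation Ks :: "plane set" where "Ks \<equiv> cball 0 \<delta> \<inter> half_plane"

definition P :: "plane set" where "P = \<Omega> \<inter> pos_set u"

abbreviation t :: "plane \<Rightarrow> real" where "t \<equiv> tq Du"

abbreviation Hx :: "plane \<Rightarrow> real" where "Hx x \<equiv> H (t x) (snd x)"

lemma closed_half_plane: "closed half_plane"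
  unfolding half_plane_def by (intro closed_Collect_le continuous_intros)

lemma compact_Ks: "compact Ks"
  using closed_half_plane by (intro compact_Int_closed) auto

lemma Omega_half_plane: "x \<in> \<Omega> \<Longrightarrow> fst x \<ge> 0"
  using openin_subset[OF rel_open] by (auto simp: half_plane_def)

lemma P_fst: "x \<in> P \<Longrightarrow> fst x > 0"
  using zero_on_axis[of x] Omega_half_plane[of x] by (fastforce simp: P_def pos_set_def)

text \<open>\<open>P\<close> is open relative to the half-plane and misses the axis, where
  \<open>u = 0\<close>.\<close>

lemma open_P: "open P"
proof -
  have "openin (top_of_set \<Omega>) (\<Omega> \<inter> u -` {0<..})"
    using continuous by (simp add: continuous_openin_preimage_gen)
  then have "openin (top_of_set half_plane) (\<Omega> \<inter> u -` {0<..})"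
    using rel_open openin_trans by blast
  then obtain V where V: "open V" "\<Omega> \<inter> u -` {0<..} = half_plane \<inter> V"
    by (auto simp: openin_open)
  have "P = half_plane \<inter> V" using V(2) by (auto simp: P_def pos_set_def)
  then have "P = {x. fst x > 0} \<inter> V" using P_fst by (fastforce simp: half_plane_def)
  moreover have "open {x::plane. fst x > 0}" by (intro open_Collect_less continuous_intros)
  ultimately show ?thesis using V by auto
qed

text \<open>An open set inside \<open>x_2 \<ge> 0\<close> cannot touch
  \<open>x_2 = 0\<close>.\<close>

lemma P_snd: assumes "x \<in> P" shows "0 < snd x" "snd x < s_star g \<rho>0 p"
proof -
  obtain e where e: "e > 0" "ball x e \<subseteq> P" using open_P assms open_contains_ball by blast
  have "dist x (fst x, snd x - e / 2) = e / 2"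
    using e by (cases x) (simp add: dist_Pair_Pair dist_real_def)
  then have "(fst x, snd x - e / 2) \<in> P" using e by (intro subsetD[OF e(2)]) auto
  then have "snd x - e / 2 \<ge> 0" using support by (auto simp: P_def)
  then show "0 < snd x" using e by simp
  show "snd x < s_star g \<rho>0 p" using assms below_s_star by (auto simp: P_def)
qed

lemma P_in_S: "x \<in> P \<Longrightarrow> snd x \<in> S"
  using P_snd[of x] by (intro in_S) auto

lemma continuous_Du: "continuous_on P Du"
  using C2(2) unfolding P_def[symmetric] C1_on_def
  by (auto intro: has_derivative_continuous_on)

lemma continuous_t: "continuous_on P t"
  unfolding tq_def using P_fst by (intro continuous_intros continuous_Du) force

lemma t_nonneg: "t x \<ge> 0"
  by (simp add: tq_def)

lemma AE_in_D:
  assumes "compact K" "K \<subseteq> \<Omega> \<inter> upper"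
  shows "AE x in lebesgue. x \<in> K \<longrightarrow> (t x, snd x) \<in> D"
proof -
  obtain e where "AE x in lebesgue. x \<in> K \<longrightarrow>
           (\<exists>\<eta>. is_H g \<rho>0 p (t x) (snd x) \<eta>) \<and> H_fun g \<rho>0 p (t x) (snd x) - rho_cr g \<rho>0 p (snd x) \<ge> e"
    using subsonic[OF assms] by blast
  then show ?thesis
  proof eventually_elim
    case (elim x)
    show ?case
    proof
      assume x: "x \<in> K"
      then have "snd x \<in> S" using assms(2) below_s_star by (intro in_S) (auto simp: upper_def)
      then show "(t x, snd x) \<in> D" using elim x by (auto simp: in_D_iff)
    qed
  qed
qed

text \<open>Subsonicity is given almost everywhere, but \<open>t\<close> is continuous on
  \<open>P\<close> and the gap \<open>\<epsilon>\<close> survives the limit. If \<open>t x\<close>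
  exceeded \<open>T b (snd x)\<close>, where \<open>b\<close> is
  \<open>rho_cr + \<epsilon> / 2\<close>, the same would hold on an open set. That set contains a
  point with density at least \<open>b\<close>, where \<open>t\<close> is at most \<open>T b\<close>
  because \<open>T\<close> decreases.\<close>

lemma P_in_D:
  assumes x: "x \<in> P" shows "(t x, snd x) \<in> D"
proof -
  obtain e where e: "e > 0" "cball x e \<subseteq> P" using open_P x open_contains_cball by blast
  have sub: "cball x e \<subseteq> \<Omega> \<inter> upper"
  proof
    fix y assume "y \<in> cball x e"
    then have "y \<in> P" using e by blast
    then show "y \<in> \<Omega> \<inter> upper" using P_snd(1)[of y] by (simp add: P_def upper_def)
  qed
  obtain \<epsilon> where \<epsilon>: "\<epsilon> > 0" "AE y in lebesgue. y \<in> cball x e \<longrightarrow>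
           (\<exists>\<eta>. is_H g \<rho>0 p (t y) (snd y) \<eta>) \<and> Hx y - rho_cr g \<rho>0 p (snd y) \<ge> \<epsilon>"
    using subsonic[OF compact_cball sub] by blast
  have xS: "snd x \<in> S" using P_in_S x .
  define c b where "c = rho_cr g \<rho>0 p (snd x) - \<epsilon> / 2" and "b = rho_cr g \<rho>0 p (snd x) + \<epsilon> / 2"
  have b0: "b > 0" using Q_rho_cr(1)[OF xS] \<epsilon> by (simp add: b_def)
  have bV: "g * snd x < Q b" using rho_cr_less_iff[OF xS b0] \<epsilon> by (simp add: b_def)
  have "t x \<le> T b (snd x)"
  proof (rule ccontr)
    assume *: "\<not> ?thesis"
    \<comment> \<open>The last condition keeps \<open>rho_cr (snd y) \<ge> c\<close>, so that adding
      \<open>\<epsilon>\<close> gives at least \<open>b\<close>. It is guarded by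
      \<open>0 < c\<close> because \<open>Q\<close> is monotone on positive arguments only.\<close>
    define N where "N = {y \<in> ball x e. T b (snd y) < t y \<and> g * snd y < Q b \<and> (0 < c \<longrightarrow> Q c < g * snd y)}"
    have ct: "continuous_on (ball x e) t" using e by (intro continuous_on_subset[OF continuous_t]) auto
    have cT: "continuous_on (ball x e) (\<lambda>y. T b (snd y))" unfolding T_def by (intro continuous_intros) (use g_pos rho0_pos in auto)
    have o1: "open {y \<in> ball x e. T b (snd y) - t y < 0}"
    proof -
      have "open (ball x e \<inter> (\<lambda>y. T b (snd y) - t y) -` {..<0})"
        by (intro continuous_open_preimage continuous_on_diff ct cT) auto
      then show ?thesis by (simp add: vimage_def Int_def)
    qed
    have o2: "open {y::plane. g * snd y < Q b}" by (intro open_Collect_less continuous_intros)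
    have o3: "open {y::plane. 0 < c \<longrightarrow> Q c < g * snd y}"
      by (cases "0 < c") (auto intro!: open_Collect_less continuous_intros)
    have "N = {y \<in> ball x e. T b (snd y) - t y < 0} \<inter> {y. g * snd y < Q b} \<inter> {y. 0 < c \<longrightarrow> Q c < g * snd y}"
      by (auto simp: N_def)
    then have "open N" using o1 o2 o3 by (auto intro: open_Int)
    moreover have "x \<in> N"
      using * e bV \<epsilon> rho_cr_less_iff[OF xS, of c] Q_rho_cr[OF xS] Q_less[of c "rho_cr g \<rho>0 p (snd x)"]
      by (auto simp: N_def c_def)
    ultimately obtain y where y: "y \<in> N" "y \<in> cball x e \<longrightarrow>
           (\<exists>\<eta>. is_H g \<rho>0 p (t y) (snd y) \<eta>) \<and> Hx y - rho_cr g \<rho>0 p (snd y) \<ge> \<epsilon>"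
      using AE_in_open[OF _ _ \<epsilon>(2), of N] by blast
    then have yP: "y \<in> P" and yH: "\<exists>\<eta>. is_H g \<rho>0 p (t y) (snd y) \<eta>" "Hx y - rho_cr g \<rho>0 p (snd y) \<ge> \<epsilon>"
      using e by (auto simp: N_def)
    have yS: "snd y \<in> S" using P_in_S yP .
    have yD: "(t y, snd y) \<in> D" using yH yS by (simp add: in_D_iff)
    have "c \<le> rho_cr g \<rho>0 p (snd y)"
    proof (cases "0 < c")
      case True
      then have "Q c < Q (rho_cr g \<rho>0 p (snd y))" using y Q_rho_cr[OF yS] by (simp add: N_def)
      then show ?thesis using Q_less_iff[OF True Q_rho_cr(1)[OF yS]] by simp
    qed (use Q_rho_cr(1)[OF yS] in simp)
    then have "b \<le> Hx y" using yH by (simp add: b_def c_def)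
    moreover have "(b, snd y) \<in> V" using b0 yS y by (auto simp: V_def N_def)
    ultimately have "T (Hx y) (snd y) \<le> T b (snd y)" using T_less[of b "snd y" "Hx y"] by (cases "b = Hx y") auto
    then have "t y \<le> T b (snd y)" using H_in_V(2)[OF yD] by simp
    then show False using y by (simp add: N_def)
  qed
  moreover have "(T b (snd x), snd x) \<in> D" using b0 xS bV by (intro D_I) (simp add: V_def)
  ultimately show ?thesis using D_interval[OF zero_in_D[OF xS]] t_nonneg by blast
qed

lemma \<delta>_less: "\<delta> < s_star g \<rho>0 p"
proof -
  have "(0, \<delta>) \<in> Ks" using \<delta>_pos by (simp add: half_plane_def norm_prod_def)
  then have "(0, \<delta>) \<in> \<Omega>" by (rule subsetD[OF disc_subset])
  from subsetD[OF below_s_star this] show ?thesis by simp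
qed

lemma Ks_snd: "x \<in> Ks \<Longrightarrow> \<bar>snd x\<bar> \<le> \<delta>" and Ks_fst: "x \<in> Ks \<Longrightarrow> 0 \<le> fst x \<and> fst x \<le> \<delta>"
  using norm_snd_le[of "snd x" "fst x"] norm_fst_le[of "fst x" "snd x"] by (auto simp: half_plane_def)

text \<open>The constants of \<open>uniform_bounds\<close> for \<open>s1 = \<delta>\<close>, fixed
  once for the whole context; this definition and the next two project one and the same
  choice.\<close>

definition cH :: real where "cH = fst (SOME q. case q of (c, C, M) \<Rightarrow> 0 < c \<and> 0 < C \<and>
  (\<forall>t s. (t, s) \<in> D \<longrightarrow> 0 \<le> t \<longrightarrow> 0 \<le> s \<longrightarrow> s \<le> \<delta> \<longrightarrow> c \<le> H t s \<and> H t s \<le> C \<and> t \<le> M))"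
definition CH :: real where "CH = fst (snd (SOME q. case q of (c, C, M) \<Rightarrow> 0 < c \<and> 0 < C \<and>
  (\<forall>t s. (t, s) \<in> D \<longrightarrow> 0 \<le> t \<longrightarrow> 0 \<le> s \<longrightarrow> s \<le> \<delta> \<longrightarrow> c \<le> H t s \<and> H t s \<le> C \<and> t \<le> M)))"
definition Mt :: real where "Mt = snd (snd (SOME q. case q of (c, C, M) \<Rightarrow> 0 < c \<and> 0 < C \<and>
  (\<forall>t s. (t, s) \<in> D \<longrightarrow> 0 \<le> t \<longrightarrow> 0 \<le> s \<longrightarrow> s \<le> \<delta> \<longrightarrow> c \<le> H t s \<and> H t s \<le> C \<and> t \<le> M)))"

lemma bounds:
  shows cH: "0 < cH" and CH: "0 < CH"
    and H_bounds: "\<And>t s. (t, s) \<in> D \<Longrightarrow> 0 \<le> t \<Longrightarrow> 0 \<le> s \<Longrightarrow> s \<le> \<delta> \<Longrightarrow> cH \<le> H t s \<and> H t s \<le> CH \<and> t \<le> Mt"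
proof -
  let ?R = "\<lambda>q. case q of (c, C, M) \<Rightarrow> 0 < c \<and> 0 < C \<and>
    (\<forall>t s. (t, s) \<in> D \<longrightarrow> 0 \<le> t \<longrightarrow> 0 \<le> s \<longrightarrow> s \<le> \<delta> \<longrightarrow> c \<le> H t s \<and> H t s \<le> C \<and> t \<le> M)"
  obtain c C M where "0 < c" "0 < C" and cCM:
    "\<And>t s. (t, s) \<in> D \<Longrightarrow> 0 \<le> t \<Longrightarrow> 0 \<le> s \<Longrightarrow> s \<le> \<delta> \<Longrightarrow> c \<le> H t s \<and> H t s \<le> C \<and> t \<le> M"
    by (rule uniform_bounds[OF less_imp_le[OF \<delta>_pos] \<delta>_less]) (rule that)
  then have "?R (c, C, M)" by simp
  then have "?R (SOME q. ?R q)" by (rule someI)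
  then have R: "?R (cH, CH, Mt)" unfolding cH_def CH_def Mt_def by simp
  show "0 < cH" "0 < CH" using R by auto
  show "\<And>t s. (t, s) \<in> D \<Longrightarrow> 0 \<le> t \<Longrightarrow> 0 \<le> s \<Longrightarrow> s \<le> \<delta> \<Longrightarrow> cH \<le> H t s \<and> H t s \<le> CH \<and> t \<le> Mt"
    using R by auto
qed

lemma Mt_nonneg: "0 \<le> Mt"
  using H_bounds[OF zero_in_D[OF in_S[of 0]]] \<delta>_pos \<delta>_less by fastforce

text \<open>Since \<open>t = |Du|^2 / x_1^2\<close>, this bounds \<open>|Du| / x_1\<close> and so
  compensates the singular weight on the axis.\<close>

definition L :: real where "L = sqrt Mt"

lemma L_nonneg: "0 \<le> L"
  by (simp add: L_def Mt_nonneg)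

lemma norm_Du_le_of_D:
  assumes "(t x, snd x) \<in> D" "x \<in> Ks" "0 \<le> snd x" "fst x > 0" shows "norm (Du x) \<le> L * fst x"
proof -
  have "t x \<le> Mt" using H_bounds[OF assms(1) t_nonneg] assms Ks_snd[of x] by auto
  then have "(norm (Du x) / fst x)\<^sup>2 \<le> Mt" by (simp add: tq_def power_divide)
  then have "norm (Du x) / fst x \<le> L" unfolding L_def by (rule real_le_rsqrt)
  then show ?thesis using assms by (simp add: field_simps)
qed

lemma P_bounds:
  assumes "x \<in> P" "x \<in> Ks"
  shows "cH \<le> Hx x" "Hx x \<le> CH" "t x \<le> Mt" "norm (Du x) \<le> L * fst x"
  using H_bounds[OF P_in_D[OF assms(1)] t_nonneg] norm_Du_le_of_D[OF P_in_D[OF assms(1)] assms(2)]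
    P_snd[OF assms(1)] P_fst[OF assms(1)] Ks_snd[OF assms(2)] by auto

end

section \<open>The gradient off the positivity set\<close>

definition bump0 :: "real \<Rightarrow> real \<Rightarrow> real \<Rightarrow> real" where
  "bump0 l r z = (max 0 (z - l))\<^sup>2 * (max 0 (r - z))\<^sup>2"

definition bump0' :: "real \<Rightarrow> real \<Rightarrow> real \<Rightarrow> real" where
  "bump0' l r z = 2 * max 0 (z - l) * (max 0 (r - z))\<^sup>2 - 2 * max 0 (r - z) * (max 0 (z - l))\<^sup>2"

text \<open>A regularised indicator function of \<open>(l, r)\<close>: of class
  \<open>C\<^sup>1\<close>, with values in \<open>[0, 1]\<close>, zero outside the interval, and
  convergent to the indicator as \<open>e\<close> tends to \<open>0\<close>.\<close>

definition bump :: "real \<Rightarrow> real \<Rightarrow> real \<Rightarrow> real \<Rightarrow> real" where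
  "bump e l r z = bump0 l r z / (bump0 l r z + e)"

definition bump' :: "real \<Rightarrow> real \<Rightarrow> real \<Rightarrow> real \<Rightarrow> real" where
  "bump' e l r z = e * bump0' l r z / (bump0 l r z + e)\<^sup>2"

lemma bump0_nonneg: "bump0 l r z \<ge> 0"
  by (simp add: bump0_def)

lemma bump0_has_derivative: "(bump0 l r has_real_derivative bump0' l r z) (at z)"
proof -
  have 1: "((\<lambda>z. (max 0 (z - l))\<^sup>2) has_real_derivative 2 * max 0 (z - l) * 1) (at z)"
    by (rule DERIV_chain2[OF max0_square_has_derivative]) (auto intro!: derivative_eq_intros)
  have 2: "((\<lambda>z. (max 0 (r - z))\<^sup>2) has_real_derivative 2 * max 0 (r - z) * (-1)) (at z)"
    by (rule DERIV_chain2[OF max0_square_has_derivative]) (auto intro!: derivative_eq_intros)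
  show ?thesis
    unfolding bump0_def[abs_def] bump0'_def
    by (rule DERIV_cong[OF DERIV_mult[OF 1 2]]) (simp add: algebra_simps)
qed

lemma bump_has_derivative:
  assumes e: "e > 0" shows "(bump e l r has_real_derivative bump' e l r z) (at z)"
proof -
  have ne: "bump0 l r z + e \<noteq> 0" using bump0_nonneg[of l r z] e by linarith
  have "((\<lambda>z. bump0 l r z + e) has_real_derivative bump0' l r z) (at z)"
    using DERIV_add[OF bump0_has_derivative DERIV_const[of e]] by simp
  from DERIV_divide[OF bump0_has_derivative this ne]
  show ?thesis unfolding bump_def[abs_def] bump'_def
    by (rule DERIV_cong) (simp add: power2_eq_square algebra_simps)
qed

lemma continuous_bump: "e > 0 \<Longrightarrow> continuous_on A (bump e l r)"
  by (meson DERIV_isCont continuous_at_imp_continuous_on bump_has_derivative)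

lemma continuous_bump': "e > 0 \<Longrightarrow> continuous_on A (bump' e l r)"
proof -
  assume e: "e > 0"
  have "bump0 l r z + e \<noteq> 0" for z using bump0_nonneg[of l r z] e by linarith
  then show ?thesis unfolding bump'_def bump0_def bump0'_def
    by (intro continuous_intros) auto
qed

lemma bump_bounds: "e > 0 \<Longrightarrow> 0 \<le> bump e l r z \<and> bump e l r z \<le> 1"
  unfolding bump_def using bump0_nonneg[of l r z] by (auto intro!: divide_nonneg_pos simp: divide_le_eq_1)

lemma bump_outside: "z \<notin> {l<..<r} \<Longrightarrow> bump e l r z = 0" "z \<notin> {l<..<r} \<Longrightarrow> bump' e l r z = 0"
  by (auto simp: bump_def bump'_def bump0_def bump0'_def max_def)

lemma bump_tendsto:
  assumes "\<And>n. e n > 0" "e \<longlonglongrightarrow> 0"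
  shows "(\<lambda>n. bump (e n) l r z) \<longlonglongrightarrow> indicator {l<..<r} z"
proof (cases "z \<in> {l<..<r}")
  case True
  then have "bump0 l r z > 0" by (simp add: bump0_def)
  moreover from this have "(\<lambda>n. bump0 l r z / (bump0 l r z + e n)) \<longlonglongrightarrow> bump0 l r z / (bump0 l r z + 0)"
    by (intro tendsto_intros assms) auto
  ultimately show ?thesis using True by (simp add: bump_def)
qed (simp add: bump_outside)

definition box_bump :: "real \<Rightarrow> plane \<Rightarrow> plane \<Rightarrow> plane \<Rightarrow> real" where
  "box_bump e a b x = bump e (fst a) (fst b) (fst x) * bump e (snd a) (snd b) (snd x)"

definition box_bump' :: "real \<Rightarrow> plane \<Rightarrow> plane \<Rightarrow> plane \<Rightarrow> plane \<Rightarrow> real" where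
  "box_bump' e a b x v = bump e (fst a) (fst b) (fst x) * (bump' e (snd a) (snd b) (snd x) * snd v)
     + bump' e (fst a) (fst b) (fst x) * fst v * bump e (snd a) (snd b) (snd x)"

lemma box_bump_has_derivative:
  assumes e: "e > 0" shows "(box_bump e a b has_derivative box_bump' e a b x) (at x)"
proof -
  have 1: "((\<lambda>x::plane. bump e (fst a) (fst b) (fst x)) has_derivative
      (\<lambda>v. bump' e (fst a) (fst b) (fst x) * fst v)) (at x)"
    by (rule has_derivative_compose[OF has_derivative_fst[OF has_derivative_ident]
        bump_has_derivative[OF e, unfolded has_field_derivative_def]])
  have 2: "((\<lambda>x::plane. bump e (snd a) (snd b) (snd x)) has_derivative
      (\<lambda>v. bump' e (snd a) (snd b) (snd x) * snd v)) (at x)"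
    by (rule has_derivative_compose[OF has_derivative_snd[OF has_derivative_ident]
        bump_has_derivative[OF e, unfolded has_field_derivative_def]])
  show ?thesis
    unfolding box_bump_def[abs_def] box_bump'_def[abs_def] by (rule has_derivative_mult[OF 1 2])
qed

lemma continuous_bump_coord:
  assumes e: "e > 0"
  shows "continuous_on A (\<lambda>x::plane. bump e l r (fst x))" "continuous_on A (\<lambda>x::plane. bump e l r (snd x))"
    "continuous_on A (\<lambda>x::plane. bump' e l r (fst x))" "continuous_on A (\<lambda>x::plane. bump' e l r (snd x))"
  by (rule continuous_on_compose2[OF continuous_bump[OF e, of UNIV] _ subset_UNIV]
      continuous_on_compose2[OF continuous_bump'[OF e, of UNIV] _ subset_UNIV]
      continuous_on_fst continuous_on_snd continuous_on_id)+

lemma continuous_box_bump': "e > 0 \<Longrightarrow> continuous_on A (\<lambda>x. box_bump' e a b x v)"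
  unfolding box_bump'_def
  by (intro continuous_intros continuous_bump_coord)

lemma continuous_box_bump: "e > 0 \<Longrightarrow> continuous_on A (box_bump e a b)"
  unfolding box_bump_def
  by (intro continuous_intros continuous_bump_coord)

lemma mem_box_plane: "x \<in> box a b \<longleftrightarrow> fst x \<in> {fst a<..<fst b} \<and> snd x \<in> {snd a<..<snd b}" for a b x :: plane
  by (cases x; cases a; cases b) (auto simp: mem_box Basis_prod_def)

lemma box_bump_outside: "x \<notin> cbox a b \<Longrightarrow> box_bump e a b x = 0" "x \<notin> cbox a b \<Longrightarrow> box_bump' e a b x v = 0"
proof -
  assume "x \<notin> cbox a b"
  then have "x \<notin> box a b" using box_subset_cbox by blast
  then show "box_bump e a b x = 0" "box_bump' e a b x v = 0"
    unfolding mem_box_plane box_bump_def box_bump'_def by (auto simp: bump_outside)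
qed

lemma box_bump_bounds: "e > 0 \<Longrightarrow> \<bar>box_bump e a b x\<bar> \<le> 1"
  using bump_bounds[of e "fst a" "fst b" "fst x"] bump_bounds[of e "snd a" "snd b" "snd x"]
  by (simp add: box_bump_def abs_mult mult_le_one)

lemma box_bump_tendsto:
  assumes "\<And>n. e n > 0" "e \<longlonglongrightarrow> 0"
  shows "(\<lambda>n. box_bump (e n) a b x) \<longlonglongrightarrow> indicator (box a b) x"
proof -
  have "(\<lambda>n. box_bump (e n) a b x) \<longlonglongrightarrow> indicator {fst a<..<fst b} (fst x) * indicator {snd a<..<snd b} (snd x)"
    unfolding box_bump_def by (intro tendsto_intros bump_tendsto assms)
  also have "indicator {fst a<..<fst b} (fst x) * indicator {snd a<..<snd b} (snd x) = (indicator (box a b) x :: real)"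
    by (simp add: indicator_def mem_box_plane)
  finally show ?thesis .
qed

lemma inverse_Suc_seq: "inverse (real (Suc n)) > 0" "(\<lambda>n. inverse (real (Suc n))) \<longlonglongrightarrow> 0"
  using LIMSEQ_inverse_real_of_nat by auto

lemma integral_dominated_convergence_compact:
  fixes s :: "nat \<Rightarrow> 'a::euclidean_space \<Rightarrow> real"
  assumes "compact K" and "\<And>n. s n \<in> borel_measurable lebesgue" and "f \<in> borel_measurable lebesgue"
    and "\<And>x. (\<lambda>n. s n x) \<longlonglongrightarrow> f x"
    and "\<And>n. AE x in lebesgue. \<bar>s n x\<bar> \<le> B * indicator K x"
  shows "(\<lambda>n. integral\<^sup>L lebesgue (s n)) \<longlonglongrightarrow> integral\<^sup>L lebesgue f"
proof (rule integral_dominated_convergence)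
  show "integrable lebesgue (\<lambda>x. B * indicator K x)"
    using lmeasurable_compact[OF assms(1)]
    by (intro integrable_mult_right integrable_real_indicator) (auto simp: fmeasurable_def)
qed (use assms in auto)

context solution_near_origin
begin

lemma u_has_derivative: "x \<in> P \<Longrightarrow> (u has_derivative (\<lambda>v. Du x \<bullet> v)) (at x)"
  using C2(1) open_P at_within_open[of x P] unfolding P_def[symmetric] C1_on_def by auto

lemma Ks_Omega: "x \<in> Ks \<Longrightarrow> x \<in> \<Omega>"
  using disc_subset by blast

lemma P_iff: "x \<in> \<Omega> \<Longrightarrow> x \<in> P \<longleftrightarrow> u x > 0"
  by (simp add: P_def pos_set_def)

text \<open>An open quarter-disc: it avoids both coordinate axes and lies in \<open>upper\<close>,
  where the subsonic condition is available.\<close>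

definition Uo :: "plane set" where
  "Uo = ball 0 \<delta> \<inter> {x. fst x > 0} \<inter> {x. snd x > 0}"

lemma open_Uo: "open Uo"
  unfolding Uo_def by (intro open_Int open_ball open_Collect_less continuous_intros)

lemma Uo_Ks: "Uo \<subseteq> Ks"
  by (auto simp: Uo_def half_plane_def)

lemma compact_level:
  assumes "compact K" "K \<subseteq> \<Omega>" "\<epsilon> > 0"
  shows "compact {x\<in>K. \<epsilon> \<le> u x}" "{x\<in>K. \<epsilon> \<le> u x} \<subseteq> P"
proof -
  have "continuous_on K u" using continuous assms(2) continuous_on_subset by blast
  then have "closed (K \<inter> u -` {\<epsilon>..})"
    using compact_imp_closed[OF assms(1)] by (intro continuous_closed_preimage) auto
  then have "compact (K \<inter> (K \<inter> u -` {\<epsilon>..}))" using assms(1) by (rule compact_Int_closed[rotated])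
  moreover have "K \<inter> (K \<inter> u -` {\<epsilon>..}) = {x\<in>K. \<epsilon> \<le> u x}" by auto
  ultimately show "compact {x\<in>K. \<epsilon> \<le> u x}" by simp
  show "{x\<in>K. \<epsilon> \<le> u x} \<subseteq> P" using assms by (auto simp: P_def pos_set_def)
qed

text \<open>The truncation vanishes where \<open>u \<le> \<epsilon>\<close>, so multiplying by it
  moves the support of \<open>\<psi>\<close> into a compact subset of \<open>P\<close>, where
  \<open>u\<close> is differentiable.\<close>

lemma cutoff_product_C1:
  fixes \<psi> :: "plane \<Rightarrow> real"
  assumes K: "compact K" "K \<subseteq> \<Omega>" and \<epsilon>: "\<epsilon> > 0"
    and der: "\<And>x. (\<psi> has_derivative \<psi>' x) (at x)"
    and cont: "\<And>v. continuous_on UNIV (\<lambda>x. \<psi>' x v)"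
    and "\<forall>x\<in>P. x \<notin> K \<longrightarrow> \<psi> x = 0"
  defines "f \<equiv> \<lambda>x. if x \<in> P then cutoff \<epsilon> (u x) * \<psi> x else 0"
    and "f' \<equiv> \<lambda>x v. cutoff \<epsilon> (u x) * \<psi>' x v + cutoff' \<epsilon> (u x) * (Du x \<bullet> v) * \<psi> x"
  shows "\<forall>x\<in>P. (f has_derivative f' x) (at x)"
    and "\<And>v. continuous_on P (\<lambda>x. f' x v)"
    and "\<forall>x. x \<notin> {x\<in>K. \<epsilon> \<le> u x} \<longrightarrow> f x = 0"
    and "continuous_on P f"
proof -
  have zero: "\<psi> x = 0" if "x \<in> P" "x \<notin> K" for x using assms(6) that by blast
  have c\<psi>: "continuous_on A \<psi>" for A
    using der has_derivative_continuous continuous_at_imp_continuous_on by blast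
  have cu: "continuous_on P u" using continuous P_def continuous_on_subset by (metis inf_le1)
  have der': "(f has_derivative f' x) (at x)" if x: "x \<in> P" for x
  proof -
    have "((\<lambda>x. cutoff \<epsilon> (u x)) has_derivative (\<lambda>v. cutoff' \<epsilon> (u x) * (Du x \<bullet> v))) (at x)"
      using has_derivative_compose[OF u_has_derivative[OF x]
          cutoff_has_derivative[OF \<epsilon>, unfolded has_field_derivative_def]] .
    from has_derivative_mult[OF this der]
    have "((\<lambda>x. cutoff \<epsilon> (u x) * \<psi> x) has_derivative f' x) (at x)" by (simp add: f'_def)
    then show ?thesis
      by (rule has_derivative_transform_within_open[OF _ open_P x]) (simp add: f_def)
  qed
  then show "\<forall>x\<in>P. (f has_derivative f' x) (at x)" by blast
  show "continuous_on P (\<lambda>x. f' x v)" for v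
    unfolding f'_def
    by (intro continuous_intros continuous_Du c\<psi> continuous_on_subset[OF cont]
        continuous_on_compose2[OF continuous_cutoff[OF \<epsilon>] cu, of UNIV]
        continuous_on_compose2[OF continuous_cutoff'[OF \<epsilon>] cu, of UNIV]) auto
  show "\<forall>x. x \<notin> {x\<in>K. \<epsilon> \<le> u x} \<longrightarrow> f x = 0"
    using zero cutoff_eq_0[of "u _" \<epsilon>] by (auto simp: f_def)
  show "continuous_on P f"
    using der' has_derivative_continuous continuous_at_imp_continuous_on by blast
qed

text \<open>By density of truncations the classical gradient on \<open>P\<close>, extended by zero, is the weak
  gradient; uniqueness of the weak gradient then makes \<open>Du\<close> vanish off \<open>P\<close>.\<close>

lemma AE_Du_eq_0: "AE x in lebesgue. x \<in> Uo \<longrightarrow> x \<notin> P \<longrightarrow> Du x = 0"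
proof -
  have main: "AE x in lebesgue. x \<in> Uo \<longrightarrow> (if u x > 0 then 0 else Du x \<bullet> e) = 0"
    if e: "e \<in> {(1, 0), (0, 1)}" for e
  proof -
    have eB: "e \<in> Basis" using e by (auto simp: Basis_prod_def)
    have ne: "norm e = 1" using e by auto
    define B where "B = L * \<delta>"
    have B: "B \<ge> 0" using L_nonneg \<delta>_pos by (simp add: B_def)
    have key: "set_integrable lebesgue (cbox a b) (\<lambda>x. if u x > 0 then 0 else Du x \<bullet> e) \<and>
        (LINT x:cbox a b|lebesgue. if u x > 0 then 0 else Du x \<bullet> e) = 0" if sub: "cbox a b \<subseteq> Uo" for a b
    proof -
      let ?K = "cbox a b"
      define uK where "uK x = indicator ?K x * u x" for x
      define dK where "dK x = indicator ?K x * (Du x \<bullet> e)" for x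
      have KO: "?K \<subseteq> \<Omega>" using sub Uo_Ks disc_subset by blast
      have cK: "continuous_on ?K u" using continuous KO continuous_on_subset by blast
      obtain Bu where Bu: "\<And>x. x \<in> ?K \<Longrightarrow> \<bar>u x\<bar> \<le> Bu" and Bu0: "Bu \<ge> 0"
      proof -
        have "compact (u ` ?K)" by (rule compact_continuous_image[OF cK compact_cbox])
        then have "bounded (u ` ?K)" by (rule compact_imp_bounded)
        then obtain c where "\<forall>y\<in>u ` ?K. norm y \<le> c" unfolding bounded_iff by blast
        then have "\<bar>u x\<bar> \<le> \<bar>c\<bar>" if "x \<in> ?K" for x using that by fastforce
        then show ?thesis using that[of "\<bar>c\<bar>"] by simp
      qed
      have [measurable]: "uK \<in> borel_measurable lebesgue"
      proof -
        have "uK \<in> borel_measurable borel"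
          unfolding uK_def using borel_measurable_continuous_on_indicator[OF _ cK] by simp
        then show ?thesis by (simp add: measurable_completion)
      qed
      have [measurable]: "dK \<in> borel_measurable lebesgue"
      proof -
        have m: "(\<lambda>x. indicator \<Omega> x *\<^sub>R Du x) \<in> borel_measurable lebesgue"
          using sobolev by (simp add: W12_w_loc_def set_borel_measurable_def)
        have "dK = (\<lambda>x. indicator ?K x * ((indicator \<Omega> x *\<^sub>R Du x) \<bullet> e))"
          using KO by (auto simp: dK_def fun_eq_iff split: split_indicator)
        then show ?thesis
          using borel_measurable_times[OF borel_measurable_indicator[of ?K lebesgue] borel_measurable_inner[OF m borel_measurable_const[of e]]]
          by simp
      qed
      have P1: "indicator {0<..} (uK x) = (if u x > 0 then 1 else 0::real)" if "x \<in> ?K" for x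
        using that by (simp add: uK_def)
      have dP: "\<bar>dK x\<bar> \<le> B" if "uK x > 0" for x
      proof -
        have x: "x \<in> ?K" "u x > 0" using that by (auto simp: uK_def split: split_indicator_asm)
        then have xP: "x \<in> P" and xK: "x \<in> Ks" using KO sub Uo_Ks by (auto simp: P_def pos_set_def)
        have "\<bar>Du x \<bullet> e\<bar> \<le> norm (Du x)" using Cauchy_Schwarz_ineq2[of "Du x" e] ne by simp
        also have "\<dots> \<le> B" unfolding B_def
          using P_bounds(4)[OF xP xK] Ks_fst[OF xK] L_nonneg mult_left_mono[of "fst x" \<delta> L] by linarith
        finally show ?thesis using x by (simp add: dK_def)
      qed
      \<comment> \<open>Subsonicity bounds \<open>Du\<close> almost everywhere, also off
        \<open>P\<close>; this supplies the majorant of \<open>E\<close> and the integrability of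
        the gradient terms below.\<close>
      have dAE: "AE x in lebesgue. \<bar>dK x\<bar> \<le> B * indicator ?K x"
      proof -
        have "?K \<subseteq> \<Omega> \<inter> upper" using KO sub by (auto simp: Uo_def upper_def less_imp_le)
        from AE_in_D[OF compact_cbox this] show ?thesis
        proof eventually_elim
          case (elim x)
          show ?case
          proof (cases "x \<in> ?K")
            case True
            then have x: "x \<in> Uo" using sub by blast
            have xK: "x \<in> Ks" using x Uo_Ks by blast
            have "norm (Du x) \<le> L * fst x"
              using True elim x xK by (intro norm_Du_le_of_D) (auto simp: Uo_def)
            moreover have "\<bar>Du x \<bullet> e\<bar> \<le> norm (Du x)" using Cauchy_Schwarz_ineq2[of "Du x" e] ne by simp
            ultimately show ?thesis
              using True Ks_fst[OF xK] L_nonneg mult_left_mono[of "fst x" \<delta> L] by (simp add: dK_def B_def)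
          qed (simp add: dK_def)
        qed
      qed
      have int: "integrable lebesgue (\<lambda>x. dK x * m x)"
        if [measurable]: "m \<in> borel_measurable lebesgue" and mB: "\<And>x. \<bar>m x\<bar> \<le> C" for m C
      proof (rule Bochner_Integration.integrable_bound)
        show "integrable lebesgue (\<lambda>x. (B * C) * indicator ?K x)"
          using lmeasurable_cbox[of a b] by (intro integrable_mult_right integrable_real_indicator) (auto simp: fmeasurable_def)
        show "AE x in lebesgue. norm (dK x * m x) \<le> norm (B * C * indicator ?K x)"
          using dAE
        proof eventually_elim
          case (elim x)
          have "C \<ge> 0" using mB[of x] by linarith
          have "\<bar>dK x\<bar> * \<bar>m x\<bar> \<le> (B * indicator ?K x) * C"
            using elim mB[of x] B by (intro mult_mono) auto
          then show ?case using B \<open>C \<ge> 0\<close> by (simp add: abs_mult mult_ac)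
        qed
      qed simp
      \<comment> \<open>The part of the weak gradient that lives off \<open>P\<close>; it has to be
        shown to have zero integral over the box.\<close>
      define E where "E x = dK x * (1 - indicator {0<..} (uK x))" for x
      have test: "(\<integral>x. E x * box_bump k a b x \<partial>lebesgue) = 0" if k: "k > 0" for k
      proof -
        define \<psi> where "\<psi> = box_bump k a b"
        define \<psi>' where "\<psi>' = box_bump' k a b"
        have c\<psi>: "continuous_on UNIV \<psi>" "\<And>v. continuous_on UNIV (\<lambda>x. \<psi>' x v)"
          unfolding \<psi>_def \<psi>'_def using k by (auto intro: continuous_box_bump continuous_box_bump')
        have [measurable]: "\<psi> \<in> borel_measurable lebesgue" "(\<lambda>x. \<psi>' x v) \<in> borel_measurable lebesgue" for v
          using borel_measurable_continuous_onI[OF c\<psi>(1)] borel_measurable_continuous_onI[OF c\<psi>(2)[of v]]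
          by (simp_all add: measurable_completion)
        have zero: "x \<notin> ?K \<Longrightarrow> \<psi> x = 0" "x \<notin> ?K \<Longrightarrow> \<psi>' x v = 0" for x v
          unfolding \<psi>_def \<psi>'_def by (auto simp: box_bump_outside)
        have \<psi>1: "\<bar>\<psi> x\<bar> \<le> 1" for x using box_bump_bounds[OF k] by (simp add: \<psi>_def)
        obtain C where C: "\<And>x. \<bar>\<psi>' x e\<bar> \<le> C"
        proof -
          have "compact ((\<lambda>x. \<psi>' x e) ` ?K)"
            by (intro compact_continuous_image compact_cbox continuous_on_subset[OF c\<psi>(2) subset_UNIV])
          then have "bounded ((\<lambda>x. \<psi>' x e) ` ?K)" by (rule compact_imp_bounded)
          then obtain c where c: "\<forall>y\<in>(\<lambda>x. \<psi>' x e) ` ?K. norm y \<le> c" unfolding bounded_iff by blast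
          have "\<bar>\<psi>' x e\<bar> \<le> \<bar>c\<bar>" for x using c zero(2)[of x e] by (cases "x \<in> ?K") fastforce+
          then show ?thesis using that by blast
        qed
        have C0: "C \<ge> 0" using C[of 0] by linarith
        have D\<psi>: "(\<psi> has_derivative \<psi>' x) (at x)" for x
          unfolding \<psi>_def \<psi>'_def by (rule box_bump_has_derivative[OF k])
        \<comment> \<open>The definition of the weak gradient, tested with
          \<open>\<psi>\<close>.\<close>
        have A: "(\<integral>x. uK x * \<psi>' x e \<partial>lebesgue) = - (\<integral>x. dK x * \<psi> x \<partial>lebesgue)"
        proof -
          let ?U = "\<Omega> \<inter> {x. fst x > 0}"
          have KU: "?K \<subseteq> ?U" using KO sub by (auto simp: Uo_def)
          have "C1_0 ?U \<psi> \<psi>'"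
            by (rule C1_0_of_UNIV[OF D\<psi> c\<psi>(2) compact_cbox KU]) (use zero in auto)
          then have "(LINT x:?U|lebesgue. u x * \<psi>' x e) = - (LINT x:?U|lebesgue. (Du x \<bullet> e) * \<psi> x)"
            using sobolev eB unfolding W12_w_loc_def weak_gradient_def by blast
          moreover have "(LINT x:?U|lebesgue. u x * \<psi>' x e) = (\<integral>x. uK x * \<psi>' x e \<partial>lebesgue)"
            unfolding set_lebesgue_integral_def
            by (rule Bochner_Integration.integral_cong)
               (use KU zero in \<open>auto simp: uK_def split: split_indicator\<close>)
          moreover have "(LINT x:?U|lebesgue. (Du x \<bullet> e) * \<psi> x) = (\<integral>x. dK x * \<psi> x \<partial>lebesgue)"
            unfolding set_lebesgue_integral_def
            by (rule Bochner_Integration.integral_cong)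
               (use KU zero in \<open>auto simp: dK_def split: split_indicator\<close>)
          ultimately show ?thesis by simp
        qed
        define s where "s \<epsilon> x = cutoff' \<epsilon> (uK x) * dK x * \<psi> x + cutoff \<epsilon> (uK x) * \<psi>' x e" for \<epsilon> x
        \<comment> \<open>\<open>s \<epsilon>\<close> is a partial derivative of the truncated
          product \<open>cutoff \<epsilon> (u x) * \<psi> x\<close>, extended by zero, which has
          compact support in \<open>P\<close>.\<close>
        have s0: "(\<integral>x. s \<epsilon> x \<partial>lebesgue) = 0" if \<epsilon>: "\<epsilon> > 0" for \<epsilon>
        proof -
          define f where "f = (\<lambda>x. if x \<in> P then cutoff \<epsilon> (u x) * \<psi> x else 0)"
          define f' where "f' = (\<lambda>x v. cutoff \<epsilon> (u x) * \<psi>' x v + cutoff' \<epsilon> (u x) * (Du x \<bullet> v) * \<psi> x)"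
          let ?L = "{x\<in>?K. \<epsilon> \<le> u x}"
          have z: "\<forall>x\<in>P. x \<notin> ?K \<longrightarrow> \<psi> x = 0" using zero(1) by blast
          have C1: "\<forall>x\<in>P. (f has_derivative f' x) (at x)" "\<And>v. continuous_on P (\<lambda>x. f' x v)"
            "\<forall>x. x \<notin> ?L \<longrightarrow> f x = 0"
            unfolding f_def f'_def by (rule cutoff_product_C1[OF compact_cbox KO \<epsilon> D\<psi> c\<psi>(2) z])+
          note lev = compact_level[OF compact_cbox KO \<epsilon>]
          note ext = C1_extend[OF open_P C1(1,2) lev C1(3)]
          have "\<forall>x v. x \<notin> ?L \<longrightarrow> (if x \<in> ?L then f' x v else 0) = 0"
            by (intro allI impI) (rule if_not_P)
          note I = integral_partial_derivative_eq_0[OF ext(1,2) lev(1) C1(3) this]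
          have "e = (1, 0) \<or> e = (0, 1)" using e by blast
          then have "(\<integral>x. (if x \<in> ?L then f' x e else 0) \<partial>lborel) = 0"
            using I by (elim disjE) (simp_all only:)
          moreover have "(if x \<in> ?L then f' x e else 0) = s \<epsilon> x" for x
            using \<epsilon> zero by (auto simp: f'_def s_def uK_def dK_def cutoff_eq_0 cutoff'_eq_0 split: split_indicator)
          ultimately have "(\<integral>x. s \<epsilon> x \<partial>lborel) = 0" by simp
          moreover have "s \<epsilon> \<in> borel_measurable borel"
          proof -
            have "continuous_on UNIV (\<lambda>x. if x \<in> ?L then f' x e else 0)" by (rule ext(2))
            then show ?thesis
              using \<open>\<And>x. (if x \<in> ?L then f' x e else 0) = s \<epsilon> x\<close> by (simp add: borel_measurable_continuous_onI)
          qed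
          ultimately show ?thesis by (simp add: integral_completion)
        qed
        have lim1: "(\<lambda>n. \<integral>x. s (inverse (real (Suc n))) x \<partial>lebesgue) \<longlonglongrightarrow>
            (\<integral>x. (indicator {0<..} (uK x) * dK x * \<psi> x + uK x * \<psi>' x e) \<partial>lebesgue)"
        proof (rule integral_dominated_convergence_compact[OF compact_cbox[of a b], where B = "2 * B + Bu * C"])
          fix n
          have [measurable]: "cutoff' (inverse (real (Suc n))) \<in> borel_measurable borel"
              "cutoff (inverse (real (Suc n))) \<in> borel_measurable borel"
            by (intro borel_measurable_continuous_onI continuous_cutoff continuous_cutoff', simp)+
          show "s (inverse (real (Suc n))) \<in> borel_measurable lebesgue" unfolding s_def by measurable
          show "AE x in lebesgue. \<bar>s (inverse (real (Suc n))) x\<bar> \<le> (2 * B + Bu * C) * indicator ?K x"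
          proof (rule AE_I2)
            fix x
            define \<epsilon> where "\<epsilon> = inverse (real (Suc n))"
            have \<epsilon>: "\<epsilon> > 0" by (simp add: \<epsilon>_def)
            show "\<bar>s (inverse (real (Suc n))) x\<bar> \<le> (2 * B + Bu * C) * indicator ?K x"
            proof (cases "x \<in> ?K")
              case True
              have "\<bar>cutoff' \<epsilon> (uK x) * dK x\<bar> \<le> 2 * B"
              proof (cases "uK x > 0")
                case True
                then show ?thesis unfolding abs_mult using cutoff'_bounds[OF \<epsilon>] dP B by (intro mult_mono) auto
              next
                case False
                then show ?thesis using \<epsilon> B by (simp add: cutoff'_eq_0)
              qed
              then have 1: "\<bar>cutoff' \<epsilon> (uK x) * dK x * \<psi> x\<bar> \<le> 2 * B * 1"
                unfolding abs_mult[of _ "\<psi> x"] using \<psi>1 B by (intro mult_mono) auto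
              have "\<bar>cutoff \<epsilon> (uK x)\<bar> \<le> Bu"
                using cutoff_bounds[OF \<epsilon>, of "uK x"] Bu[OF True] True Bu0 by (auto simp: uK_def)
              then have 2: "\<bar>cutoff \<epsilon> (uK x) * \<psi>' x e\<bar> \<le> Bu * C"
                unfolding abs_mult using C Bu0 by (intro mult_mono) auto
              have "\<bar>s \<epsilon> x\<bar> \<le> 2 * B + Bu * C" unfolding s_def using 1 2 by linarith
              then show ?thesis using True by (simp add: \<epsilon>_def)
            qed (simp add: s_def zero)
          qed
          show "(\<lambda>n. s (inverse (real (Suc n))) x) \<longlonglongrightarrow> indicator {0<..} (uK x) * dK x * \<psi> x + uK x * \<psi>' x e" for x
          proof -
            have "uK x \<ge> 0" using subsetD[OF KO, of x] nonneg[of x] by (cases "x \<in> ?K") (simp_all add: uK_def)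
            moreover have "(\<lambda>n. s (inverse (real (Suc n))) x) \<longlonglongrightarrow> indicator {0<..} (uK x) * dK x * \<psi> x + max 0 (uK x) * \<psi>' x e"
              unfolding s_def by (intro tendsto_intros cutoff_tendsto cutoff'_tendsto inverse_Suc_seq)
            ultimately show ?thesis by (simp add: max_def)
          qed
        qed measurable
        have seq0: "(\<lambda>n. \<integral>x. s (inverse (real (Suc n))) x \<partial>lebesgue) = (\<lambda>n. 0)"
          by (intro ext s0 inverse_Suc_seq)
        \<comment> \<open>In the limit the gradient restricted to \<open>P\<close> satisfies the
          same identity as the full one in \<open>A\<close>; subtracting the two isolates
          \<open>E\<close>.\<close>
        have lim: "(\<integral>x. (indicator {0<..} (uK x) * dK x * \<psi> x + uK x * \<psi>' x e) \<partial>lebesgue) = 0"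
          using lim1 unfolding seq0 by (rule LIMSEQ_unique) (rule tendsto_const)
        have i1: "integrable lebesgue (\<lambda>x. dK x * (indicator {0<..} (uK x) * \<psi> x))"
          by (rule int[of _ 1]) (auto simp: \<psi>1 split: split_indicator)
        have i2: "integrable lebesgue (\<lambda>x. dK x * \<psi> x)" by (rule int[of _ 1]) (auto simp: \<psi>1)
        have i3: "integrable lebesgue (\<lambda>x. uK x * \<psi>' x e)"
        proof (rule Bochner_Integration.integrable_bound)
          show "integrable lebesgue (\<lambda>x. (Bu * C) * indicator ?K x)"
            using lmeasurable_cbox[of a b] by (intro integrable_mult_right integrable_real_indicator) (auto simp: fmeasurable_def)
          show "AE x in lebesgue. norm (uK x * \<psi>' x e) \<le> norm (Bu * C * indicator ?K x)"
            using C Bu Bu0 C0 by (intro AE_I2) (auto simp: uK_def abs_mult split: split_indicator intro: mult_mono)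
        qed simp
        have "(\<integral>x. (indicator {0<..} (uK x) * dK x * \<psi> x + uK x * \<psi>' x e) \<partial>lebesgue) =
            (\<integral>x. dK x * (indicator {0<..} (uK x) * \<psi> x) \<partial>lebesgue) + (\<integral>x. uK x * \<psi>' x e \<partial>lebesgue)"
          using Bochner_Integration.integral_add[OF i1 i3] by (simp add: mult_ac)
        then have "(\<integral>x. dK x * (indicator {0<..} (uK x) * \<psi> x) \<partial>lebesgue) = (\<integral>x. dK x * \<psi> x \<partial>lebesgue)"
          using lim A by simp
        moreover have "(\<integral>x. E x * \<psi> x \<partial>lebesgue) = (\<integral>x. dK x * \<psi> x \<partial>lebesgue) - (\<integral>x. dK x * (indicator {0<..} (uK x) * \<psi> x) \<partial>lebesgue)"
          using Bochner_Integration.integral_diff[OF i2 i1] by (simp add: E_def algebra_simps)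
        ultimately show ?thesis by (simp add: \<psi>_def)
      qed
      have [measurable]: "E \<in> borel_measurable lebesgue" unfolding E_def by measurable
      have EB: "AE x in lebesgue. \<bar>E x\<bar> \<le> B * indicator ?K x"
        using dAE by eventually_elim (auto simp: E_def B split: split_indicator)
      have mE: "(\<lambda>x. E x * indicator (box a b) x) \<in> borel_measurable lebesgue"
        by (intro borel_measurable_times borel_measurable_indicator fmeasurableD[OF lmeasurable_box]) fact
      \<comment> \<open>The test functions tend to the indicator of the open box, which differs from
        the closed one by a null set.\<close>
      have lim2: "(\<lambda>n. \<integral>x. E x * box_bump (inverse (real (Suc n))) a b x \<partial>lebesgue) \<longlonglongrightarrow> (\<integral>x. E x * indicator (box a b) x \<partial>lebesgue)"
      proof (rule integral_dominated_convergence_compact[OF compact_cbox[of a b], where B = B])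
        fix n
        have "box_bump (inverse (real (Suc n))) a b \<in> borel_measurable borel"
          by (intro borel_measurable_continuous_onI continuous_box_bump inverse_Suc_seq)
        then have [measurable]: "box_bump (inverse (real (Suc n))) a b \<in> borel_measurable lebesgue"
          by (simp add: measurable_completion)
        show "(\<lambda>x. E x * box_bump (inverse (real (Suc n))) a b x) \<in> borel_measurable lebesgue" by measurable
        show "AE x in lebesgue. \<bar>E x * box_bump (inverse (real (Suc n))) a b x\<bar> \<le> B * indicator ?K x"
          using EB
        proof eventually_elim
          case (elim x)
          have "\<bar>E x\<bar> * \<bar>box_bump (inverse (real (Suc n))) a b x\<bar> \<le> (B * indicator ?K x) * 1"
            using elim box_bump_bounds[OF inverse_Suc_seq(1)] B by (intro mult_mono) auto
          then show ?case by (simp add: abs_mult)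
        qed
        show "(\<lambda>n. E x * box_bump (inverse (real (Suc n))) a b x) \<longlonglongrightarrow> E x * indicator (box a b) x" for x
          by (intro tendsto_intros box_bump_tendsto inverse_Suc_seq)
      qed (rule mE)
      have seq0: "(\<lambda>n. \<integral>x. E x * box_bump (inverse (real (Suc n))) a b x \<partial>lebesgue) = (\<lambda>n. 0)"
        by (intro ext test inverse_Suc_seq)
      have "(\<integral>x. E x * indicator (box a b) x \<partial>lebesgue) = 0"
        using lim2 unfolding seq0 by (rule LIMSEQ_unique) (rule tendsto_const)
      moreover have "(\<integral>x. E x * indicator (box a b) x \<partial>lebesgue) = (\<integral>x. E x \<partial>lebesgue)"
      proof (rule integral_cong_AE)
        show "(\<lambda>x. E x * indicator (box a b) x) \<in> borel_measurable lebesgue" by (rule mE)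
        show "E \<in> borel_measurable lebesgue" by fact
        have "AE x in lebesgue. x \<notin> cbox a b - box a b"
          using negligible_frontier_interval[of a b] by (intro AE_not_in) (simp add: negligible_iff_null_sets)
        then show "AE x in lebesgue. E x * indicator (box a b) x = E x"
          by eventually_elim (auto simp: E_def dK_def split: split_indicator)
      qed
      ultimately have E0: "(\<integral>x. E x \<partial>lebesgue) = 0" by simp
      have Eeq: "indicator ?K x *\<^sub>R (if u x > 0 then 0 else Du x \<bullet> e) = E x" for x
        by (auto simp: E_def dK_def uK_def split: split_indicator)
      have "integrable lebesgue E"
        unfolding E_def by (rule int[of _ 1]) (auto split: split_indicator)
      then show ?thesis
        using E0 unfolding set_integrable_def set_lebesgue_integral_def Eeq by simp
    qed
    show ?thesis by (rule AE_eq_0_of_boxes[OF open_Uo]) (use key in auto)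
  qed
  have "AE x in lebesgue. x \<in> Uo \<longrightarrow> (if u x > 0 then 0 else Du x \<bullet> (1, 0)) = 0"
    "AE x in lebesgue. x \<in> Uo \<longrightarrow> (if u x > 0 then 0 else Du x \<bullet> (0, 1)) = 0"
    by (rule main, simp)+
  then show ?thesis
  proof eventually_elim
    case (elim x)
    show ?case
    proof (intro impI)
      assume x: "x \<in> Uo" "x \<notin> P"
      then have "x \<in> \<Omega>" using Uo_Ks disc_subset by blast
      then have "\<not> u x > 0" using x P_iff by simp
      then have "fst (Du x) = 0" "snd (Du x) = 0" using elim x by (auto simp: inner_prod_def)
      then show "Du x = 0" by (simp add: prod_eq_iff)
    qed
  qed
qed

end

section \<open>Domain variations near the origin\<close>

lemma linear_plane:
  fixes v :: plane
  assumes l: "linear f"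
  shows "f v = fst v *\<^sub>R f (1, 0) + snd v *\<^sub>R f (0, 1)"
proof -
  have "v = fst v *\<^sub>R (1, 0) + snd v *\<^sub>R (0, 1)" by (simp add: prod_eq_iff)
  then have "f v = f (fst v *\<^sub>R (1, 0) + snd v *\<^sub>R (0, 1))" by (rule arg_cong)
  then show ?thesis by (simp only: linear_add[OF l] linear_scale[OF l])
qed

context solution_near_origin
begin

text \<open>\<open>PB\<close> carries all the integrals; \<open>Gx\<close> is \<open>F + \<lambda>\<close> on it, and \<open>BC\<close> collects the functions
  that may be integrated over it without further ado.\<close>

definition PB :: "plane set" where "PB = P \<inter> ball 0 \<delta>"

lemma open_PB: "open PB" and bounded_PB: "bounded PB"
  by (auto simp: PB_def open_P bounded_Int)

lemma PB_D:
  assumes "x \<in> PB"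
  shows "x \<in> P" "x \<in> Ks" "x \<in> \<Omega>" "0 < fst x" "0 < snd x" "norm x < \<delta>" "x \<in> Uo" "fst x \<le> \<delta>" "snd x \<le> \<delta>"
proof -
  show x: "x \<in> P" "norm x < \<delta>" using assms by (auto simp: PB_def)
  show f: "0 < fst x" "0 < snd x" using P_fst[OF x(1)] P_snd[OF x(1)] by auto
  show K: "x \<in> Ks" using x f by (simp add: half_plane_def)
  show "x \<in> \<Omega>" using Ks_Omega[OF K] .
  show "x \<in> Uo" using x f by (simp add: Uo_def)
  show "fst x \<le> \<delta>" "snd x \<le> \<delta>" using Ks_fst[OF K] Ks_snd[OF K] by auto
qed

definition Gx :: "plane \<Rightarrow> real" where "Gx x = Fx (t x, snd x) + lamx (snd x)"

definition BC :: "(plane \<Rightarrow> real) \<Rightarrow> bool" where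
  "BC f \<longleftrightarrow> continuous_on PB f \<and> (\<exists>B. \<forall>x\<in>PB. \<bar>f x\<bar> \<le> B)"

lemma BC_I: "continuous_on PB f \<Longrightarrow> (\<And>x. x \<in> PB \<Longrightarrow> \<bar>f x\<bar> \<le> B) \<Longrightarrow> BC f"
  unfolding BC_def by blast

lemma BC_add: assumes "BC f" "BC k" shows "BC (\<lambda>x. f x + k x)"
proof -
  obtain B C where "\<forall>x\<in>PB. \<bar>f x\<bar> \<le> B" "\<forall>x\<in>PB. \<bar>k x\<bar> \<le> C" using assms by (auto simp: BC_def)
  then show ?thesis
    using assms by (intro BC_I[where B = "B + C"] continuous_on_add)
      (auto simp: BC_def intro!: order.trans[OF abs_triangle_ineq] add_mono)
qed

lemma BC_mult: assumes "BC f" "BC k" shows "BC (\<lambda>x. f x * k x)"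
proof -
  obtain B C where BC: "\<forall>x\<in>PB. \<bar>f x\<bar> \<le> B" "\<forall>x\<in>PB. \<bar>k x\<bar> \<le> C" using assms by (auto simp: BC_def)
  have "\<bar>f x * k x\<bar> \<le> \<bar>B\<bar> * \<bar>C\<bar>" if "x \<in> PB" for x
    unfolding abs_mult using BC that by (intro mult_mono) (auto intro: order.trans[OF _ abs_ge_self])
  then show ?thesis
    using assms by (intro BC_I[where B = "\<bar>B\<bar> * \<bar>C\<bar>"] continuous_on_mult) (auto simp: BC_def)
qed

lemma BC_const: "BC (\<lambda>x. c)"
  by (rule BC_I[of _ "\<bar>c\<bar>"]) auto

lemma BC_diff: assumes "BC f" "BC k" shows "BC (\<lambda>x. f x - k x)"
  using BC_add[OF assms(1) BC_mult[OF BC_const[of "-1"] assms(2)]] by simp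

lemma BC_cong: "BC f \<Longrightarrow> (\<And>x. x \<in> PB \<Longrightarrow> f x = k x) \<Longrightarrow> BC k"
  unfolding BC_def by (metis (no_types, lifting) continuous_on_cong)

lemma BC_of_continuous:
  assumes "continuous_on Ks f" shows "BC f"
proof -
  have "bounded (f ` Ks)" by (intro compact_imp_bounded compact_continuous_image assms compact_Ks)
  then obtain B where "\<forall>y\<in>f ` Ks. norm y \<le> B" unfolding bounded_iff by blast
  moreover have "PB \<subseteq> Ks" using PB_D(2) by blast
  ultimately show ?thesis
    by (intro BC_I[where B = B] continuous_on_subset[OF assms]) (auto simp: subset_iff)
qed

lemma BC_fst: "BC fst" and BC_snd: "BC snd"
  by (intro BC_of_continuous continuous_intros)+

lemma continuous_pair: "continuous_on PB (\<lambda>x. (t x, snd x))"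
  by (intro continuous_intros continuous_on_subset[OF continuous_t]) (auto simp: PB_def)

lemma pair_in_D: "(\<lambda>x. (t x, snd x)) ` PB \<subseteq> D"
  using P_in_D PB_D(1) by blast

lemma BC_H: "BC Hx" and BC_inv_H: "BC (\<lambda>x. 1 / Hx x)"
proof -
  have c: "continuous_on PB Hx"
    using continuous_on_compose2[OF continuous_on_H continuous_pair pair_in_D] by simp
  have b: "cH \<le> Hx x" "Hx x \<le> CH" if "x \<in> PB" for x using P_bounds PB_D(1,2)[OF that] by auto
  show "BC Hx" by (rule BC_I[OF c, of CH]) (use b cH in fastforce)
  have "\<bar>1 / Hx x\<bar> \<le> 1 / cH" if "x \<in> PB" for x
    using b(1)[OF that] cH by (auto intro!: divide_left_mono simp: abs_if)
  moreover have "continuous_on PB (\<lambda>x. 1 / Hx x)"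
    using b(1) cH by (intro continuous_intros c) fastforce
  ultimately show "BC (\<lambda>x. 1 / Hx x)" by (rule BC_I[rotated])
qed

lemma BC_t: "BC t"
  using P_bounds(3) PB_D(1,2) t_nonneg
  by (intro BC_I[where B = Mt] continuous_on_subset[OF continuous_t]) (auto simp: PB_def)

lemma BC_Gx: "BC Gx"
proof -
  have 1: "BC (\<lambda>x. Fx (t x, snd x))"
  proof (rule BC_I[where B = "Mt / cH"])
    show "continuous_on PB (\<lambda>x. Fx (t x, snd x))"
      using continuous_on_compose2[OF continuous_on_Fx continuous_pair pair_in_D] by simp
    fix x assume x: "x \<in> PB"
    have "0 \<le> Fx (t x, snd x) \<and> Fx (t x, snd x) \<le> t x / cH"
      by (rule Fx_bounds[OF P_in_D[OF PB_D(1)[OF x]] t_nonneg cH P_bounds(1)[OF PB_D(1,2)[OF x]]])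
    moreover have "t x / cH \<le> Mt / cH"
      using P_bounds(3)[OF PB_D(1,2)[OF x]] cH by (intro divide_right_mono) auto
    ultimately show "\<bar>Fx (t x, snd x)\<bar> \<le> Mt / cH" by linarith
  qed
  have S: "{0..\<delta>} \<subseteq> S" using in_S \<delta>_less by auto
  have "bounded (lamx ` {0..\<delta>})"
    by (intro compact_imp_bounded compact_continuous_image continuous_on_subset[OF continuous_on_lamx S]) auto
  then obtain B where B: "\<forall>y\<in>lamx ` {0..\<delta>}. norm y \<le> B" unfolding bounded_iff by blast
  have sub: "snd ` PB \<subseteq> {0..\<delta>}"
  proof (rule image_subsetI)
    fix x assume "x \<in> PB"
    then show "snd x \<in> {0..\<delta>}" using PB_D(5,9)[of x] by simp
  qed
  have 2: "BC (\<lambda>x. lamx (snd x))"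
  proof (rule BC_I[where B = B])
    show "continuous_on PB (\<lambda>x. lamx (snd x))"
      using sub by (intro continuous_on_compose2[OF continuous_on_subset[OF continuous_on_lamx S]] continuous_intros) auto
    show "\<bar>lamx (snd x)\<bar> \<le> B" if "x \<in> PB" for x using B sub that by auto
  qed
  show ?thesis unfolding Gx_def by (rule BC_add[OF 1 2])
qed

lemma BC_u: "BC u"
  by (intro BC_of_continuous continuous_on_subset[OF continuous disc_subset])

lemma continuous_Du_PB: "continuous_on PB Du"
  by (rule continuous_on_subset[OF continuous_Du]) (auto simp: PB_def)

lemma BC_Du_div: "BC (\<lambda>x. fst (Du x) / fst x)" "BC (\<lambda>x. snd (Du x) / fst x)"
proof -
  have *: "norm (Du x) / fst x \<le> L" if "x \<in> PB" for x
    using P_bounds(4)[OF PB_D(1,2)[OF that]] PB_D(4)[OF that] by (simp add: field_simps)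
  have "\<bar>fst (Du x) / fst x\<bar> \<le> L" "\<bar>snd (Du x) / fst x\<bar> \<le> L" if x: "x \<in> PB" for x
  proof -
    have "\<bar>fst (Du x)\<bar> / fst x \<le> norm (Du x) / fst x" "\<bar>snd (Du x)\<bar> / fst x \<le> norm (Du x) / fst x"
      using norm_fst_le[of "fst (Du x)" "snd (Du x)"] norm_snd_le[of "snd (Du x)" "fst (Du x)"] PB_D(4)[OF x]
      by (auto intro!: divide_right_mono)
    then show "\<bar>fst (Du x) / fst x\<bar> \<le> L" "\<bar>snd (Du x) / fst x\<bar> \<le> L"
      using *[OF x] PB_D(4)[OF x] by (auto simp: abs_divide intro: order.trans)
  qed
  moreover have "continuous_on PB (\<lambda>x. fst (Du x) / fst x)" "continuous_on PB (\<lambda>x. snd (Du x) / fst x)"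
    using PB_D(4) by (intro continuous_intros continuous_Du_PB; fastforce)+
  ultimately show "BC (\<lambda>x. fst (Du x) / fst x)" "BC (\<lambda>x. snd (Du x) / fst x)"
    by (blast intro: BC_I)+
qed

lemma BC_Du: "BC (\<lambda>x. fst (Du x))" "BC (\<lambda>x. snd (Du x))"
  by (rule BC_cong[OF BC_mult[OF BC_fst BC_Du_div(1)]] BC_cong[OF BC_mult[OF BC_fst BC_Du_div(2)]];
      use PB_D(4) in fastforce)+

lemmas BC_intros = BC_add BC_mult BC_diff BC_const BC_fst BC_snd BC_H BC_inv_H BC_t BC_Gx BC_u BC_Du_div BC_Du

lemma BC_measurable: "BC f \<Longrightarrow> (\<lambda>x. indicator PB x * f x) \<in> borel_measurable borel"
  and BC_integrable: "BC f \<Longrightarrow> integrable lborel (\<lambda>x. indicator PB x * f x)"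
proof -
  assume "BC f"
  then obtain B where c: "continuous_on PB f" and B: "\<And>x. x \<in> PB \<Longrightarrow> \<bar>f x\<bar> \<le> B"
    unfolding BC_def by blast
  show "(\<lambda>x. indicator PB x * f x) \<in> borel_measurable borel" "integrable lborel (\<lambda>x. indicator PB x * f x)"
    by (rule integrable_bounded_open[OF open_PB bounded_PB c B]; assumption)+
qed

text \<open>The coordinate axes are null sets. Off them such a point lies in \<open>Uo\<close>,
  where \<open>AE_Du_eq_0\<close> applies, and \<open>u = 0\<close> outside
  \<open>P\<close>.\<close>

lemma AE_off_PB:
  "AE x in lebesgue. x \<in> half_plane \<inter> upper \<longrightarrow> norm x < \<delta> \<longrightarrow> x \<notin> PB \<longrightarrow>
     x \<in> Uo \<and> Du x = 0 \<and> u x = 0"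
proof -
  have n: "{x::plane. x \<bullet> (1, 0) = 0} \<in> null_sets lebesgue" "{x::plane. x \<bullet> (0, 1) = 0} \<in> null_sets lebesgue"
    unfolding negligible_iff_null_sets[symmetric]
    by (rule negligible_standard_hyperplane, simp add: Basis_prod_def)+
  from AE_not_in[OF n(1)] AE_not_in[OF n(2)] AE_Du_eq_0 show ?thesis
  proof eventually_elim
    case (elim x)
    show ?case
    proof (intro impI)
      assume x: "x \<in> half_plane \<inter> upper" "norm x < \<delta>" "x \<notin> PB"
      then have "fst x > 0" "snd x > 0"
        using elim(1,2) by (auto simp: half_plane_def upper_def inner_prod_def less_le)
      then have U: "x \<in> Uo" using x by (simp add: Uo_def)
      moreover have nP: "x \<notin> P" using x by (simp add: PB_def)
      moreover have "x \<in> \<Omega>" using U Uo_Ks disc_subset by blast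
      ultimately show "x \<in> Uo \<and> Du x = 0 \<and> u x = 0"
        using elim(3) P_iff[of x] nonneg[of x] by force
    qed
  qed
qed

lemma Uo_in_S: "x \<in> Uo \<Longrightarrow> snd x \<in> S" "x \<in> Uo \<Longrightarrow> 0 \<le> snd x"
proof -
  assume x: "x \<in> Uo"
  then show "0 \<le> snd x" by (simp add: Uo_def)
  have "x \<in> Ks" using x Uo_Ks by blast
  then show "snd x \<in> S" using Ks_snd[of x] \<delta>_less \<open>0 \<le> snd x\<close> by (intro in_S) auto
qed

text \<open>At \<open>t = 0\<close> both \<open>F\<close> and its derivative in \<open>s\<close>
  vanish, and \<open>d1F\<close> always comes multiplied by \<open>Du\<close> or \<open>t\<close>.
  So every integrand of the variation formula is zero at such points.\<close>

lemma zero_gradient_values: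
  assumes "x \<in> Uo" "Du x = 0" "u x = 0"
  shows "t x = 0" "F_fun g \<rho>0 p (t x) (snd x) = 0" "d2F g \<rho>0 p (t x) (snd x) = 0"
    "indicator (pos_set u) x = (0::real)"
proof -
  show t0: "t x = 0" using assms by (simp add: tq_def)
  show "F_fun g \<rho>0 p (t x) (snd x) = 0" by (simp add: t0 F_fun_def)
  show "d2F g \<rho>0 p (t x) (snd x) = 0"
    unfolding t0 using d2F_eq[OF zero_in_D[OF Uo_in_S(1)[OF assms(1)]] Uo_in_S(2)[OF assms(1)]] by simp
  show "indicator (pos_set u) x = (0::real)" using assms by (simp add: pos_set_def)
qed

lemma PB_values:
  assumes x: "x \<in> PB"
  shows "F_fun g \<rho>0 p (t x) (snd x) + lam g \<rho>0 p (snd x) * indicator (pos_set u) x = Gx x"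
    "d1F g \<rho>0 p (t x) (snd x) = 1 / Hx x"
    "d2F g \<rho>0 p (t x) (snd x) + dlam g \<rho>0 p (snd x) * indicator (pos_set u) x = Hx x / \<rho>0\<^sup>2"
    "indicator (pos_set u) x = (1::real)"
proof -
  have D: "(t x, snd x) \<in> D" using P_in_D PB_D(1)[OF x] by blast
  have s: "0 \<le> snd x" "snd x < s_star g \<rho>0 p" using P_snd[OF PB_D(1)[OF x]] by auto
  show i: "indicator (pos_set u) x = (1::real)" using PB_D(1)[OF x] by (simp add: P_def)
  show "F_fun g \<rho>0 p (t x) (snd x) + lam g \<rho>0 p (snd x) * indicator (pos_set u) x = Gx x"
    by (simp add: i Gx_def F_eq_Fx[OF D] lam_eq[OF D_in_S[OF D]])
  show "d1F g \<rho>0 p (t x) (snd x) = 1 / Hx x" by (rule d1F_eq[OF D t_nonneg])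
  show "d2F g \<rho>0 p (t x) (snd x) + dlam g \<rho>0 p (snd x) * indicator (pos_set u) x = Hx x / \<rho>0\<^sup>2"
    unfolding i d2F_eq[OF D s(1)] dlam_eq[OF s] using rho0_pos by (simp add: field_simps power2_eq_square)
qed

lemma set_integral_PB:
  fixes f F :: "plane \<Rightarrow> real"
  assumes F: "BC F" and A: "A \<inter> upper \<subseteq> \<Omega>" "PB \<subseteq> A"
    and eq: "\<And>x. x \<in> PB \<Longrightarrow> f x = F x"
    and off: "\<And>x. x \<in> A \<inter> upper \<Longrightarrow> x \<in> Uo \<Longrightarrow> Du x = 0 \<Longrightarrow> u x = 0 \<Longrightarrow> f x = 0"
    and far: "\<And>x. x \<in> A \<inter> upper \<Longrightarrow> \<delta> \<le> norm x \<Longrightarrow> f x = 0"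
  shows "(LINT x:A \<inter> upper|lebesgue. f x) = (\<integral>x. indicator PB x * F x \<partial>lborel)"
proof (rule set_integral_cong_lborel[OF BC_measurable[OF F]])
  show "AE x in lebesgue. indicator (A \<inter> upper) x * f x = indicator PB x * F x"
    using AE_off_PB
  proof eventually_elim
    case (elim x)
    have PU: "PB \<subseteq> upper" using PB_D(5) by (auto simp: upper_def less_imp_le)
    consider "x \<in> PB" | "x \<notin> PB" "x \<in> A \<inter> upper" "norm x < \<delta>" | "x \<notin> PB" "x \<in> A \<inter> upper" "\<delta> \<le> norm x"
      | "x \<notin> PB" "x \<notin> A \<inter> upper" by linarith
    then show ?case
    proof cases
      case 1
      then have "x \<in> A \<inter> upper" using A(2) PU by blast
      then show ?thesis using 1 eq[OF 1] by simp
    next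
      case 2
      then have "x \<in> half_plane" using A Omega_half_plane[of x] by (auto simp: half_plane_def)
      then show ?thesis using 2 elim off by auto
    qed (use far in auto)
  qed
qed

lemma domain_variation_P:
  assumes C: "C1_0 \<Omega> \<phi> \<phi>'" and axis: "\<And>x. x \<in> \<Omega> \<Longrightarrow> fst x = 0 \<Longrightarrow> fst (\<phi> x) = 0"
    and far: "\<And>x. x \<in> \<Omega> \<Longrightarrow> \<delta> \<le> norm x \<Longrightarrow> \<phi> x = 0" "\<And>x v. x \<in> \<Omega> \<Longrightarrow> \<delta> \<le> norm x \<Longrightarrow> \<phi>' x v = 0"
  shows "(\<integral>x. indicator PB x * (fst x * Gx x * (fst (\<phi>' x (1, 0)) + snd (\<phi>' x (0, 1)))
      - 2 * (1 / Hx x * (1 / fst x) * (Du x \<bullet> \<phi>' x (Du x)))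
      + (Gx x - 2 * (1 / Hx x) * t x) * fst (\<phi> x) + fst x * (Hx x / \<rho>0\<^sup>2) * snd (\<phi> x)) \<partial>lborel) = 0"
proof -
  have C1: "(\<phi> has_derivative \<phi>' x) (at x within \<Omega>)" if "x \<in> \<Omega>" for x
    using C that by (auto simp: C1_0_def C1_on_def)
  have "continuous_on Ks (\<lambda>x. \<phi>' x v)" for v
  proof -
    have "continuous_on \<Omega> (\<lambda>x. \<phi>' x v)" using C unfolding C1_0_def C1_on_def by blast
    then show ?thesis using disc_subset by (rule continuous_on_subset)
  qed
  then have BC1: "BC (\<lambda>x. fst (\<phi>' x v))" "BC (\<lambda>x. snd (\<phi>' x v))" for v
    by (intro BC_of_continuous continuous_intros; assumption)+
  have "continuous_on \<Omega> \<phi>" using C1 by (rule has_derivative_continuous_on)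
  then have "continuous_on Ks \<phi>" using disc_subset by (rule continuous_on_subset)
  then have BC2: "BC (\<lambda>x. fst (\<phi> x))" "BC (\<lambda>x. snd (\<phi> x))"
    by (intro BC_of_continuous continuous_intros; assumption)+
  have lin: "\<phi>' x (Du x) = fst (Du x) *\<^sub>R \<phi>' x (1, 0) + snd (Du x) *\<^sub>R \<phi>' x (0, 1)" if "x \<in> \<Omega>" for x
  proof -
    have l: "linear (\<phi>' x)" using has_derivative_bounded_linear[OF C1[OF that]] bounded_linear.linear by blast
    show ?thesis by (rule linear_plane[OF l])
  qed
  \<comment> \<open>The weight \<open>1 / x_1\<close> is attached to one of the two factors
    \<open>Du\<close>; the quotient is bounded by \<open>L\<close>.\<close>
  have BCq: "BC (\<lambda>x. 1 / Hx x * (1 / fst x) * (Du x \<bullet> \<phi>' x (Du x)))"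
  proof (rule BC_cong)
    show "BC (\<lambda>x. 1 / Hx x * (fst (Du x) / fst x * (fst (Du x) * fst (\<phi>' x (1, 0)) + snd (Du x) * fst (\<phi>' x (0, 1)))
       + snd (Du x) / fst x * (fst (Du x) * snd (\<phi>' x (1, 0)) + snd (Du x) * snd (\<phi>' x (0, 1)))))"
      by (intro BC_intros BC1)
    show "1 / Hx x * (fst (Du x) / fst x * (fst (Du x) * fst (\<phi>' x (1, 0)) + snd (Du x) * fst (\<phi>' x (0, 1)))
       + snd (Du x) / fst x * (fst (Du x) * snd (\<phi>' x (1, 0)) + snd (Du x) * snd (\<phi>' x (0, 1)))) =
       1 / Hx x * (1 / fst x) * (Du x \<bullet> \<phi>' x (Du x))" if "x \<in> PB" for x
      unfolding lin[OF PB_D(3)[OF that]] by (simp add: inner_prod_def divide_inverse algebra_simps)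
  qed
  have BCH: "BC (\<lambda>x. Hx x / \<rho>0\<^sup>2)" using BC_mult[OF BC_const[of "1 / \<rho>0\<^sup>2"] BC_H] by simp
  define F1 F2 F3 F4 where "F1 x = fst x * Gx x * (fst (\<phi>' x (1, 0)) + snd (\<phi>' x (0, 1)))"
    and "F2 x = 1 / Hx x * (1 / fst x) * (Du x \<bullet> \<phi>' x (Du x))"
    and "F3 x = (Gx x - 2 * (1 / Hx x) * t x) * fst (\<phi> x)"
    and "F4 x = fst x * (Hx x / \<rho>0\<^sup>2) * snd (\<phi> x)" for x
  have BF: "BC F1" "BC F2" "BC F3" "BC F4"
    unfolding F1_def F2_def F3_def F4_def by (intro BC_intros BC1 BC2 BCq BCH)+
  have PO: "PB \<subseteq> \<Omega>" using PB_D(3) by blast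
  let ?f1 = "\<lambda>x. fst x * (F_fun g \<rho>0 p (t x) (snd x) + lam g \<rho>0 p (snd x) * indicator (pos_set u) x)
      * (fst (\<phi>' x (1, 0)) + snd (\<phi>' x (0, 1)))"
  have I1: "(LINT x:\<Omega> \<inter> upper|lebesgue. ?f1 x) = (\<integral>x. indicator PB x * F1 x \<partial>lborel)"
  proof (rule set_integral_PB[OF BF(1) _ PO])
    show "?f1 x = F1 x" if "x \<in> PB" for x
      unfolding F1_def PB_values(1)[OF that] ..
    show "?f1 x = 0" if "x \<in> \<Omega> \<inter> upper" "x \<in> Uo" "Du x = 0" "u x = 0" for x
      using zero_gradient_values[OF that(2-4)] that(3) by simp
    show "?f1 x = 0" if "x \<in> \<Omega> \<inter> upper" "\<delta> \<le> norm x" for x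
      using that by (simp add: far)
  qed simp
  let ?f2 = "\<lambda>x. d1F g \<rho>0 p (t x) (snd x) * (1 / fst x) * (Du x \<bullet> \<phi>' x (Du x))"
  have I2: "(LINT x:\<Omega> \<inter> upper|lebesgue. ?f2 x) = (\<integral>x. indicator PB x * F2 x \<partial>lborel)"
  proof (rule set_integral_PB[OF BF(2) _ PO])
    show "?f2 x = F2 x" if "x \<in> PB" for x
      unfolding F2_def PB_values(2)[OF that] ..
    show "?f2 x = 0" if "x \<in> \<Omega> \<inter> upper" "x \<in> Uo" "Du x = 0" "u x = 0" for x
      using zero_gradient_values[OF that(2-4)] that(3) by simp
    show "?f2 x = 0" if "x \<in> \<Omega> \<inter> upper" "\<delta> \<le> norm x" for x
      using that by (simp add: far)
  qed simp
  let ?f3 = "\<lambda>x. (F_fun g \<rho>0 p (t x) (snd x) - 2 * d1F g \<rho>0 p (t x) (snd x) * t x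
      + lam g \<rho>0 p (snd x) * indicator (pos_set u) x) * fst (\<phi> x)"
  have I3: "(LINT x:\<Omega> \<inter> upper|lebesgue. ?f3 x) = (\<integral>x. indicator PB x * F3 x \<partial>lborel)"
  proof (rule set_integral_PB[OF BF(3) _ PO])
    show "?f3 x = F3 x" if "x \<in> PB" for x
      proof -
      have "F_fun g \<rho>0 p (t x) (snd x) - 2 * (1 / Hx x) * t x + lam g \<rho>0 p (snd x) * indicator (pos_set u) x
          = Gx x - 2 * (1 / Hx x) * t x" unfolding PB_values(1)[OF that, symmetric] by simp
      then show ?thesis unfolding PB_values(2)[OF that] F3_def by (rule arg_cong)
    qed
    show "?f3 x = 0" if "x \<in> \<Omega> \<inter> upper" "x \<in> Uo" "Du x = 0" "u x = 0" for x
      using zero_gradient_values[OF that(2-4)] that(3) by simp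
    show "?f3 x = 0" if "x \<in> \<Omega> \<inter> upper" "\<delta> \<le> norm x" for x
      using that by (simp add: far)
  qed simp
  let ?f4 = "\<lambda>x. fst x * (d2F g \<rho>0 p (t x) (snd x) + dlam g \<rho>0 p (snd x) * indicator (pos_set u) x) * snd (\<phi> x)"
  have I4: "(LINT x:\<Omega> \<inter> upper|lebesgue. ?f4 x) = (\<integral>x. indicator PB x * F4 x \<partial>lborel)"
  proof (rule set_integral_PB[OF BF(4) _ PO])
    show "?f4 x = F4 x" if "x \<in> PB" for x
      unfolding F4_def PB_values(3)[OF that] ..
    show "?f4 x = 0" if "x \<in> \<Omega> \<inter> upper" "x \<in> Uo" "Du x = 0" "u x = 0" for x
      using zero_gradient_values[OF that(2-4)] that(3) by simp
    show "?f4 x = 0" if "x \<in> \<Omega> \<inter> upper" "\<delta> \<le> norm x" for x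
      using that by (simp add: far)
  qed simp
  have "0 = (\<integral>x. indicator PB x * F1 x \<partial>lborel) - 2 * (\<integral>x. indicator PB x * F2 x \<partial>lborel)
      + (\<integral>x. indicator PB x * F3 x \<partial>lborel) + (\<integral>x. indicator PB x * F4 x \<partial>lborel)"
    by (rule domain_variation[OF C, unfolded I1 I2 I3 I4]) (rule axis)
  moreover have "(\<integral>x. indicator PB x * (F1 x - 2 * F2 x + F3 x + F4 x) \<partial>lborel) =
     (\<integral>x. indicator PB x * F1 x \<partial>lborel) - 2 * (\<integral>x. indicator PB x * F2 x \<partial>lborel)
      + (\<integral>x. indicator PB x * F3 x \<partial>lborel) + (\<integral>x. indicator PB x * F4 x \<partial>lborel)"
  proof -
    note i = BC_integrable[OF BF(1)] BC_integrable[OF BF(2)] BC_integrable[OF BF(3)] BC_integrable[OF BF(4)]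
    have "(\<lambda>x. indicator PB x * (F1 x - 2 * F2 x + F3 x + F4 x)) =
        (\<lambda>x. indicator PB x * F1 x - 2 * (indicator PB x * F2 x) + indicator PB x * F3 x + indicator PB x * F4 x)"
      by (simp add: fun_eq_iff algebra_simps)
    then show ?thesis using i by simp
  qed
  ultimately show ?thesis unfolding F1_def F2_def F3_def F4_def by simp
qed


section \<open>Radial variations\<close>

lemma BC_abs: "BC f \<Longrightarrow> BC (\<lambda>x. \<bar>f x\<bar>)"
  unfolding BC_def by (auto intro: continuous_on_rabs)

lemma BC_radial:
  fixes e :: "real \<Rightarrow> real"
  assumes "continuous_on UNIV e" shows "BC (\<lambda>x. e (x \<bullet> x))"
  by (intro BC_of_continuous continuous_on_compose2[OF assms]) (auto intro!: continuous_intros)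

lemma inner_plane: "x \<bullet> y = fst x * fst y + snd x * snd y" for x y :: plane
  by (simp add: inner_prod_def)

lemma norm_less_inner: "norm x < \<delta> \<longleftrightarrow> x \<bullet> x < \<delta>\<^sup>2" for x :: plane
  unfolding dot_square_norm using \<delta>_pos
  by (metis less_imp_le norm_ge_zero power2_less_imp_less power_strict_mono zero_less_numeral)

lemma has_derivative_inner_self: "((\<lambda>x. x \<bullet> x) has_derivative (\<lambda>v. 2 * (x \<bullet> v))) (at x)" for x :: plane
  by (rule has_derivative_eq_rhs[OF has_derivative_inner[OF has_derivative_ident has_derivative_ident]])
     (simp add: fun_eq_iff inner_commute)

lemma radial_has_derivative:
  fixes x :: plane
  assumes "\<And>w. (e has_real_derivative e' w) (at w)"
  shows "((\<lambda>x. e (x \<bullet> x)) has_derivative (\<lambda>v. e' (x \<bullet> x) * (2 * (x \<bullet> v)))) (at x)"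
  using has_derivative_compose[OF has_derivative_inner_self assms[unfolded has_field_derivative_def]] .

text \<open>The first component of the field \<open>e(|x|^2) x\<close> vanishes on the axis, as
  required. The \<open>3\<close> is the divergence \<open>2\<close> of \<open>x\<close> plus
  \<open>1\<close> from the term with \<open>fst \<phi>\<close>; the \<open>4\<close> is
  \<open>2\<close> from the quadratic form in \<open>Du\<close> plus \<open>2\<close> from that same
  term.\<close>

lemma radial_variation:
  fixes e e' :: "real \<Rightarrow> real"
  assumes der: "\<And>w. (e has_real_derivative e' w) (at w)" and cont: "continuous_on UNIV e'"
    and c: "c < \<delta>\<^sup>2" and zero: "\<And>w. c \<le> w \<Longrightarrow> e w = 0" "\<And>w. c \<le> w \<Longrightarrow> e' w = 0"
  shows "(\<integral>x. indicator PB x *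
      (e (x \<bullet> x) * (3 * (fst x * Gx x) - 4 * (fst x * t x * (1 / Hx x)) + fst x * snd x * (Hx x / \<rho>0\<^sup>2))
       + e' (x \<bullet> x) * (2 * (x \<bullet> x) * (fst x * Gx x) - 4 * (1 / Hx x * (1 / fst x) * (x \<bullet> Du x)\<^sup>2))) \<partial>lborel) = 0"
proof -
  define \<phi> where "\<phi> x = e (x \<bullet> x) *\<^sub>R x" for x :: plane
  define \<phi>' where "\<phi>' x v = e (x \<bullet> x) *\<^sub>R v + (e' (x \<bullet> x) * (2 * (x \<bullet> v))) *\<^sub>R x" for x v :: plane
  have ce: "continuous_on UNIV e" using der by (meson DERIV_isCont continuous_at_imp_continuous_on)
  have D: "(\<phi> has_derivative \<phi>' x) (at x)" for x
    unfolding \<phi>_def[abs_def] \<phi>'_def[abs_def]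
    by (rule has_derivative_scaleR[OF radial_has_derivative[OF der] has_derivative_ident])
  have Dc: "continuous_on UNIV (\<lambda>x. \<phi>' x v)" for v
    unfolding \<phi>'_def
    by (intro continuous_intros continuous_on_compose2[OF ce] continuous_on_compose2[OF cont]) auto
  \<comment> \<open>The support may touch the axis \<open>x_1 = 0\<close>; it stays inside the
    circle of radius \<open>\<delta>\<close> because \<open>c < \<delta>\<^sup>2\<close>.\<close>
  define K where "K = Ks \<inter> {x. x \<bullet> x \<le> c}"
  have K: "compact K"
    unfolding K_def by (intro compact_Int_closed compact_Ks closed_Collect_le continuous_intros)
  have KO: "K \<subseteq> \<Omega>" using disc_subset by (auto simp: K_def)
  have z: "e (x \<bullet> x) = 0" "e' (x \<bullet> x) = 0" if "\<delta> \<le> norm x" for x :: plane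
    using that norm_less_inner[of x] c by (auto intro!: zero)
  have off: "\<phi> x = 0" if "x \<in> \<Omega> - K" for x
  proof (cases "norm x < \<delta>")
    case True
    then have "x \<in> Ks" using that Omega_half_plane[of x] by (simp add: half_plane_def)
    then have "c \<le> x \<bullet> x" using that by (auto simp: K_def)
    then show ?thesis by (simp add: \<phi>_def zero)
  qed (simp add: \<phi>_def z)
  have "C1_0 \<Omega> \<phi> \<phi>'"
    unfolding C1_0_def C1_on_def using D Dc K KO off
    by (meson continuous_on_subset has_derivative_at_withinI subset_UNIV)
  from domain_variation_P[OF this]
  have "(\<integral>x. indicator PB x * (fst x * Gx x * (fst (\<phi>' x (1, 0)) + snd (\<phi>' x (0, 1)))
      - 2 * (1 / Hx x * (1 / fst x) * (Du x \<bullet> \<phi>' x (Du x)))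
      + (Gx x - 2 * (1 / Hx x) * t x) * fst (\<phi> x) + fst x * (Hx x / \<rho>0\<^sup>2) * snd (\<phi> x)) \<partial>lborel) = 0"
    by (simp add: \<phi>_def \<phi>'_def z)
  moreover have "indicator PB x * (fst x * Gx x * (fst (\<phi>' x (1, 0)) + snd (\<phi>' x (0, 1)))
      - 2 * (1 / Hx x * (1 / fst x) * (Du x \<bullet> \<phi>' x (Du x)))
      + (Gx x - 2 * (1 / Hx x) * t x) * fst (\<phi> x) + fst x * (Hx x / \<rho>0\<^sup>2) * snd (\<phi> x)) =
     indicator PB x *
      (e (x \<bullet> x) * (3 * (fst x * Gx x) - 4 * (fst x * t x * (1 / Hx x)) + fst x * snd x * (Hx x / \<rho>0\<^sup>2))
       + e' (x \<bullet> x) * (2 * (x \<bullet> x) * (fst x * Gx x) - 4 * (1 / Hx x * (1 / fst x) * (x \<bullet> Du x)\<^sup>2)))" for x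
  proof (cases "x \<in> PB")
    case True
    define E E' h where "E = e (x \<bullet> x)" and "E' = e' (x \<bullet> x)" and "h = 1 / Hx x"
    have f: "fst x > 0" using PB_D(4)[OF True] .
    have 1: "fst (\<phi>' x (1, 0)) + snd (\<phi>' x (0, 1)) = 2 * E + 2 * E' * (x \<bullet> x)"
      by (simp add: \<phi>'_def E_def E'_def inner_plane algebra_simps)
    have 2: "Du x \<bullet> \<phi>' x (Du x) = E * (Du x \<bullet> Du x) + 2 * E' * (x \<bullet> Du x)\<^sup>2"
      by (simp add: \<phi>'_def E_def E'_def inner_add_right inner_commute power2_eq_square)
    have 3: "(1 / fst x) * (Du x \<bullet> Du x) = fst x * t x"
      using f by (simp add: tq_def dot_square_norm power2_eq_square)
    have "h * (1 / fst x) * (E * (Du x \<bullet> Du x) + 2 * E' * (x \<bullet> Du x)\<^sup>2) =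
        h * E * ((1 / fst x) * (Du x \<bullet> Du x)) + 2 * E' * (h * (1 / fst x) * (x \<bullet> Du x)\<^sup>2)"
      by (simp add: algebra_simps)
    then have 4: "h * (1 / fst x) * (Du x \<bullet> \<phi>' x (Du x)) = h * E * (fst x * t x) + 2 * E' * (h * (1 / fst x) * (x \<bullet> Du x)\<^sup>2)"
      unfolding 2 3 .
    have 5: "fst (\<phi> x) = E * fst x" "snd (\<phi> x) = E * snd x" by (simp_all add: \<phi>_def E_def)
    show ?thesis
      unfolding 1 5 E_def[symmetric] E'_def[symmetric] h_def[symmetric] 4
      by (simp add: algebra_simps)
  qed simp
  ultimately show ?thesis by (simp only:)
qed

lemma ifK_continuous_integrable:
  fixes f :: "plane \<Rightarrow> real"
  assumes "compact K" "continuous_on K f"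
  shows "integrable lborel (\<lambda>x. indicator K x * f x)" "(\<lambda>x. indicator K x * f x) \<in> borel_measurable borel"
proof -
  show i: "integrable lborel (\<lambda>x. indicator K x * f x)"
    using borel_integrable_compact[OF assms] by (simp add: set_integrable_def)
  then show "(\<lambda>x. indicator K x * f x) \<in> borel_measurable borel" by auto
qed

section \<open>The weak equation and the energy identity\<close>

definition D2u :: "plane \<Rightarrow> plane \<Rightarrow> plane" where
  "D2u = (SOME D2. C1_on P Du D2)"

lemma D2u: "x \<in> P \<Longrightarrow> (Du has_derivative D2u x) (at x)" "continuous_on P (\<lambda>x. D2u x v)"
proof -
  have "C1_on P Du D2u" unfolding D2u_def using C2(2) unfolding P_def by (rule someI_ex)
  then show "x \<in> P \<Longrightarrow> (Du has_derivative D2u x) (at x)" "continuous_on P (\<lambda>x. D2u x v)"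
    using at_within_open[OF _ open_P] unfolding C1_on_def by (metis, blast)
qed

definition td :: "plane \<Rightarrow> plane \<Rightarrow> real" where
  "td x v = (2 * (Du x \<bullet> D2u x v) * (fst x)\<^sup>2 - (Du x \<bullet> Du x) * (2 * fst x * fst v)) / ((fst x)\<^sup>2 * (fst x)\<^sup>2)"

lemma t_has_derivative: assumes x: "x \<in> P" shows "(t has_derivative td x) (at x)"
proof -
  have 1: "((\<lambda>x. Du x \<bullet> Du x) has_derivative (\<lambda>v. 2 * (Du x \<bullet> D2u x v))) (at x)"
    by (rule has_derivative_eq_rhs[OF has_derivative_inner[OF D2u(1)[OF x] D2u(1)[OF x]]])
       (simp add: fun_eq_iff inner_commute)
  have 2: "((\<lambda>x::plane. (fst x)\<^sup>2) has_derivative (\<lambda>v. 2 * fst x * fst v)) (at x)"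
    unfolding power2_eq_square
    by (rule has_derivative_eq_rhs[OF has_derivative_mult[OF has_derivative_fst has_derivative_fst]])
       (auto intro!: has_derivative_ident simp: fun_eq_iff)
  have "(\<lambda>x. (Du x \<bullet> Du x) / (fst x)\<^sup>2) = t"
    by (simp add: fun_eq_iff tq_def dot_square_norm)
  moreover have "(fst x)\<^sup>2 \<noteq> 0" using P_fst[OF x] by simp
  ultimately show ?thesis
    using has_derivative_divide'[OF 1 2] unfolding td_def[abs_def] by simp
qed

text \<open>The terms with \<open>H 0 (snd x)\<close> from \<open>F\<close> and from
  \<open>lam\<close> cancel. What remains of the explicit dependence on \<open>x_2\<close> is, up to
  the weight \<open>x_1\<close>, the coefficient of \<open>snd \<phi>\<close> in the variation
  formula.\<close>

lemma Gx_has_derivative: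
  assumes x: "x \<in> P"
  shows "(Gx has_derivative (\<lambda>v. td x v / Hx x + Hx x / \<rho>0\<^sup>2 * snd v)) (at x)"
proof -
  have D: "(t x, snd x) \<in> D" using P_in_D[OF x] .
  have 1: "((\<lambda>x. Fx (t x, snd x)) has_derivative
      (\<lambda>v. fst (td x v, snd v) / Hx x + (Hx x - H 0 (snd x)) / \<rho>0\<^sup>2 * snd (td x v, snd v))) (at x)"
    by (rule has_derivative_compose[OF has_derivative_Pair[OF t_has_derivative[OF x]
          has_derivative_snd[OF has_derivative_ident]] Fx_has_derivative[OF D]])
  have 2: "((\<lambda>x. lamx (snd x)) has_derivative (\<lambda>v. (1 / \<rho>0 - (\<rho>0 - H 0 (snd x)) / \<rho>0\<^sup>2) * snd v)) (at x)"
    by (rule has_derivative_compose[OF has_derivative_snd[OF has_derivative_ident]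
          lamx_has_derivative[OF D_in_S[OF D], unfolded has_field_derivative_def]])
  have c: "(Hx x - H 0 (snd x)) / \<rho>0\<^sup>2 + (1 / \<rho>0 - (\<rho>0 - H 0 (snd x)) / \<rho>0\<^sup>2) = Hx x / \<rho>0\<^sup>2"
    using rho0_pos by (simp add: field_simps power2_eq_square)
  show ?thesis
    unfolding Gx_def[abs_def]
  proof (rule has_derivative_eq_rhs[OF has_derivative_add[OF 1 2]])
    show "(\<lambda>v. fst (td x v, snd v) / Hx x + (Hx x - H 0 (snd x)) / \<rho>0\<^sup>2 * snd (td x v, snd v)
        + (1 / \<rho>0 - (\<rho>0 - H 0 (snd x)) / \<rho>0\<^sup>2) * snd v) = (\<lambda>v. td x v / Hx x + Hx x / \<rho>0\<^sup>2 * snd v)"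
      unfolding c[symmetric] by (simp add: fun_eq_iff distrib_right)
  qed
qed

lemma BC_continuous: "BC f \<Longrightarrow> continuous_on PB f"
  by (simp add: BC_def)

text \<open>The integral of the divergence of \<open>x_1 Gx \<phi>\<close>. Subtracted from the
  domain variation formula it removes the divergence of \<open>\<phi>\<close> and leaves only terms
  with the factor \<open>1 / H\<close>.\<close>

lemma integral_divergence_PB:
  fixes \<phi> :: "plane \<Rightarrow> plane"
  assumes der: "\<forall>x\<in>PB. (\<phi> has_derivative \<phi>' x) (at x)"
    and cont: "\<And>v. continuous_on PB (\<lambda>x. \<phi>' x v)"
    and K: "compact K" "K \<subseteq> PB" and zero: "\<forall>x. x \<notin> K \<longrightarrow> \<phi> x = 0"
  shows "(\<integral>x. indicator K x * (fst x * Gx x * (fst (\<phi>' x (1, 0)) + snd (\<phi>' x (0, 1)))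
     + Gx x * fst (\<phi> x) + fst x * (td x (\<phi> x) / Hx x + Hx x / \<rho>0\<^sup>2 * snd (\<phi> x))) \<partial>lborel) = 0"
proof -
  have PBP: "PB \<subseteq> P" by (auto simp: PB_def)
  have cDu: "continuous_on PB Du" by (rule continuous_Du_PB)
  have cD2: "continuous_on PB (\<lambda>x. D2u x v)" for v by (rule continuous_on_subset[OF D2u(2) PBP])
  have cG: "continuous_on PB Gx" and cHx: "continuous_on PB Hx"
    using BC_Gx BC_H by (auto simp: BC_def)
  have cf: "continuous_on PB \<phi>"
    using der has_derivative_continuous continuous_at_imp_continuous_on by blast
  have f0: "fst x \<noteq> 0" and H0: "Hx x \<noteq> 0" if "x \<in> PB" for x
    using PB_D(4)[OF that] P_bounds(1)[OF PB_D(1,2)[OF that]] cH by auto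
  define Gd where "Gd x v = fst x * (td x v / Hx x + Hx x / \<rho>0\<^sup>2 * snd v) + fst v * Gx x" for x v
  have DG: "((\<lambda>x. fst x * Gx x) has_derivative Gd x) (at x)" if "x \<in> PB" for x
    unfolding Gd_def[abs_def] using that PBP
    by (intro has_derivative_mult has_derivative_fst has_derivative_ident Gx_has_derivative) auto
  have ctd: "continuous_on PB (\<lambda>x. td x v)" for v
    unfolding td_def using f0 by (intro continuous_intros cDu cD2) auto
  have cGd: "continuous_on PB (\<lambda>x. Gd x v)" for v
    unfolding Gd_def using H0 rho0_pos by (intro continuous_intros ctd cG cHx) auto
  have part: "integrable lborel (\<lambda>x. indicator K x * (fst x * Gx x * pr (\<phi>' x e) + Gd x e * pr (\<phi> x))) \<and>
      (\<integral>x. indicator K x * (fst x * Gx x * pr (\<phi>' x e) + Gd x e * pr (\<phi> x)) \<partial>lborel) = 0"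
    if pr: "bounded_linear pr" and e: "e = (1, 0) \<or> e = (0, 1)" for pr e
  proof -
    define f where "f x = fst x * Gx x * pr (\<phi> x)" for x
    define f' where "f' x v = fst x * Gx x * pr (\<phi>' x v) + Gd x v * pr (\<phi> x)" for x v
    have Df: "\<forall>x\<in>PB. (f has_derivative f' x) (at x)"
      unfolding f_def[abs_def] f'_def[abs_def] using der
      by (auto intro!: has_derivative_mult DG bounded_linear.has_derivative[OF pr])
    have cf': "continuous_on PB (\<lambda>x. f' x v)" for v
      unfolding f'_def
      by (intro continuous_intros cG cGd bounded_linear.continuous_on[OF pr] cont cf)
    have fz: "\<forall>x. x \<notin> K \<longrightarrow> f x = 0"
      using zero linear_0[OF bounded_linear.linear[OF pr]] by (simp add: f_def)
    note ext = C1_extend[OF open_PB Df cf' K fz]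
    have z: "\<forall>x v. x \<notin> K \<longrightarrow> (if x \<in> K then f' x v else 0) = 0"
      by (intro allI impI) (rule if_not_P)
    note I = integral_partial_derivative_eq_0[OF ext(1,2) K(1) fz z]
    have "(\<integral>x. (if x \<in> K then f' x e else 0) \<partial>lborel) = 0"
      using e I by (elim disjE) (simp_all only:)
    moreover have eq: "(\<lambda>x. if x \<in> K then f' x e else 0) =
        (\<lambda>x. indicator K x * (fst x * Gx x * pr (\<phi>' x e) + Gd x e * pr (\<phi> x)))"
      by (simp add: fun_eq_iff f'_def)
    moreover have "integrable lborel (\<lambda>x. if x \<in> K then f' x e else 0)"
      by (rule integrable_compact_support[OF K(1) continuous_on_subset[OF ext(2) subset_UNIV]]) (rule if_not_P)
    ultimately show ?thesis by simp
  qed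
  have p1: "integrable lborel (\<lambda>x. indicator K x * (fst x * Gx x * fst (\<phi>' x (1, 0)) + Gd x (1, 0) * fst (\<phi> x)))"
      "(\<integral>x. indicator K x * (fst x * Gx x * fst (\<phi>' x (1, 0)) + Gd x (1, 0) * fst (\<phi> x)) \<partial>lborel) = 0"
    using part[OF bounded_linear_fst, of "(1, 0)"] by simp_all
  have p2: "integrable lborel (\<lambda>x. indicator K x * (fst x * Gx x * snd (\<phi>' x (0, 1)) + Gd x (0, 1) * snd (\<phi> x)))"
      "(\<integral>x. indicator K x * (fst x * Gx x * snd (\<phi>' x (0, 1)) + Gd x (0, 1) * snd (\<phi> x)) \<partial>lborel) = 0"
    using part[OF bounded_linear_snd, of "(0, 1)"] by simp_all
  have "(\<integral>x. indicator K x * (fst x * Gx x * fst (\<phi>' x (1, 0)) + Gd x (1, 0) * fst (\<phi> x))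
      + indicator K x * (fst x * Gx x * snd (\<phi>' x (0, 1)) + Gd x (0, 1) * snd (\<phi> x)) \<partial>lborel) = 0"
    using Bochner_Integration.integral_add[OF p1(1) p2(1)] p1(2) p2(2) by simp
  moreover have "indicator K x * (fst x * Gx x * fst (\<phi>' x (1, 0)) + Gd x (1, 0) * fst (\<phi> x))
      + indicator K x * (fst x * Gx x * snd (\<phi>' x (0, 1)) + Gd x (0, 1) * snd (\<phi> x)) =
     indicator K x * (fst x * Gx x * (fst (\<phi>' x (1, 0)) + snd (\<phi>' x (0, 1)))
     + Gx x * fst (\<phi> x) + fst x * (td x (\<phi> x) / Hx x + Hx x / \<rho>0\<^sup>2 * snd (\<phi> x)))" for x
  proof (cases "x \<in> K")
    case True
    then have x: "x \<in> PB" using K by blast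
    have "linear (Gd x)"
      using has_derivative_bounded_linear[OF DG[OF x]] by (rule bounded_linear.linear)
    from linear_plane[OF this, of "\<phi> x"]
    have "Gd x (1, 0) * fst (\<phi> x) + Gd x (0, 1) * snd (\<phi> x) = Gd x (\<phi> x)"
      by (simp add: mult.commute)
    then show ?thesis using True unfolding Gd_def by (simp add: algebra_simps)
  qed simp
  ultimately show ?thesis by (simp only:)
qed


text \<open>A linear map on the plane is determined by its values on two vectors, so continuity in
  fixed directions suffices.\<close>

lemma continuous_linear_apply:
  fixes A :: "plane \<Rightarrow> plane \<Rightarrow> 'b::real_normed_vector"
  assumes "\<forall>x\<in>B. linear (A x)" "\<And>v. continuous_on B (\<lambda>x. A x v)" "continuous_on B w"
  shows "continuous_on B (\<lambda>x. A x (w x))"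
proof (rule continuous_on_eq)
  show "continuous_on B (\<lambda>x. fst (w x) *\<^sub>R A x (1, 0) + snd (w x) *\<^sub>R A x (0, 1))"
    by (intro continuous_intros assms)
  show "fst (w x) *\<^sub>R A x (1, 0) + snd (w x) *\<^sub>R A x (0, 1) = A x (w x)" if "x \<in> B" for x
    using linear_plane[of "A x" "w x"] assms(1) that by simp
qed

lemma continuous_on_K_bounded:
  fixes f :: "plane \<Rightarrow> real"
  assumes "compact K" "continuous_on K f"
  obtains B where "\<And>x. x \<in> K \<Longrightarrow> \<bar>f x\<bar> \<le> B" "B \<ge> 0"
proof -
  have "bounded (f ` K)" by (intro compact_imp_bounded compact_continuous_image assms)
  then obtain c where c: "\<forall>y\<in>f ` K. norm y \<le> c" unfolding bounded_iff by blast
  have "\<bar>f x\<bar> \<le> \<bar>c\<bar>" if "x \<in> K" for x using c that by fastforce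
  then show ?thesis using that[of "\<bar>c\<bar>"] by simp
qed

text \<open>Variations \<open>\<phi> = \<psi> Du / (|Du|\<^sup>2 + k)\<close> turn the domain variation formula into the weak form of
  the equation tested with \<open>\<psi>\<close>; letting \<open>k\<close> tend to \<open>0\<close> handles the critical points of \<open>u\<close>.\<close>

lemma weak_equation_approx:
  fixes \<psi> :: "plane \<Rightarrow> real"
  assumes der\<psi>: "\<forall>x\<in>PB. (\<psi> has_derivative \<psi>' x) (at x)"
    and cont\<psi>: "\<And>v. continuous_on PB (\<lambda>x. \<psi>' x v)"
    and K: "compact K" "K \<subseteq> PB" and zero: "\<forall>x. x \<notin> K \<longrightarrow> \<psi> x = 0" and k: "k > 0"
  shows "(\<integral>x. indicator K x * (1 / Hx x * (1 / fst x) * (\<psi>' x (Du x) * ((Du x \<bullet> Du x) / (Du x \<bullet> Du x + k))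
     + 2 * \<psi> x * (Du x \<bullet> D2u x (Du x)) * (k / (Du x \<bullet> Du x + k)\<^sup>2))) \<partial>lborel) = 0"
proof -
  have PBP: "PB \<subseteq> P" by (auto simp: PB_def)
  define N where "N x = Du x \<bullet> Du x + k" for x
  have N: "N x > 0" for x unfolding N_def using k by (simp add: add_nonneg_pos)
  have DDu: "(Du has_derivative D2u x) (at x)" if "x \<in> PB" for x using D2u(1) PBP that by blast
  have DN: "(N has_derivative (\<lambda>v. 2 * (Du x \<bullet> D2u x v))) (at x)" if "x \<in> PB" for x
    unfolding N_def[abs_def]
    by (rule has_derivative_eq_rhs[OF has_derivative_add[OF has_derivative_inner[OF DDu[OF that] DDu[OF that]] has_derivative_const]])
       (simp add: fun_eq_iff inner_commute)
  define \<phi> where "\<phi> x = (\<psi> x / N x) *\<^sub>R Du x" for x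
  define \<phi>' where "\<phi>' x v = (\<psi> x / N x) *\<^sub>R D2u x v + ((\<psi>' x v * N x - \<psi> x * (2 * (Du x \<bullet> D2u x v))) / (N x * N x)) *\<^sub>R Du x" for x v
  have D\<phi>: "\<forall>x\<in>PB. (\<phi> has_derivative \<phi>' x) (at x)"
  proof
    fix x assume x: "x \<in> PB"
    have "N x \<noteq> 0" using N[of x] by simp
    from has_derivative_divide'[OF der\<psi>[rule_format, OF x] DN[OF x] this]
    show "(\<phi> has_derivative \<phi>' x) (at x)"
      unfolding \<phi>_def[abs_def] \<phi>'_def[abs_def] by (rule has_derivative_scaleR[OF _ DDu[OF x]])
  qed
  have cDu: "continuous_on PB Du" by (rule continuous_Du_PB)
  have cD2: "continuous_on PB (\<lambda>x. D2u x v)" for v by (rule continuous_on_subset[OF D2u(2) PBP])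
  have c\<psi>: "continuous_on PB \<psi>"
    using der\<psi> has_derivative_continuous continuous_at_imp_continuous_on by blast
  have cN: "continuous_on PB N" unfolding N_def by (intro continuous_intros cDu)
  have N0: "N x \<noteq> 0" for x using N[of x] by simp
  have cG: "continuous_on PB Gx" and cHx: "continuous_on PB Hx"
    using BC_Gx BC_H by (auto simp: BC_def)
  have f0: "fst x \<noteq> 0" and H0: "Hx x \<noteq> 0" if "x \<in> PB" for x
    using PB_D(4)[OF that] P_bounds(1)[OF PB_D(1,2)[OF that]] cH by auto
  have c\<phi>': "continuous_on PB (\<lambda>x. \<phi>' x v)" for v
    unfolding \<phi>'_def using N0 by (intro continuous_intros cDu cD2 c\<psi> cont\<psi> cN) auto
  have c\<phi>: "continuous_on PB \<phi>"
    unfolding \<phi>_def using N0 by (intro continuous_intros cDu c\<psi> cN) auto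
  have z\<phi>: "\<forall>x. x \<notin> K \<longrightarrow> \<phi> x = 0" using zero by (simp add: \<phi>_def)
  note ext = C1_extend[OF open_PB D\<phi> c\<phi>' K z\<phi>]
  define \<phi>'' where "\<phi>'' x v = (if x \<in> K then \<phi>' x v else 0)" for x v
  have KO: "K \<subseteq> \<Omega>" using K(2) PB_D(3) by blast
  have C10: "C1_0 \<Omega> \<phi> \<phi>''"
  proof -
    have "(\<phi> has_derivative \<phi>'' x) (at x)" "continuous_on UNIV (\<lambda>x. \<phi>'' x v)" for x v
      unfolding \<phi>''_def by (rule ext)+
    then show ?thesis
      unfolding C1_0_def C1_on_def using K(1) KO z\<phi>
      by (meson DiffD2 continuous_on_subset has_derivative_at_withinI subset_UNIV)
  qed
  have notK: "x \<notin> K" if "fst x = 0 \<or> \<delta> \<le> norm x" for x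
    using PB_D(4)[of x] PB_D(6)[of x] K(2) that by fastforce
  let ?E1 = "\<lambda>\<phi>' x. fst x * Gx x * (fst (\<phi>' x (1, 0)) + snd (\<phi>' x (0, 1)))
      - 2 * (1 / Hx x * (1 / fst x) * (Du x \<bullet> \<phi>' x (Du x)))
      + (Gx x - 2 * (1 / Hx x) * t x) * fst (\<phi> x) + fst x * (Hx x / \<rho>0\<^sup>2) * snd (\<phi> x)"
  let ?E2 = "\<lambda>x. fst x * Gx x * (fst (\<phi>' x (1, 0)) + snd (\<phi>' x (0, 1)))
     + Gx x * fst (\<phi> x) + fst x * (td x (\<phi> x) / Hx x + Hx x / \<rho>0\<^sup>2 * snd (\<phi> x))"
  have "(\<integral>x. indicator PB x * ?E1 \<phi>'' x \<partial>lborel) = 0"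
    by (rule domain_variation_P[OF C10]) (use notK z\<phi> in \<open>auto simp: \<phi>''_def\<close>)
  moreover have "indicator PB x * ?E1 \<phi>'' x = indicator K x * ?E1 \<phi>' x" for x
  proof (cases "x \<in> K")
    case True
    then have "x \<in> PB" using K by blast
    then show ?thesis using True by (simp add: \<phi>''_def)
  next
    case False
    then have "\<phi> x = 0" using z\<phi> by blast
    then show ?thesis using False by (simp add: \<phi>''_def)
  qed
  ultimately have I1: "(\<integral>x. indicator K x * ?E1 \<phi>' x \<partial>lborel) = 0" by (simp only:)
  have I2: "(\<integral>x. indicator K x * ?E2 x \<partial>lborel) = 0"
    by (rule integral_divergence_PB[OF D\<phi> c\<phi>' K z\<phi>])
  have lin\<phi>': "\<forall>x\<in>PB. linear (\<phi>' x)" and linD2: "\<forall>x\<in>PB. linear (D2u x)"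
    using D\<phi> DDu has_derivative_bounded_linear bounded_linear.linear by blast+
  have ct: "continuous_on PB t" by (rule BC_continuous[OF BC_t])
  have c1: "continuous_on PB (?E1 \<phi>')"
    by (intro continuous_intros cG cHx ct c\<phi>' c\<phi> cDu continuous_linear_apply[OF lin\<phi>' c\<phi>' cDu])
      (use f0 H0 rho0_pos in simp_all)
  have c2: "continuous_on PB ?E2"
    unfolding td_def
    by (intro continuous_intros cG cHx c\<phi>' c\<phi> cDu continuous_linear_apply[OF linD2 cD2 c\<phi>])
      (use f0 H0 rho0_pos in simp_all)
  note i1 = ifK_continuous_integrable(1)[OF K(1) continuous_on_subset[OF c1 K(2)]]
  note i2 = ifK_continuous_integrable(1)[OF K(1) continuous_on_subset[OF c2 K(2)]]
  \<comment> \<open>The difference of the two identities is \<open>- 2\<close> times the weak form;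
    the factor normalises it.\<close>
  have "(\<integral>x. (- 1 / 2) * (indicator K x * ?E1 \<phi>' x - indicator K x * ?E2 x) \<partial>lborel) = 0"
    using Bochner_Integration.integral_diff[OF i1 i2] I1 I2 by simp
  moreover have "(- 1 / 2) * (indicator K x * ?E1 \<phi>' x - indicator K x * ?E2 x) =
      indicator K x * (1 / Hx x * (1 / fst x) * (\<psi>' x (Du x) * ((Du x \<bullet> Du x) / N x)
        + 2 * \<psi> x * (Du x \<bullet> D2u x (Du x)) * (k / (N x)\<^sup>2)))" for x
  proof (cases "x \<in> K")
    case True
    then have x: "x \<in> PB" using K by blast
    have f: "fst x > 0" using PB_D(4)[OF x] .
    define h where "h = 1 / Hx x"
    have D2\<phi>: "D2u x (\<phi> x) = (\<psi> x / N x) *\<^sub>R D2u x (Du x)"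
      using linD2 x unfolding \<phi>_def by (simp add: linear_scale)
    define q s a where "q = Du x \<bullet> D2u x (Du x)" and "s = Du x \<bullet> Du x" and "a = \<psi>' x (Du x)"
    \<comment> \<open>Both terms produce \<open>\<psi> q / N\<close>, and differentiating
      \<open>1 / N\<close> takes off \<open>2 \<psi> q s / N^2\<close>. As \<open>N - s = k\<close>,
      only a multiple of \<open>k\<close> is left.\<close>
    have A: "Du x \<bullet> \<phi>' x (Du x) + Du x \<bullet> D2u x (\<phi> x) = a * (s / N x) + 2 * \<psi> x * q * (k / (N x)\<^sup>2)"
    proof -
      have "Du x \<bullet> \<phi>' x (Du x) + Du x \<bullet> D2u x (\<phi> x) =
          (\<psi> x / N x) * q + (a * N x - \<psi> x * (2 * q)) / (N x * N x) * s + (\<psi> x / N x) * q"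
        by (simp add: D2\<phi> \<phi>'_def inner_add_right q_def s_def a_def)
      also have "\<dots> = a * (s / N x) + 2 * \<psi> x * q * ((N x - s) / (N x)\<^sup>2)"
        using N0[of x] by (simp add: field_simps power2_eq_square)
      also have "N x - s = k" by (simp add: N_def s_def)
      finally show ?thesis .
    qed
    \<comment> \<open>Differentiating the weight in \<open>t = |Du|^2 / x_1^2\<close> produces
      exactly the term that cancels the contribution of \<open>fst \<phi>\<close> to the variation
      formula.\<close>
    have td: "fst x * td x (\<phi> x) = 2 * (1 / fst x) * (Du x \<bullet> D2u x (\<phi> x)) - 2 * t x * fst (\<phi> x)"
      using f unfolding td_def tq_def dot_square_norm by (simp add: field_simps power2_eq_square)
    have "?E1 \<phi>' x - ?E2 x = - 2 * (h * (1 / fst x) * (Du x \<bullet> \<phi>' x (Du x))) - 2 * h * t x * fst (\<phi> x) - h * (fst x * td x (\<phi> x))"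
      unfolding h_def by (simp add: algebra_simps)
    also have "\<dots> = - 2 * (h * (1 / fst x) * (Du x \<bullet> \<phi>' x (Du x) + Du x \<bullet> D2u x (\<phi> x)))"
      unfolding td by (simp add: algebra_simps)
    finally have E: "?E1 \<phi>' x - ?E2 x = - 2 * (h * (1 / fst x) * (a * (s / N x) + 2 * \<psi> x * q * (k / (N x)\<^sup>2)))"
      unfolding A .
    have "(- 1 / 2) * (indicator K x * ?E1 \<phi>' x - indicator K x * ?E2 x) = (- 1 / 2) * (?E1 \<phi>' x - ?E2 x)"
      using True by simp
    also have "\<dots> = h * (1 / fst x) * (a * (s / N x) + 2 * \<psi> x * q * (k / (N x)\<^sup>2))"
      unfolding E by simp
    finally show ?thesis using True unfolding h_def a_def s_def q_def by simp
  qed simp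
  ultimately show ?thesis unfolding N_def by (simp only:)
qed

text \<open>Dominated convergence as \<open>k\<close> tends to \<open>0\<close>. Since
  \<open>q\<close> is quadratic in \<open>Du\<close>, with \<open>d = |Du|^2\<close> the error term
  is at most a constant times \<open>d k / (d + k)^2\<close>, which is at most \<open>1\<close>. At
  critical points of \<open>u\<close> the integrand and its limit are both zero.\<close>

lemma weak_equation:
  fixes \<psi> :: "plane \<Rightarrow> real"
  assumes der\<psi>: "\<forall>x\<in>PB. (\<psi> has_derivative \<psi>' x) (at x)"
    and cont\<psi>: "\<And>v. continuous_on PB (\<lambda>x. \<psi>' x v)"
    and K: "compact K" "K \<subseteq> PB" and zero: "\<forall>x. x \<notin> K \<longrightarrow> \<psi> x = 0"
  shows "(\<integral>x. indicator K x * (1 / Hx x * (1 / fst x) * \<psi>' x (Du x)) \<partial>lborel) = 0"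
proof -
  have PBP: "PB \<subseteq> P" by (auto simp: PB_def)
  have cDu: "continuous_on PB Du" by (rule continuous_Du_PB)
  have cD2: "continuous_on PB (\<lambda>x. D2u x v)" for v by (rule continuous_on_subset[OF D2u(2) PBP])
  have c\<psi>: "continuous_on PB \<psi>"
    using der\<psi> has_derivative_continuous continuous_at_imp_continuous_on by blast
  have cHx: "continuous_on PB Hx" using BC_H by (auto simp: BC_def)
  have f0: "fst x \<noteq> 0" and H0: "Hx x \<noteq> 0" if "x \<in> PB" for x
    using PB_D(4)[OF that] P_bounds(1)[OF PB_D(1,2)[OF that]] cH by auto
  have lin\<psi>: "\<forall>x\<in>PB. linear (\<psi>' x)" and linD2: "\<forall>x\<in>PB. linear (D2u x)"
    using der\<psi> D2u(1) PBP has_derivative_bounded_linear bounded_linear.linear by blast+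
  define A where "A x = 1 / Hx x * (1 / fst x) * \<psi>' x (Du x)" for x
  define q where "q x = Du x \<bullet> D2u x (Du x)" for x
  define C where "C x = 1 / Hx x * (1 / fst x) * (2 * \<psi> x)" for x
  define Z where "Z x = norm (D2u x (1, 0)) + norm (D2u x (0, 1))" for x
  have cA: "continuous_on PB A" unfolding A_def using f0 H0
    by (intro continuous_intros cHx continuous_linear_apply[OF lin\<psi> cont\<psi> cDu]) auto
  have cq: "continuous_on PB q" unfolding q_def
    by (intro continuous_intros cDu continuous_linear_apply[OF linD2 cD2 cDu])
  have cC: "continuous_on PB C" unfolding C_def using f0 H0 by (intro continuous_intros cHx c\<psi>) auto
  have cZ: "continuous_on PB Z" unfolding Z_def by (intro continuous_intros cD2)
  obtain B1 where B1: "\<And>x. x \<in> K \<Longrightarrow> \<bar>A x\<bar> \<le> B1" "B1 \<ge> 0"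
    by (rule continuous_on_K_bounded[OF K(1) continuous_on_subset[OF cA K(2)]]) (rule that)
  obtain B2 where B2: "\<And>x. x \<in> K \<Longrightarrow> \<bar>C x * Z x\<bar> \<le> B2" "B2 \<ge> 0"
    by (rule continuous_on_K_bounded[OF K(1) continuous_on_subset[OF continuous_on_mult[OF cC cZ] K(2)]]) (rule that)
  define s where "s k x = A x * ((Du x \<bullet> Du x) / (Du x \<bullet> Du x + k)) + C x * q x * (k / (Du x \<bullet> Du x + k)\<^sup>2)" for k x
  have I: "(\<integral>x. indicator K x * s k x \<partial>lborel) = 0" if k: "k > 0" for k
  proof -
    have "s k x = 1 / Hx x * (1 / fst x) * (\<psi>' x (Du x) * ((Du x \<bullet> Du x) / (Du x \<bullet> Du x + k))
     + 2 * \<psi> x * (Du x \<bullet> D2u x (Du x)) * (k / (Du x \<bullet> Du x + k)\<^sup>2))" for x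
      unfolding s_def A_def C_def q_def by (simp add: algebra_simps)
    then show ?thesis using weak_equation_approx[OF der\<psi> cont\<psi> K zero k] by (simp only:)
  qed
  have "(\<lambda>n. \<integral>x. indicator K x * s (inverse (real (Suc n))) x \<partial>lborel) \<longlonglongrightarrow> (\<integral>x. indicator K x * A x \<partial>lborel)"
  proof (rule integral_dominated_convergence)
    show "integrable lborel (\<lambda>x. indicator K x * (B1 + B2))"
      by (rule ifK_continuous_integrable(1)[OF K(1)]) (intro continuous_intros)
    show "(\<lambda>x. indicator K x * A x) \<in> borel_measurable lborel"
      using ifK_continuous_integrable(2)[OF K(1) continuous_on_subset[OF cA K(2)]] by simp
    fix n
    define k where "k = inverse (real (Suc n))"
    have k: "k > 0" unfolding k_def by (rule inverse_Suc_seq)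
    have N: "Du x \<bullet> Du x + k > 0" for x using k by (simp add: add_nonneg_pos)
    have N0: "Du x \<bullet> Du x + k \<noteq> 0" for x using N[of x] by simp
    have "continuous_on PB (s k)" unfolding s_def using N0
      by (intro continuous_intros cA cC cq cDu) auto
    then show "(\<lambda>x. indicator K x * s (inverse (real (Suc n))) x) \<in> borel_measurable lborel"
      using ifK_continuous_integrable(2)[OF K(1) continuous_on_subset[OF _ K(2)]] by (simp add: k_def)
    show "AE x in lborel. norm (indicator K x * s (inverse (real (Suc n))) x) \<le> indicator K x * (B1 + B2)"
    proof (rule AE_I2)
      fix x
      show "norm (indicator K x * s (inverse (real (Suc n))) x) \<le> indicator K x * (B1 + B2)"
      proof (cases "x \<in> K")
        case True
        then have x: "x \<in> PB" using K by blast
        define d where "d = Du x \<bullet> Du x"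
        have d: "d \<ge> 0" "d + k > 0" using N[of x] by (auto simp: d_def)
        have r1: "0 \<le> d / (d + k)" "d / (d + k) \<le> 1" using d k by auto
        have r2: "\<bar>d / (d + k)\<bar> \<le> 1" using r1 by linarith
        have t1: "\<bar>A x * (d / (d + k))\<bar> \<le> B1 * 1"
          unfolding abs_mult by (intro mult_mono B1(1)[OF True] B1(2) r2) auto
        have "\<bar>q x\<bar> \<le> d * Z x"
        proof -
          have "norm (D2u x (Du x)) \<le> norm (Du x) * Z x"
          proof -
            have "D2u x (Du x) = fst (Du x) *\<^sub>R D2u x (1, 0) + snd (Du x) *\<^sub>R D2u x (0, 1)"
              using linD2 x by (intro linear_plane) auto
            then have "norm (D2u x (Du x)) \<le> \<bar>fst (Du x)\<bar> * norm (D2u x (1, 0)) + \<bar>snd (Du x)\<bar> * norm (D2u x (0, 1))"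
              by (metis norm_scaleR norm_triangle_ineq)
            also have "\<dots> \<le> norm (Du x) * norm (D2u x (1, 0)) + norm (Du x) * norm (D2u x (0, 1))"
              using norm_fst_le[of "fst (Du x)" "snd (Du x)"] norm_snd_le[of "snd (Du x)" "fst (Du x)"]
              by (intro add_mono mult_right_mono) auto
            finally show ?thesis by (simp add: Z_def distrib_left)
          qed
          then have "norm (Du x) * norm (D2u x (Du x)) \<le> norm (Du x) * (norm (Du x) * Z x)"
            by (rule mult_left_mono) simp
          moreover have "\<bar>q x\<bar> \<le> norm (Du x) * norm (D2u x (Du x))" unfolding q_def by (rule Cauchy_Schwarz_ineq2)
          ultimately show ?thesis by (simp add: d_def dot_square_norm power2_eq_square mult.assoc)
        qed
        then have "\<bar>C x * q x * (k / (d + k)\<^sup>2)\<bar> \<le> \<bar>C x\<bar> * (d * Z x) * (k / (d + k)\<^sup>2)"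
          unfolding abs_mult using k d by (intro mult_mono) auto
        also have "\<dots> = \<bar>C x * Z x\<bar> * (d * k / (d + k)\<^sup>2)"
          by (simp add: abs_mult Z_def)
        also have "\<dots> \<le> B2 * 1"
        proof (intro mult_mono B2(1)[OF True] B2(2))
          have "d * k \<le> (d + k)\<^sup>2" using d k by (simp add: power2_eq_square algebra_simps)
          then show "d * k / (d + k)\<^sup>2 \<le> 1" using d by (simp add: divide_le_eq_1)
        qed (use d k in auto)
        finally have "\<bar>s k x\<bar> \<le> B1 + B2" using t1 unfolding s_def d_def[symmetric] by linarith
        then show ?thesis using True by (simp add: k_def)
      qed simp
    qed
  next
    show "AE x in lborel. (\<lambda>n. indicator K x * s (inverse (real (Suc n))) x) \<longlonglongrightarrow> indicator K x * A x"
    proof (rule AE_I2)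
      fix x
      show "(\<lambda>n. indicator K x * s (inverse (real (Suc n))) x) \<longlonglongrightarrow> indicator K x * A x"
      proof (cases "x \<in> K")
        case True
        then have x: "x \<in> PB" using K by blast
        show ?thesis
        proof (cases "Du x = 0")
          case True
          have "A x = 0" "q x = 0"
            using lin\<psi> x True by (auto simp: A_def q_def linear_0)
          then show ?thesis by (simp add: s_def)
        next
          case False
          define d where "d = Du x \<bullet> Du x"
          have d: "d > 0" using False by (simp add: d_def)
          have "(\<lambda>n. indicator K x * s (inverse (real (Suc n))) x) \<longlonglongrightarrow>
             indicator K x * (A x * (d / (d + 0)) + C x * q x * (0 / (d + 0)\<^sup>2))"
            unfolding s_def d_def[symmetric] using d
            by (intro tendsto_intros inverse_Suc_seq) auto
          then show ?thesis using d by simp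
        qed
      qed simp
    qed
  qed
  moreover have "(\<lambda>n. \<integral>x. indicator K x * s (inverse (real (Suc n))) x \<partial>lborel) = (\<lambda>n. 0)"
    by (intro ext I inverse_Suc_seq)
  ultimately have "(\<lambda>n. 0) \<longlonglongrightarrow> (\<integral>x. indicator K x * A x \<partial>lborel)" by (simp only:)
  then have "(\<integral>x. indicator K x * A x \<partial>lborel) = 0" by (rule LIMSEQ_unique) (rule tendsto_const)
  then show ?thesis unfolding A_def .
qed

text \<open>The test function \<open>cutoff \<epsilon> (u x) * e (x \<bullet> x)\<close> is
  supported away from the free boundary and the axis, as \<open>u = 0\<close> on both. For
  \<open>\<epsilon>\<close> tending to \<open>0\<close>, \<open>cutoff\<close> tends to
  \<open>u\<close> and \<open>cutoff'\<close> to \<open>1\<close> on \<open>PB\<close>.\<close>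

lemma energy_identity:
  fixes e e' :: "real \<Rightarrow> real"
  assumes der: "\<And>w. (e has_real_derivative e' w) (at w)" and cont: "continuous_on UNIV e'"
    and c: "c < \<delta>\<^sup>2" and zero: "\<And>w. c \<le> w \<Longrightarrow> e w = 0"
  shows "(\<integral>x. indicator PB x * (e (x \<bullet> x) * (fst x * t x * (1 / Hx x))
     + e' (x \<bullet> x) * (2 * u x * (1 / Hx x) * ((x \<bullet> Du x) / fst x))) \<partial>lborel) = 0"
proof -
  have ce: "continuous_on UNIV e" using der by (meson DERIV_isCont continuous_at_imp_continuous_on)
  define \<psi>0 where "\<psi>0 x = e (x \<bullet> x)" for x :: plane
  define \<psi>0' where "\<psi>0' x v = e' (x \<bullet> x) * (2 * (x \<bullet> v))" for x v :: plane
  have D0: "(\<psi>0 has_derivative \<psi>0' x) (at x)" for x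
    unfolding \<psi>0_def[abs_def] \<psi>0'_def[abs_def] by (rule radial_has_derivative[OF der])
  have c0: "continuous_on UNIV (\<lambda>x. \<psi>0' x v)" for v
    unfolding \<psi>0'_def by (intro continuous_intros continuous_on_compose2[OF cont]) auto
  define K where "K = Ks \<inter> {x. x \<bullet> x \<le> c}"
  have K: "compact K"
    unfolding K_def by (intro compact_Int_closed compact_Ks closed_Collect_le continuous_intros)
  have KO: "K \<subseteq> \<Omega>" using disc_subset by (auto simp: K_def)
  have off: "\<forall>x\<in>P. x \<notin> K \<longrightarrow> \<psi>0 x = 0"
  proof (intro ballI impI)
    fix x assume x: "x \<in> P" "x \<notin> K"
    have "c \<le> x \<bullet> x"
    proof (rule ccontr)
      assume "\<not> ?thesis"
      moreover from this have "norm x < \<delta>" using norm_less_inner[of x] c by simp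
      ultimately show False using x P_fst[OF x(1)] by (simp add: K_def half_plane_def)
    qed
    then show "\<psi>0 x = 0" unfolding \<psi>0_def by (rule zero)
  qed
  define X Y where "X x = 1 / Hx x * (e' (x \<bullet> x) * (2 * ((x \<bullet> Du x) / fst x)))"
    and "Y x = e (x \<bullet> x) * (fst x * t x * (1 / Hx x))" for x
  have BXY: "BC X" "BC Y"
  proof -
    have "BC (\<lambda>x. 1 / Hx x * (e' (x \<bullet> x) * (2 * (fst x * (fst (Du x) / fst x) + snd x * (snd (Du x) / fst x)))))"
      by (intro BC_intros BC_radial cont)
    then show "BC X" unfolding X_def inner_plane by (simp add: add_divide_distrib)
    show "BC Y" unfolding Y_def by (intro BC_intros BC_radial ce)
  qed
  have approx: "(\<integral>x. indicator PB x * (cutoff \<epsilon> (u x) * X x + cutoff' \<epsilon> (u x) * Y x) \<partial>lborel) = 0" if \<epsilon>: "\<epsilon> > 0" for \<epsilon>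
  proof -
    define f where "f = (\<lambda>x. if x \<in> P then cutoff \<epsilon> (u x) * \<psi>0 x else 0)"
    define f' where "f' = (\<lambda>x v. cutoff \<epsilon> (u x) * \<psi>0' x v + cutoff' \<epsilon> (u x) * (Du x \<bullet> v) * \<psi>0 x)"
    let ?L = "{x\<in>K. \<epsilon> \<le> u x}"
    have C1: "\<forall>x\<in>P. (f has_derivative f' x) (at x)" "\<And>v. continuous_on P (\<lambda>x. f' x v)"
        "\<forall>x. x \<notin> ?L \<longrightarrow> f x = 0"
      unfolding f_def f'_def by (rule cutoff_product_C1[OF K KO \<epsilon> D0 c0 off])+
    note lev = compact_level[OF K KO \<epsilon>]
    have LPB: "?L \<subseteq> PB"
    proof
      fix x assume x: "x \<in> ?L"
      then have "x \<bullet> x < \<delta>\<^sup>2" using c by (auto simp: K_def)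
      then show "x \<in> PB" using lev(2) x norm_less_inner[of x] by (auto simp: PB_def)
    qed
    have PBP: "PB \<subseteq> P" by (auto simp: PB_def)
    have "(\<integral>x. indicator ?L x * (1 / Hx x * (1 / fst x) * f' x (Du x)) \<partial>lborel) = 0"
      by (rule weak_equation[OF _ continuous_on_subset[OF C1(2) PBP] lev(1) LPB C1(3)]) (use C1(1) PBP in blast)
    moreover have "indicator ?L x * (1 / Hx x * (1 / fst x) * f' x (Du x)) =
        indicator PB x * (cutoff \<epsilon> (u x) * X x + cutoff' \<epsilon> (u x) * Y x)" for x
    proof (cases "x \<in> PB")
      case True
      have f: "fst x > 0" using PB_D(4)[OF True] .
      have 3: "(1 / fst x) * (Du x \<bullet> Du x) = fst x * t x"
        using f by (simp add: tq_def dot_square_norm power2_eq_square)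
      have "1 / Hx x * (1 / fst x) * f' x (Du x) = cutoff \<epsilon> (u x) * X x
          + cutoff' \<epsilon> (u x) * (e (x \<bullet> x) * (1 / Hx x * ((1 / fst x) * (Du x \<bullet> Du x))))"
        unfolding f'_def X_def \<psi>0_def \<psi>0'_def by (simp add: algebra_simps)
      also have "\<dots> = cutoff \<epsilon> (u x) * X x + cutoff' \<epsilon> (u x) * Y x"
        unfolding 3 Y_def by (simp add: mult_ac)
      finally have eq: "1 / Hx x * (1 / fst x) * f' x (Du x) = cutoff \<epsilon> (u x) * X x + cutoff' \<epsilon> (u x) * Y x" .
      show ?thesis
      proof (cases "x \<in> ?L")
        case False
        have "cutoff \<epsilon> (u x) * X x + cutoff' \<epsilon> (u x) * Y x = 0"
        proof (cases "\<epsilon> \<le> u x")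
          case True
          then have "x \<notin> K" using False by simp
          then have cx: "c < x \<bullet> x" using PB_D(2)[OF \<open>x \<in> PB\<close>] by (auto simp: K_def)
          have "(e has_real_derivative 0) (at (x \<bullet> x))"
            by (rule has_field_derivative_transform_within_open[OF DERIV_const[of 0], of "{c<..}"])
               (use cx zero in auto)
          then have "e' (x \<bullet> x) = 0" by (rule DERIV_unique[OF der])
          moreover have "e (x \<bullet> x) = 0" using zero cx by simp
          ultimately show ?thesis by (simp add: X_def Y_def)
        qed (simp add: cutoff_eq_0 cutoff'_eq_0)
        then show ?thesis using False by simp
      qed (use True eq in simp)
    next
      case False
      then have "x \<notin> ?L" using LPB by blast
      then show ?thesis using False by simp
    qed
    ultimately show ?thesis by (simp only:)
  qed
  have u0: "u x > 0" if "x \<in> PB" for x using that by (auto simp: PB_def P_def pos_set_def)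
  have "(\<lambda>n. \<integral>x. indicator PB x * (cutoff (inverse (real (Suc n))) (u x) * X x
        + cutoff' (inverse (real (Suc n))) (u x) * Y x) \<partial>lborel) \<longlonglongrightarrow> (\<integral>x. indicator PB x * (u x * X x + Y x) \<partial>lborel)"
  proof (rule integral_dominated_convergence)
    show "integrable lborel (\<lambda>x. indicator PB x * (\<bar>u x * X x\<bar> + 2 * \<bar>Y x\<bar>))"
      by (intro BC_integrable BC_intros BC_abs BXY)
    show "(\<lambda>x. indicator PB x * (u x * X x + Y x)) \<in> borel_measurable lborel"
      using BC_measurable[OF BC_add[OF BC_mult[OF BC_u BXY(1)] BXY(2)]] by simp
    fix n
    define \<epsilon> where "\<epsilon> = inverse (real (Suc n))"
    have \<epsilon>: "\<epsilon> > 0" unfolding \<epsilon>_def by (rule inverse_Suc_seq)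
    have cu: "continuous_on PB u" using BC_u by (simp add: BC_def)
    have "continuous_on PB (\<lambda>x. cutoff \<epsilon> (u x) * X x + cutoff' \<epsilon> (u x) * Y x)"
      by (intro continuous_intros BC_continuous BXY continuous_on_compose2[OF continuous_cutoff[OF \<epsilon>] cu, of UNIV]
        continuous_on_compose2[OF continuous_cutoff'[OF \<epsilon>] cu, of UNIV]) auto
    then have "(\<lambda>x. indicator PB x *\<^sub>R (cutoff \<epsilon> (u x) * X x + cutoff' \<epsilon> (u x) * Y x)) \<in> borel_measurable borel"
      by (rule borel_measurable_continuous_on_indicator[OF borel_open[OF open_PB]])
    then show "(\<lambda>x. indicator PB x * (cutoff (inverse (real (Suc n))) (u x) * X x
        + cutoff' (inverse (real (Suc n))) (u x) * Y x)) \<in> borel_measurable lborel"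
      by (simp add: \<epsilon>_def)
    show "AE x in lborel. norm (indicator PB x * (cutoff (inverse (real (Suc n))) (u x) * X x
        + cutoff' (inverse (real (Suc n))) (u x) * Y x)) \<le> indicator PB x * (\<bar>u x * X x\<bar> + 2 * \<bar>Y x\<bar>)"
    proof (rule AE_I2)
      fix x
      show "norm (indicator PB x * (cutoff (inverse (real (Suc n))) (u x) * X x
        + cutoff' (inverse (real (Suc n))) (u x) * Y x)) \<le> indicator PB x * (\<bar>u x * X x\<bar> + 2 * \<bar>Y x\<bar>)"
      proof (cases "x \<in> PB")
        case True
        have "\<bar>cutoff \<epsilon> (u x)\<bar> \<le> \<bar>u x\<bar>" using cutoff_bounds[OF \<epsilon>, of "u x"] u0[OF True] by simp
        then have 1: "\<bar>cutoff \<epsilon> (u x) * X x\<bar> \<le> \<bar>u x * X x\<bar>"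
          unfolding abs_mult by (rule mult_right_mono) simp
        have 2: "\<bar>cutoff' \<epsilon> (u x) * Y x\<bar> \<le> 2 * \<bar>Y x\<bar>"
          unfolding abs_mult using cutoff'_bounds[OF \<epsilon>] by (rule mult_right_mono) simp
        have "\<bar>cutoff \<epsilon> (u x) * X x + cutoff' \<epsilon> (u x) * Y x\<bar> \<le> \<bar>u x * X x\<bar> + 2 * \<bar>Y x\<bar>"
          using 1 2 by linarith
        then show ?thesis using True by (simp add: \<epsilon>_def)
      qed simp
    qed
  next
    show "AE x in lborel. (\<lambda>n. indicator PB x * (cutoff (inverse (real (Suc n))) (u x) * X x
        + cutoff' (inverse (real (Suc n))) (u x) * Y x)) \<longlonglongrightarrow> indicator PB x * (u x * X x + Y x)"
    proof (rule AE_I2)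
      fix x
      show "(\<lambda>n. indicator PB x * (cutoff (inverse (real (Suc n))) (u x) * X x
        + cutoff' (inverse (real (Suc n))) (u x) * Y x)) \<longlonglongrightarrow> indicator PB x * (u x * X x + Y x)"
      proof (cases "x \<in> PB")
        case True
        have "(\<lambda>n. indicator PB x * (cutoff (inverse (real (Suc n))) (u x) * X x
        + cutoff' (inverse (real (Suc n))) (u x) * Y x)) \<longlonglongrightarrow>
          indicator PB x * (max 0 (u x) * X x + indicator {0<..} (u x) * Y x)"
          by (intro tendsto_intros cutoff_tendsto cutoff'_tendsto inverse_Suc_seq)
        then show ?thesis using u0[OF True] by simp
      qed simp
    qed
  qed
  moreover have "(\<lambda>n. \<integral>x. indicator PB x * (cutoff (inverse (real (Suc n))) (u x) * X x
        + cutoff' (inverse (real (Suc n))) (u x) * Y x) \<partial>lborel) = (\<lambda>n. 0)"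
    by (intro ext approx inverse_Suc_seq)
  ultimately have "(\<lambda>n. 0) \<longlonglongrightarrow> (\<integral>x. indicator PB x * (u x * X x + Y x) \<partial>lborel)" by (simp only:)
  then have "(\<integral>x. indicator PB x * (u x * X x + Y x) \<partial>lborel) = 0" by (rule LIMSEQ_unique) (rule tendsto_const)
  moreover have "u x * X x + Y x = e (x \<bullet> x) * (fst x * t x * (1 / Hx x))
     + e' (x \<bullet> x) * (2 * u x * (1 / Hx x) * ((x \<bullet> Du x) / fst x))" for x
    unfolding X_def Y_def by (simp add: algebra_simps)
  ultimately show ?thesis by (simp only:)
qed


section \<open>From radial test functions to discs\<close>

definition ID :: "(plane \<Rightarrow> real) \<Rightarrow> real \<Rightarrow> real" where
  "ID f r = (LINT x:half_disc r|lborel. indicator PB x * f x)"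

definition cPB :: "(plane \<Rightarrow> real) \<Rightarrow> real \<Rightarrow> real" where
  "cPB f r = circ (\<lambda>x. indicator PB x * f x) r"

lemma half_disc_borel [measurable]: "half_disc r \<in> sets borel"
  unfolding half_disc_def by (intro sets.Int borel_open open_ball half_space_borel)

lemma BC_set_integrable: assumes "BC f" "A \<in> sets borel" shows "set_integrable lborel A (\<lambda>x. indicator PB x * f x)"
  unfolding set_integrable_def
  by (rule integrable_mult_indicator) (use assms BC_integrable in auto)

lemma ID_linear:
  assumes "BC f" "BC k"
  shows "ID (\<lambda>x. f x + k x) r = ID f r + ID k r" "ID (\<lambda>x. c * f x) r = c * ID f r"
proof -
  have "ID (\<lambda>x. f x + k x) r = (LINT x:half_disc r|lborel. indicator PB x * f x + indicator PB x * k x)"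
    unfolding ID_def by (simp add: distrib_left)
  also have "\<dots> = ID f r + ID k r"
    unfolding ID_def by (intro set_integral_add BC_set_integrable assms half_disc_borel)
  finally show "ID (\<lambda>x. f x + k x) r = ID f r + ID k r" .
  have "ID (\<lambda>x. c * f x) r = (LINT x:half_disc r|lborel. c * (indicator PB x * f x))"
    unfolding ID_def by (simp add: mult.left_commute)
  then show "ID (\<lambda>x. c * f x) r = c * ID f r" by (simp add: ID_def)
qed

lemma cPB_integrable:
  assumes f: "BC f"
  shows "set_integrable lborel angles (\<lambda>\<theta>. r * (indicator PB (polar r \<theta>) * f (polar r \<theta>)))"
proof -
  have [measurable]: "(\<lambda>x. indicator PB x * f x) \<in> borel_measurable borel" using BC_measurable[OF f] .
  obtain B where B: "\<And>x. x \<in> PB \<Longrightarrow> \<bar>f x\<bar> \<le> B" using f by (auto simp: BC_def)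
  have m: "(\<lambda>\<theta>. indicator PB (polar r \<theta>) * f (polar r \<theta>)) \<in> borel_measurable borel"
    using measurable_compose[OF borel_measurable_polar BC_measurable[OF f]] .
  have "integrable lborel (\<lambda>\<theta>. indicator angles \<theta> * (\<bar>r\<bar> * \<bar>B\<bar>))"
    by (intro integrable_mult_left integrable_real_indicator) auto
  then show ?thesis
    unfolding set_integrable_def
  proof (rule Bochner_Integration.integrable_bound)
    show "(\<lambda>\<theta>. indicator angles \<theta> *\<^sub>R (r * (indicator PB (polar r \<theta>) * f (polar r \<theta>)))) \<in> borel_measurable lborel"
      using m by simp
    show "AE \<theta> in lborel. norm (indicator angles \<theta> *\<^sub>R (r * (indicator PB (polar r \<theta>) * f (polar r \<theta>))))
        \<le> norm (indicator angles \<theta> * (\<bar>r\<bar> * \<bar>B\<bar>))"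
    proof (rule AE_I2)
      fix \<theta>
      have "\<bar>indicator PB (polar r \<theta>) * f (polar r \<theta>)\<bar> \<le> \<bar>B\<bar>"
        using B[of "polar r \<theta>"] by (cases "polar r \<theta> \<in> PB") auto
      then have "\<bar>r\<bar> * \<bar>indicator PB (polar r \<theta>) * f (polar r \<theta>)\<bar> \<le> \<bar>r\<bar> * \<bar>B\<bar>" by (rule mult_left_mono) simp
      then show "norm (indicator angles \<theta> *\<^sub>R (r * (indicator PB (polar r \<theta>) * f (polar r \<theta>))))
        \<le> norm (indicator angles \<theta> * (\<bar>r\<bar> * \<bar>B\<bar>))"
        by (cases "\<theta> \<in> angles") (simp_all add: abs_mult)
    qed
  qed
qed

lemma cPB_add: "BC f \<Longrightarrow> BC k \<Longrightarrow> cPB (\<lambda>x. f x + k x) r = cPB f r + cPB k r"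
  unfolding cPB_def circ_def
  by (subst set_integral_add(2)[symmetric, OF cPB_integrable cPB_integrable])
     (auto intro!: set_lebesgue_integral_cong simp: algebra_simps)

lemma cPB_cmult: "cPB (\<lambda>x. c * f x) r = c * cPB f r"
  unfolding cPB_def circ_def
  by (subst set_integral_mult_right[symmetric]) (auto intro!: set_lebesgue_integral_cong simp: mult_ac)

lemma cPB_cong:
  assumes "r > 0" "\<And>x. x \<in> PB \<Longrightarrow> x \<in> half_circle r \<Longrightarrow> f x = k x"
  shows "cPB f r = cPB k r"
  unfolding cPB_def circ_def
proof (rule set_lebesgue_integral_cong)
  show "\<forall>\<theta>. \<theta> \<in> angles \<longrightarrow> r * (indicator PB (polar r \<theta>) * f (polar r \<theta>)) = r * (indicator PB (polar r \<theta>) * k (polar r \<theta>))"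
  proof (intro allI impI)
    fix \<theta> assume "\<theta> \<in> angles"
    then have "polar r \<theta> \<in> half_circle r" using half_circle_eq[OF assms(1)] by blast
    then show "r * (indicator PB (polar r \<theta>) * f (polar r \<theta>)) = r * (indicator PB (polar r \<theta>) * k (polar r \<theta>))"
      using assms(2) by (cases "polar r \<theta> \<in> PB") auto
  qed
qed simp

lemma AE_ID_derivative:
  assumes "BC f"
  shows "AE r in lborel. r > 0 \<longrightarrow> (ID f has_real_derivative cPB f r) (at r)"
  unfolding ID_def[abs_def] cPB_def
  by (rule AE_has_derivative_half_disc[OF BC_measurable[OF assms] BC_set_integrable[OF assms half_space_borel]])

lemma ID_eq_integral: "ID f r = (\<integral>x. indicator PB x * (indicator {..<r\<^sup>2} (x \<bullet> x) * f x) \<partial>lborel)" if "r > 0"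
  unfolding ID_def set_lebesgue_integral_def
proof (rule Bochner_Integration.integral_cong[OF refl])
  fix x :: plane
  have "norm x < r \<longleftrightarrow> x \<bullet> x < r\<^sup>2"
    unfolding dot_square_norm using that
    by (metis less_imp_le norm_ge_zero power2_less_imp_less power_strict_mono zero_less_numeral)
  then show "indicator (half_disc r) x *\<^sub>R (indicator PB x * f x) = indicator PB x * (indicator {..<r\<^sup>2} (x \<bullet> x) * f x)"
    using PB_D(4)[of x] by (cases "x \<in> PB") (auto simp: half_disc_def indicator_def)
qed

text \<open>The radial profiles \<open>e\<close> approximate the piecewise linear function that decreases from \<open>1\<close>
  to \<open>0\<close> on \<open>[r\<^sup>2, r\<^sup>2 + h]\<close>; then \<open>h\<close> tends to \<open>0\<close>.\<close>

lemma radial_test: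
  fixes a b :: "plane \<Rightarrow> real"
  assumes a: "BC a" and b: "BC b"
    and test: "\<And>e e' c. (\<And>w. (e has_real_derivative e' w) (at w)) \<Longrightarrow> continuous_on UNIV e' \<Longrightarrow> c < \<delta>\<^sup>2 \<Longrightarrow>
       (\<And>w. c \<le> w \<Longrightarrow> e w = 0) \<Longrightarrow> (\<And>w. c \<le> w \<Longrightarrow> e' w = 0) \<Longrightarrow>
       (\<integral>x. indicator PB x * (e (x \<bullet> x) * b x + e' (x \<bullet> x) * a x) \<partial>lborel) = 0"
    and r: "0 < r" "r < \<delta>" and d: "(ID a has_real_derivative d) (at r)"
  shows "ID b r = d / (2 * r)"
proof -
  \<comment> \<open>The test functions depend on \<open>|x|^2\<close>, so the radius
    \<open>r\<close> appears as a level of that variable.\<close>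
  define A where "A = r\<^sup>2"
  have A: "A > 0" "A < \<delta>\<^sup>2" using r by (auto simp: A_def intro: power_strict_mono)
  define \<eta> where "\<eta> h w = (max 0 (A + h - w) - max 0 (A - w)) / h" for h w
  have step1: "(\<integral>x. indicator PB x * (\<eta> h (x \<bullet> x) * b x) \<partial>lborel) = (ID a (sqrt (A + h)) - ID a (sqrt A)) / h"
    if h: "h > 0" "A + h < \<delta>\<^sup>2" for h
  proof -
    define e where "e \<epsilon> w = (cutoff \<epsilon> (A + h - w) - cutoff \<epsilon> (A - w)) / h" for \<epsilon> w
    define e' where "e' \<epsilon> w = (cutoff' \<epsilon> (A - w) - cutoff' \<epsilon> (A + h - w)) / h" for \<epsilon> w
    \<comment> \<open>The derivative of \<open>\<eta> h\<close>: it is \<open>- 1 / h\<close> on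
      \<open>[A, A + h)\<close> and \<open>0\<close> elsewhere, which turns the term with
      \<open>a\<close> into a difference quotient of \<open>ID a\<close>.\<close>
    define J where "J w = (indicator {0<..} (A - w) - indicator {0<..} (A + h - w)) / h" for w :: real
    have D: "(e \<epsilon> has_real_derivative e' \<epsilon> w) (at w)" if "\<epsilon> > 0" for \<epsilon> w
    proof -
      have 1: "((\<lambda>w. cutoff \<epsilon> (B - w)) has_real_derivative cutoff' \<epsilon> (B - w) * (-1)) (at w)" for B
        by (rule DERIV_chain2[OF cutoff_has_derivative[OF that]]) (auto intro!: derivative_eq_intros)
      show ?thesis unfolding e_def[abs_def] e'_def
        by (rule DERIV_cong[OF DERIV_cdivide[OF DERIV_diff[OF 1 1]]]) simp
    qed
    have ce': "continuous_on UNIV (e' \<epsilon>)" if "\<epsilon> > 0" for \<epsilon>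
    proof -
      have "continuous_on UNIV (\<lambda>w. cutoff' \<epsilon> (B - w))" for B
        by (rule continuous_on_compose2[OF continuous_cutoff'[OF that, of UNIV]]) (auto intro!: continuous_intros)
      then show ?thesis unfolding e'_def using h by (intro continuous_intros) auto
    qed
    have ce: "continuous_on UNIV (e \<epsilon>)" if "\<epsilon> > 0" for \<epsilon>
      using D[OF that] by (meson DERIV_isCont continuous_at_imp_continuous_on)
    have zero: "e \<epsilon> w = 0" "e' \<epsilon> w = 0" if "\<epsilon> > 0" "A + h \<le> w" for \<epsilon> w
      using that h by (auto simp: e_def e'_def cutoff_eq_0 cutoff'_eq_0)
    have I: "(\<integral>x. indicator PB x * (e \<epsilon> (x \<bullet> x) * b x + e' \<epsilon> (x \<bullet> x) * a x) \<partial>lborel) = 0" if "\<epsilon> > 0" for \<epsilon>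
      by (rule test[OF D[OF that] ce'[OF that] h(2)]) (use zero that in auto)
    obtain Ba where Ba: "\<And>x. x \<in> PB \<Longrightarrow> \<bar>a x\<bar> \<le> Ba" using a by (auto simp: BC_def)
    have xx: "0 \<le> x \<bullet> x" for x :: plane by simp
    have m: "(\<lambda>x::plane. x \<bullet> x) \<in> borel_measurable borel"
      by (intro borel_measurable_continuous_onI continuous_intros)
    have lim: "(\<lambda>n. \<integral>x. indicator PB x * (e (inverse (real (Suc n))) (x \<bullet> x) * b x + e' (inverse (real (Suc n))) (x \<bullet> x) * a x) \<partial>lborel)
       \<longlonglongrightarrow> (\<integral>x. indicator PB x * (\<eta> h (x \<bullet> x) * b x + J (x \<bullet> x) * a x) \<partial>lborel)"
    proof (rule integral_dominated_convergence)
      show "integrable lborel (\<lambda>x. indicator PB x * ((2 * (A + h) / h) * \<bar>b x\<bar> + (4 / h) * \<bar>a x\<bar>))"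
        by (intro BC_integrable BC_intros BC_abs a b)
      have [measurable]: "(\<lambda>x. indicator PB x * b x) \<in> borel_measurable borel"
        "(\<lambda>x. indicator PB x * a x) \<in> borel_measurable borel"
        using BC_measurable a b by auto
      note m [measurable]
      have "\<eta> h \<in> borel_measurable borel" "J \<in> borel_measurable borel"
        unfolding \<eta>_def[abs_def] J_def[abs_def] by measurable
      then have "(\<lambda>x. \<eta> h (x \<bullet> x) * (indicator PB x * b x) + J (x \<bullet> x) * (indicator PB x * a x)) \<in> borel_measurable borel"
        by measurable
      then show "(\<lambda>x. indicator PB x * (\<eta> h (x \<bullet> x) * b x + J (x \<bullet> x) * a x)) \<in> borel_measurable lborel"
        by (simp add: algebra_simps)
      fix n
      define \<epsilon> where "\<epsilon> = inverse (real (Suc n))"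
      have \<epsilon>: "\<epsilon> > 0" unfolding \<epsilon>_def by (rule inverse_Suc_seq)
      have "BC (\<lambda>x. e \<epsilon> (x \<bullet> x) * b x + e' \<epsilon> (x \<bullet> x) * a x)"
        by (intro BC_intros BC_radial ce ce' \<epsilon> a b)
      from BC_measurable[OF this]
      show "(\<lambda>x. indicator PB x * (e (inverse (real (Suc n))) (x \<bullet> x) * b x + e' (inverse (real (Suc n))) (x \<bullet> x) * a x)) \<in> borel_measurable lborel"
        by (simp add: \<epsilon>_def)
      show "AE x in lborel. norm (indicator PB x * (e (inverse (real (Suc n))) (x \<bullet> x) * b x + e' (inverse (real (Suc n))) (x \<bullet> x) * a x))
          \<le> indicator PB x * ((2 * (A + h) / h) * \<bar>b x\<bar> + (4 / h) * \<bar>a x\<bar>)"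
      proof (rule AE_I2)
        fix x :: plane
        have "\<bar>cutoff \<epsilon> (A + h - x \<bullet> x) - cutoff \<epsilon> (A - x \<bullet> x)\<bar> \<le> 2 * (A + h)"
        proof -
          have "cutoff \<epsilon> (A + h - x \<bullet> x) \<le> A + h" "cutoff \<epsilon> (A - x \<bullet> x) \<le> A + h"
            using cutoff_bounds[OF \<epsilon>, of "A + h - x \<bullet> x"] cutoff_bounds[OF \<epsilon>, of "A - x \<bullet> x"] xx[of x] h A
            unfolding max_def by (simp_all split: if_splits; linarith)+
          moreover have "cutoff \<epsilon> (A + h - x \<bullet> x) \<ge> 0" "cutoff \<epsilon> (A - x \<bullet> x) \<ge> 0"
            using cutoff_bounds[OF \<epsilon>] by auto
          moreover have "\<bar>y - z\<bar> \<le> 2 * B" if "y \<le> B" "z \<le> B" "0 \<le> y" "0 \<le> z" for y z B :: real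
            using that by linarith
          ultimately show ?thesis by blast
        qed
        then have "\<bar>e \<epsilon> (x \<bullet> x)\<bar> \<le> 2 * (A + h) / h" using h by (simp add: e_def abs_divide divide_right_mono)
        then have 1: "\<bar>e \<epsilon> (x \<bullet> x) * b x\<bar> \<le> 2 * (A + h) / h * \<bar>b x\<bar>"
          unfolding abs_mult by (rule mult_right_mono) simp
        have "\<bar>cutoff' \<epsilon> (A - x \<bullet> x) - cutoff' \<epsilon> (A + h - x \<bullet> x)\<bar> \<le> 4"
          using cutoff'_bounds[OF \<epsilon>, of "A - x \<bullet> x"] cutoff'_bounds[OF \<epsilon>, of "A + h - x \<bullet> x"] by linarith
        then have "\<bar>e' \<epsilon> (x \<bullet> x)\<bar> \<le> 4 / h" using h by (simp add: e'_def abs_divide divide_right_mono)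
        then have 2: "\<bar>e' \<epsilon> (x \<bullet> x) * a x\<bar> \<le> 4 / h * \<bar>a x\<bar>"
          unfolding abs_mult by (rule mult_right_mono) simp
        have "\<bar>e \<epsilon> (x \<bullet> x) * b x + e' \<epsilon> (x \<bullet> x) * a x\<bar> \<le> 2 * (A + h) / h * \<bar>b x\<bar> + 4 / h * \<bar>a x\<bar>"
          using 1 2 by linarith
        then show "norm (indicator PB x * (e (inverse (real (Suc n))) (x \<bullet> x) * b x + e' (inverse (real (Suc n))) (x \<bullet> x) * a x))
          \<le> indicator PB x * ((2 * (A + h) / h) * \<bar>b x\<bar> + (4 / h) * \<bar>a x\<bar>)"
          unfolding \<epsilon>_def by (cases "x \<in> PB") simp_all
      qed
    next
      show "AE x in lborel. (\<lambda>n. indicator PB x * (e (inverse (real (Suc n))) (x \<bullet> x) * b x + e' (inverse (real (Suc n))) (x \<bullet> x) * a x))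
        \<longlonglongrightarrow> indicator PB x * (\<eta> h (x \<bullet> x) * b x + J (x \<bullet> x) * a x)"
        unfolding e_def e'_def \<eta>_def J_def
        by (intro AE_I2 tendsto_intros cutoff_tendsto cutoff'_tendsto inverse_Suc_seq) (use h in auto)
    qed
    have seq0: "(\<lambda>n. \<integral>x. indicator PB x * (e (inverse (real (Suc n))) (x \<bullet> x) * b x + e' (inverse (real (Suc n))) (x \<bullet> x) * a x) \<partial>lborel) = (\<lambda>n. 0)"
      by (intro ext I inverse_Suc_seq)
    have L0: "(\<integral>x. indicator PB x * (\<eta> h (x \<bullet> x) * b x + J (x \<bullet> x) * a x) \<partial>lborel) = 0"
      using lim unfolding seq0 by (rule LIMSEQ_unique) (rule tendsto_const)
    have B\<eta>: "BC (\<lambda>x. \<eta> h (x \<bullet> x) * b x)"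
    proof -
      have "continuous_on UNIV (\<eta> h)" unfolding \<eta>_def using h by (intro continuous_intros) auto
      then show ?thesis by (intro BC_mult BC_radial b)
    qed
    have ind: "integrable lborel (\<lambda>x. indicator PB x * (indicator {..<B} (x \<bullet> x) * a x))" for B
    proof -
      have s: "(\<lambda>x::plane. x \<bullet> x) -` {..<B} \<in> sets borel"
        using measurable_sets_borel[OF m, of "{..<B}"] by simp
      have "integrable lborel (\<lambda>x. indicator ((\<lambda>x. x \<bullet> x) -` {..<B}) x *\<^sub>R (indicator PB x * a x))"
        by (rule integrable_mult_indicator[OF _ BC_integrable[OF a]]) (use s in simp)
      then show ?thesis by (rule Bochner_Integration.integrable_cong[THEN iffD1, rotated 2]) (auto simp: indicator_def)
    qed
    have Jeq: "indicator PB x * (\<eta> h (x \<bullet> x) * b x + J (x \<bullet> x) * a x) = indicator PB x * (\<eta> h (x \<bullet> x) * b x)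
        - (1 / h) * (indicator PB x * (indicator {..<A + h} (x \<bullet> x) * a x) - indicator PB x * (indicator {..<A} (x \<bullet> x) * a x))" for x
    proof -
      have "J w = - (1 / h) * (indicator {..<A + h} w - indicator {..<A} w)" for w
        by (simp add: J_def indicator_def)
      then have Jx: "J (x \<bullet> x) = - (1 / h) * (indicator {..<A + h} (x \<bullet> x) - indicator {..<A} (x \<bullet> x))" .
      show ?thesis unfolding Jx by algebra
    qed
    have "0 = (\<integral>x. indicator PB x * (\<eta> h (x \<bullet> x) * b x) \<partial>lborel)
        - (1 / h) * ((\<integral>x. indicator PB x * (indicator {..<A + h} (x \<bullet> x) * a x) \<partial>lborel)
          - (\<integral>x. indicator PB x * (indicator {..<A} (x \<bullet> x) * a x) \<partial>lborel))"
      using L0 unfolding Jeq using BC_integrable[OF B\<eta>] ind by simp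
    also have "(\<integral>x. indicator PB x * (indicator {..<A + h} (x \<bullet> x) * a x) \<partial>lborel) = ID a (sqrt (A + h))"
      using ID_eq_integral[of "sqrt (A + h)" a] A h by simp
    also have "(\<integral>x. indicator PB x * (indicator {..<A} (x \<bullet> x) * a x) \<partial>lborel) = ID a (sqrt A)"
      using ID_eq_integral[of "sqrt A" a] A by simp
    finally show ?thesis by simp
  qed
  \<comment> \<open>Keeps \<open>A + h\<close> below \<open>\<delta>\<^sup>2\<close>, as
    \<open>test\<close> demands of the support.\<close>
  define \<kappa> where "\<kappa> = (\<delta>\<^sup>2 - A) / 2"
  have \<kappa>: "\<kappa> > 0" using A by (simp add: \<kappa>_def)
  define hn where "hn n = \<kappa> * inverse (real (Suc n))" for n
  have hn: "hn n > 0" "A + hn n < \<delta>\<^sup>2" for n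
  proof -
    show "hn n > 0" unfolding hn_def by (intro mult_pos_pos \<kappa> inverse_Suc_seq)
    have "hn n \<le> \<kappa> * 1" unfolding hn_def using \<kappa> by (intro mult_left_mono) (auto simp: inverse_le_1_iff)
    then show "A + hn n < \<delta>\<^sup>2" using \<kappa> by (simp add: \<kappa>_def field_simps)
  qed
  have H0: "hn \<longlonglongrightarrow> 0" unfolding hn_def using tendsto_mult_left[OF inverse_Suc_seq(2), of \<kappa>] by simp
  \<comment> \<open>Chain rule through the square root, the source of the factor
    \<open>1 / (2 * r)\<close>.\<close>
  have "((\<lambda>h. (ID a (sqrt (A + h)) - ID a (sqrt A)) / h) \<longlongrightarrow> d * (1 / (2 * r))) (at 0)"
  proof -
    have sA: "sqrt A = r" using r by (simp add: A_def)
    have "(sqrt has_real_derivative inverse (sqrt A) / 2) (at A)" by (rule DERIV_real_sqrt[OF A(1)])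
    from DERIV_chain2[OF d[folded sA] this]
    have "((\<lambda>w. ID a (sqrt w)) has_real_derivative d * (inverse (sqrt A) / 2)) (at A)" .
    then have "((\<lambda>h. (ID a (sqrt (A + h)) - ID a (sqrt A)) / h) \<longlongrightarrow> d * (inverse (sqrt A) / 2)) (at 0)"
      unfolding DERIV_def .
    moreover have "inverse (sqrt A) / 2 = 1 / (2 * r)" unfolding sA using r by (simp add: field_simps)
    ultimately show ?thesis by (simp only:)
  qed
  moreover have "filterlim hn (at 0) sequentially"
    unfolding filterlim_at using H0 hn(1) by (auto simp: less_imp_neq[THEN not_sym] intro!: always_eventually)
  ultimately have R: "(\<lambda>n. (ID a (sqrt (A + hn n)) - ID a (sqrt A)) / hn n) \<longlonglongrightarrow> d * (1 / (2 * r))"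
    by (rule filterlim_compose)
  have "(\<lambda>n. \<integral>x. indicator PB x * (\<eta> (hn n) (x \<bullet> x) * b x) \<partial>lborel) \<longlonglongrightarrow> ID b r"
    unfolding ID_eq_integral[OF r(1)]
  proof (rule integral_dominated_convergence)
    show "integrable lborel (\<lambda>x. indicator PB x * \<bar>b x\<bar>)" by (intro BC_integrable BC_abs b)
    have m: "(\<lambda>x::plane. x \<bullet> x) \<in> borel_measurable borel"
      by (intro borel_measurable_continuous_onI continuous_intros)
    note m [measurable]
    have [measurable]: "(\<lambda>x. indicator PB x * b x) \<in> borel_measurable borel" using BC_measurable b by auto
    have "(\<lambda>x. indicator {..<r\<^sup>2} (x \<bullet> x) * (indicator PB x * b x)) \<in> borel_measurable borel" by measurable
    then show "(\<lambda>x. indicator PB x * (indicator {..<r\<^sup>2} (x \<bullet> x) * b x)) \<in> borel_measurable lborel"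
      by (simp add: mult.left_commute)
    fix n
    have "(\<lambda>x. \<eta> (hn n) (x \<bullet> x) * (indicator PB x * b x)) \<in> borel_measurable borel"
      unfolding \<eta>_def by measurable
    then show "(\<lambda>x. indicator PB x * (\<eta> (hn n) (x \<bullet> x) * b x)) \<in> borel_measurable lborel"
      by (simp add: mult.left_commute)
    have \<eta>1: "\<bar>\<eta> (hn n) w\<bar> \<le> 1" for w
    proof -
      have "0 \<le> max 0 (A + hn n - w) - max 0 (A - w)" "max 0 (A + hn n - w) - max 0 (A - w) \<le> hn n"
        using hn(1)[of n] by (auto simp: max_def)
      then show ?thesis using hn(1)[of n] by (simp add: \<eta>_def abs_divide)
    qed
    show "AE x in lborel. norm (indicator PB x * (\<eta> (hn n) (x \<bullet> x) * b x)) \<le> indicator PB x * \<bar>b x\<bar>"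
    proof (rule AE_I2)
      fix x
      have "\<bar>\<eta> (hn n) (x \<bullet> x)\<bar> * \<bar>b x\<bar> \<le> 1 * \<bar>b x\<bar>" using \<eta>1 by (rule mult_right_mono) simp
      then show "norm (indicator PB x * (\<eta> (hn n) (x \<bullet> x) * b x)) \<le> indicator PB x * \<bar>b x\<bar>"
        by (cases "x \<in> PB") (simp_all add: abs_mult)
    qed
  next
    \<comment> \<open>On the circle itself \<open>\<eta>\<close> equals \<open>1\<close> while the
      limit is \<open>0\<close>; the circle is a null set.\<close>
    have "AE x in lebesgue. x \<notin> sphere (0::plane) r"
      using negligible_sphere[of "0::plane" r] by (intro AE_not_in) (simp add: negligible_iff_null_sets)
    then have "AE x in lborel. x \<notin> sphere (0::plane) r" using AE_completion_iff by blast
    then show "AE x in lborel. (\<lambda>n. indicator PB x * (\<eta> (hn n) (x \<bullet> x) * b x))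
        \<longlonglongrightarrow> indicator PB x * (indicator {..<r\<^sup>2} (x \<bullet> x) * b x)"
    proof eventually_elim
      case (elim x)
      have "norm x \<noteq> r" using elim by simp
      then have ne: "x \<bullet> x \<noteq> A" unfolding A_def dot_square_norm using r(1) by (simp add: power2_eq_iff_nonneg)
      have "(\<lambda>n. \<eta> (hn n) (x \<bullet> x)) \<longlonglongrightarrow> indicator {..<r\<^sup>2} (x \<bullet> x)"
      proof (cases "x \<bullet> x < A")
        case True
        have "\<eta> (hn n) (x \<bullet> x) = 1" for n using True hn(1)[of n] by (simp add: \<eta>_def max_def)
        then show ?thesis using True by (simp add: A_def)
      next
        case False
        then have "x \<bullet> x - A > 0" using ne by simp
        then have "\<forall>\<^sub>F n in sequentially. hn n < x \<bullet> x - A" using H0 by (rule order_tendstoD(2)[rotated])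
        then have "\<forall>\<^sub>F n in sequentially. \<eta> (hn n) (x \<bullet> x) = 0"
          by eventually_elim (use False in \<open>simp add: \<eta>_def max_def\<close>)
        then have "(\<lambda>n. \<eta> (hn n) (x \<bullet> x)) \<longlonglongrightarrow> 0" by (rule tendsto_eventually)
        then show ?thesis using False by (simp add: A_def)
      qed
      then show ?case by (intro tendsto_intros)
    qed
  qed
  moreover have "(\<lambda>n. \<integral>x. indicator PB x * (\<eta> (hn n) (x \<bullet> x) * b x) \<partial>lborel) =
      (\<lambda>n. (ID a (sqrt (A + hn n)) - ID a (sqrt A)) / hn n)"
    by (intro ext step1 hn)
  ultimately have "(\<lambda>n. (ID a (sqrt (A + hn n)) - ID a (sqrt A)) / hn n) \<longlonglongrightarrow> ID b r" by (simp only:)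
  from LIMSEQ_unique[OF this R] show ?thesis by simp
qed


section \<open>The derivative of the boundary term\<close>

lemma polar_simps [simp]: "fst (polar r \<theta>) = r * cos \<theta>" "snd (polar r \<theta>) = r * sin \<theta>"
  by (simp_all add: polar_def)

lemma polar_in_Ks: "\<theta> \<in> angles \<Longrightarrow> 0 \<le> r \<Longrightarrow> r \<le> \<delta> \<Longrightarrow> polar r \<theta> \<in> Ks"
proof -
  assume a: "\<theta> \<in> angles" "0 \<le> r" "r \<le> \<delta>"
  have "norm (polar r \<theta>) \<le> \<delta>"
  proof (cases "r = 0")
    case True then show ?thesis using \<delta>_pos by (simp add: polar_def flip: zero_prod_def)
  next
    case False then show ?thesis using a norm_polar[of r \<theta>] by simp
  qed
  moreover have "0 \<le> r * cos \<theta>" using a cos_gt_zero_pi[of \<theta>] by simp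
  ultimately show ?thesis by (simp add: half_plane_def)
qed

lemma u_polar_has_derivative:
  assumes "polar r \<theta> \<in> P"
  shows "((\<lambda>\<rho>. u (polar \<rho> \<theta>)) has_real_derivative Du (polar r \<theta>) \<bullet> (cos \<theta>, sin \<theta>)) (at r)"
proof -
  have "((\<lambda>\<rho>. polar \<rho> \<theta>) has_derivative (\<lambda>h. (h * cos \<theta>, h * sin \<theta>))) (at r)"
    unfolding polar_def[abs_def] by (auto intro!: derivative_eq_intros)
  from has_derivative_compose[OF this u_has_derivative[OF assms]]
  show ?thesis
    unfolding has_field_derivative_def
    by (rule has_derivative_eq_rhs) (simp add: fun_eq_iff inner_prod_def algebra_simps)
qed

text \<open>Where \<open>u > 0\<close>, \<open>|Du| \<le> L x_1\<close> and
  \<open>x_1 \<le> \<delta> cos \<theta>\<close> along the ray;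
  \<open>lipschitz_of_positive_part\<close> turns this into a Lipschitz bound across the free
  boundary. The factor \<open>cos \<theta>\<close> is kept because it pays for the weight
  \<open>1 / x_1\<close>.\<close>

lemma u_polar_lipschitz:
  assumes \<theta>: "\<theta> \<in> angles" and ab: "0 \<le> a" "a \<le> b" "b \<le> \<delta>"
  shows "\<bar>u (polar b \<theta>) - u (polar a \<theta>)\<bar> \<le> 2 * (L * \<delta> * cos \<theta>) * (b - a)"
proof (rule lipschitz_of_positive_part)
  have c: "cos \<theta> > 0" using \<theta> cos_gt_zero_pi[of \<theta>] by simp
  have K: "polar x \<theta> \<in> Ks" if "a \<le> x" "x \<le> b" for x
    using that ab by (intro polar_in_Ks \<theta>) auto
  show "continuous_on {a..b} (\<lambda>x. u (polar x \<theta>))"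
  proof (rule continuous_on_compose2[OF continuous])
    show "continuous_on {a..b} (\<lambda>x. polar x \<theta>)" unfolding polar_def by (intro continuous_intros)
    show "(\<lambda>x. polar x \<theta>) ` {a..b} \<subseteq> \<Omega>"
    proof (rule image_subsetI)
      fix x assume "x \<in> {a..b}"
      then show "polar x \<theta> \<in> \<Omega>" by (intro Ks_Omega K) auto
    qed
  qed
  show "0 \<le> u (polar x \<theta>)" if "a \<le> x" "x \<le> b" for x
    using K[OF that] nonneg Ks_Omega by blast
  fix x assume x: "a < x" "x < b" "u (polar x \<theta>) > 0"
  have Kx: "polar x \<theta> \<in> Ks" using K x by simp
  have Px: "polar x \<theta> \<in> P" using P_iff[OF Ks_Omega[OF Kx]] x by blast
  show "((\<lambda>\<rho>. u (polar \<rho> \<theta>)) has_real_derivative Du (polar x \<theta>) \<bullet> (cos \<theta>, sin \<theta>)) (at x)"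
    by (rule u_polar_has_derivative[OF Px])
  have "\<bar>Du (polar x \<theta>) \<bullet> (cos \<theta>, sin \<theta>)\<bar> \<le> norm (Du (polar x \<theta>)) * norm (cos \<theta>, sin \<theta>)"
    by (rule Cauchy_Schwarz_ineq2)
  also have "\<dots> = norm (Du (polar x \<theta>))" by (simp add: norm_prod_def)
  also have "\<dots> \<le> L * (x * cos \<theta>)" using P_bounds(4)[OF Px Kx] by simp
  also have "\<dots> \<le> L * (\<delta> * cos \<theta>)"
    using x ab c L_nonneg by (intro mult_left_mono mult_right_mono) auto
  finally show "\<bar>Du (polar x \<theta>) \<bullet> (cos \<theta>, sin \<theta>)\<bar> \<le> L * \<delta> * cos \<theta>" by simp
qed (use ab \<delta>_pos L_nonneg cos_gt_zero_pi[of \<theta>] \<theta> in auto)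

lemma u_polar_le:
  assumes \<theta>: "\<theta> \<in> angles" and r: "0 \<le> r" "r \<le> \<delta>"
  shows "0 \<le> u (polar r \<theta>)" "u (polar r \<theta>) \<le> 2 * (L * \<delta> * cos \<theta>) * r"
proof -
  have K: "polar s \<theta> \<in> \<Omega>" if "0 \<le> s" "s \<le> \<delta>" for s using polar_in_Ks[OF \<theta> that] Ks_Omega by blast
  have "u (polar 0 \<theta>) = 0" using zero_on_axis[OF K[of 0]] \<delta>_pos by simp
  then show "0 \<le> u (polar r \<theta>)" "u (polar r \<theta>) \<le> 2 * (L * \<delta> * cos \<theta>) * r"
    using u_polar_lipschitz[OF \<theta> _ r(1,2)] nonneg[OF K[OF r]] by auto
qed

text \<open>The Lipschitz bound along the ray from the origin, where \<open>u = 0\<close>, gives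
  \<open>u \<le> 2 L \<delta> x_1\<close>.\<close>

lemma BC_u_div: "BC (\<lambda>x. u x / fst x)"
proof (rule BC_I[where B = "2 * (L * \<delta>)"])
  show "continuous_on PB (\<lambda>x. u x / fst x)"
    using PB_D(4) by (intro continuous_intros BC_continuous BC_u) fastforce
  fix x assume x: "x \<in> PB"
  have n: "norm x > 0" using PB_D(4)[OF x] by auto
  have "x \<in> half_circle (norm x)" using PB_D(4)[OF x] by (simp add: half_circle_def)
  then obtain \<theta> where \<theta>: "\<theta> \<in> angles" "x = polar (norm x) \<theta>" using half_circle_eq[OF n] by blast
  have "u x \<le> 2 * (L * \<delta> * cos \<theta>) * norm x" "0 \<le> u x"
    using u_polar_le[OF \<theta>(1), of "norm x"] PB_D(6)[OF x] \<theta>(2) by auto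
  moreover have "fst x = norm x * cos \<theta>" by (subst \<theta>(2)) simp
  ultimately have "u x \<le> 2 * (L * \<delta>) * fst x" "0 \<le> u x" by (simp_all add: mult_ac)
  then show "\<bar>u x / fst x\<bar> \<le> 2 * (L * \<delta>)" using PB_D(4)[OF x] by (simp add: field_simps)
qed

lemma BC_inner_div: "BC (\<lambda>x. (x \<bullet> Du x) / fst x)"
proof (rule BC_cong)
  show "BC (\<lambda>x. fst x * (fst (Du x) / fst x) + snd x * (snd (Du x) / fst x))" by (intro BC_intros)
qed (simp add: inner_plane add_divide_distrib)

text \<open>The densities \<open>q1\<close> to \<open>q5\<close> are written as products of bounded
  factors, with \<open>1 / x_1\<close> attached to \<open>u\<close> or to
  \<open>x \<bullet> Du\<close>. On the arc, \<open>x \<bullet> Du\<close> is \<open>r\<close> times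
  the normal derivative.\<close>

definition q3 :: "plane \<Rightarrow> real" where "q3 x = 1 / \<rho>0 * (u x * ((x \<bullet> Du x) / fst x))"
definition q4 :: "plane \<Rightarrow> real" where "q4 x = 1 / \<rho>0 * (u x * (u x / fst x))"

lemma BC_q3: "BC q3" and BC_q4: "BC q4"
  unfolding q3_def[abs_def] q4_def[abs_def] by (intro BC_intros BC_inner_div BC_u_div)+

lemma u_eq_0_off_PB:
  assumes "x \<in> Ks" "norm x < \<delta>" "x \<notin> PB" shows "u x = 0"
  using assms P_iff[OF Ks_Omega[OF assms(1)]] nonneg[OF Ks_Omega[OF assms(1)]] by (auto simp: PB_def)

text \<open>The length element \<open>r\<close> cancels against \<open>x_1 = r cos \<theta>\<close>,
  so the radius enters only through \<open>u\<close>.\<close>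

lemma q4_polar:
  assumes \<theta>: "\<theta> \<in> angles" and r: "0 < r" "r < \<delta>"
  shows "r * (indicator PB (polar r \<theta>) * q4 (polar r \<theta>)) = (u (polar r \<theta>))\<^sup>2 / (cos \<theta> * \<rho>0)"
proof (cases "polar r \<theta> \<in> PB")
  case True
  then show ?thesis using r cos_gt_zero_pi[of \<theta>] \<theta> by (simp add: q4_def power2_eq_square)
next
  case False
  have "u (polar r \<theta>) = 0"
    using u_eq_0_off_PB[OF polar_in_Ks[OF \<theta>] _ False] r by (simp add: norm_polar)
  then show ?thesis by (simp add: q4_def)
qed

text \<open>On \<open>PB\<close> this is the chain rule. At a zero of \<open>u\<close> the Lipschitz
  bound makes \<open>u\<^sup>2\<close> quadratically small along the ray, so the derivative exists
  and is \<open>0\<close>, whatever the free boundary looks like.\<close>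

lemma q4_polar_has_derivative:
  assumes \<theta>: "\<theta> \<in> angles" and r: "0 < r" "r < \<delta>"
  shows "((\<lambda>\<rho>. (u (polar \<rho> \<theta>))\<^sup>2 / (cos \<theta> * \<rho>0)) has_real_derivative
    2 * (indicator PB (polar r \<theta>) * q3 (polar r \<theta>))) (at r)"
proof (cases "polar r \<theta> \<in> PB")
  case True
  have c: "cos \<theta> > 0" using \<theta> cos_gt_zero_pi[of \<theta>] by simp
  have "((\<lambda>\<rho>. (u (polar \<rho> \<theta>))\<^sup>2 / (cos \<theta> * \<rho>0)) has_real_derivative
     2 * u (polar r \<theta>) * (Du (polar r \<theta>) \<bullet> (cos \<theta>, sin \<theta>)) / (cos \<theta> * \<rho>0)) (at r)"
    using u_polar_has_derivative[OF PB_D(1)[OF True]]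
    by (auto intro!: derivative_eq_intros DERIV_cdivide)
  moreover have "polar r \<theta> \<bullet> Du (polar r \<theta>) = r * (Du (polar r \<theta>) \<bullet> (cos \<theta>, sin \<theta>))"
    by (simp add: inner_plane algebra_simps)
  then have "2 * (indicator PB (polar r \<theta>) * q3 (polar r \<theta>)) =
     2 * u (polar r \<theta>) * (Du (polar r \<theta>) \<bullet> (cos \<theta>, sin \<theta>)) / (cos \<theta> * \<rho>0)"
    using r c True by (simp add: q3_def mult_ac)
  ultimately show ?thesis by simp
next
  case False
  have c: "cos \<theta> > 0" using \<theta> cos_gt_zero_pi[of \<theta>] by simp
  define C where "C = 2 * (L * \<delta> * cos \<theta>)"
  define K where "K = C\<^sup>2 / (cos \<theta> * \<rho>0)"
  have u0: "u (polar r \<theta>) = 0"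
    using u_eq_0_off_PB[OF polar_in_Ks[OF \<theta>] _ False] r by (simp add: norm_polar)
  have bd: "\<bar>((u (polar (r + h) \<theta>))\<^sup>2 / (cos \<theta> * \<rho>0)) / h\<bar> \<le> K * \<bar>h\<bar>"
    if h: "h \<noteq> 0" "0 < r + h" "r + h < \<delta>" for h
  proof -
    have "\<bar>u (polar (r + h) \<theta>)\<bar> \<le> C * \<bar>h\<bar>"
      using u_polar_lipschitz[OF \<theta>, of r "r + h"] u_polar_lipschitz[OF \<theta>, of "r + h" r] u0 r h
      by (cases "h > 0") (auto simp: C_def abs_if split: if_splits)
    then have "\<bar>u (polar (r + h) \<theta>)\<bar>\<^sup>2 \<le> (C * \<bar>h\<bar>)\<^sup>2" by (rule power_mono) simp
    then have "(u (polar (r + h) \<theta>))\<^sup>2 / (cos \<theta> * \<rho>0) \<le> (C\<^sup>2 * h\<^sup>2) / (cos \<theta> * \<rho>0)"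
      using c rho0_pos by (intro divide_right_mono) (auto simp: power_mult_distrib)
    also have "\<dots> = K * h\<^sup>2" by (simp add: K_def)
    finally have "(u (polar (r + h) \<theta>))\<^sup>2 / (cos \<theta> * \<rho>0) / \<bar>h\<bar> \<le> K * h\<^sup>2 / \<bar>h\<bar>"
      by (rule divide_right_mono) simp
    also have "K * h\<^sup>2 / \<bar>h\<bar> = K * \<bar>h\<bar>" using h by (simp add: power2_eq_square abs_if)
    finally show ?thesis using c rho0_pos by (simp add: abs_divide abs_mult)
  qed
  have "((\<lambda>h. ((u (polar (r + h) \<theta>))\<^sup>2 / (cos \<theta> * \<rho>0)) / h) \<longlongrightarrow> 0) (at 0)"
  proof (rule Lim_null_comparison)
    show "((\<lambda>h. K * \<bar>h\<bar>) \<longlongrightarrow> 0) (at 0)"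
      by (rule tendsto_eq_intros refl | simp)+
    have "open {- r<..<\<delta> - r}" "0 \<in> {- r<..<\<delta> - r}" using r by auto
    then have "eventually (\<lambda>h. h \<in> {- r<..<\<delta> - r}) (at 0)" by (rule eventually_at_in_open')
    moreover have "eventually (\<lambda>h::real. h \<noteq> 0) (at 0)" by (simp add: eventually_at_filter)
    ultimately show "\<forall>\<^sub>F h in at 0. norm (((u (polar (r + h) \<theta>))\<^sup>2 / (cos \<theta> * \<rho>0)) / h) \<le> K * \<bar>h\<bar>"
      by eventually_elim (use bd in auto)
  qed
  then show ?thesis using False by (simp add: DERIV_def u0)
qed

text \<open>The difference of squares carries \<open>(cos \<theta>)\<^sup>2\<close>, one power from
  the sum and one from the difference of the two values; dividing by \<open>cos \<theta>\<close>
  leaves a bound uniform in \<open>\<theta>\<close>. The \<open>8\<close> is \<open>2\<close> times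
  the square of the \<open>2\<close> in \<open>u_polar_lipschitz\<close>.\<close>

lemma q4_polar_lipschitz:
  assumes \<theta>: "\<theta> \<in> angles" and rs: "0 < r" "r < \<delta>" "0 < s" "s < \<delta>"
  shows "\<bar>(u (polar s \<theta>))\<^sup>2 / (cos \<theta> * \<rho>0) - (u (polar r \<theta>))\<^sup>2 / (cos \<theta> * \<rho>0)\<bar>
    \<le> 8 * (L * \<delta>)\<^sup>2 * \<delta> / \<rho>0 * \<bar>s - r\<bar>"
proof -
  have c: "cos \<theta> > 0" using \<theta> cos_gt_zero_pi[of \<theta>] by simp
  define C where "C = 2 * (L * \<delta> * cos \<theta>)"
  have C0: "0 \<le> C" unfolding C_def using c L_nonneg \<delta>_pos by simp
  have d: "\<bar>u (polar s \<theta>) - u (polar r \<theta>)\<bar> \<le> C * \<bar>s - r\<bar>"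
    using u_polar_lipschitz[OF \<theta>, of r s] u_polar_lipschitz[OF \<theta>, of s r] rs
    by (cases "s \<ge> r") (auto simp: C_def abs_if split: if_splits)
  have "u (polar y \<theta>) \<le> C * \<delta>" "0 \<le> u (polar y \<theta>)" if "0 < y" "y < \<delta>" for y
  proof -
    have "u (polar y \<theta>) \<le> C * y" "0 \<le> u (polar y \<theta>)" using u_polar_le[OF \<theta>, of y] that by (auto simp: C_def)
    moreover have "C * y \<le> C * \<delta>" using that C0 by (intro mult_left_mono) auto
    ultimately show "u (polar y \<theta>) \<le> C * \<delta>" "0 \<le> u (polar y \<theta>)" by auto
  qed
  from this[OF rs(1,2)] this[OF rs(3,4)]
  have "\<bar>u (polar s \<theta>) + u (polar r \<theta>)\<bar> \<le> 2 * (C * \<delta>)" by simp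
  then have "\<bar>u (polar s \<theta>) + u (polar r \<theta>)\<bar> * \<bar>u (polar s \<theta>) - u (polar r \<theta>)\<bar> \<le> 2 * (C * \<delta>) * (C * \<bar>s - r\<bar>)"
    using d C0 \<delta>_pos by (intro mult_mono) auto
  then have "\<bar>(u (polar s \<theta>))\<^sup>2 - (u (polar r \<theta>))\<^sup>2\<bar> \<le> 2 * \<delta> * C\<^sup>2 * \<bar>s - r\<bar>"
    unfolding abs_mult[symmetric] by (simp add: power2_eq_square algebra_simps)
  also have "\<dots> = (8 * (L * \<delta>)\<^sup>2 * \<delta> * \<bar>s - r\<bar>) * (cos \<theta>)\<^sup>2" by (simp add: C_def power2_eq_square algebra_simps)
  also have "\<dots> \<le> (8 * (L * \<delta>)\<^sup>2 * \<delta> * \<bar>s - r\<bar>) * cos \<theta>"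
  proof (rule mult_left_mono)
    have "cos \<theta> * cos \<theta> \<le> 1 * cos \<theta>" using c by (intro mult_right_mono) auto
    then show "(cos \<theta>)\<^sup>2 \<le> cos \<theta>" by (simp add: power2_eq_square)
  qed (use \<delta>_pos in auto)
  finally have "\<bar>(u (polar s \<theta>))\<^sup>2 - (u (polar r \<theta>))\<^sup>2\<bar> / (cos \<theta> * \<rho>0) \<le> (8 * (L * \<delta>)\<^sup>2 * \<delta> * \<bar>s - r\<bar>) * cos \<theta> / (cos \<theta> * \<rho>0)"
    using c rho0_pos by (intro divide_right_mono) auto
  then show ?thesis using c rho0_pos by (simp add: diff_divide_distrib[symmetric] abs_divide abs_mult)
qed

text \<open>Dominated convergence for difference quotients in angular form, with the uniform
  Lipschitz bound as majorant. It works at every radius, not just almost every one.\<close>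

lemma J_has_derivative:
  assumes r: "0 < r" "r < \<delta>"
  shows "(cPB q4 has_real_derivative 2 / r * cPB q3 r) (at r)"
proof -
  define W where "W \<rho> \<theta> = indicator angles \<theta> * (\<rho> * (indicator PB (polar \<rho> \<theta>) * q4 (polar \<rho> \<theta>)))" for \<rho> \<theta>
  define W' where "W' \<theta> = 2 / r * (indicator angles \<theta> * (r * (indicator PB (polar r \<theta>) * q3 (polar r \<theta>))))" for \<theta>
  have iW: "integrable lborel (W \<rho>)" for \<rho>
    using cPB_integrable[OF BC_q4, of \<rho>] unfolding set_integrable_def W_def[abs_def] by simp
  have iW': "integrable lborel W'"
    unfolding W'_def[abs_def]
    by (rule integrable_mult_right) (use cPB_integrable[OF BC_q3, of r] in \<open>simp add: set_integrable_def\<close>)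
  have c4: "cPB q4 \<rho> = (\<integral>\<theta>. W \<rho> \<theta> \<partial>lborel)" for \<rho>
    unfolding cPB_def circ_def set_lebesgue_integral_def W_def real_scaleR_def ..
  have c3: "2 / r * cPB q3 r = (\<integral>\<theta>. W' \<theta> \<partial>lborel)"
    unfolding cPB_def circ_def set_lebesgue_integral_def W'_def real_scaleR_def integral_mult_right_zero ..
  define N where "N = {- r<..<\<delta> - r}"
  define K where "K = 8 * (L * \<delta>)\<^sup>2 * \<delta> / \<rho>0"
  have K0: "0 \<le> K" unfolding K_def using \<delta>_pos rho0_pos by simp
  have Weq: "W \<rho> \<theta> = indicator angles \<theta> * ((u (polar \<rho> \<theta>))\<^sup>2 / (cos \<theta> * \<rho>0))" if "0 < \<rho>" "\<rho> < \<delta>" for \<rho> \<theta>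
    using q4_polar[of \<theta>, OF _ that] unfolding W_def by (cases "\<theta> \<in> angles") auto
  have "((\<lambda>h. (cPB q4 (r + h) - cPB q4 r) / h) \<longlongrightarrow> 2 / r * cPB q3 r) (at 0 within N)"
    unfolding tendsto_at_iff_sequentially
  proof (intro allI impI)
    fix X :: "nat \<Rightarrow> real"
    assume X: "\<forall>i. X i \<in> N - {0}" and X0: "X \<longlonglongrightarrow> 0"
    have rX: "X n \<noteq> 0" "0 < r + X n" "r + X n < \<delta>" for n
      using X[rule_format, of n] by (auto simp: N_def)
    have "(\<lambda>n. \<integral>\<theta>. (W (r + X n) \<theta> - W r \<theta>) / X n \<partial>lborel) \<longlonglongrightarrow> (\<integral>\<theta>. W' \<theta> \<partial>lborel)"
    proof (rule integral_dominated_convergence)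
      show "W' \<in> borel_measurable lborel" using iW' by simp
      show "(\<lambda>\<theta>. (W (r + X n) \<theta> - W r \<theta>) / X n) \<in> borel_measurable lborel" for n
        using iW by (intro borel_measurable_divide borel_measurable_diff) auto
      show "integrable lborel (\<lambda>\<theta>. indicator angles \<theta> * K)"
        by (intro integrable_mult_left integrable_real_indicator) auto
      show "AE \<theta> in lborel. norm ((W (r + X n) \<theta> - W r \<theta>) / X n) \<le> indicator angles \<theta> * K" for n
      proof (rule AE_I2)
        fix \<theta>
        show "norm ((W (r + X n) \<theta> - W r \<theta>) / X n) \<le> indicator angles \<theta> * K"
        proof (cases "\<theta> \<in> angles")
          case True
          have "\<bar>W (r + X n) \<theta> - W r \<theta>\<bar> \<le> K * \<bar>X n\<bar>"
            using q4_polar_lipschitz[OF True r rX(2,3)] True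
            unfolding Weq[OF rX(2,3)] Weq[OF r] K_def by simp
          then show ?thesis using True rX(1)[of n] by (simp add: abs_divide field_simps)
        qed (simp add: W_def)
      qed
      show "AE \<theta> in lborel. (\<lambda>n. (W (r + X n) \<theta> - W r \<theta>) / X n) \<longlonglongrightarrow> W' \<theta>"
      proof (rule AE_I2)
        fix \<theta>
        show "(\<lambda>n. (W (r + X n) \<theta> - W r \<theta>) / X n) \<longlonglongrightarrow> W' \<theta>"
        proof (cases "\<theta> \<in> angles")
          case True
          let ?w = "\<lambda>\<rho>. (u (polar \<rho> \<theta>))\<^sup>2 / (cos \<theta> * \<rho>0)"
          have "W' \<theta> = 2 * (indicator PB (polar r \<theta>) * q3 (polar r \<theta>))" using True r by (simp add: W'_def)
          then have "((\<lambda>h. (?w (r + h) - ?w r) / h) \<longlongrightarrow> W' \<theta>) (at 0)"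
            using q4_polar_has_derivative[OF True r] unfolding DERIV_def by simp
          moreover have "filterlim X (at 0) sequentially"
            unfolding filterlim_at using X0 rX(1) by auto
          ultimately have "(\<lambda>n. (?w (r + X n) - ?w r) / X n) \<longlonglongrightarrow> W' \<theta>" by (rule filterlim_compose)
          then show ?thesis unfolding Weq[OF rX(2,3)] Weq[OF r] using True by simp
        qed (simp add: W_def W'_def)
      qed
    qed
    moreover have "(\<integral>\<theta>. (W (r + X n) \<theta> - W r \<theta>) / X n \<partial>lborel) = (cPB q4 (r + X n) - cPB q4 r) / X n" for n
      unfolding c4 using iW by simp
    ultimately show "((\<lambda>h. (cPB q4 (r + h) - cPB q4 r) / h) \<circ> X) \<longlonglongrightarrow> 2 / r * cPB q3 r"
      unfolding comp_def c3 by (simp only:)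
  qed
  moreover have "at 0 within N = at 0" by (rule at_within_open) (use r in \<open>auto simp: N_def\<close>)
  ultimately show ?thesis unfolding DERIV_def by simp
qed

lemma J_fun_eq:
  assumes r: "0 < r" "r < \<delta>" shows "J_fun \<rho>0 u r = cPB q4 r"
proof -
  have "J_fun \<rho>0 u r = (LINT x:half_circle r|hausdorff1. indicator PB x * q4 x)"
    unfolding J_fun_def set_lebesgue_integral_def
  proof (rule Bochner_Integration.integral_cong[OF refl])
    fix x :: plane
    have "(u x)\<^sup>2 / (fst x * \<rho>0) = indicator PB x * q4 x" if x: "x \<in> half_circle r"
    proof (cases "x \<in> PB")
      case False
      have "x \<in> Ks" "norm x < \<delta>" using x r by (auto simp: half_circle_def half_plane_def)
      then have "u x = 0" by (rule u_eq_0_off_PB[OF _ _ False])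
      then show ?thesis by (simp add: q4_def)
    qed (simp add: q4_def power2_eq_square)
    then show "indicator (half_circle r) x *\<^sub>R ((u x)\<^sup>2 / (fst x * \<rho>0)) =
        indicator (half_circle r) x *\<^sub>R (indicator PB x * q4 x)"
      by (cases "x \<in> half_circle r") auto
  qed
  also have "\<dots> = cPB q4 r" unfolding cPB_def by (rule circ_eq[OF r(1) BC_measurable[OF BC_q4]])
  finally show ?thesis .
qed


section \<open>The monotonicity formula\<close>

definition q0 :: "plane \<Rightarrow> real" where "q0 x = fst x * Gx x"
definition q1 :: "plane \<Rightarrow> real" where "q1 x = 1 / Hx x * (u x * ((x \<bullet> Du x) / fst x))"
definition q2 :: "plane \<Rightarrow> real" where "q2 x = 1 / Hx x * ((x \<bullet> Du x) * ((x \<bullet> Du x) / fst x))"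
definition q5 :: "plane \<Rightarrow> real" where "q5 x = 1 / Hx x * (u x * (u x / fst x))"
definition k1 :: "plane \<Rightarrow> real" where "k1 x = fst x * (t x * (1 / Hx x) - Gx x + 1 / \<rho>0 * snd x)"
definition k2 :: "plane \<Rightarrow> real" where "k2 x = fst x * snd x * (1 / \<rho>0\<^sup>2 * Hx x - 1 / \<rho>0)"

lemma BC_inner: "BC (\<lambda>x. x \<bullet> Du x)"
  unfolding inner_plane by (intro BC_intros)

lemma BC_q: "BC q0" "BC q1" "BC q2" "BC q5" "BC k1" "BC k2"
  unfolding q0_def[abs_def] q1_def[abs_def] q2_def[abs_def] q5_def[abs_def] k1_def[abs_def] k2_def[abs_def]
  by (intro BC_intros BC_inner_div BC_u_div BC_inner)+

lemma interior_integral: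
  assumes F: "BC F" and r: "0 < r" "r < \<delta>"
    and on: "\<And>x. x \<in> PB \<Longrightarrow> f x = F x"
    and off: "\<And>x. x \<in> Uo \<Longrightarrow> Du x = 0 \<Longrightarrow> u x = 0 \<Longrightarrow> f x = 0"
  shows "(LINT x:half_disc r \<inter> upper|lebesgue. f x) = ID F r"
proof -
  have "(\<lambda>x. indicator (half_disc r) x * (indicator PB x * F x)) \<in> borel_measurable borel"
    by (intro borel_measurable_times borel_measurable_indicator half_disc_borel BC_measurable F)
  then have "(LINT x:half_disc r \<inter> upper|lebesgue. f x) =
      (\<integral>x. indicator (half_disc r) x * (indicator PB x * F x) \<partial>lborel)"
  proof (rule set_integral_cong_lborel)
    show "AE x in lebesgue. indicator (half_disc r \<inter> upper) x * f x = indicator (half_disc r) x * (indicator PB x * F x)"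
      using AE_off_PB
    proof eventually_elim
      case (elim x)
      show ?case
      proof (cases "x \<in> half_disc r")
        case True
        then have x: "x \<in> half_plane" "norm x < \<delta>" using r by (auto simp: half_disc_def half_plane_def)
        show ?thesis
        proof (cases "x \<in> PB")
          case True
          then have "x \<in> upper" using PB_D(5)[OF True] by (simp add: upper_def)
          then show ?thesis using True on[OF True] by (simp add: indicator_def)
        next
          case False
          then show ?thesis using elim x off[of x] by (simp add: indicator_def)
        qed
      qed simp
    qed
  qed
  then show ?thesis by (simp add: ID_def set_lebesgue_integral_def)
qed

lemma I_fun_eq:
  assumes r: "0 < r" "r < \<delta>" shows "I_fun g \<rho>0 p u Du r = ID q0 r"
  unfolding I_fun_def
proof (rule interior_integral[OF BC_q(1) r])
  show "fst x * (F_fun g \<rho>0 p (t x) (snd x) + lam g \<rho>0 p (snd x) * indicator (pos_set u) x) = q0 x"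
    if "x \<in> PB" for x unfolding PB_values(1)[OF that] q0_def ..
  show "fst x * (F_fun g \<rho>0 p (t x) (snd x) + lam g \<rho>0 p (snd x) * indicator (pos_set u) x) = 0"
    if "x \<in> Uo" "Du x = 0" "u x = 0" for x using zero_gradient_values[OF that] by simp
qed

text \<open>By \<open>integral_dinvH\<close> the inner integrals are \<open>t / H - F(t; s)\<close>
  and, on the diagonal, \<open>s / \<rho>0 - F(s; s)\<close>. As \<open>lam\<close> is
  \<open>2 s / \<rho>0 - F(s; s)\<close>, their difference is
  \<open>t / H - Gx + s / \<rho>0\<close>.\<close>

lemma K1_x2_eq:
  assumes r: "0 < r" "r < \<delta>" shows "K1_x2 g \<rho>0 p u Du r = ID k1 r"
  unfolding K1_x2_def
proof (rule interior_integral[OF BC_q(5) r])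
  fix x assume x: "x \<in> PB"
  have D: "(t x, snd x) \<in> D" using P_in_D PB_D(1)[OF x] by blast
  have s: "snd x \<in> S" "0 \<le> snd x" using D_in_S[OF D] PB_D(5)[OF x] by auto
  have 1: "(LBINT \<tau>=ereal 0..ereal (t x). dinvH g \<rho>0 p \<tau> (snd x) * \<tau>) = t x / Hx x - F_fun g \<rho>0 p (t x) (snd x)"
    by (rule integral_dinvH[OF D t_nonneg])
  have 2: "(LBINT \<tau>=ereal 0..ereal (snd x). dinvH g \<rho>0 p \<tau> (snd x) * \<tau>) =
      snd x / \<rho>0 - F_fun g \<rho>0 p (snd x) (snd x)"
    using integral_dinvH[OF diag_in_D[OF s(1)] s(2)] unfolding H_diag[OF s(1)] .
  have 3: "Gx x = F_fun g \<rho>0 p (t x) (snd x) + (2 * snd x / \<rho>0 - F_fun g \<rho>0 p (snd x) (snd x))"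
    using PB_values(1)[OF x] unfolding PB_values(4)[OF x] lam_def by simp
  show "fst x * ((LBINT \<tau>=ereal 0..ereal (t x). dinvH g \<rho>0 p \<tau> (snd x) * \<tau>)
      - (LBINT \<tau>=ereal 0..ereal (snd x). dinvH g \<rho>0 p \<tau> (snd x) * \<tau>) * indicator (pos_set u) x) = k1 x"
    unfolding 1 2 k1_def 3 PB_values(4)[OF x] by simp
next
  fix x assume "x \<in> Uo" "Du x = 0" "u x = 0"
  from zero_gradient_values[OF this]
  show "fst x * ((LBINT \<tau>=ereal 0..ereal (t x). dinvH g \<rho>0 p \<tau> (snd x) * \<tau>)
      - (LBINT \<tau>=ereal 0..ereal (snd x). dinvH g \<rho>0 p \<tau> (snd x) * \<tau>) * indicator (pos_set u) x) = 0"
    by simp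
qed

lemma K1_x1x2_eq:
  assumes r: "0 < r" "r < \<delta>" shows "K1_x1x2 g \<rho>0 p u Du r = ID k2 r"
  unfolding K1_x1x2_def
proof (rule interior_integral[OF BC_q(6) r])
  show "fst x * snd x * (d2F g \<rho>0 p (t x) (snd x) + (dlam g \<rho>0 p (snd x) - 1 / \<rho>0) * indicator (pos_set u) x) = k2 x"
    if x: "x \<in> PB" for x
  proof -
    have "d2F g \<rho>0 p (t x) (snd x) + (dlam g \<rho>0 p (snd x) - 1 / \<rho>0) * indicator (pos_set u) x = Hx x / \<rho>0\<^sup>2 - 1 / \<rho>0"
      using PB_values(3)[OF x] unfolding PB_values(4)[OF x] by simp
    then show ?thesis unfolding k2_def by simp
  qed
  show "fst x * snd x * (d2F g \<rho>0 p (t x) (snd x) + (dlam g \<rho>0 p (snd x) - 1 / \<rho>0) * indicator (pos_set u) x) = 0"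
    if "x \<in> Uo" "Du x = 0" "u x = 0" for x using zero_gradient_values[OF that] by simp
qed

text \<open>That \<open>Du\<close> vanishes off \<open>PB\<close> is known only up to a null set of
  the plane. For such a radius the exceptional points on the arc have length zero.\<close>

definition good_radius :: "real \<Rightarrow> bool" where
  "good_radius r \<longleftrightarrow> (\<exists>N\<in>sets borel. emeasure hausdorff1 (half_circle r \<inter> N) = 0 \<and>
     (\<forall>x\<in>half_circle r \<inter> upper. x \<notin> N \<longrightarrow> x \<notin> PB \<longrightarrow> Du x = 0 \<and> u x = 0))"

text \<open>The exceptional set is enlarged to a Borel null set, to which
  \<open>AE_half_circle_null\<close> applies.\<close>

lemma AE_good_radius: "AE r in lborel. 0 < r \<longrightarrow> r < \<delta> \<longrightarrow> good_radius r"
proof -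
  obtain Z where Z: "Z \<in> null_sets lebesgue"
    "{x \<in> space lebesgue. \<not> (x \<in> half_plane \<inter> upper \<longrightarrow> norm x < \<delta> \<longrightarrow> x \<notin> PB \<longrightarrow> x \<in> Uo \<and> Du x = 0 \<and> u x = 0)} \<subseteq> Z"
    using AE_off_PB unfolding eventually_ae_filter by blast
  obtain N where N: "N \<in> null_sets lborel" "Z \<subseteq> N"
    using Z(1) null_sets_completion_iff2[of Z lborel] by auto
  have off: "Du x = 0 \<and> u x = 0" if "x \<in> half_plane" "x \<in> upper" "norm x < \<delta>" "x \<notin> PB" "x \<notin> N" for x
    using Z(2) N(2) that by auto
  from AE_half_circle_null[OF N(1)] show ?thesis
  proof eventually_elim
    case (elim r)
    show ?case
    proof (intro impI)
      assume r: "0 < r" "r < \<delta>"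
      show "good_radius r" unfolding good_radius_def
      proof (intro bexI conjI ballI impI)
        show "emeasure hausdorff1 (half_circle r \<inter> N) = 0" using elim r by simp
        show "N \<in> sets borel" using N(1) by auto
        fix x assume "x \<in> half_circle r \<inter> upper" "x \<notin> N" "x \<notin> PB"
        then show "Du x = 0" "u x = 0" using off[of x] r by (auto simp: half_circle_def half_plane_def)
      qed
    qed
  qed
qed

lemma boundary_integral:
  assumes r: "0 < r" and good: "good_radius r" and F: "BC F"
    and on: "\<And>x. x \<in> PB \<Longrightarrow> f x = F x"
    and off: "\<And>x. Du x = 0 \<Longrightarrow> u x = 0 \<Longrightarrow> f x = 0"
  shows "(LINT x:half_circle r \<inter> upper|hausdorff1. f x) = cPB F r"
proof -
  obtain N where N: "N \<in> sets borel" "emeasure hausdorff1 (half_circle r \<inter> N) = 0"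
    and N0: "\<forall>x\<in>half_circle r \<inter> upper. x \<notin> N \<longrightarrow> x \<notin> PB \<longrightarrow> Du x = 0 \<and> u x = 0"
    using good unfolding good_radius_def by blast
  have "(LINT x:half_circle r \<inter> upper|hausdorff1. f x) = (LINT x:half_circle r|hausdorff1. indicator upper x * f x)"
    unfolding set_lebesgue_integral_def by (simp add: indicator_inter_arith mult.assoc)
  also have "\<dots> = (LINT x:half_circle r|hausdorff1. indicator PB x * F x)"
  proof (rule integral_half_circle_cong[OF BC_measurable[OF F] N])
    fix x assume x: "x \<in> half_circle r" "x \<notin> N"
    show "indicator upper x * f x = indicator PB x * F x"
    proof (cases "x \<in> PB")
      case True
      then have "x \<in> upper" using PB_D(5)[OF True] by (simp add: upper_def)
      then show ?thesis using True on[OF True] by simp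
    next
      case False
      then show ?thesis using N0[rule_format, of x] off[of x] x by (cases "x \<in> upper") auto
    qed
  qed
  also have "\<dots> = cPB F r" unfolding cPB_def by (rule circ_eq[OF r BC_measurable[OF F]])
  finally show ?thesis .
qed

text \<open>The square is expanded with
  \<open>Du \<bullet> \<nu> = (x \<bullet> Du) / r\<close>.\<close>

lemma boundary_square_term:
  assumes r: "0 < r" and good: "good_radius r"
  shows "(LINT x:half_circle r \<inter> upper|hausdorff1. 1 / (fst x * H_fun g \<rho>0 p (t x) (snd x))
           * (Du x \<bullet> (x /\<^sub>R r) - 5 / 2 * (u x / r))\<^sup>2)
    = (1 / r)\<^sup>2 * (cPB q2 r - 5 * cPB q1 r + 25 / 4 * cPB q5 r)"
proof -
  let ?F = "\<lambda>x. (1 / r)\<^sup>2 * q2 x + ((- 5 * (1 / r)\<^sup>2) * q1 x + (25 / 4 * (1 / r)\<^sup>2) * q5 x)"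
  have "(LINT x:half_circle r \<inter> upper|hausdorff1. 1 / (fst x * H_fun g \<rho>0 p (t x) (snd x))
           * (Du x \<bullet> (x /\<^sub>R r) - 5 / 2 * (u x / r))\<^sup>2) = cPB ?F r"
  proof (rule boundary_integral[OF r good])
    show "BC ?F" by (intro BC_intros BC_q)
    show "1 / (fst x * Hx x) * (Du x \<bullet> (x /\<^sub>R r) - 5 / 2 * (u x / r))\<^sup>2 = ?F x" for x
    proof -
      have "1 / (a * b) * (w * (1 / r) - 5 / 2 * (y / r))\<^sup>2 = (1 / r)\<^sup>2 * (1 / b * (w * (w / a))) +
         ((- 5 * (1 / r)\<^sup>2) * (1 / b * (y * (w / a))) + (25 / 4 * (1 / r)\<^sup>2) * (1 / b * (y * (y / a))))"
        for a b w y :: real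
        unfolding divide_inverse inverse_mult_distrib mult_1 by algebra
      moreover have "Du x \<bullet> (x /\<^sub>R r) = (x \<bullet> Du x) * (1 / r)"
        by (simp add: inner_commute divide_inverse)
      ultimately show ?thesis unfolding q1_def q2_def q5_def by (simp only:)
    qed
    show "1 / (fst x * Hx x) * (Du x \<bullet> (x /\<^sub>R r) - 5 / 2 * (u x / r))\<^sup>2 = 0" if "Du x = 0" "u x = 0" for x
      using that by simp
  qed
  also have "\<dots> = (1 / r)\<^sup>2 * (cPB q2 r - 5 * cPB q1 r + 25 / 4 * cPB q5 r)"
    by (simp only: cPB_add cPB_cmult BC_add BC_mult BC_const BC_q) (simp add: algebra_simps)
  finally show ?thesis .
qed

lemma K2_x1x2_eq:
  assumes r: "0 < r" and good: "good_radius r"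
  shows "K2_x1x2 g \<rho>0 p u Du r = 5 * (1 / r) * (cPB q1 r - cPB q3 r)"
proof -
  let ?F = "\<lambda>x. (1 / r) * q1 x + (- (1 / r)) * q3 x"
  have "(LINT x:half_circle r \<inter> upper|hausdorff1.
      (1 / (fst x * H_fun g \<rho>0 p (t x) (snd x)) - 1 / (fst x * \<rho>0)) * u x * (Du x \<bullet> (x /\<^sub>R r))) = cPB ?F r"
  proof (rule boundary_integral[OF r good])
    show "BC ?F" by (intro BC_intros BC_q BC_q3)
    show "(1 / (fst x * Hx x) - 1 / (fst x * \<rho>0)) * u x * (Du x \<bullet> (x /\<^sub>R r)) = ?F x" for x
    proof -
      have "(1 / (a * b) - 1 / (a * \<rho>0)) * y * (w * (1 / r)) =
         (1 / r) * (1 / b * (y * (w / a))) + (- (1 / r)) * (1 / \<rho>0 * (y * (w / a)))" for a b w y :: real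
        unfolding divide_inverse inverse_mult_distrib mult_1 by algebra
      moreover have "Du x \<bullet> (x /\<^sub>R r) = (x \<bullet> Du x) * (1 / r)"
        by (simp add: inner_commute divide_inverse)
      ultimately show ?thesis unfolding q1_def q3_def by (simp only:)
    qed
  qed simp
  also have "\<dots> = (1 / r) * (cPB q1 r - cPB q3 r)"
    by (simp only: cPB_add cPB_cmult BC_add BC_mult BC_const BC_q BC_q3) (simp add: algebra_simps)
  finally show ?thesis unfolding K2_x1x2_def by simp
qed

lemma K3_x1x2_eq:
  assumes r: "0 < r" and good: "good_radius r"
  shows "K3_x1x2 g \<rho>0 p u Du r = 25 / 2 * (1 / r) * (cPB q4 r - cPB q5 r)"
proof -
  let ?F = "\<lambda>x. q4 x + (- 1) * q5 x"
  have "(LINT x:half_circle r \<inter> upper|hausdorff1.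
      (1 / (fst x * \<rho>0) - 1 / (fst x * H_fun g \<rho>0 p (t x) (snd x))) * (u x)\<^sup>2) = cPB ?F r"
  proof (rule boundary_integral[OF r good])
    show "BC ?F" by (intro BC_intros BC_q BC_q4)
    show "(1 / (fst x * \<rho>0) - 1 / (fst x * Hx x)) * (u x)\<^sup>2 = ?F x" for x
    proof -
      have "(1 / (a * \<rho>0) - 1 / (a * b)) * y\<^sup>2 = 1 / \<rho>0 * (y * (y / a)) + (- 1) * (1 / b * (y * (y / a)))"
        for a b y :: real
        unfolding divide_inverse inverse_mult_distrib mult_1 by algebra
      then show ?thesis unfolding q4_def q5_def by (simp only:)
    qed
  qed simp
  also have "\<dots> = cPB q4 r - cPB q5 r"
    by (simp only: cPB_add cPB_cmult BC_add BC_mult BC_const BC_q BC_q4)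
  finally show ?thesis unfolding K3_x1x2_def by simp
qed

text \<open>Pohozaev identity, minus four times \<open>I\<close>, plus five times the energy
  identity. The \<open>4\<close> anticipates the derivative of \<open>r^(-4)\<close>; the
  \<open>5\<close> supplies half of the mixed term of the boundary square.\<close>

lemma AE_Pohozaev:
  "AE r in lborel. 0 < r \<longrightarrow> r < \<delta> \<longrightarrow>
     ID k1 r + ID k2 r = r * cPB q0 r - 4 * ID q0 r + (1 / r) * (5 * cPB q1 r - 2 * cPB q2 r)"
proof -
  \<comment> \<open>Interior integrand \<open>?b\<close> and arc integrand \<open>?a\<close> of the
    Pohozaev identity; the primed ones belong to the energy identity.\<close>
  let ?b = "\<lambda>x. 3 * (fst x * Gx x) - 4 * (fst x * t x * (1 / Hx x)) + fst x * snd x * (Hx x / \<rho>0\<^sup>2)"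
  let ?a = "\<lambda>x. 2 * (x \<bullet> x) * (fst x * Gx x) - 4 * (1 / Hx x * (1 / fst x) * (x \<bullet> Du x)\<^sup>2)"
  let ?b' = "\<lambda>x. fst x * t x * (1 / Hx x)"
  let ?a' = "\<lambda>x. 2 * u x * (1 / Hx x) * ((x \<bullet> Du x) / fst x)"
  have Bb: "BC ?b" "BC ?b'"
  proof -
    have "BC (\<lambda>x. Hx x / \<rho>0\<^sup>2)" using BC_mult[OF BC_const[of "1 / \<rho>0\<^sup>2"] BC_H] by simp
    then show "BC ?b" "BC ?b'" by (intro BC_intros; assumption?)+
  qed
  have a_eq: "?a x = 2 * (x \<bullet> x) * q0 x + (- 4) * q2 x" and a'_eq: "?a' x = 2 * q1 x" for x
    by (simp_all add: q0_def q1_def q2_def power2_eq_square)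
  have Bxx: "BC (\<lambda>x. 2 * (x \<bullet> x))" unfolding inner_plane by (intro BC_intros)
  have Ba: "BC ?a" "BC ?a'"
    unfolding a_eq a'_eq by (intro BC_intros BC_q Bxx)+
  from AE_ID_derivative[OF Ba(1)] AE_ID_derivative[OF Ba(2)]
  show ?thesis
  proof eventually_elim
    case (elim r)
    show ?case
    proof (intro impI)
      assume r: "0 < r" "r < \<delta>"
      have 1: "ID ?b r = cPB ?a r / (2 * r)"
        by (rule radial_test[OF Ba(1) Bb(1) radial_variation r]) (use elim r in auto)
      have 2: "ID ?b' r = cPB ?a' r / (2 * r)"
        by (rule radial_test[OF Ba(2) Bb(2) energy_identity r]) (use elim r in auto)
      have "cPB ?a r = cPB (\<lambda>x. (2 * r\<^sup>2) * q0 x + (- 4) * q2 x) r"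
      proof (rule cPB_cong[OF r(1)])
        fix x assume "x \<in> half_circle r"
        then have "x \<bullet> x = r\<^sup>2" by (auto simp: half_circle_def dot_square_norm)
        then show "?a x = (2 * r\<^sup>2) * q0 x + (- 4) * q2 x" unfolding a_eq by simp
      qed
      also have "\<dots> = 2 * r\<^sup>2 * cPB q0 r - 4 * cPB q2 r"
        by (simp only: cPB_add cPB_cmult BC_add BC_mult BC_const BC_q)
      finally have 3: "ID ?b r = r * cPB q0 r - (1 / r) * (2 * cPB q2 r)"
        unfolding 1 using r by (simp add: field_simps power2_eq_square)
      have 4: "ID ?b' r = (1 / r) * cPB q1 r"
        unfolding 2 a'_eq cPB_cmult using r by simp
      \<comment> \<open>The terms with \<open>1 / \<rho>0\<close> in \<open>k1\<close> and
        \<open>k2\<close> have opposite signs and cancel.\<close>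
      have kk: "(\<lambda>x. k1 x + k2 x) = (\<lambda>x. ?b x + ((- 4) * q0 x + 5 * ?b' x))"
        by (simp add: fun_eq_iff k1_def k2_def q0_def algebra_simps divide_inverse)
      have "ID k1 r + ID k2 r = ID (\<lambda>x. k1 x + k2 x) r"
        by (rule ID_linear(1)[symmetric]) (intro BC_q)+
      also have "\<dots> = ID ?b r + (ID (\<lambda>x. (- 4) * q0 x) r + ID (\<lambda>x. 5 * ?b' x) r)"
        unfolding kk
        by (subst ID_linear(1), (intro BC_intros Bb BC_q)+, subst ID_linear(1)) (intro BC_intros Bb BC_q refl)+
      also have "\<dots> = ID ?b r + ((- 4) * ID q0 r + 5 * ID ?b' r)"
        by (simp only: ID_linear(2)[OF BC_q(1) BC_q(1)] ID_linear(2)[OF Bb(2) Bb(2)])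
      finally show "ID k1 r + ID k2 r = r * cPB q0 r - 4 * ID q0 r + (1 / r) * (5 * cPB q1 r - 2 * cPB q2 r)"
        unfolding 3 4 by (simp add: algebra_simps)
    qed
  qed
qed

lemma monotonicity_formula:
  "AE r in lborel. r \<in> {0<..<\<delta>} \<longrightarrow>
    (M_x1x2 g \<rho>0 p u Du has_real_derivative
       2 * r powi (-4) * (LINT x:half_circle r \<inter> upper|hausdorff1.
           1 / (fst x * H_fun g \<rho>0 p (tq Du x) (snd x))
           * (Du x \<bullet> (x /\<^sub>R r) - 5 / 2 * (u x / r))\<^sup>2)
       + r powi (-5) * K1_x2 g \<rho>0 p u Du r
       + r powi (-5) * (K1_x1x2 g \<rho>0 p u Du r + K2_x1x2 g \<rho>0 p u Du r + K3_x1x2 g \<rho>0 p u Du r))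
    (at r)"
  using AE_good_radius AE_Pohozaev AE_ID_derivative[OF BC_q(1)]
proof eventually_elim
  case (elim r)
  show ?case
  proof
    assume "r \<in> {0<..<\<delta>}"
    then have r: "0 < r" "r < \<delta>" by auto
    have good: "good_radius r" using elim(1) r by blast
    \<comment> \<open>With \<open>r * v = 1\<close> the comparison of both sides becomes polynomial
      algebra.\<close>
    define v where "v = 1 / r"
    have rv: "r * v = 1" using r by (simp add: v_def)
    have pw: "r powi (-4) = v ^ 4" "r powi (-5) = v ^ 5" "r powi (-6) = v ^ 6"
      by (simp_all add: power_int_minus v_def power_one_over inverse_eq_divide)
    define M where "M y = y powi (-4) * ID q0 y - 5 / 2 * y powi (-5) * cPB q4 y" for y
    have M: "M_x1x2 g \<rho>0 p u Du y = M y" if "0 < y" "y < \<delta>" for y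
      unfolding M_x1x2_def M_def I_fun_eq[OF that] J_fun_eq[OF that] ..
    have dI: "(ID q0 has_real_derivative cPB q0 r) (at r)" using elim(3) r by blast
    have dp: "((\<lambda>y. y powi n) has_real_derivative of_int n * r powi (n - 1)) (at r)" for n
      by (rule DERIV_cong[OF DERIV_power_int[OF DERIV_ident]]) (use r in auto)
    have "(M has_real_derivative
        (of_int (-4) * r powi (-4 - 1) * ID q0 r + cPB q0 r * r powi (-4))
        - ((5 / 2 * (of_int (-5) * r powi (-5 - 1))) * cPB q4 r + (2 / r * cPB q3 r) * (5 / 2 * r powi (-5)))) (at r)"
      unfolding M_def[abs_def]
      by (intro DERIV_diff DERIV_mult DERIV_cmult dp dI J_has_derivative r)
    moreover have "(of_int (-4) * r powi (-4 - 1) * ID q0 r + cPB q0 r * r powi (-4))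
        - ((5 / 2 * (of_int (-5) * r powi (-5 - 1))) * cPB q4 r + (2 / r * cPB q3 r) * (5 / 2 * r powi (-5)))
      = - 4 * v ^ 5 * ID q0 r + v ^ 4 * cPB q0 r + 25 / 2 * v ^ 6 * cPB q4 r - 5 * v ^ 6 * cPB q3 r"
    proof -
      have "2 / r = 2 * v" by (simp add: v_def)
      then show ?thesis using pw by (simp add: algebra_simps power_add[symmetric] eval_nat_numeral)
    qed
    \<comment> \<open>The expanded square has \<open>H\<close> in all three terms, the derivative of
      \<open>J\<close> has \<open>\<rho>0\<close>; the differences are the summands from
      \<open>K2_x1x2\<close> and \<open>K3_x1x2\<close>.\<close>
    moreover have "\<dots> = 2 * v ^ 4 * (v\<^sup>2 * (cPB q2 r - 5 * cPB q1 r + 25 / 4 * cPB q5 r))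
        + v ^ 5 * (ID k1 r) + v ^ 5 * (ID k2 r + 5 * v * (cPB q1 r - cPB q3 r) + 25 / 2 * v * (cPB q4 r - cPB q5 r))"
    proof -
      have k: "ID k1 r + ID k2 r = r * cPB q0 r - 4 * ID q0 r + v * (5 * cPB q1 r - 2 * cPB q2 r)"
        using elim(2) r unfolding v_def by blast
      have "v ^ 5 * ID k1 r + v ^ 5 * ID k2 r = v ^ 4 * (r * v) * cPB q0 r - 4 * v ^ 5 * ID q0 r
          + v ^ 6 * (5 * cPB q1 r - 2 * cPB q2 r)"
        unfolding distrib_left[symmetric] k by algebra
      then show ?thesis unfolding rv by algebra
    qed
    ultimately have "(M has_real_derivative 2 * v ^ 4 * (v\<^sup>2 * (cPB q2 r - 5 * cPB q1 r + 25 / 4 * cPB q5 r))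
        + v ^ 5 * (ID k1 r) + v ^ 5 * (ID k2 r + 5 * v * (cPB q1 r - cPB q3 r) + 25 / 2 * v * (cPB q4 r - cPB q5 r))) (at r)"
      by (simp only:)
    then have "(M_x1x2 g \<rho>0 p u Du has_real_derivative
        2 * v ^ 4 * (v\<^sup>2 * (cPB q2 r - 5 * cPB q1 r + 25 / 4 * cPB q5 r))
        + v ^ 5 * (ID k1 r) + v ^ 5 * (ID k2 r + 5 * v * (cPB q1 r - cPB q3 r) + 25 / 2 * v * (cPB q4 r - cPB q5 r))) (at r)"
    \<comment> \<open>\<open>M\<close> is identified with the functional for radii in
      \<open>(0, \<delta>)\<close> only, hence the distance to both ends.\<close>
    proof (rule has_field_derivative_transform_within[where d = "min r (\<delta> - r)"])
      show "0 < min r (\<delta> - r)" using r by simp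
      show "M y = M_x1x2 g \<rho>0 p u Du y" if "dist y r < min r (\<delta> - r)" for y
        using that by (intro M[symmetric]) (auto simp: dist_real_def abs_if split: if_splits)
    qed simp
    then show "(M_x1x2 g \<rho>0 p u Du has_real_derivative
       2 * r powi (-4) * (LINT x:half_circle r \<inter> upper|hausdorff1.
           1 / (fst x * H_fun g \<rho>0 p (tq Du x) (snd x))
           * (Du x \<bullet> (x /\<^sub>R r) - 5 / 2 * (u x / r))\<^sup>2)
       + r powi (-5) * K1_x2 g \<rho>0 p u Du r
       + r powi (-5) * (K1_x1x2 g \<rho>0 p u Du r + K2_x1x2 g \<rho>0 p u Du r + K3_x1x2 g \<rho>0 p u Du r)) (at r)"
      unfolding pw boundary_square_term[OF r(1) good] K1_x2_eq[OF r] K1_x1x2_eq[OF r]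
        K2_x1x2_eq[OF r(1) good] K3_x1x2_eq[OF r(1) good] v_def .
  qed
qed

end

text \<open>The half-disc is convex, hence connected, and contains the origin. If it left
  \<open>\<Omega>\<close>, it would meet the relative frontier at distance at most
  \<open>\<delta>\<close>, while the frontier has distance \<open>2 \<delta>\<close>.\<close>

lemma half_disc_subset:
  assumes \<Omega>: "openin (top_of_set half_plane) \<Omega>" "(0, 0) \<in> \<Omega>"
    and \<delta>: "\<delta> > 0" "\<delta> = 1 / 2 * infdist (0, 0) (top_of_set half_plane frontier_of \<Omega>)"
  shows "cball 0 \<delta> \<inter> half_plane \<subseteq> \<Omega>"
proof (rule ccontr)
  let ?K = "cball 0 \<delta> \<inter> half_plane"
  assume *: "\<not> ?thesis"
  have "convex half_plane"
    unfolding half_plane_def convex_def by (auto intro!: add_nonneg_nonneg mult_nonneg_nonneg)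
  then have "connected ?K" by (intro convex_connected convex_Int convex_cball)
  then have conn: "connectedin (top_of_set half_plane) ?K" by (simp add: connectedin_subtopology)
  have origin: "(0, 0) \<in> ?K" using \<delta>(1) by (simp add: half_plane_def flip: zero_prod_def)
  have "?K \<inter> (top_of_set half_plane frontier_of \<Omega>) \<noteq> {}"
  proof (rule connectedin_Int_frontier_of[OF conn])
    show "?K \<inter> \<Omega> \<noteq> {}" using origin \<Omega>(2) by blast
    show "?K - \<Omega> \<noteq> {}" using * by blast
  qed
  then obtain x where x: "x \<in> ?K" "x \<in> top_of_set half_plane frontier_of \<Omega>" by blast
  have "infdist (0, 0) (top_of_set half_plane frontier_of \<Omega>) \<le> dist (0, 0) x" by (rule infdist_le[OF x(2)])
  also have "\<dots> \<le> \<delta>" using x(1) by (simp flip: zero_prod_def)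
  finally show False using \<delta> by simp
qed

theorem proposition4p6:
  fixes g \<rho>0 \<alpha> \<delta> :: real and p :: "real \<Rightarrow> real"
    and \<Omega> :: "plane set" and u :: "plane \<Rightarrow> real" and Du :: "plane \<Rightarrow> plane"
  assumes "subsonic_variational_solution g \<rho>0 \<alpha> p \<Omega> u Du"
    and "(0, 0) \<in> \<Omega>"
    and "\<delta> = 1 / 2 * infdist (0, 0) (top_of_set half_plane frontier_of \<Omega>)"
  shows "AE r in lborel. r \<in> {0<..<\<delta>} \<longrightarrow>
    (M_x1x2 g \<rho>0 p u Du has_real_derivative
       2 * r powi (-4) * (LINT x:half_circle r \<inter> upper|hausdorff1.
           1 / (fst x * H_fun g \<rho>0 p (tq Du x) (snd x))
           * (Du x \<bullet> (x /\<^sub>R r) - 5 / 2 * (u x / r))\<^sup>2)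
       + r powi (-5) * K1_x2 g \<rho>0 p u Du r
       + r powi (-5) * (K1_x1x2 g \<rho>0 p u Du r + K2_x1x2 g \<rho>0 p u Du r + K3_x1x2 g \<rho>0 p u Du r))
    (at r)"
proof (cases "\<delta> > 0")
  case True
  interpret subsonic_variational_solution g \<rho>0 \<alpha> p \<Omega> u Du by fact
  have "cball 0 \<delta> \<inter> half_plane \<subseteq> \<Omega>" by (rule half_disc_subset[OF rel_open assms(2) True assms(3)])
  then interpret solution_near_origin g \<rho>0 \<alpha> p \<Omega> u Du \<delta>
    using True by unfold_locales
  show ?thesis by (rule monotonicity_formula)
next
  \<comment> \<open>For an empty frontier \<open>infdist\<close> is \<open>0\<close> by convention,
    so \<open>\<delta> = 0\<close> and the interval of radii is empty.\<close>
  case False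
  then show ?thesis by auto
qed

end
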